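(* Let $R$ be a commutative ring, let $\mathbb A\in\mathfrak F$ be a functor of commutative $\mathcal R$-algebras and let $\{\mathcal A_i\}_i$ be the set of all quasi-coherent algebra quotients of $\mathbb A$. Then (1) $\mathrm{Spec}\,\mathbb A=\varinjlim_i\mathrm{Spec}\,\mathcal A_i$. (2) $\mathbb A_{\mathrm{Spec}\,\mathbb A}=\varprojlim_i\mathcal A_i$. Moreover, if $\mathbb X$ is an affine functor with $\mathbb A_{\mathbb X}\in\mathfrak F$, then $\mathbb A_{\mathbb X}$ is a functor of pro-quasicoherent algebras.
   Context: $R$ is a commutative ring with unit. All functors are covariant functors from the category of commutative $R$-algebras to sets; limits and colimits are pointwise. $\mathcal R$ is the functor of rings $\mathcal R(S)=S$. A functor of $\mathcal R$-modules is a functor $\mathbb M$ with morphisms of functors $\mathbb M\times\mathbb M\to\mathbb M$, $\mathcal R\times\mathbb M\to\mathbb M$ making each $\mathbb M(S)$ an $S$-module; morphisms are $S$-linear for each $S$. $\mathbb M^*(S)=\mathrm{Hom}_{\mathcal S}(\mathbb M_{|S},\mathcal S)$, where $_{|S}$ is restriction to commutative $S$-algebras; $\mathbb M$ is reflexive if $\mathbb M\to\mathbb M^{**}$ is an isomorphism. For an $R$-module $M$, $\mathcal M(S)=M\otimes_RS$ is the quasi-coherent module associated with $M$. For a set $\alpha$: $\mathcal R^{(\alpha)}=\oplus_\alpha\mathcal R$; for $\alpha_1\subseteq\alpha_2$ there is the projection $\mathcal R^{(\alpha_2)}\to\mathcal R^{(\alpha_1)}$. $\mathbb M$ is essentially free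 if there exist a set $I$, a set $P$ of subsets of $I$ with $\alpha\cup\alpha'\in P$ for all $\alpha,\alpha'\in P$, and an isomorphism $\mathbb M\simeq\varprojlim_{\alpha\in P}\mathcal R^{(\alpha)}$. $\mathfrak F$ is the category of essentially free $\mathcal R$-modules. A functor of $\mathcal R$-algebras is a functor of (associative, unital) rings $\mathbb A$ with a morphism of functors of rings $\mathcal R\to\mathbb A$ with central image. A quasi-coherent algebra quotient of $\mathbb A$ is a pointwise surjective morphism of functors of algebras $\mathbb A\to\mathcal A_i$, with $\mathcal A_i$ the quasi-coherent functor associated with an $R$-algebra $A_i$. $\mathbb A$ is a functor of pro-quasicoherent algebras if it is the inverse limit of its quasi-coherent algebra quotients. For a functor of commutative $\mathcal R$-algebras $\mathbb B$, $(\mathrm{Spec}\,\mathbb B)(S)=\mathrm{Hom}_{\mathcal R\text{-alg}}(\mathbb B,\mathcal S)$, where $\mathcal S(R')=S\otimes_RR'$. For a functor of sets $\mathbb X$, $\mathbb A_{\mathbb X}=\underline{\mathrm{Hom}}(\mathbb X,\mathcal R)$, i.e. $\mathbb A_{\mathbb X}(S)=\mathrm{Hom}(\mathbb X_{|S},\mathcal R_{|S})$ (morphisms of functors of sets), a functor of commutative algebras. $\mathbb X$ is affine if the natural morphism $\mathbb X\to\mathrm{Spec}\,\mathbb A_{\mathbb X}$ is an isomorphism and $\mathbb A_{\mathbb X}$ is a reflexive functor of $\mathcal R$-modules. *)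

theory Defs
  imports
    "HOL-Algebra.Module"
    "HOL-Algebra.QuotRing"
    "HOL-Algebra.Free_Abelian_Groups"
    "HOL-Algebra.Generated_Groups"
begin

text \<open>
  The type \<open>'u\<close> is the universe: the objects of the category of commutative \<open>R\<close>-algebras are
  the algebras (in the sense of the locale \<^locale>\<open>algebra\<close>) whose carrier is a subset of \<open>'u\<close>,
  and sets used as indices of free modules are subsets of \<open>'u\<close>. The values of a functor may lie in
  any type. All maps (homomorphisms, components of natural transformations, families of components)
  are extensional, so that equality of morphisms is HOL equality.
\<close>

type_synonym 'u alg = "('u, 'u) module"

definition calg :: "('u, 'm) ring_scheme \<Rightarrow> 'u alg set" where
  "calg R = {S. algebra R S}"

definition alg_hom ::
  "('r, 'm) ring_scheme \<Rightarrow> ('r, 'a) module \<Rightarrow> ('r, 'b) module \<Rightarrow> ('a \<Rightarrow> 'b) set" where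
  "alg_hom R A B = {f \<in> ring_hom A B. f \<in> extensional (carrier A) \<and>
     (\<forall>r\<in>carrier R. \<forall>a\<in>carrier A. f (r \<odot>\<^bsub>A\<^esub> a) = r \<odot>\<^bsub>B\<^esub> f a)}"

definition mod_hom ::
  "('r, 'm) ring_scheme \<Rightarrow> ('r, 'a) module \<Rightarrow> ('r, 'b) module \<Rightarrow> ('a \<Rightarrow> 'b) set" where
  "mod_hom R M N = {f \<in> carrier M \<rightarrow>\<^sub>E carrier N.
     (\<forall>x\<in>carrier M. \<forall>y\<in>carrier M. f (x \<oplus>\<^bsub>M\<^esub> y) = f x \<oplus>\<^bsub>N\<^esub> f y) \<and>
     (\<forall>r\<in>carrier R. \<forall>x\<in>carrier M. f (r \<odot>\<^bsub>M\<^esub> x) = r \<odot>\<^bsub>N\<^esub> f x)}"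

text \<open>
  Associative unital, not necessarily commutative, algebras: rings with a ring homomorphism
  \<open>s \<mapsto> s \<odot> \<one>\<close> from \<open>S\<close> with central image, the scalar multiplication being the induced one.
\<close>

definition assoc_algebra :: "('r, 'm) ring_scheme \<Rightarrow> ('r, 'a) module \<Rightarrow> bool" where
  "assoc_algebra S A \<longleftrightarrow> cring S \<and> ring A \<and>
     (\<lambda>s. s \<odot>\<^bsub>A\<^esub> \<one>\<^bsub>A\<^esub>) \<in> ring_hom S A \<and>
     (\<forall>s\<in>carrier S. \<forall>a\<in>carrier A.
        (s \<odot>\<^bsub>A\<^esub> \<one>\<^bsub>A\<^esub>) \<otimes>\<^bsub>A\<^esub> a = a \<otimes>\<^bsub>A\<^esub> (s \<odot>\<^bsub>A\<^esub> \<one>\<^bsub>A\<^esub>) \<and>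
        s \<odot>\<^bsub>A\<^esub> a = (s \<odot>\<^bsub>A\<^esub> \<one>\<^bsub>A\<^esub>) \<otimes>\<^bsub>A\<^esub> a)"

definition self :: "'u alg \<Rightarrow> 'u alg" where
  "self S = S\<lparr>smult := monoid.mult S\<rparr>"

text \<open>
  Restriction of scalars of an \<open>S\<close>-algebra along \<open>f: R \<rightarrow> S\<close>. Cutting the scalars down to the
  carrier makes iterated restrictions equal as records.
\<close>

definition rscal :: "('u, 'm) ring_scheme \<Rightarrow> ('u \<Rightarrow> 'u) \<Rightarrow> 'u alg \<Rightarrow> 'u alg" where
  "rscal R f T = T\<lparr>smult := \<lambda>r\<in>carrier R. \<lambda>t. f r \<odot>\<^bsub>T\<^esub> t\<rparr>"

definition over :: "('u, 'm) ring_scheme \<Rightarrow> 'u alg \<Rightarrow> 'u alg \<Rightarrow> 'u alg" where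
  "over R S T = rscal R (\<lambda>r. r \<odot>\<^bsub>S\<^esub> \<one>\<^bsub>S\<^esub>) T"


section \<open>Functors on commutative algebras\<close>

record ('u, 'v, 'c) alg_functor =
  Ob :: "'u alg \<Rightarrow> 'c"
  Mor :: "'u alg \<Rightarrow> 'u alg \<Rightarrow> ('u \<Rightarrow> 'u) \<Rightarrow> 'v \<Rightarrow> 'v"

type_synonym ('u, 'v) set_fun = "('u, 'v, 'v set) alg_functor"
type_synonym ('u, 'v) mod_fun = "('u, 'v, ('u, 'v) module) alg_functor"
type_synonym ('u, 'v, 'w) trans = "'u alg \<Rightarrow> 'v \<Rightarrow> 'w"

locale set_functor =
  fixes R :: "('u, 'm) ring_scheme" and X :: "('u, 'v) set_fun"
  assumes base_cring: "cring R"
    and Mor_closed: "\<lbrakk>S \<in> calg R; T \<in> calg R; f \<in> alg_hom R S T\<rbrakk>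
      \<Longrightarrow> Mor X S T f \<in> Ob X S \<rightarrow>\<^sub>E Ob X T"
    and Mor_id: "S \<in> calg R \<Longrightarrow> Mor X S S (\<lambda>s\<in>carrier S. s) = (\<lambda>x\<in>Ob X S. x)"
    and Mor_comp: "\<lbrakk>S \<in> calg R; T \<in> calg R; U \<in> calg R; f \<in> alg_hom R S T; g \<in> alg_hom R T U\<rbrakk>
      \<Longrightarrow> Mor X S U (compose (carrier S) g f) = compose (Ob X S) (Mor X T U g) (Mor X S T f)"

definition uset :: "('u, 'v) mod_fun \<Rightarrow> ('u, 'v) set_fun" where
  "uset M = \<lparr>Ob = \<lambda>S. carrier (Ob M S), Mor = Mor M\<rparr>"

locale module_functor = set_functor R "uset M"
  for R :: "('u, 'm) ring_scheme" and M :: "('u, 'v) mod_fun" +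
  assumes Ob_module: "S \<in> calg R \<Longrightarrow> module S (Ob M S)"
    and Mor_add: "\<lbrakk>S \<in> calg R; T \<in> calg R; f \<in> alg_hom R S T;
        x \<in> carrier (Ob M S); y \<in> carrier (Ob M S)\<rbrakk>
      \<Longrightarrow> Mor M S T f (x \<oplus>\<^bsub>Ob M S\<^esub> y) = Mor M S T f x \<oplus>\<^bsub>Ob M T\<^esub> Mor M S T f y"
    and Mor_smult: "\<lbrakk>S \<in> calg R; T \<in> calg R; f \<in> alg_hom R S T;
        s \<in> carrier S; x \<in> carrier (Ob M S)\<rbrakk>
      \<Longrightarrow> Mor M S T f (s \<odot>\<^bsub>Ob M S\<^esub> x) = f s \<odot>\<^bsub>Ob M T\<^esub> Mor M S T f x"

locale algebra_functor = set_functor R "uset A"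
  for R :: "('u, 'm) ring_scheme" and A :: "('u, 'v) mod_fun" +
  assumes Ob_algebra: "S \<in> calg R \<Longrightarrow> assoc_algebra S (Ob A S)"
    and Mor_ring_hom: "\<lbrakk>S \<in> calg R; T \<in> calg R; f \<in> alg_hom R S T\<rbrakk>
      \<Longrightarrow> Mor A S T f \<in> ring_hom (Ob A S) (Ob A T)"
    and Mor_scalar: "\<lbrakk>S \<in> calg R; T \<in> calg R; f \<in> alg_hom R S T; s \<in> carrier S\<rbrakk>
      \<Longrightarrow> Mor A S T f (s \<odot>\<^bsub>Ob A S\<^esub> \<one>\<^bsub>Ob A S\<^esub>) = f s \<odot>\<^bsub>Ob A T\<^esub> \<one>\<^bsub>Ob A T\<^esub>"

locale comm_algebra_functor = algebra_functor R A
  for R :: "('u, 'm) ring_scheme" and A :: "('u, 'v) mod_fun" +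
  assumes Ob_comm: "S \<in> calg R \<Longrightarrow> cring (Ob A S)"

definition set_trans ::
  "('u, 'm) ring_scheme \<Rightarrow> ('u, 'v) set_fun \<Rightarrow> ('u, 'w) set_fun \<Rightarrow> ('u, 'v, 'w) trans set" where
  "set_trans R X Y = {\<eta> \<in> (\<Pi>\<^sub>E S\<in>calg R. Ob X S \<rightarrow>\<^sub>E Ob Y S).
     \<forall>S\<in>calg R. \<forall>T\<in>calg R. \<forall>f\<in>alg_hom R S T. \<forall>x\<in>Ob X S.
       \<eta> T (Mor X S T f x) = Mor Y S T f (\<eta> S x)}"

definition mod_trans ::
  "('u, 'm) ring_scheme \<Rightarrow> ('u, 'v) mod_fun \<Rightarrow> ('u, 'w) mod_fun \<Rightarrow> ('u, 'v, 'w) trans set" where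
  "mod_trans R M N = {\<eta> \<in> set_trans R (uset M) (uset N).
     \<forall>S\<in>calg R. \<eta> S \<in> mod_hom S (Ob M S) (Ob N S)}"

definition alg_trans ::
  "('u, 'm) ring_scheme \<Rightarrow> ('u, 'v) mod_fun \<Rightarrow> ('u, 'w) mod_fun \<Rightarrow> ('u, 'v, 'w) trans set" where
  "alg_trans R A B = {\<eta> \<in> set_trans R (uset A) (uset B).
     \<forall>S\<in>calg R. \<eta> S \<in> alg_hom S (Ob A S) (Ob B S)}"

definition set_iso ::
  "('u, 'm) ring_scheme \<Rightarrow> ('u, 'v) set_fun \<Rightarrow> ('u, 'w) set_fun \<Rightarrow> ('u, 'v, 'w) trans set" where
  "set_iso R X Y = {\<eta> \<in> set_trans R X Y. \<forall>S\<in>calg R. bij_betw (\<eta> S) (Ob X S) (Ob Y S)}"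

definition mod_iso ::
  "('u, 'm) ring_scheme \<Rightarrow> ('u, 'v) mod_fun \<Rightarrow> ('u, 'w) mod_fun \<Rightarrow> ('u, 'v, 'w) trans set" where
  "mod_iso R M N = mod_trans R M N \<inter> set_iso R (uset M) (uset N)"

definition alg_iso ::
  "('u, 'm) ring_scheme \<Rightarrow> ('u, 'v) mod_fun \<Rightarrow> ('u, 'w) mod_fun \<Rightarrow> ('u, 'v, 'w) trans set" where
  "alg_iso R A B = alg_trans R A B \<inter> set_iso R (uset A) (uset B)"

definition tcomp ::
  "('u, 'm) ring_scheme \<Rightarrow> ('u, 'v) set_fun \<Rightarrow> ('u, 'w, 'x) trans \<Rightarrow> ('u, 'v, 'w) trans
     \<Rightarrow> ('u, 'v, 'x) trans" where
  "tcomp R X \<psi> \<phi> = (\<lambda>S\<in>calg R. compose (Ob X S) (\<psi> S) (\<phi> S))"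

definition restr ::
  "('u, 'm) ring_scheme \<Rightarrow> 'u alg \<Rightarrow> ('u, 'v, 'c) alg_functor \<Rightarrow> ('u, 'v, 'c) alg_functor" where
  "restr R S F = \<lparr>Ob = \<lambda>T. Ob F (over R S T),
     Mor = \<lambda>T T' f. Mor F (over R S T) (over R S T') f\<rparr>"

definition base_fun :: "('u, 'u) mod_fun" where
  "base_fun = \<lparr>Ob = self, Mor = \<lambda>S T f. f\<rparr>"


section \<open>Limits and colimits\<close>

text \<open>
  A diagram is given by an index set \<open>Q\<close>, functors \<open>D i\<close> and sets \<open>H i j\<close> of transition
  morphisms \<open>D i \<rightarrow> D j\<close>.
\<close>

definition lim_carrier ::
  "'i set \<Rightarrow> ('i \<Rightarrow> ('u, 'v) mod_fun) \<Rightarrow> ('i \<Rightarrow> 'i \<Rightarrow> ('u, 'v, 'v) trans set) \<Rightarrow> 'u alg \<Rightarrow> ('i \<Rightarrow> 'v) set" where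
  "lim_carrier Q D H S = {x \<in> (\<Pi>\<^sub>E i\<in>Q. carrier (Ob (D i) S)).
     \<forall>i\<in>Q. \<forall>j\<in>Q. \<forall>h\<in>H i j. h S (x i) = x j}"

definition lim_fun ::
  "'i set \<Rightarrow> ('i \<Rightarrow> ('u, 'v) mod_fun) \<Rightarrow> ('i \<Rightarrow> 'i \<Rightarrow> ('u, 'v, 'v) trans set) \<Rightarrow> ('u, 'i \<Rightarrow> 'v) mod_fun" where
  "lim_fun Q D H =
    \<lparr>Ob = \<lambda>S. \<lparr>carrier = lim_carrier Q D H S,
        monoid.mult = \<lambda>x y. \<lambda>i\<in>Q. x i \<otimes>\<^bsub>Ob (D i) S\<^esub> y i,
        monoid.one = \<lambda>i\<in>Q. \<one>\<^bsub>Ob (D i) S\<^esub>,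
        ring.zero = \<lambda>i\<in>Q. \<zero>\<^bsub>Ob (D i) S\<^esub>,
        ring.add = \<lambda>x y. \<lambda>i\<in>Q. x i \<oplus>\<^bsub>Ob (D i) S\<^esub> y i,
        smult = \<lambda>s x. \<lambda>i\<in>Q. s \<odot>\<^bsub>Ob (D i) S\<^esub> x i\<rparr>,
     Mor = \<lambda>S T f. \<lambda>x\<in>lim_carrier Q D H S. \<lambda>i\<in>Q. Mor (D i) S T f (x i)\<rparr>"

definition colim_rel ::
  "'i set \<Rightarrow> ('i \<Rightarrow> ('u, 'v) set_fun) \<Rightarrow> ('i \<Rightarrow> 'i \<Rightarrow> ('u, 'v, 'v) trans set) \<Rightarrow> 'u alg
     \<Rightarrow> ('i \<times> 'v) rel" where
  "colim_rel Q D H S =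
     (let G = {((i, x), (j, h S x)) | i j h x. i \<in> Q \<and> j \<in> Q \<and> h \<in> H i j \<and> x \<in> Ob (D i) S}
      in (G \<union> G\<inverse>)\<^sup>*)"

definition colim_fun ::
  "'i set \<Rightarrow> ('i \<Rightarrow> ('u, 'v) set_fun) \<Rightarrow> ('i \<Rightarrow> 'i \<Rightarrow> ('u, 'v, 'v) trans set)
     \<Rightarrow> ('u, ('i \<times> 'v) set) set_fun" where
  "colim_fun Q D H =
    \<lparr>Ob = \<lambda>S. (SIGMA i:Q. Ob (D i) S) // colim_rel Q D H S,
     Mor = \<lambda>S T f. \<lambda>c\<in>(SIGMA i:Q. Ob (D i) S) // colim_rel Q D H S.
       colim_rel Q D H T `` ((\<lambda>(i, x). (i, Mor (D i) S T f x)) ` c)\<rparr>"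


section \<open>Essentially free modules\<close>

definition free_fun :: "'u set \<Rightarrow> ('u, 'u \<Rightarrow> 'u) mod_fun" where
  "free_fun \<alpha> = (let C = (\<lambda>S. {x \<in> \<alpha> \<rightarrow>\<^sub>E carrier S. finite {i \<in> \<alpha>. x i \<noteq> \<zero>\<^bsub>S\<^esub>}}) in
    \<lparr>Ob = \<lambda>S. \<lparr>carrier = C S,
        monoid.mult = undefined,
        monoid.one = undefined,
        ring.zero = \<lambda>i\<in>\<alpha>. \<zero>\<^bsub>S\<^esub>,
        ring.add = \<lambda>x y. \<lambda>i\<in>\<alpha>. x i \<oplus>\<^bsub>S\<^esub> y i,
        smult = \<lambda>s x. \<lambda>i\<in>\<alpha>. s \<otimes>\<^bsub>S\<^esub> x i\<rparr>,
     Mor = \<lambda>S T f. \<lambda>x\<in>C S. \<lambda>i\<in>\<alpha>. f (x i)\<rparr>)"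

definition free_proj :: "'u set \<Rightarrow> 'u set \<Rightarrow> ('u, 'u \<Rightarrow> 'u, 'u \<Rightarrow> 'u) trans set" where
  "free_proj \<alpha>2 \<alpha>1 = (if \<alpha>1 \<subseteq> \<alpha>2 then {\<lambda>S x. restrict x \<alpha>1} else {})"

definition essentially_free :: "('u, 'm) ring_scheme \<Rightarrow> ('u, 'v) mod_fun \<Rightarrow> bool" where
  "essentially_free R M \<longleftrightarrow> module_functor R M \<and>
     (\<exists>(I :: 'u set) P. P \<subseteq> Pow I \<and> (\<forall>\<alpha>\<in>P. \<forall>\<alpha>'\<in>P. \<alpha> \<union> \<alpha>' \<in> P) \<and>
        mod_iso R M (lim_fun P free_fun free_proj) \<noteq> {})"


section \<open>Tensor products and quasi-coherent algebras\<close>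

definition pair_ring :: "('r, 'a) module \<Rightarrow> ('r, 'b) module \<Rightarrow> ('a \<times> 'b \<Rightarrow>\<^sub>0 int) ring" where
  "pair_ring A T =
    \<lparr>carrier = carrier (free_Abelian_group (carrier A \<times> carrier T)),
     monoid.mult = \<lambda>x y. frag_extend (\<lambda>(a, t). frag_extend (\<lambda>(b, u). frag_of (a \<otimes>\<^bsub>A\<^esub> b, t \<otimes>\<^bsub>T\<^esub> u)) y) x,
     monoid.one = frag_of (\<one>\<^bsub>A\<^esub>, \<one>\<^bsub>T\<^esub>),
     ring.zero = 0,
     ring.add = (+)\<rparr>"

definition tensor_rel ::
  "('r, 'm) ring_scheme \<Rightarrow> ('r, 'a) module \<Rightarrow> ('r, 'b) module \<Rightarrow> ('a \<times> 'b \<Rightarrow>\<^sub>0 int) set" where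
  "tensor_rel R A T = generate (free_Abelian_group (carrier A \<times> carrier T))
    ({frag_of (a \<oplus>\<^bsub>A\<^esub> b, t) - frag_of (a, t) - frag_of (b, t) | a b t.
        a \<in> carrier A \<and> b \<in> carrier A \<and> t \<in> carrier T} \<union>
     {frag_of (a, t \<oplus>\<^bsub>T\<^esub> u) - frag_of (a, t) - frag_of (a, u) | a t u.
        a \<in> carrier A \<and> t \<in> carrier T \<and> u \<in> carrier T} \<union>
     {frag_of (r \<odot>\<^bsub>A\<^esub> a, t) - frag_of (a, r \<odot>\<^bsub>T\<^esub> t) | r a t.
        r \<in> carrier R \<and> a \<in> carrier A \<and> t \<in> carrier T})"

definition raw_tensor ::
  "('r, 'm) ring_scheme \<Rightarrow> ('r, 'a) module \<Rightarrow> ('r, 'b) module \<Rightarrow> ('a \<times> 'b \<Rightarrow>\<^sub>0 int) set ring" where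
  "raw_tensor R A T = pair_ring A T Quot tensor_rel R A T"

text \<open>
  The tensor product has to be an object of the category again, so it is copied into the universe
  along a chosen injection of its carrier, which exists as soon as \<open>'u\<close> is infinite.
\<close>

definition tensor_enc :: "('u, 'm) ring_scheme \<Rightarrow> 'u alg \<Rightarrow> 'u alg \<Rightarrow> ('u \<times> 'u \<Rightarrow>\<^sub>0 int) set \<Rightarrow> 'u" where
  "tensor_enc R A T = (SOME e. inj_on e (carrier (raw_tensor R A T)))"

definition tensor_dec :: "('u, 'm) ring_scheme \<Rightarrow> 'u alg \<Rightarrow> 'u alg \<Rightarrow> 'u \<Rightarrow> ('u \<times> 'u \<Rightarrow>\<^sub>0 int) set" where
  "tensor_dec R A T = inv_into (carrier (raw_tensor R A T)) (tensor_enc R A T)"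

definition tensor_class :: "('u, 'm) ring_scheme \<Rightarrow> 'u alg \<Rightarrow> 'u alg \<Rightarrow> ('u \<times> 'u \<Rightarrow>\<^sub>0 int) \<Rightarrow> 'u" where
  "tensor_class R A T c = tensor_enc R A T (tensor_rel R A T +>\<^bsub>pair_ring A T\<^esub> c)"

definition pure_tensor :: "('u, 'm) ring_scheme \<Rightarrow> 'u alg \<Rightarrow> 'u alg \<Rightarrow> 'u \<Rightarrow> 'u \<Rightarrow> 'u" where
  "pure_tensor R A T a t = tensor_class R A T (frag_of (a, t))"

text \<open>\<open>A \<otimes>\<^sub>R T\<close> as a \<open>T\<close>-algebra.\<close>

definition tensor :: "('u, 'm) ring_scheme \<Rightarrow> 'u alg \<Rightarrow> 'u alg \<Rightarrow> 'u alg" where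
  "tensor R A T = (let W = raw_tensor R A T; e = tensor_enc R A T; d = tensor_dec R A T in
    \<lparr>carrier = e ` carrier W,
     monoid.mult = \<lambda>x y. e (d x \<otimes>\<^bsub>W\<^esub> d y),
     monoid.one = e \<one>\<^bsub>W\<^esub>,
     ring.zero = e \<zero>\<^bsub>W\<^esub>,
     ring.add = \<lambda>x y. e (d x \<oplus>\<^bsub>W\<^esub> d y),
     smult = \<lambda>t x. e (d (pure_tensor R A T \<one>\<^bsub>A\<^esub> t) \<otimes>\<^bsub>W\<^esub> d x)\<rparr>)"

definition tensor_map ::
  "('u, 'm) ring_scheme \<Rightarrow> 'u alg \<Rightarrow> 'u alg \<Rightarrow> 'u alg \<Rightarrow> 'u alg \<Rightarrow> ('u \<Rightarrow> 'u) \<Rightarrow> ('u \<Rightarrow> 'u) \<Rightarrow> 'u \<Rightarrow> 'u" where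
  "tensor_map R A T A' T' f g = (\<lambda>x\<in>carrier (tensor R A T).
     the_elem ((\<lambda>c. tensor_class R A' T' (frag_extend (\<lambda>(a, t). frag_of (f a, g t)) c))
       ` tensor_dec R A T x))"

definition qcoh :: "('u, 'm) ring_scheme \<Rightarrow> 'u alg \<Rightarrow> ('u, 'u) mod_fun" where
  "qcoh R A = \<lparr>Ob = \<lambda>T. tensor R A T, Mor = \<lambda>T T' g. tensor_map R A T A T' (\<lambda>a. a) g\<rparr>"


section \<open>Dual modules and function algebras\<close>

text \<open>
  Common operations for \<open>\<MM>\<^sup>*\<close> and \<open>\<AA>\<^sub>\<XX>\<close>: families of functions on the sets \<open>Ob X T\<close>, with \<open>T\<close>
  ranging over the commutative \<open>S\<close>-algebras, with pointwise operations; a morphism \<open>f: S \<rightarrow> S'\<close>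
  restricts such a family to the \<open>S'\<close>-algebras. \<open>C S\<close> is the set of admissible families.
\<close>

definition pointwise ::
  "('u, 'm) ring_scheme \<Rightarrow> ('u, 'v) set_fun \<Rightarrow> ('u alg \<Rightarrow> ('u, 'v, 'u) trans set)
     \<Rightarrow> ('u, ('u, 'v, 'u) trans) mod_fun" where
  "pointwise R X C =
    \<lparr>Ob = \<lambda>S. \<lparr>carrier = C S,
        monoid.mult = \<lambda>\<phi> \<psi>. \<lambda>T\<in>calg S. \<lambda>x\<in>Ob X (over R S T). \<phi> T x \<otimes>\<^bsub>T\<^esub> \<psi> T x,
        monoid.one = \<lambda>T\<in>calg S. \<lambda>x\<in>Ob X (over R S T). \<one>\<^bsub>T\<^esub>,
        ring.zero = \<lambda>T\<in>calg S. \<lambda>x\<in>Ob X (over R S T). \<zero>\<^bsub>T\<^esub>,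
        ring.add = \<lambda>\<phi> \<psi>. \<lambda>T\<in>calg S. \<lambda>x\<in>Ob X (over R S T). \<phi> T x \<oplus>\<^bsub>T\<^esub> \<psi> T x,
        smult = \<lambda>s \<phi>. \<lambda>T\<in>calg S. \<lambda>x\<in>Ob X (over R S T). s \<odot>\<^bsub>T\<^esub> \<phi> T x\<rparr>,
     Mor = \<lambda>S S' f. \<lambda>\<phi>\<in>C S. \<lambda>T\<in>calg S'. \<phi> (rscal S f T)\<rparr>"

definition dual :: "('u, 'm) ring_scheme \<Rightarrow> ('u, 'v) mod_fun \<Rightarrow> ('u, ('u, 'v, 'u) trans) mod_fun" where
  "dual R M = pointwise R (uset M) (\<lambda>S. mod_trans S (restr R S M) base_fun)"

definition fun_alg :: "('u, 'm) ring_scheme \<Rightarrow> ('u, 'v) set_fun \<Rightarrow> ('u, ('u, 'v, 'u) trans) mod_fun" where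
  "fun_alg R X = pointwise R X (\<lambda>S. set_trans S (restr R S X) (uset base_fun))"

text \<open>
  \<open>\<MM> \<rightarrow> \<MM>\<^sup>*\<^sup>*\<close>: at an \<open>S\<close>-algebra \<open>T\<close>, an element \<open>m\<close> of \<open>\<MM>(S)\<close> sends \<open>\<phi>: \<MM>|\<^sub>T \<rightarrow> \<T>\<close> to the value of \<open>\<phi>\<close>
  at the \<open>T\<close>-algebra \<open>T\<close> on the image of \<open>m\<close> in \<open>\<MM>(T)\<close>.
\<close>

definition bidual_map ::
  "('u, 'm) ring_scheme \<Rightarrow> ('u, 'v) mod_fun
     \<Rightarrow> ('u, 'v, ('u, ('u, 'v, 'u) trans, 'u) trans) trans" where
  "bidual_map R M = (\<lambda>S\<in>calg R. \<lambda>m\<in>carrier (Ob M S). \<lambda>T\<in>calg S.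
     \<lambda>\<phi>\<in>carrier (Ob (dual R M) (over R S T)).
       \<phi> (self T) (Mor M S (over R (over R S T) (self T)) (\<lambda>s\<in>carrier S. s \<odot>\<^bsub>T\<^esub> \<one>\<^bsub>T\<^esub>) m))"

definition reflexive_fun :: "('u, 'm) ring_scheme \<Rightarrow> ('u, 'v) mod_fun \<Rightarrow> bool" where
  "reflexive_fun R M \<longleftrightarrow> module_functor R M \<and> bidual_map R M \<in> mod_iso R M (dual R (dual R M))"


section \<open>Spectra and affine functors\<close>

definition spec ::
  "('u, 'm) ring_scheme \<Rightarrow> ('u, 'v) mod_fun \<Rightarrow> ('u, ('u, 'v, 'u) trans) set_fun" where
  "spec R B =
    \<lparr>Ob = \<lambda>S. alg_trans R B (qcoh R S),
     Mor = \<lambda>S S' f. \<lambda>x\<in>alg_trans R B (qcoh R S).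
       tcomp R (uset B) (\<lambda>T. tensor_map R S T S' T f (\<lambda>t. t)) x\<rparr>"

definition spec_map ::
  "('u, 'm) ring_scheme \<Rightarrow> ('u, 'v) mod_fun \<Rightarrow> ('u, 'w) mod_fun \<Rightarrow> ('u, 'v, 'w) trans
     \<Rightarrow> ('u, ('u, 'w, 'u) trans, ('u, 'v, 'u) trans) trans" where
  "spec_map R A B \<eta> = (\<lambda>S\<in>calg R. \<lambda>x\<in>Ob (spec R B) S. tcomp R (uset A) x \<eta>)"

text \<open>
  \<open>\<XX> \<rightarrow> Spec \<AA>\<^sub>\<XX>\<close>: a point \<open>x\<close> of \<open>\<XX>(S)\<close> sends \<open>F\<close> in \<open>\<AA>\<^sub>\<XX>(T)\<close> to the value of \<open>F\<close> on the image of \<open>x\<close>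
  in \<open>\<XX>(S \<otimes>\<^sub>R T)\<close>.
\<close>

definition point_map ::
  "('u, 'm) ring_scheme \<Rightarrow> ('u, 'v) set_fun
     \<Rightarrow> ('u, 'v, ('u, ('u, 'v, 'u) trans, 'u) trans) trans" where
  "point_map R X = (\<lambda>S\<in>calg R. \<lambda>x\<in>Ob X S. \<lambda>T\<in>calg R. \<lambda>F\<in>carrier (Ob (fun_alg R X) T).
     let U = tensor R S T in
     F U (Mor X S (over R T U) (\<lambda>s\<in>carrier S. pure_tensor R S T s \<one>\<^bsub>T\<^esub>) x))"

definition affine_fun :: "('u, 'm) ring_scheme \<Rightarrow> ('u, 'v) set_fun \<Rightarrow> bool" where
  "affine_fun R X \<longleftrightarrow> set_functor R X \<and>
     point_map R X \<in> set_iso R X (spec R (fun_alg R X)) \<and>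
     reflexive_fun R (fun_alg R X)"


section \<open>Quasi-coherent algebra quotients\<close>

type_synonym ('u, 'v) quot = "'u alg \<times> ('u, 'v, 'u) trans"

definition quotients :: "('u, 'm) ring_scheme \<Rightarrow> ('u, 'v) mod_fun \<Rightarrow> ('u, 'v) quot set" where
  "quotients R A = {(B, \<pi>). assoc_algebra R B \<and> \<pi> \<in> alg_trans R A (qcoh R B) \<and>
     (\<forall>S\<in>calg R. \<pi> S ` carrier (Ob A S) = carrier (Ob (qcoh R B) S))}"

definition quot_fun :: "('u, 'm) ring_scheme \<Rightarrow> ('u, 'v) quot \<Rightarrow> ('u, 'u) mod_fun" where
  "quot_fun R i = qcoh R (fst i)"

definition quot_mor ::
  "('u, 'm) ring_scheme \<Rightarrow> ('u, 'v) mod_fun \<Rightarrow> ('u, 'v) quot \<Rightarrow> ('u, 'v) quot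
     \<Rightarrow> ('u, 'u, 'u) trans set" where
  "quot_mor R A i j = {h \<in> alg_trans R (quot_fun R i) (quot_fun R j).
     tcomp R (uset A) h (snd i) = snd j}"

definition quot_lim ::
  "('u, 'm) ring_scheme \<Rightarrow> ('u, 'v) mod_fun \<Rightarrow> ('u, ('u, 'v) quot \<Rightarrow> 'u) mod_fun" where
  "quot_lim R A = lim_fun (quotients R A) (quot_fun R) (quot_mor R A)"

definition quot_lim_map ::
  "('u, 'm) ring_scheme \<Rightarrow> ('u, 'v) mod_fun \<Rightarrow> ('u, 'v, ('u, 'v) quot \<Rightarrow> 'u) trans" where
  "quot_lim_map R A = (\<lambda>S\<in>calg R. \<lambda>a\<in>carrier (Ob A S). \<lambda>i\<in>quotients R A. snd i S a)"

definition pro_quasicoherent :: "('u, 'm) ring_scheme \<Rightarrow> ('u, 'v) mod_fun \<Rightarrow> bool" where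
  "pro_quasicoherent R A \<longleftrightarrow> algebra_functor R A \<and> quot_lim_map R A \<in> alg_iso R A (quot_lim R A)"

definition spec_colim ::
  "('u, 'm) ring_scheme \<Rightarrow> ('u, 'v) mod_fun
     \<Rightarrow> ('u, (('u, 'v) quot \<times> ('u, 'u, 'u) trans) set) set_fun" where
  "spec_colim R A = colim_fun (quotients R A) (\<lambda>i. spec R (quot_fun R i))
     (\<lambda>i j. spec_map R (quot_fun R j) (quot_fun R i) ` quot_mor R A j i)"

text \<open>The canonical morphism induced by the morphisms \<open>Spec \<A>\<^sub>i \<rightarrow> Spec \<AA>\<close>.\<close>

definition spec_colim_map ::
  "('u, 'm) ring_scheme \<Rightarrow> ('u, 'v) mod_fun
     \<Rightarrow> ('u, (('u, 'v) quot \<times> ('u, 'u, 'u) trans) set, ('u, 'v, 'u) trans) trans" where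
  "spec_colim_map R A = (\<lambda>S\<in>calg R. \<lambda>c\<in>Ob (spec_colim R A) S.
     the_elem ((\<lambda>(i, x). spec_map R A (quot_fun R i) (snd i) S x) ` c))"

text \<open>
  The canonical morphism from the function algebra of \<open>Spec \<AA>\<close> to the limit of the \<open>\<A>\<^sub>i\<close>. The quotient
  map \<open>\<AA> \<rightarrow> \<A>\<^sub>i\<close> is itself an \<open>A\<^sub>i\<close>-point of \<open>Spec \<AA>\<close> (\<open>A\<^sub>i\<close> is commutative when \<open>\<AA>\<close> is), and the component
  in \<open>\<A>\<^sub>i(S) = A\<^sub>i \<otimes>\<^sub>R S\<close> of a function \<open>F\<close> over \<open>S\<close> is its value at the image of this point over \<open>A\<^sub>i \<otimes>\<^sub>R S\<close>.
  By Yoneda this is the restriction of \<open>F\<close> along \<open>Spec \<A>\<^sub>i \<rightarrow> Spec \<AA>\<close>, the function algebra of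
  \<open>Spec \<A>\<^sub>i\<close> being identified with \<open>\<A>\<^sub>i\<close>.
\<close>

definition spec_fun_lim_map ::
  "('u, 'm) ring_scheme \<Rightarrow> ('u, 'v) mod_fun
     \<Rightarrow> ('u, ('u, ('u, 'v, 'u) trans, 'u) trans, ('u, 'v) quot \<Rightarrow> 'u) trans" where
  "spec_fun_lim_map R A = (\<lambda>S\<in>calg R. \<lambda>F\<in>carrier (Ob (fun_alg R (spec R A)) S).
     \<lambda>i\<in>quotients R A. let B = fst i; U = tensor R B S in
       F U (Mor (spec R A) B (over R S U) (\<lambda>b\<in>carrier B. pure_tensor R B S b \<one>\<^bsub>S\<^esub>) (snd i)))"

end

theory Submission
  imports Defs
begin

text \<open>
  In coordinates, \<open>\<AA>(S)\<close> consists of the vectors \<open>x: J \<rightarrow> S\<close> whose support belongs to an ideal of subsets of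
  \<open>J\<close>. A natural linear map \<open>\<phi>\<close> from \<open>\<AA>\<close> to a quasi-coherent module has only finitely many nonzero
  values on the basis vectors \<open>e\<^sub>i\<close> with \<open>i\<close> in a given support, and \<open>\<phi>(x) = \<Sum> x\<^sub>i \<phi>(e\<^sub>i)\<close>: evaluate \<open>\<phi>\<close> at a generic
  vector over a square-zero extension. Hence \<open>\<phi>\<close> is determined by its values on \<open>\<AA>(R)\<close>. Consequently a point
  \<open>\<AA> \<rightarrow> \<S>\<close> of the spectrum factors through the quasi-coherent algebra of the image of \<open>\<AA>(R)\<close> in \<open>S\<close>, which is a
  quotient of \<open>\<AA>\<close>, and every other factorization through a quotient maps to this one. This is the colimit
  statement, and together with the Yoneda lemma it identifies the functions on \<open>Spec \<AA>\<close> with \<open>lim \<A>\<^sub>i\<close>. For affine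
  \<open>\<XX>\<close> the latter is transported along \<open>\<XX> \<simeq> Spec \<AA>\<^sub>\<XX>\<close>.
\<close>


section \<open>Algebras\<close>

text \<open>The image of the point is a subalgebra B of S, but B \<otimes> T \<rightarrow> S
  \<otimes> T can fail to be injective when T is not R, so the quotient map cannot be read off from
  the point inside S \<otimes> T. It is defined instead by the coordinate sum with coefficients in
  B, a finite sum because the point kills almost all basis vectors in a given support. The price is
  that multiplicativity does not come for free: it is inherited from the point only over R, where B
  \<otimes> R is B, and is carried to every T by the uniqueness of linear maps with given values on
  basis vectors. Products with an element that lives over some T0 and not over R force the linear
  maps to be families over T0-algebras.

  The square-zero extension makes homogeneity exploitable: a map that is merely natural and
  homogeneous is compared over T[\<epsilon>] at \<epsilon>x and at the image of the generic vector.
  A tensor over the extension is a finite sum of pure tensors, each with finitely many coordinates,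
  whence the finiteness.\<close>

lemma assoc_algebra_ring: "assoc_algebra R B \<Longrightarrow> ring B"
  and assoc_algebra_cring: "assoc_algebra R B \<Longrightarrow> cring R"
  by (simp_all add: assoc_algebra_def)

text \<open>Scalars act as left multiplication by the elements \<open>s \<odot> \<one>\<close>, so
  every module law becomes a ring law in \<open>B\<close>.\<close>

lemma assoc_algebra_module:
  assumes "assoc_algebra R B" shows "module R B"
proof -
  interpret R: cring R using assms by (simp add: assoc_algebra_def)
  interpret B: ring B using assms by (simp add: assoc_algebra_def)
  let ?i = "\<lambda>s. s \<odot>\<^bsub>B\<^esub> \<one>\<^bsub>B\<^esub>"
  have h: "?i \<in> ring_hom R B" using assms by (simp add: assoc_algebra_def)
  have sm: "s \<odot>\<^bsub>B\<^esub> a = ?i s \<otimes>\<^bsub>B\<^esub> a" if "s \<in> carrier R" "a \<in> carrier B" for s a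
    using assms that unfolding assoc_algebra_def by blast
  have c: "?i s \<in> carrier B" if "s \<in> carrier R" for s
    using ring_hom_closed[OF h] that by simp
  show ?thesis
  proof (rule moduleI)
    show "cring R" "abelian_group B" by unfold_locales
    fix a b x y assume a: "a \<in> carrier R" and b: "b \<in> carrier R" and x: "x \<in> carrier B" and y: "y \<in> carrier B"
    show "a \<odot>\<^bsub>B\<^esub> (x \<oplus>\<^bsub>B\<^esub> y) = a \<odot>\<^bsub>B\<^esub> x \<oplus>\<^bsub>B\<^esub> a \<odot>\<^bsub>B\<^esub> y"
      using a x y by (simp add: sm[OF a x] sm[OF a y] sm[OF a B.a_closed[OF x y]] c B.r_distr)
  next
    fix a x assume a: "a \<in> carrier R" and x: "x \<in> carrier B"
    show "a \<odot>\<^bsub>B\<^esub> x \<in> carrier B" by (simp add: sm[OF a x] c a x)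
  next
    fix a b x assume a: "a \<in> carrier R" and b: "b \<in> carrier R" and x: "x \<in> carrier B"
    show "(a \<oplus>\<^bsub>R\<^esub> b) \<odot>\<^bsub>B\<^esub> x = a \<odot>\<^bsub>B\<^esub> x \<oplus>\<^bsub>B\<^esub> b \<odot>\<^bsub>B\<^esub> x"
      using ring_hom_add[OF h a b]
      by (simp add: sm[OF a x] sm[OF b x] sm[OF R.a_closed[OF a b] x] c a b x B.l_distr)
    have bx: "b \<odot>\<^bsub>B\<^esub> x \<in> carrier B" by (simp add: sm[OF b x] c b x)
    show "(a \<otimes>\<^bsub>R\<^esub> b) \<odot>\<^bsub>B\<^esub> x = a \<odot>\<^bsub>B\<^esub> (b \<odot>\<^bsub>B\<^esub> x)"
      using ring_hom_mult[OF h a b] sm[OF a bx] sm[OF b x] sm[OF R.m_closed[OF a b] x]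
      by (simp add: c a b x B.m_assoc)
  next
    fix x assume x: "x \<in> carrier B"
    show "\<one>\<^bsub>R\<^esub> \<odot>\<^bsub>B\<^esub> x = x"
      using ring_hom_one[OF h] by (simp add: sm[OF R.one_closed x] x)
  qed
qed

text \<open>The first law is associativity. The second is where centrality of the scalars enters:
  the scalar is moved past \<open>a\<close>.\<close>

lemma assoc_algebra_smult_mult:
  assumes "assoc_algebra R B" "s \<in> carrier R" "a \<in> carrier B" "b \<in> carrier B"
  shows "(s \<odot>\<^bsub>B\<^esub> a) \<otimes>\<^bsub>B\<^esub> b = s \<odot>\<^bsub>B\<^esub> (a \<otimes>\<^bsub>B\<^esub> b)"
    and "a \<otimes>\<^bsub>B\<^esub> (s \<odot>\<^bsub>B\<^esub> b) = s \<odot>\<^bsub>B\<^esub> (a \<otimes>\<^bsub>B\<^esub> b)"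
proof -
  interpret B: ring B using assms by (simp add: assoc_algebra_def)
  let ?i = "\<lambda>s. s \<odot>\<^bsub>B\<^esub> \<one>\<^bsub>B\<^esub>"
  have h: "?i \<in> ring_hom R B" using assms by (simp add: assoc_algebra_def)
  have sm: "s \<odot>\<^bsub>B\<^esub> a = ?i s \<otimes>\<^bsub>B\<^esub> a" if "a \<in> carrier B" for a
    using assms that unfolding assoc_algebra_def by blast
  have cm: "?i s \<otimes>\<^bsub>B\<^esub> a = a \<otimes>\<^bsub>B\<^esub> ?i s" if "a \<in> carrier B" for a
    using assms that unfolding assoc_algebra_def by blast
  have c: "?i s \<in> carrier B"
    using ring_hom_closed[OF h] assms by simp
  show "(s \<odot>\<^bsub>B\<^esub> a) \<otimes>\<^bsub>B\<^esub> b = s \<odot>\<^bsub>B\<^esub> (a \<otimes>\<^bsub>B\<^esub> b)"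
    using c assms by (simp add: sm[of a] sm[of "a \<otimes>\<^bsub>B\<^esub> b"] B.m_assoc)
  have "a \<otimes>\<^bsub>B\<^esub> (?i s \<otimes>\<^bsub>B\<^esub> b) = (?i s \<otimes>\<^bsub>B\<^esub> a) \<otimes>\<^bsub>B\<^esub> b"
    using c assms by (simp add: cm[of a] B.m_assoc)
  then show "a \<otimes>\<^bsub>B\<^esub> (s \<odot>\<^bsub>B\<^esub> b) = s \<odot>\<^bsub>B\<^esub> (a \<otimes>\<^bsub>B\<^esub> b)"
    using c assms by (simp add: sm[of b] sm[of "a \<otimes>\<^bsub>B\<^esub> b"] B.m_assoc)
qed

lemma algebra_imp_assoc_algebra:
  assumes "algebra R S" shows "assoc_algebra R S"
proof -
  interpret algebra R S by fact
  have 1: "(s \<odot>\<^bsub>S\<^esub> \<one>\<^bsub>S\<^esub>) \<otimes>\<^bsub>S\<^esub> a = s \<odot>\<^bsub>S\<^esub> a"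
    and 2: "(s \<odot>\<^bsub>S\<^esub> \<one>\<^bsub>S\<^esub>) \<otimes>\<^bsub>S\<^esub> a = a \<otimes>\<^bsub>S\<^esub> (s \<odot>\<^bsub>S\<^esub> \<one>\<^bsub>S\<^esub>)"
    if "s \<in> carrier R" "a \<in> carrier S" for s a
    using that m_comm[of a "s \<odot>\<^bsub>S\<^esub> \<one>\<^bsub>S\<^esub>"] by (simp_all add: smult_assoc2)
  have "(\<lambda>s. s \<odot>\<^bsub>S\<^esub> \<one>\<^bsub>S\<^esub>) \<in> ring_hom R S"
    by (rule ring_hom_memI) (simp_all add: smult_closed smult_l_distr smult_assoc1 smult_assoc2)
  then show ?thesis
    unfolding assoc_algebra_def using 1 2 R_cring ring_axioms by auto
qed

lemma assoc_algebra_imp_algebra: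
  assumes "assoc_algebra R B" "cring B" shows "algebra R B"
proof -
  interpret module R B by (rule assoc_algebra_module) fact
  interpret B: cring B by fact
  show ?thesis
    by (intro algebraI) (auto simp: smult_l_distr smult_r_distr smult_assoc1 R.cring_axioms B.cring_axioms
      assoc_algebra_smult_mult[OF assms(1)])
qed

text \<open>Algebra homomorphisms without the extensionality demanded by \<open>alg_hom\<close>.
  Plain functions such as \<open>\<lambda>b. b\<close>, which occur as arguments of
  \<open>tensor_map\<close>, belong here.\<close>

definition lin_hom ::
  "('r, 'm) ring_scheme \<Rightarrow> ('r, 'a) module \<Rightarrow> ('r, 'b) module \<Rightarrow> ('a \<Rightarrow> 'b) set" where
  "lin_hom R A B = {f \<in> ring_hom A B. \<forall>r\<in>carrier R. \<forall>a\<in>carrier A. f (r \<odot>\<^bsub>A\<^esub> a) = r \<odot>\<^bsub>B\<^esub> f a}"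

lemma alg_hom_iff: "f \<in> alg_hom R A B \<longleftrightarrow> f \<in> lin_hom R A B \<and> f \<in> extensional (carrier A)"
  by (auto simp: alg_hom_def lin_hom_def)

lemma lin_homD:
  assumes "f \<in> lin_hom R A B"
  shows "f \<in> ring_hom A B" "a \<in> carrier A \<Longrightarrow> f a \<in> carrier B"
    "a \<in> carrier A \<Longrightarrow> b \<in> carrier A \<Longrightarrow> f (a \<oplus>\<^bsub>A\<^esub> b) = f a \<oplus>\<^bsub>B\<^esub> f b"
    "a \<in> carrier A \<Longrightarrow> b \<in> carrier A \<Longrightarrow> f (a \<otimes>\<^bsub>A\<^esub> b) = f a \<otimes>\<^bsub>B\<^esub> f b"
    "f \<one>\<^bsub>A\<^esub> = \<one>\<^bsub>B\<^esub>"
    "r \<in> carrier R \<Longrightarrow> a \<in> carrier A \<Longrightarrow> f (r \<odot>\<^bsub>A\<^esub> a) = r \<odot>\<^bsub>B\<^esub> f a"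
  using assms by (auto simp: lin_hom_def ring_hom_def)

lemma lin_homI:
  assumes "\<And>a. a \<in> carrier A \<Longrightarrow> f a \<in> carrier B"
    "\<And>a b. a \<in> carrier A \<Longrightarrow> b \<in> carrier A \<Longrightarrow> f (a \<oplus>\<^bsub>A\<^esub> b) = f a \<oplus>\<^bsub>B\<^esub> f b"
    "\<And>a b. a \<in> carrier A \<Longrightarrow> b \<in> carrier A \<Longrightarrow> f (a \<otimes>\<^bsub>A\<^esub> b) = f a \<otimes>\<^bsub>B\<^esub> f b"
    "f \<one>\<^bsub>A\<^esub> = \<one>\<^bsub>B\<^esub>"
    "\<And>r a. r \<in> carrier R \<Longrightarrow> a \<in> carrier A \<Longrightarrow> f (r \<odot>\<^bsub>A\<^esub> a) = r \<odot>\<^bsub>B\<^esub> f a"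
  shows "f \<in> lin_hom R A B"
  using assms by (auto simp: lin_hom_def ring_hom_def)

lemma additive_zero:
  assumes "abelian_group A" "abelian_group B" "\<And>a. a \<in> carrier A \<Longrightarrow> f a \<in> carrier B"
    "\<And>a b. a \<in> carrier A \<Longrightarrow> b \<in> carrier A \<Longrightarrow> f (a \<oplus>\<^bsub>A\<^esub> b) = f a \<oplus>\<^bsub>B\<^esub> f b"
  shows "f \<zero>\<^bsub>A\<^esub> = \<zero>\<^bsub>B\<^esub>"
proof -
  interpret A: abelian_group A by fact
  interpret B: abelian_group B by fact
  have "f \<zero>\<^bsub>A\<^esub> \<oplus>\<^bsub>B\<^esub> f \<zero>\<^bsub>A\<^esub> = f \<zero>\<^bsub>A\<^esub>"
    using assms(4)[of "\<zero>\<^bsub>A\<^esub>" "\<zero>\<^bsub>A\<^esub>"] by simp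
  then show ?thesis using assms(3)[of "\<zero>\<^bsub>A\<^esub>"] by (simp add: B.add.l_cancel_one)
qed

lemma additive_finsum:
  assumes "abelian_group A" "abelian_group B" "\<And>a. a \<in> carrier A \<Longrightarrow> f a \<in> carrier B"
    "\<And>a b. a \<in> carrier A \<Longrightarrow> b \<in> carrier A \<Longrightarrow> f (a \<oplus>\<^bsub>A\<^esub> b) = f a \<oplus>\<^bsub>B\<^esub> f b"
    "finite I" "\<And>i. i \<in> I \<Longrightarrow> g i \<in> carrier A"
  shows "f (finsum A g I) = finsum B (\<lambda>i. f (g i)) I"
  using assms(5,6)
proof (induction I)
  case empty
  interpret A: abelian_group A by fact
  interpret B: abelian_group B by fact
  show ?case using additive_zero[OF assms(1-4)] by simp
next
  case (insert i I)
  interpret A: abelian_group A by fact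
  interpret B: abelian_group B by fact
  show ?case using insert assms(3)
    by (subst A.finsum_insert; simp add: Pi_iff assms(4) A.finsum_closed)
qed


section \<open>Encoding into the universe\<close>

text \<open>Cardinal arithmetic: the free abelian group on an infinite set is equipollent to that
  set, and so is the square of an infinite set. It makes the choice behind \<open>tensor_enc\<close>
  succeed.\<close>

lemma inj_frag_universe:
  assumes "infinite (UNIV :: 'u set)"
  shows "\<exists>e :: ('u \<times> 'u \<Rightarrow>\<^sub>0 int) \<Rightarrow> 'u. inj e"
proof -
  have inf: "infinite (UNIV :: ('u \<times> 'u) set)"
    using assms by (simp add: finite_prod)
  have "(UNIV :: ('u \<times> 'u \<Rightarrow>\<^sub>0 int) set) \<lesssim> (UNIV :: ('u \<times> 'u) set)"
    using eqpoll_imp_lepoll[OF eqpoll_free_Abelian_group_infinite[OF inf]]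
    by (simp add: free_Abelian_group_def)
  also have "(UNIV :: ('u \<times> 'u) set) \<lesssim> (UNIV :: 'u set)"
    using card_of_Times_same_infinite[OF assms]
    by (metis UNIV_Times_UNIV eqpoll_iff_card_of_ordIso eqpoll_imp_lepoll)
  finally show ?thesis by (auto simp: lepoll_def)
qed

text \<open>A finitely supported vector is coded by the finite graph of its nonzero values, so an
  element of a square-zero extension becomes a pair of a scalar and a finite set.\<close>

lemma inj_pair_Fpow_universe:
  assumes "infinite (UNIV :: 'u set)"
  shows "\<exists>e :: 'u \<times> ('u \<times> 'u) set \<Rightarrow> 'u. inj_on e (UNIV \<times> Fpow UNIV)"
proof -
  have inf: "infinite (UNIV :: ('u \<times> 'u) set)"
    using assms by (simp add: finite_prod)
  have U: "(UNIV :: ('u \<times> 'u) set) \<lesssim> (UNIV :: 'u set)"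
    using card_of_Times_same_infinite[OF assms]
    by (metis UNIV_Times_UNIV eqpoll_iff_card_of_ordIso eqpoll_imp_lepoll)
  have "Fpow (UNIV :: ('u \<times> 'u) set) \<lesssim> (UNIV :: 'u set)"
    using eqpoll_imp_lepoll[OF eqpoll_Fpow[OF inf]] U lepoll_trans by blast
  then have "(UNIV :: 'u set) \<times> Fpow (UNIV :: ('u \<times> 'u) set) \<lesssim> (UNIV :: 'u set) \<times> (UNIV :: 'u set)"
    by (intro times_lepoll_mono lepoll_refl)
  also have "\<dots> \<lesssim> (UNIV :: 'u set)" using U by simp
  finally show ?thesis by (auto simp: lepoll_def)
qed


section \<open>Tensor products\<close>

text \<open>\<open>frag_extend\<close> is additive in the function as well. The product of
  \<open>pair_ring\<close> has its right factor inside the function, so this and the next lemma give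
  distributivity on that side.\<close>

lemma frag_extend_fun_diff:
  "frag_extend (\<lambda>p. f p - g p) c = frag_extend f c - frag_extend g c"
  using subset_UNIV[of "Poly_Mapping.keys c"]
  by (induction c rule: frag_induction) (auto simp: frag_extend_diff)

lemma frag_extend_fun_add:
  "frag_extend (\<lambda>p. f p + g p) c = frag_extend f c + frag_extend g c"
  using subset_UNIV[of "Poly_Mapping.keys c"]
  by (induction c rule: frag_induction) (auto simp: frag_extend_diff)

section \<open>The ring of formal sums of pairs and its ideal of bilinear relations\<close>

locale tensor_setup =
  fixes R :: "('u, 'm) ring_scheme" and B T :: "'u alg"
  assumes universe_infinite: "infinite (UNIV :: 'u set)"
    and B_algebra: "assoc_algebra R B" and T_algebra: "algebra R T"
begin

sublocale R: cring R using B_algebra by (simp add: assoc_algebra_def)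
sublocale B: module R B using B_algebra by (rule assoc_algebra_module)
sublocale B: ring B using B_algebra by (simp add: assoc_algebra_def)
sublocale T: module R T using T_algebra by (rule algebra.module)
sublocale T: cring T using T_algebra by (rule algebra.M_cring)

lemmas B_sm = assoc_algebra_smult_mult[OF B_algebra]
lemmas T_sm = assoc_algebra_smult_mult[OF algebra_imp_assoc_algebra[OF T_algebra]]

definition "gens =
    ({frag_of (a \<oplus>\<^bsub>B\<^esub> b, t) - frag_of (a, t) - frag_of (b, t) | a b t.
        a \<in> carrier B \<and> b \<in> carrier B \<and> t \<in> carrier T} \<union>
     {frag_of (a, t \<oplus>\<^bsub>T\<^esub> u) - frag_of (a, t) - frag_of (a, u) | a t u.
        a \<in> carrier B \<and> t \<in> carrier T \<and> u \<in> carrier T} \<union>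
     {frag_of (r \<odot>\<^bsub>B\<^esub> a, t) - frag_of (a, r \<odot>\<^bsub>T\<^esub> t) | r a t.
        r \<in> carrier R \<and> a \<in> carrier B \<and> t \<in> carrier T})"

abbreviation "P \<equiv> pair_ring B T"
abbreviation "I \<equiv> tensor_rel R B T"
abbreviation "FG \<equiv> free_Abelian_group (carrier B \<times> carrier T)"

lemma carrier_P: "carrier P = {c. Poly_Mapping.keys c \<subseteq> carrier B \<times> carrier T}"
  by (simp add: pair_ring_def set_eq_iff)

lemma P_simps: "ring.zero P = 0" "ring.add P = (+)" "monoid.one P = frag_of (\<one>\<^bsub>B\<^esub>, \<one>\<^bsub>T\<^esub>)"
  by (auto simp: pair_ring_def)

lemma add_monoid_P: "add_monoid P = FG"
  by (simp add: pair_ring_def free_Abelian_group_def)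

lemma mult_of: "frag_of (a, t) \<otimes>\<^bsub>P\<^esub> frag_of (b, u) = frag_of (a \<otimes>\<^bsub>B\<^esub> b, t \<otimes>\<^bsub>T\<^esub> u)"
  by (simp add: pair_ring_def)

lemma mult_diff:
  "(x - y) \<otimes>\<^bsub>P\<^esub> z = x \<otimes>\<^bsub>P\<^esub> z - y \<otimes>\<^bsub>P\<^esub> z" "x \<otimes>\<^bsub>P\<^esub> (y - z) = x \<otimes>\<^bsub>P\<^esub> y - x \<otimes>\<^bsub>P\<^esub> z"
  "(x + y) \<otimes>\<^bsub>P\<^esub> z = x \<otimes>\<^bsub>P\<^esub> z + y \<otimes>\<^bsub>P\<^esub> z" "x \<otimes>\<^bsub>P\<^esub> (y + z) = x \<otimes>\<^bsub>P\<^esub> y + x \<otimes>\<^bsub>P\<^esub> z"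
  "0 \<otimes>\<^bsub>P\<^esub> z = 0" "x \<otimes>\<^bsub>P\<^esub> 0 = 0"
  by (simp_all add: pair_ring_def frag_extend_diff frag_extend_add case_prod_unfold
      frag_extend_fun_diff frag_extend_fun_add frag_extend_eq_0)

text \<open>Differences cover sums and negatives at once, so a biadditive identity has to be checked
  on single pairs only.\<close>

lemma P_induct [consumes 1, case_names zero one diff]:
  assumes "c \<in> carrier P" "Q 0" "\<And>b t. b \<in> carrier B \<Longrightarrow> t \<in> carrier T \<Longrightarrow> Q (frag_of (b, t))"
    "\<And>x y. Q x \<Longrightarrow> Q y \<Longrightarrow> Q (x - y)"
  shows "Q c"
  using assms frag_induction[of c "carrier B \<times> carrier T" Q] by (auto simp: carrier_P)

lemma frag_of_in_P [simp]: "frag_of (b, t) \<in> carrier P \<longleftrightarrow> b \<in> carrier B \<and> t \<in> carrier T"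
  by (simp add: carrier_P)

lemma P_diff_closed: "x \<in> carrier P \<Longrightarrow> y \<in> carrier P \<Longrightarrow> x - y \<in> carrier P"
  using keys_diff[of x y] by (auto simp: carrier_P)

lemma P_add_closed: "x \<in> carrier P \<Longrightarrow> y \<in> carrier P \<Longrightarrow> x + y \<in> carrier P"
  using keys_add[of x y] by (auto simp: carrier_P)

lemma P_zero_closed: "0 \<in> carrier P" by (simp add: carrier_P)

lemma P_mult_closed:
  assumes "x \<in> carrier P" "y \<in> carrier P" shows "x \<otimes>\<^bsub>P\<^esub> y \<in> carrier P"
  using assms
proof (induction x rule: P_induct)
  case (one b t)
  from one(3) show ?case
    by (induction y rule: P_induct) (use one in \<open>auto simp: mult_of mult_diff P_diff_closed P_zero_closed\<close>)
qed (auto simp: mult_diff P_diff_closed P_zero_closed)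

lemma P_mult_assoc:
  assumes "x \<in> carrier P" "y \<in> carrier P" "z \<in> carrier P"
  shows "(x \<otimes>\<^bsub>P\<^esub> y) \<otimes>\<^bsub>P\<^esub> z = x \<otimes>\<^bsub>P\<^esub> (y \<otimes>\<^bsub>P\<^esub> z)"
  using assms(1)
proof (induction x rule: P_induct)
  case (one b t)
  note bt = one
  from assms(2) show ?case
  proof (induction y rule: P_induct)
    case (one c u)
    from assms(3) show ?case
      by (induction z rule: P_induct)
        (use one bt in \<open>auto simp: mult_of mult_diff B.m_assoc T.m_assoc\<close>)
  qed (auto simp: mult_diff)
qed (auto simp: mult_diff)

lemma ring_P: "ring P"
proof (rule ringI)
  have "comm_group (add_monoid P)"
    unfolding add_monoid_P by (rule abelian_free_Abelian_group)
  then show "abelian_group P"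
    by (rule comm_group_abelian_groupI)
  have l: "\<one>\<^bsub>P\<^esub> \<otimes>\<^bsub>P\<^esub> x = x" if "x \<in> carrier P" for x
    using that by (induction x rule: P_induct) (simp_all add: P_simps mult_of mult_diff)
  have r: "x \<otimes>\<^bsub>P\<^esub> \<one>\<^bsub>P\<^esub> = x" if "x \<in> carrier P" for x
    using that by (induction x rule: P_induct) (simp_all add: P_simps mult_of mult_diff)
  show "monoid P"
    by (rule monoidI) (auto simp: P_mult_closed P_mult_assoc l r, simp add: P_simps)
qed (auto simp: mult_diff P_simps(2))

sublocale P: ring P by (rule ring_P)

lemma gens_P: "gens \<subseteq> carrier P"
  unfolding gens_def by (auto intro!: P_diff_closed)

lemma I_gen: "I = generate FG gens"
  by (simp add: tensor_rel_def gens_def)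

lemma I_subgroup: "subgroup I (add_monoid P)"
  unfolding I_gen add_monoid_P
  using group.generate_is_subgroup[OF group_free_Abelian_group] gens_P
  by (metis add_monoid_P partial_object.select_convs(1))

lemma I_diff: "x \<in> I \<Longrightarrow> y \<in> I \<Longrightarrow> x - y \<in> I"
  using subgroup.m_closed[OF I_subgroup[unfolded add_monoid_P], of x "- y"]
    subgroup.m_inv_closed[OF I_subgroup[unfolded add_monoid_P], of y]
    subgroup.mem_carrier[OF I_subgroup[unfolded add_monoid_P], of y]
  by simp

lemma I_zero: "0 \<in> I" using subgroup.one_closed[OF I_subgroup] by (simp add: P_simps)

lemma gens_I: "x \<in> gens \<Longrightarrow> x \<in> I" by (simp add: I_gen generate.incl)

text \<open>One closure case is enough for a generated subgroup: an inverse is \<open>0 - h\<close>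
  and a sum is \<open>x - (0 - y)\<close>.\<close>

lemma I_induct [consumes 1]:
  assumes "x \<in> I" "\<And>g. g \<in> gens \<Longrightarrow> Q g" "\<And>g h. Q g \<Longrightarrow> Q h \<Longrightarrow> Q (g - h)" "Q 0"
  shows "Q x"
  using assms(1) unfolding I_gen
proof (induction rule: generate.induct)
  case (inv h)
  then have "Q (0 - h)" using assms(2,3,4) by blast
  moreover have "Poly_Mapping.keys h \<subseteq> carrier B \<times> carrier T" using inv gens_P by (auto simp: carrier_P)
  ultimately show ?case by simp
next
  case (eng x y)
  then have "Q (x - (0 - y))" using assms(3,4) by blast
  then show ?case by simp
qed (use assms in auto)

lemma gens_cases:
  assumes "g \<in> gens"
  obtains (1) a b t where "g = frag_of (a \<oplus>\<^bsub>B\<^esub> b, t) - frag_of (a, t) - frag_of (b, t)"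
        "a \<in> carrier B" "b \<in> carrier B" "t \<in> carrier T"
  | (2) a t u where "g = frag_of (a, t \<oplus>\<^bsub>T\<^esub> u) - frag_of (a, t) - frag_of (a, u)"
        "a \<in> carrier B" "t \<in> carrier T" "u \<in> carrier T"
  | (3) r a t where "g = frag_of (r \<odot>\<^bsub>B\<^esub> a, t) - frag_of (a, r \<odot>\<^bsub>T\<^esub> t)"
        "r \<in> carrier R" "a \<in> carrier B" "t \<in> carrier T"
  using assms unfolding gens_def by blast

lemma gensI:
  "a \<in> carrier B \<Longrightarrow> b \<in> carrier B \<Longrightarrow> t \<in> carrier T \<Longrightarrow> frag_of (a \<oplus>\<^bsub>B\<^esub> b, t) - frag_of (a, t) - frag_of (b, t) \<in> gens"
  "a \<in> carrier B \<Longrightarrow> t \<in> carrier T \<Longrightarrow> u \<in> carrier T \<Longrightarrow> frag_of (a, t \<oplus>\<^bsub>T\<^esub> u) - frag_of (a, t) - frag_of (a, u) \<in> gens"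
  "r \<in> carrier R \<Longrightarrow> a \<in> carrier B \<Longrightarrow> t \<in> carrier T \<Longrightarrow> frag_of (r \<odot>\<^bsub>B\<^esub> a, t) - frag_of (a, r \<odot>\<^bsub>T\<^esub> t) \<in> gens"
  unfolding gens_def by blast+

text \<open>A pair times a generator, on either side, is again a generator of the same kind, by
  distributivity and the scalar laws in \<open>B\<close> and \<open>T\<close>. Additivity extends
  this to all of \<open>P\<close> and to the whole generated subgroup.\<close>

lemma ideal_I: "ideal I P"
proof (rule idealI[OF ring_P I_subgroup])
  have l: "frag_of (b, u) \<otimes>\<^bsub>P\<^esub> g \<in> gens" and r: "g \<otimes>\<^bsub>P\<^esub> frag_of (b, u) \<in> gens"
    if "g \<in> gens" "b \<in> carrier B" "u \<in> carrier T" for g b u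
    using that
    by (cases rule: gens_cases;
      simp add: mult_diff mult_of B.r_distr B.l_distr T.r_distr T.l_distr B_sm T_sm gensI)+
  have L: "p \<otimes>\<^bsub>P\<^esub> g \<in> I" and R: "g \<otimes>\<^bsub>P\<^esub> p \<in> I" if "g \<in> gens" "p \<in> carrier P" for g p
    using that(2) by (induction p rule: P_induct) (auto simp: l r gens_I mult_diff I_diff I_zero that(1))
  fix x p assume "x \<in> I" and p: "p \<in> carrier P"
  then show "p \<otimes>\<^bsub>P\<^esub> x \<in> I"
    by (induction x rule: I_induct) (auto simp: mult_diff I_diff I_zero L)
  from \<open>x \<in> I\<close> p show "x \<otimes>\<^bsub>P\<^esub> p \<in> I"
    by (induction x rule: I_induct) (auto simp: mult_diff I_diff I_zero R)
qed

end

section \<open>The quotient ring and its universal property\<close>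

context tensor_setup
begin

abbreviation "W \<equiv> raw_tensor R B T"
abbreviation "TP \<equiv> tensor R B T"
abbreviation "tc \<equiv> tensor_class R B T"
abbreviation "pt \<equiv> pure_tensor R B T"

sublocale J: ideal I P by (rule ideal_I)

lemma W_eq: "W = P Quot I"
  by (simp add: raw_tensor_def)

lemma carrier_W: "carrier W = (\<lambda>c. I +>\<^bsub>P\<^esub> c) ` carrier P"
  by (auto simp: W_eq FactRing_def A_RCOSETS_def' a_r_coset_def')

lemma ring_W: "ring W"
  unfolding W_eq by (rule J.quotient_is_ring)

lemma mem_coset: "x \<in> I +>\<^bsub>P\<^esub> c \<longleftrightarrow> x - c \<in> I"
proof -
  have "x \<in> I +>\<^bsub>P\<^esub> c \<longleftrightarrow> (\<exists>h\<in>I. x = h + c)"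
    by (simp add: a_r_coset_def' P_simps)
  also have "\<dots> \<longleftrightarrow> x - c \<in> I" by (metis add_diff_cancel diff_add_cancel)
  finally show ?thesis .
qed

lemma coset_eq:
  assumes "c - c' \<in> I" shows "I +>\<^bsub>P\<^esub> c = I +>\<^bsub>P\<^esub> c'"
proof -
  have "x - c \<in> I \<longleftrightarrow> x - c' \<in> I" for x
  proof
    assume "x - c \<in> I"
    then have "(x - c) - (0 - (c - c')) \<in> I" using assms I_diff I_zero by blast
    then show "x - c' \<in> I" by simp
  next
    assume "x - c' \<in> I"
    then have "(x - c') - (c - c') \<in> I" using assms I_diff by blast
    then show "x - c \<in> I" by simp
  qed
  then show ?thesis by (auto simp: mem_coset)
qed

text \<open>Distinct cosets are disjoint, so a chosen representative determines its coset, and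
  representatives embed into \<open>'u\<close>. An injection therefore exists, and the one chosen in
  \<open>tensor_enc\<close> is injective.\<close>

lemma inj_enc: "inj_on (tensor_enc R B T) (carrier W)"
proof -
  obtain e0 :: "('u \<times> 'u \<Rightarrow>\<^sub>0 int) \<Rightarrow> 'u" where e0: "inj e0"
    using inj_frag_universe[OF universe_infinite] by blast
  have "inj_on (\<lambda>X. e0 (SOME c. c \<in> X)) (carrier W)"
  proof (rule inj_onI)
    fix X Y assume "X \<in> carrier W" "Y \<in> carrier W" and eq: "e0 (SOME c. c \<in> X) = e0 (SOME c. c \<in> Y)"
    then obtain x y where X: "X = I +>\<^bsub>P\<^esub> x" and Y: "Y = I +>\<^bsub>P\<^esub> y" by (auto simp: carrier_W)
    have "x \<in> X" "y \<in> Y" using I_zero by (simp_all add: X Y mem_coset)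
    then have "(SOME c. c \<in> X) \<in> X" "(SOME c. c \<in> Y) \<in> Y" by (auto intro: someI)
    moreover have "(SOME c. c \<in> X) = (SOME c. c \<in> Y)" using e0 eq by (simp add: inj_eq)
    ultimately obtain c where "c \<in> X" "c \<in> Y" by auto
    then show "X = Y" using coset_eq[of c x] coset_eq[of c y] by (simp add: X Y mem_coset)
  qed
  then show ?thesis unfolding tensor_enc_def by (rule someI[where P = "\<lambda>e. inj_on e (carrier W)"])
qed

lemma dec_enc: "X \<in> carrier W \<Longrightarrow> tensor_dec R B T (tensor_enc R B T X) = X"
  unfolding tensor_dec_def by (rule inv_into_f_f[OF inj_enc])

lemma tensor_simps:
  "carrier TP = tensor_enc R B T ` carrier W"
  "x \<otimes>\<^bsub>TP\<^esub> y = tensor_enc R B T (tensor_dec R B T x \<otimes>\<^bsub>W\<^esub> tensor_dec R B T y)"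
  "\<one>\<^bsub>TP\<^esub> = tensor_enc R B T \<one>\<^bsub>W\<^esub>"
  "\<zero>\<^bsub>TP\<^esub> = tensor_enc R B T \<zero>\<^bsub>W\<^esub>"
  "x \<oplus>\<^bsub>TP\<^esub> y = tensor_enc R B T (tensor_dec R B T x \<oplus>\<^bsub>W\<^esub> tensor_dec R B T y)"
  "t \<odot>\<^bsub>TP\<^esub> x = pt \<one>\<^bsub>B\<^esub> t \<otimes>\<^bsub>TP\<^esub> x"
  by (simp_all add: tensor_def Let_def)

lemma ring_TP: "ring TP"
proof -
  interpret W: ring W by (rule ring_W)
  have "tensor_enc R B T \<in> ring_iso W TP"
    unfolding ring_iso_def
    by (auto intro!: ring_hom_memI simp: tensor_simps dec_enc bij_betw_def inj_enc)
  from W.ring_iso_imp_img_ring[OF this] show ?thesis by (simp flip: tensor_simps(4))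
qed

sublocale TP: ring TP by (rule ring_TP)

lemma coset_in_W: "c \<in> carrier P \<Longrightarrow> I +>\<^bsub>P\<^esub> c \<in> carrier W"
  by (simp add: carrier_W)

lemma dec_tc: "c \<in> carrier P \<Longrightarrow> tensor_dec R B T (tc c) = I +>\<^bsub>P\<^esub> c"
  by (simp add: tensor_class_def dec_enc coset_in_W)

lemma tc_closed: "c \<in> carrier P \<Longrightarrow> tc c \<in> carrier TP"
  by (simp add: tensor_class_def tensor_simps coset_in_W)

lemma tc_surj: "x \<in> carrier TP \<Longrightarrow> \<exists>c\<in>carrier P. x = tc c"
  by (auto simp: tensor_class_def tensor_simps carrier_W)

lemma tc_cong: "c - c' \<in> I \<Longrightarrow> tc c = tc c'"
  by (simp add: tensor_class_def coset_eq)

lemma tc_add: "c \<in> carrier P \<Longrightarrow> c' \<in> carrier P \<Longrightarrow> tc c \<oplus>\<^bsub>TP\<^esub> tc c' = tc (c + c')"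
  using ring_hom_add[OF J.rcos_ring_hom, of c c']
  by (simp add: tensor_simps dec_tc P_simps flip: W_eq) (simp add: tensor_class_def)

lemma tc_mult: "c \<in> carrier P \<Longrightarrow> c' \<in> carrier P \<Longrightarrow> tc c \<otimes>\<^bsub>TP\<^esub> tc c' = tc (c \<otimes>\<^bsub>P\<^esub> c')"
  using ring_hom_mult[OF J.rcos_ring_hom, of c c']
  by (simp add: tensor_simps dec_tc P_simps flip: W_eq) (simp add: tensor_class_def)

lemma tc_one: "\<one>\<^bsub>TP\<^esub> = tc \<one>\<^bsub>P\<^esub>"
  using ring_hom_one[OF J.rcos_ring_hom] by (simp add: tensor_simps tensor_class_def W_eq)

lemma pt_closed [simp]: "b \<in> carrier B \<Longrightarrow> t \<in> carrier T \<Longrightarrow> pt b t \<in> carrier TP"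
  by (simp add: pure_tensor_def tc_closed)

lemma pt_add_left:
  assumes "a \<in> carrier B" "b \<in> carrier B" "t \<in> carrier T"
  shows "pt (a \<oplus>\<^bsub>B\<^esub> b) t = pt a t \<oplus>\<^bsub>TP\<^esub> pt b t"
  using assms by (simp add: pure_tensor_def tc_add) (rule tc_cong, simp add: gens_I gensI diff_diff_eq[symmetric])

lemma pt_add_right:
  assumes "a \<in> carrier B" "t \<in> carrier T" "u \<in> carrier T"
  shows "pt a (t \<oplus>\<^bsub>T\<^esub> u) = pt a t \<oplus>\<^bsub>TP\<^esub> pt a u"
  using assms by (simp add: pure_tensor_def tc_add) (rule tc_cong, simp add: gens_I gensI diff_diff_eq[symmetric])

lemma pt_balanced:
  assumes "r \<in> carrier R" "a \<in> carrier B" "t \<in> carrier T"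
  shows "pt (r \<odot>\<^bsub>B\<^esub> a) t = pt a (r \<odot>\<^bsub>T\<^esub> t)"
  using assms by (simp add: pure_tensor_def) (rule tc_cong, simp add: gens_I gensI)

lemma pt_mult:
  assumes "a \<in> carrier B" "b \<in> carrier B" "t \<in> carrier T" "u \<in> carrier T"
  shows "pt a t \<otimes>\<^bsub>TP\<^esub> pt b u = pt (a \<otimes>\<^bsub>B\<^esub> b) (t \<otimes>\<^bsub>T\<^esub> u)"
  using assms by (simp add: pure_tensor_def tc_mult mult_of)

lemma pt_one: "pt \<one>\<^bsub>B\<^esub> \<one>\<^bsub>T\<^esub> = \<one>\<^bsub>TP\<^esub>"
  by (simp add: tc_one pure_tensor_def P_simps)

lemma pt_zero_left: "t \<in> carrier T \<Longrightarrow> pt \<zero>\<^bsub>B\<^esub> t = \<zero>\<^bsub>TP\<^esub>"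
  by (rule additive_zero[of B TP "\<lambda>b. pt b t"]) (auto simp: pt_add_left B.abelian_group_axioms TP.abelian_group_axioms)

lemma pt_zero_right: "b \<in> carrier B \<Longrightarrow> pt b \<zero>\<^bsub>T\<^esub> = \<zero>\<^bsub>TP\<^esub>"
  by (rule additive_zero[of T TP "\<lambda>t. pt b t"]) (auto simp: pt_add_right T.abelian_group_axioms TP.abelian_group_axioms)

lemma pt_minus_left:
  assumes "b \<in> carrier B" "t \<in> carrier T" shows "pt (\<ominus>\<^bsub>B\<^esub> b) t = \<ominus>\<^bsub>TP\<^esub> pt b t"
  using pt_add_left[of "\<ominus>\<^bsub>B\<^esub> b" b t] assms
  by (simp add: B.l_neg pt_zero_left TP.minus_equality)

text \<open>Sums of pure tensors exhaust the carrier without a case for negatives, because the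
  negative of a pure tensor is pure, with \<open>\<ominus> b\<close> in the first place.\<close>

lemma tensor_induct [consumes 1, case_names pure add]:
  assumes "x \<in> carrier TP" "\<And>b t. b \<in> carrier B \<Longrightarrow> t \<in> carrier T \<Longrightarrow> Q (pt b t)"
    "\<And>x y. x \<in> carrier TP \<Longrightarrow> y \<in> carrier TP \<Longrightarrow> Q x \<Longrightarrow> Q y \<Longrightarrow> Q (x \<oplus>\<^bsub>TP\<^esub> y)"
  shows "Q x"
proof -
  obtain c where c: "c \<in> carrier P" "x = tc c" using tc_surj[OF assms(1)] by blast
  have tm: "tc (0 - c) = \<ominus>\<^bsub>TP\<^esub> tc c" if "c \<in> carrier P" for c
  proof -
    have m: "0 - c \<in> carrier P" using that P_zero_closed P_diff_closed by blast
    have "tc (0 - c) \<oplus>\<^bsub>TP\<^esub> tc c = pt \<zero>\<^bsub>B\<^esub> \<zero>\<^bsub>T\<^esub> \<oplus>\<^bsub>TP\<^esub> tc 0"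
      using that by (simp only: tc_add[OF m that] pt_zero_left T.zero_closed) (simp add: tc_closed P_zero_closed)
    also have "tc 0 = \<zero>\<^bsub>TP\<^esub>"
      using tc_add[OF P_zero_closed P_zero_closed] tc_closed[OF P_zero_closed] TP.add.l_cancel_one by force
    finally show ?thesis using that m by (simp add: tc_closed pt_zero_left TP.minus_equality)
  qed
  \<comment> \<open>The claim is strengthened to a formal sum together with its negative, since the
    induction on formal sums proceeds by differences.\<close>
  have "Q (tc c) \<and> Q (tc (0 - c)) \<and> c \<in> carrier P"
    using c(1)
  proof (induction c rule: P_induct)
    case zero
    have "tc 0 = \<zero>\<^bsub>TP\<^esub>"
      using tc_add[OF P_zero_closed P_zero_closed] tc_closed[OF P_zero_closed] TP.add.l_cancel_one by force
    then show ?case using assms(2)[of "\<zero>\<^bsub>B\<^esub>" "\<zero>\<^bsub>T\<^esub>"] by (simp add: pt_zero_left P_zero_closed)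
  next
    case (one b t)
    then have "tc (0 - frag_of (b, t)) = pt (\<ominus>\<^bsub>B\<^esub> b) t"
      using tm[of "frag_of (b, t)"] by (simp add: pt_minus_left) (simp add: pure_tensor_def)
    then show ?case using one assms(2)[of b t] assms(2)[of "\<ominus>\<^bsub>B\<^esub> b" t] by (simp add: pure_tensor_def)
  next
    case (diff x y)
    then have m: "0 - x \<in> carrier P" "0 - y \<in> carrier P" using P_diff_closed P_zero_closed by blast+
    have "tc (x - y) = tc x \<oplus>\<^bsub>TP\<^esub> tc (0 - y)" "tc (0 - (x - y)) = tc (0 - x) \<oplus>\<^bsub>TP\<^esub> tc y"
      using diff m by (simp_all add: tc_add)
    then show ?case using diff m assms(3) by (auto simp: tc_closed P_diff_closed)
  qed
  then show ?thesis using c by simp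
qed

lemma tensor_ext:
  assumes "x \<in> carrier TP" "\<And>x y. x \<in> carrier TP \<Longrightarrow> y \<in> carrier TP \<Longrightarrow> f (x \<oplus>\<^bsub>TP\<^esub> y) = f x \<oplus>\<^bsub>G\<^esub> f y"
    "\<And>x y. x \<in> carrier TP \<Longrightarrow> y \<in> carrier TP \<Longrightarrow> g (x \<oplus>\<^bsub>TP\<^esub> y) = g x \<oplus>\<^bsub>G\<^esub> g y"
    "\<And>b t. b \<in> carrier B \<Longrightarrow> t \<in> carrier T \<Longrightarrow> f (pt b t) = g (pt b t)"
  shows "f x = g x"
  using assms(1) by (induction x rule: tensor_induct) (simp_all add: assms(2-4))

text \<open>The universal property is stated for additive maps only: some later uses are coefficient
  maps that respect no product, and multiplicative maps get their product law afterwards from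
  \<open>tensor_induct\<close>.\<close>

lemma tensor_lift:
  assumes "abelian_group G"
    and cl: "\<And>b t. b \<in> carrier B \<Longrightarrow> t \<in> carrier T \<Longrightarrow> \<beta> b t \<in> carrier G"
    and l: "\<And>a b t. a \<in> carrier B \<Longrightarrow> b \<in> carrier B \<Longrightarrow> t \<in> carrier T \<Longrightarrow> \<beta> (a \<oplus>\<^bsub>B\<^esub> b) t = \<beta> a t \<oplus>\<^bsub>G\<^esub> \<beta> b t"
    and r: "\<And>a t u. a \<in> carrier B \<Longrightarrow> t \<in> carrier T \<Longrightarrow> u \<in> carrier T \<Longrightarrow> \<beta> a (t \<oplus>\<^bsub>T\<^esub> u) = \<beta> a t \<oplus>\<^bsub>G\<^esub> \<beta> a u"
    and b: "\<And>r a t. r \<in> carrier R \<Longrightarrow> a \<in> carrier B \<Longrightarrow> t \<in> carrier T \<Longrightarrow> \<beta> (r \<odot>\<^bsub>B\<^esub> a) t = \<beta> a (r \<odot>\<^bsub>T\<^esub> t)"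
  obtains h where "\<And>x. x \<in> carrier TP \<Longrightarrow> h x \<in> carrier G"
    "\<And>x y. x \<in> carrier TP \<Longrightarrow> y \<in> carrier TP \<Longrightarrow> h (x \<oplus>\<^bsub>TP\<^esub> y) = h x \<oplus>\<^bsub>G\<^esub> h y"
    "\<And>b t. b \<in> carrier B \<Longrightarrow> t \<in> carrier T \<Longrightarrow> h (pt b t) = \<beta> b t"
proof -
  interpret G: abelian_group G by fact
  \<comment> \<open>Extend \<beta> to the free abelian group on pairs; what remains is that this
    extension kills the relations.\<close>
  obtain k where k: "k \<in> hom FG (add_monoid G)"
    and kf: "\<And>x. x \<in> carrier B \<times> carrier T \<Longrightarrow> k (frag_of x) = (\<lambda>(b, t). \<beta> b t) x"
    by (rule comm_group.free_Abelian_group_universal[OF G.a_comm_group, of "\<lambda>(b, t). \<beta> b t" "carrier B \<times> carrier T"])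
      (use cl in auto)
  have kc: "k x \<in> carrier G" if "x \<in> carrier P" for x
    using hom_in_carrier[OF k] that by (simp add: carrier_P)
  have ka: "k (x + y) = k x \<oplus>\<^bsub>G\<^esub> k y" if "x \<in> carrier P" "y \<in> carrier P" for x y
    using hom_mult[OF k] that by (simp add: carrier_P)
  have k0: "k 0 = \<zero>\<^bsub>G\<^esub>" using ka[OF P_zero_closed P_zero_closed] kc[OF P_zero_closed] by (simp add: G.add.l_cancel_one)
  have kd: "k (x - y) = k x \<ominus>\<^bsub>G\<^esub> k y" if "x \<in> carrier P" "y \<in> carrier P" for x y
  proof -
    have "k x = k (x - y) \<oplus>\<^bsub>G\<^esub> k y" using ka[OF P_diff_closed[OF that] that(2)] by simp
    then show ?thesis using kc that P_diff_closed[OF that] by (simp add: G.minus_eq G.a_assoc G.r_neg)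
  qed
  have cancel: "(p \<oplus>\<^bsub>G\<^esub> q) \<ominus>\<^bsub>G\<^esub> p \<ominus>\<^bsub>G\<^esub> q = \<zero>\<^bsub>G\<^esub>" if "p \<in> carrier G" "q \<in> carrier G" for p q
  proof -
    have "(p \<oplus>\<^bsub>G\<^esub> q) \<ominus>\<^bsub>G\<^esub> p \<ominus>\<^bsub>G\<^esub> q = (p \<oplus>\<^bsub>G\<^esub> \<ominus>\<^bsub>G\<^esub> p) \<oplus>\<^bsub>G\<^esub> (q \<oplus>\<^bsub>G\<^esub> \<ominus>\<^bsub>G\<^esub> q)"
      using that by (simp add: G.minus_eq G.a_ac)
    then show ?thesis using that by (simp add: G.r_neg)
  qed
  have kg: "k g = \<zero>\<^bsub>G\<^esub>" if "g \<in> gens" for g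
    using that
    by (cases rule: gens_cases)
      (simp_all add: kd kf P_diff_closed l r b cl B.smult_closed T.smult_closed cancel, simp add: G.minus_eq G.r_neg cl)
  have kI: "x \<in> carrier P \<and> k x = \<zero>\<^bsub>G\<^esub>" if "x \<in> I" for x
    using that
  proof (induction x rule: I_induct)
    fix g assume "g \<in> gens"
    then show "g \<in> carrier P \<and> k g = \<zero>\<^bsub>G\<^esub>" using gens_P kg by blast
  next
    fix g h assume "g \<in> carrier P \<and> k g = \<zero>\<^bsub>G\<^esub>" "h \<in> carrier P \<and> k h = \<zero>\<^bsub>G\<^esub>"
    then show "g - h \<in> carrier P \<and> k (g - h) = \<zero>\<^bsub>G\<^esub>"
      by (simp add: P_diff_closed kd G.minus_eq)
  qed (simp add: k0 P_zero_closed)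
  have kcong: "k c = k c'" if "c \<in> carrier P" "c' \<in> carrier P" "tc c = tc c'" for c c'
  proof -
    have "I +>\<^bsub>P\<^esub> c = I +>\<^bsub>P\<^esub> c'" using that dec_tc by metis
    then have "c - c' \<in> I" using mem_coset[of c c] mem_coset[of c c'] I_zero by simp
    then have "c - c' \<in> carrier P" "k (c - c') = \<zero>\<^bsub>G\<^esub>" using kI by blast+
    then show ?thesis using ka[of "c - c'" c'] that(2) kc[OF that(2)] by simp
  qed
  \<comment> \<open>The value at a tensor is \<open>k\<close> at any representative;
    \<open>kcong\<close> makes the choice immaterial.\<close>
  define h where "h x = k (SOME c. c \<in> carrier P \<and> x = tc c)" for x
  have h: "h (tc c) = k c" if "c \<in> carrier P" for c
  proof -
    have "(SOME c'. c' \<in> carrier P \<and> tc c = tc c') \<in> carrier P \<and> tc c = tc (SOME c'. c' \<in> carrier P \<and> tc c = tc c')"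
      by (rule someI[where x = c]) (use that in simp)
    then show ?thesis unfolding h_def by (intro kcong[OF _ that, symmetric, THEN sym]) auto
  qed
  show ?thesis
  proof
    show "h x \<in> carrier G" if "x \<in> carrier TP" for x using tc_surj[OF that] h kc by auto
    show "h (x \<oplus>\<^bsub>TP\<^esub> y) = h x \<oplus>\<^bsub>G\<^esub> h y" if "x \<in> carrier TP" "y \<in> carrier TP" for x y
      using tc_surj[OF that(1)] tc_surj[OF that(2)] h ka by (auto simp: tc_add P_add_closed)
    show "h (pt b t) = \<beta> b t" if "b \<in> carrier B" "t \<in> carrier T" for b t
      using that by (simp add: pure_tensor_def h kf)
  qed
qed

lemma smult_pt: "b \<in> carrier B \<Longrightarrow> t \<in> carrier T \<Longrightarrow> u \<in> carrier T \<Longrightarrow> u \<odot>\<^bsub>TP\<^esub> pt b t = pt b (u \<otimes>\<^bsub>T\<^esub> t)"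
  by (simp add: tensor_simps(6) pt_mult)

text \<open>The scalars are the tensors 1 \<otimes> u. They commute with every pure tensor because
  \<open>T\<close> is commutative, even where \<open>B\<close> is not.\<close>

lemma tensor_assoc_algebra: "assoc_algebra T TP"
proof -
  have i: "u \<odot>\<^bsub>TP\<^esub> \<one>\<^bsub>TP\<^esub> = pt \<one>\<^bsub>B\<^esub> u" if "u \<in> carrier T" for u
    using that by (simp add: tensor_simps(6))
  have c: "pt \<one>\<^bsub>B\<^esub> u \<otimes>\<^bsub>TP\<^esub> x = x \<otimes>\<^bsub>TP\<^esub> pt \<one>\<^bsub>B\<^esub> u" if "u \<in> carrier T" "x \<in> carrier TP" for u x
    using that(2) by (induction x rule: tensor_induct) (simp_all add: that pt_mult TP.r_distr TP.l_distr T.m_comm)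
  show ?thesis unfolding assoc_algebra_def
    by (auto intro!: ring_hom_memI T.cring_axioms ring_TP simp: i pt_add_right pt_mult pt_one)
       (simp_all add: tensor_simps(6) c)
qed

lemma tensor_cring: assumes "cring B" shows "cring TP"
proof -
  interpret cring B by fact
  have "x \<otimes>\<^bsub>TP\<^esub> y = y \<otimes>\<^bsub>TP\<^esub> x" if x: "x \<in> carrier TP" and y: "y \<in> carrier TP" for x y
    using x
  proof (induction x rule: tensor_induct)
    case (pure b t)
    from y show ?case
      by (induction y rule: tensor_induct) (simp_all add: pure pt_mult TP.r_distr TP.l_distr T.m_comm m_comm)
  qed (simp_all add: y TP.r_distr TP.l_distr)
  then show ?thesis
    by (intro cring.intro ring_TP comm_monoid.intro comm_monoid_axioms.intro) (auto intro: TP.monoid_axioms)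
qed

lemma tensor_algebra: "cring B \<Longrightarrow> algebra T TP"
  by (intro assoc_algebra_imp_algebra tensor_assoc_algebra tensor_cring)

end

section \<open>Functoriality of the tensor product\<close>

lemma tensor_map_properties:
  assumes "tensor_setup R B T" "tensor_setup R B' T'" "f \<in> lin_hom R B B'" "g \<in> lin_hom R T T'"
  shows tensor_map_closed: "x \<in> carrier (tensor R B T) \<Longrightarrow> tensor_map R B T B' T' f g x \<in> carrier (tensor R B' T')"
    and tensor_map_add: "x \<in> carrier (tensor R B T) \<Longrightarrow> y \<in> carrier (tensor R B T) \<Longrightarrow>
      tensor_map R B T B' T' f g (x \<oplus>\<^bsub>tensor R B T\<^esub> y) =
      tensor_map R B T B' T' f g x \<oplus>\<^bsub>tensor R B' T'\<^esub> tensor_map R B T B' T' f g y"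
    and tensor_map_pure: "b \<in> carrier B \<Longrightarrow> t \<in> carrier T \<Longrightarrow>
      tensor_map R B T B' T' f g (pure_tensor R B T b t) = pure_tensor R B' T' (f b) (g t)"
proof -
  interpret S: tensor_setup R B T by fact
  interpret S': tensor_setup R B' T' by fact
  note f = lin_homD[OF assms(3)] and g = lin_homD[OF assms(4)]
  define m where "m = frag_extend (\<lambda>(a, t). frag_of (f a, g t))"
  have md: "m (x - y) = m x - m y" "m (x + y) = m x + m y" "m 0 = 0" for x y
    by (simp_all add: m_def frag_extend_diff frag_extend_add)
  have mo: "m (frag_of (a, t)) = frag_of (f a, g t)" for a t by (simp add: m_def)
  \<comment> \<open>The induced map on formal sums carries each kind of generator to a generator of
    the same kind, hence relations to relations.\<close>
  have mg: "m x \<in> S'.gens" if "x \<in> S.gens" for x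
    using that by (cases rule: S.gens_cases) (simp_all add: md mo f g S'.gensI)
  have mI: "m x \<in> tensor_rel R B' T'" if "x \<in> tensor_rel R B T" for x
    using that by (induction x rule: S.I_induct) (auto simp: md mg S'.gens_I S'.I_diff S'.I_zero)
  have mP: "m x \<in> carrier (pair_ring B' T')" if "x \<in> carrier (pair_ring B T)" for x
    using that by (induction x rule: S.P_induct) (auto simp: md mo f g S'.P_diff_closed S'.P_zero_closed)
  have main: "tensor_map R B T B' T' f g (S.tc c) = S'.tc (m c)" if "c \<in> carrier (pair_ring B T)" for c
  proof -
    \<comment> \<open>\<open>tensor_map\<close> is defined with \<open>the_elem\<close>, so the
      image of a whole coset has to be a single class.\<close>
    have "(\<lambda>c. S'.tc (m c)) ` (tensor_rel R B T +>\<^bsub>pair_ring B T\<^esub> c) = {S'.tc (m c)}"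
    proof (intro equalityI subsetI)
      fix y assume "y \<in> (\<lambda>c. S'.tc (m c)) ` (tensor_rel R B T +>\<^bsub>pair_ring B T\<^esub> c)"
      then obtain c' where "c' - c \<in> tensor_rel R B T" "y = S'.tc (m c')" by (auto simp: S.mem_coset)
      then show "y \<in> {S'.tc (m c)}" using mI[of "c' - c"] S'.tc_cong[of "m c'" "m c"] by (simp add: md)
    qed (use S.I_zero in \<open>auto simp: S.mem_coset intro!: image_eqI[where x = c]\<close>)
    then show ?thesis using S.tc_closed[OF that] by (simp add: tensor_map_def S.dec_tc that flip: m_def)
  qed
  show "tensor_map R B T B' T' f g x \<in> carrier S'.TP" if "x \<in> carrier S.TP"
    using S.tc_surj[OF that] main mP S'.tc_closed by auto
  show "tensor_map R B T B' T' f g (x \<oplus>\<^bsub>S.TP\<^esub> y) = tensor_map R B T B' T' f g x \<oplus>\<^bsub>S'.TP\<^esub> tensor_map R B T B' T' f g y"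
    if "x \<in> carrier S.TP" "y \<in> carrier S.TP"
    using S.tc_surj[OF that(1)] S.tc_surj[OF that(2)] main mP
    by (auto simp: S.tc_add S'.tc_add md S.P_add_closed)
  show "tensor_map R B T B' T' f g (S.pt b t) = S'.pt (f b) (g t)" if "b \<in> carrier B" "t \<in> carrier T"
    using that by (simp add: pure_tensor_def main mo)
qed

lemma tensor_map_extensional: "tensor_map R B T B' T' f g \<in> extensional (carrier (tensor R B T))"
  by (simp add: tensor_map_def)

lemma tensor_map_ring_hom:
  assumes "tensor_setup R B T" "tensor_setup R B' T'" "f \<in> lin_hom R B B'" "g \<in> lin_hom R T T'"
  shows "tensor_map R B T B' T' f g \<in> ring_hom (tensor R B T) (tensor R B' T')"
proof -
  interpret S: tensor_setup R B T by fact
  interpret S': tensor_setup R B' T' by fact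
  note tm = tensor_map_properties[OF assms]
  note f = lin_homD[OF assms(3)] and g = lin_homD[OF assms(4)]
  let ?h = "tensor_map R B T B' T' f g"
  show ?thesis
  proof (rule ring_hom_memI)
    fix x y assume x: "x \<in> carrier S.TP" and y: "y \<in> carrier S.TP"
    show "?h x \<in> carrier S'.TP" "?h (x \<oplus>\<^bsub>S.TP\<^esub> y) = ?h x \<oplus>\<^bsub>S'.TP\<^esub> ?h y" using tm x y by blast+
    show "?h (x \<otimes>\<^bsub>S.TP\<^esub> y) = ?h x \<otimes>\<^bsub>S'.TP\<^esub> ?h y"
      using x
    proof (induction x rule: S.tensor_induct)
      case (pure b t)
      from y show ?case
        by (induction y rule: S.tensor_induct)
          (simp_all add: pure tm f g S.pt_mult S'.pt_mult S.TP.r_distr S'.TP.r_distr)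
    qed (simp_all add: y tm S.TP.l_distr S'.TP.l_distr)
  next
    show "?h \<one>\<^bsub>S.TP\<^esub> = \<one>\<^bsub>S'.TP\<^esub>"
      using tm(3)[of "\<one>\<^bsub>B\<^esub>" "\<one>\<^bsub>T\<^esub>"] by (simp add: f g S.pt_one S'.pt_one)
  qed
qed

lemma tensor_map_smult:
  assumes "tensor_setup R B T" "tensor_setup R B' T'" "f \<in> lin_hom R B B'" "g \<in> lin_hom R T T'"
    "t \<in> carrier T" "x \<in> carrier (tensor R B T)"
  shows "tensor_map R B T B' T' f g (t \<odot>\<^bsub>tensor R B T\<^esub> x) = g t \<odot>\<^bsub>tensor R B' T'\<^esub> tensor_map R B T B' T' f g x"
proof -
  interpret S: tensor_setup R B T by fact
  interpret S': tensor_setup R B' T' by fact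
  show ?thesis using assms(5,6) lin_homD[OF assms(3)]
    by (simp add: S.tensor_simps(6) S'.tensor_simps(6) ring_hom_mult[OF tensor_map_ring_hom[OF assms(1-4)]]
      tensor_map_pure[OF assms(1-4)])
qed

text \<open>The composites enter as separate functions that agree pointwise on the carriers:
  identities and extensional compositions coincide with plain composites only there.\<close>

lemma tensor_map_comp:
  assumes "tensor_setup R B T" "tensor_setup R B' T'" "tensor_setup R B'' T''"
    "f \<in> lin_hom R B B'" "g \<in> lin_hom R T T'" "f' \<in> lin_hom R B' B''" "g' \<in> lin_hom R T' T''"
    "f'' \<in> lin_hom R B B''" "g'' \<in> lin_hom R T T''"
    "\<And>b. b \<in> carrier B \<Longrightarrow> f'' b = f' (f b)" "\<And>t. t \<in> carrier T \<Longrightarrow> g'' t = g' (g t)"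
    "x \<in> carrier (tensor R B T)"
  shows "tensor_map R B' T' B'' T'' f' g' (tensor_map R B T B' T' f g x) = tensor_map R B T B'' T'' f'' g'' x"
proof -
  interpret S: tensor_setup R B T by fact
  note a = tensor_map_properties[OF assms(1,2,4,5)]
  note b = tensor_map_properties[OF assms(2,3,6,7)]
  note c = tensor_map_properties[OF assms(1,3,8,9)]
  note f = lin_homD[OF assms(4)] and g = lin_homD[OF assms(5)]
  show ?thesis using assms(12)
    by (induction x rule: S.tensor_induct) (simp_all add: a b c f g assms(10,11))
qed

lemma tensor_map_id:
  assumes "tensor_setup R B T" "x \<in> carrier (tensor R B T)"
    "\<And>b. b \<in> carrier B \<Longrightarrow> f b = b" "\<And>t. t \<in> carrier T \<Longrightarrow> g t = t"
  shows "tensor_map R B T B T f g x = x"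
proof -
  interpret S: tensor_setup R B T by fact
  have "f \<in> lin_hom R B B" "g \<in> lin_hom R T T"
    using assms(3,4) by (auto intro!: lin_homI)
  note a = tensor_map_properties[OF assms(1,1) this]
  show ?thesis using assms(2)
    by (induction x rule: S.tensor_induct) (simp_all add: a assms)
qed


section \<open>The category of commutative algebras\<close>

lemma calgD:
  assumes "S \<in> calg R"
  shows calg_algebra: "algebra R S" and calg_cring: "cring S" and calg_module: "module R S"
    and calg_base_cring: "cring R" and calg_assoc_algebra: "assoc_algebra R S"
  using assms algebra_imp_assoc_algebra[of R S]
  by (auto simp: calg_def algebra.M_cring algebra.R_cring algebra.module)

lemma calg_smult_mult:
  assumes "S \<in> calg R" "s \<in> carrier R" "a \<in> carrier S" "b \<in> carrier S"
  shows "(s \<odot>\<^bsub>S\<^esub> a) \<otimes>\<^bsub>S\<^esub> b = s \<odot>\<^bsub>S\<^esub> (a \<otimes>\<^bsub>S\<^esub> b)"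
    and "a \<otimes>\<^bsub>S\<^esub> (s \<odot>\<^bsub>S\<^esub> b) = s \<odot>\<^bsub>S\<^esub> (a \<otimes>\<^bsub>S\<^esub> b)"
  using assoc_algebra_smult_mult[OF calg_assoc_algebra[OF assms(1)] assms(2-4)] by blast+

lemma tensor_setupI:
  "infinite (UNIV :: 'u set) \<Longrightarrow> assoc_algebra R B \<Longrightarrow> T \<in> calg R \<Longrightarrow> tensor_setup R (B :: 'u alg) T"
  by (simp add: tensor_setup_def calg_def)

lemma lin_hom_id: "(\<lambda>a. a) \<in> lin_hom R A A" "(\<lambda>a\<in>carrier A. a) \<in> lin_hom R A A"
  if "assoc_algebra R A"
proof -
  interpret A: ring A using that by (rule assoc_algebra_ring)
  interpret A: module R A using that by (rule assoc_algebra_module)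
  show "(\<lambda>a. a) \<in> lin_hom R A A" "(\<lambda>a\<in>carrier A. a) \<in> lin_hom R A A"
    by (auto intro!: lin_homI)
qed

lemma alg_homD:
  assumes "f \<in> alg_hom R A B"
  shows "f \<in> lin_hom R A B" "f \<in> extensional (carrier A)" "f \<in> ring_hom A B"
    "a \<in> carrier A \<Longrightarrow> f a \<in> carrier B"
    "a \<in> carrier A \<Longrightarrow> b \<in> carrier A \<Longrightarrow> f (a \<oplus>\<^bsub>A\<^esub> b) = f a \<oplus>\<^bsub>B\<^esub> f b"
    "a \<in> carrier A \<Longrightarrow> b \<in> carrier A \<Longrightarrow> f (a \<otimes>\<^bsub>A\<^esub> b) = f a \<otimes>\<^bsub>B\<^esub> f b"
    "f \<one>\<^bsub>A\<^esub> = \<one>\<^bsub>B\<^esub>"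
    "r \<in> carrier R \<Longrightarrow> a \<in> carrier A \<Longrightarrow> f (r \<odot>\<^bsub>A\<^esub> a) = r \<odot>\<^bsub>B\<^esub> f a"
  using assms by (auto simp: alg_hom_iff dest: lin_homD)

lemma alg_hom_zero:
  assumes "f \<in> alg_hom R A B" "ring A" "ring B" shows "f \<zero>\<^bsub>A\<^esub> = \<zero>\<^bsub>B\<^esub>"
  using additive_zero[OF ring.is_abelian_group[OF assms(2)] ring.is_abelian_group[OF assms(3)], of f] alg_homD[OF assms(1)] by blast

lemma restrict_alg_hom: "f \<in> lin_hom R A B \<Longrightarrow> assoc_algebra R A \<Longrightarrow> (\<lambda>a\<in>carrier A. f a) \<in> alg_hom R A B"
proof -
  assume f: "f \<in> lin_hom R A B" and A: "assoc_algebra R A"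
  interpret A: ring A using A by (rule assoc_algebra_ring)
  interpret A: module R A using A by (rule assoc_algebra_module)
  show ?thesis unfolding alg_hom_iff using lin_homD[OF f] by (auto intro!: lin_homI)
qed

lemma alg_hom_eqI:
  assumes "f \<in> alg_hom R A B" "g \<in> alg_hom R' A B'" "\<And>a. a \<in> carrier A \<Longrightarrow> f a = g a"
  shows "f = g"
  using assms by (auto intro!: extensionalityI[of f "carrier A" g] dest: alg_homD(2))

lemma alg_hom_id: "S \<in> calg R \<Longrightarrow> (\<lambda>s\<in>carrier S. s) \<in> alg_hom R S S"
  by (simp add: alg_hom_iff lin_hom_id calg_assoc_algebra)

lemma alg_hom_compose:
  assumes "assoc_algebra R A" "f \<in> alg_hom R A B" "g \<in> alg_hom R B C"
  shows "compose (carrier A) g f \<in> alg_hom R A C"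
proof -
  interpret A: ring A using assms(1) by (rule assoc_algebra_ring)
  interpret A: module R A using assms(1) by (rule assoc_algebra_module)
  show ?thesis
    unfolding alg_hom_iff using alg_homD[OF assms(2)] alg_homD[OF assms(3)]
    by (auto intro!: lin_homI simp: compose_eq)
qed

section \<open>The base ring as an object, and restriction of scalars\<close>

definition base :: "('u, 'm) ring_scheme \<Rightarrow> 'u alg" where
  "base R = \<lparr>carrier = carrier R, monoid.mult = monoid.mult R, monoid.one = \<one>\<^bsub>R\<^esub>, ring.zero = \<zero>\<^bsub>R\<^esub>,
     ring.add = ring.add R, smult = monoid.mult R\<rparr>"

lemma base_simps [simp]:
  "carrier (base R) = carrier R" "x \<otimes>\<^bsub>base R\<^esub> y = x \<otimes>\<^bsub>R\<^esub> y" "\<one>\<^bsub>base R\<^esub> = \<one>\<^bsub>R\<^esub>"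
  "\<zero>\<^bsub>base R\<^esub> = \<zero>\<^bsub>R\<^esub>" "x \<oplus>\<^bsub>base R\<^esub> y = x \<oplus>\<^bsub>R\<^esub> y" "x \<odot>\<^bsub>base R\<^esub> y = x \<otimes>\<^bsub>R\<^esub> y"
  by (simp_all add: base_def)

lemma base_calg:
  assumes "cring R" shows "base R \<in> calg R"
proof -
  interpret R: cring R by fact
  have "abelian_group (base R)"
    by (rule abelian_groupI) (auto simp: R.a_ac intro: R.l_neg)
  moreover have "comm_monoid (base R)"
    by (rule comm_monoidI) (auto simp: R.m_ac)
  ultimately have "cring (base R)"
    by (rule cringI) (simp add: R.l_distr)
  then show ?thesis unfolding calg_def
    by (auto intro!: algebraI simp: R.cring_axioms R.l_distr R.r_distr R.m_assoc)
qed

text \<open>The only morphism out of \<open>base R\<close>, the initial object; elements over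
  \<open>R\<close> are moved to \<open>S\<close> along it.\<close>

definition unit_hom :: "('u, 'm) ring_scheme \<Rightarrow> 'u alg \<Rightarrow> 'u \<Rightarrow> 'u" where
  "unit_hom R S = (\<lambda>r\<in>carrier R. r \<odot>\<^bsub>S\<^esub> \<one>\<^bsub>S\<^esub>)"

lemma unit_hom_alg_hom:
  assumes "S \<in> calg R" shows "unit_hom R S \<in> alg_hom R (base R) S"
proof -
  interpret S: module R S using assms by (rule calg_module)
  interpret S: cring S using assms by (rule calg_cring)
  show ?thesis unfolding alg_hom_iff unit_hom_def
    by (auto intro!: lin_homI simp: S.smult_l_distr S.smult_assoc1 calg_smult_mult(1)[OF assms])
qed

lemma over_simps [simp]:
  "carrier (over R S T) = carrier T" "x \<otimes>\<^bsub>over R S T\<^esub> y = x \<otimes>\<^bsub>T\<^esub> y" "\<one>\<^bsub>over R S T\<^esub> = \<one>\<^bsub>T\<^esub>"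
  "\<zero>\<^bsub>over R S T\<^esub> = \<zero>\<^bsub>T\<^esub>" "x \<oplus>\<^bsub>over R S T\<^esub> y = x \<oplus>\<^bsub>T\<^esub> y"
  "r \<in> carrier R \<Longrightarrow> r \<odot>\<^bsub>over R S T\<^esub> x = (r \<odot>\<^bsub>S\<^esub> \<one>\<^bsub>S\<^esub>) \<odot>\<^bsub>T\<^esub> x"
  by (simp_all add: over_def rscal_def)

lemma rscal_simps [simp]:
  "carrier (rscal S f T) = carrier T" "x \<otimes>\<^bsub>rscal S f T\<^esub> y = x \<otimes>\<^bsub>T\<^esub> y" "\<one>\<^bsub>rscal S f T\<^esub> = \<one>\<^bsub>T\<^esub>"
  "\<zero>\<^bsub>rscal S f T\<^esub> = \<zero>\<^bsub>T\<^esub>" "x \<oplus>\<^bsub>rscal S f T\<^esub> y = x \<oplus>\<^bsub>T\<^esub> y"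
  "r \<in> carrier S \<Longrightarrow> r \<odot>\<^bsub>rscal S f T\<^esub> x = f r \<odot>\<^bsub>T\<^esub> x"
  by (simp_all add: rscal_def)

lemma rscal_calg:
  assumes "cring S" "T \<in> calg S'" "f \<in> ring_hom S S'"
  shows "rscal S f T \<in> calg S"
proof -
  interpret S: cring S by fact
  interpret T: module S' T using assms(2) by (rule calg_module)
  interpret T: cring T using assms(2) by (rule calg_cring)
  have "abelian_group (rscal S f T)"
    by (rule abelian_groupI) (auto simp: T.a_ac intro: T.l_neg)
  moreover have "comm_monoid (rscal S f T)"
    by (rule comm_monoidI) (auto simp: T.m_ac)
  ultimately have "cring (rscal S f T)"
    by (rule cringI) (simp add: T.l_distr)
  then show ?thesis unfolding calg_def
    by (auto intro!: algebraI S.cring_axioms simp: ring_hom_closed[OF assms(3)] ring_hom_add[OF assms(3)] ring_hom_mult[OF assms(3)]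
      ring_hom_one[OF assms(3)] T.smult_l_distr T.smult_r_distr T.smult_assoc1 calg_smult_mult[OF assms(2)])
qed

lemma scalar_ring_hom: "S \<in> calg R \<Longrightarrow> (\<lambda>r. r \<odot>\<^bsub>S\<^esub> \<one>\<^bsub>S\<^esub>) \<in> ring_hom R S"
  using calg_assoc_algebra[of S R] by (simp add: assoc_algebra_def)

lemma over_calg: "S \<in> calg R \<Longrightarrow> T \<in> calg S \<Longrightarrow> over R S T \<in> calg R"
  unfolding over_def by (rule rscal_calg[OF calg_base_cring _ scalar_ring_hom])

lemma rscal_alg_hom: "g \<in> alg_hom S' T T' \<Longrightarrow> f \<in> ring_hom S S' \<Longrightarrow> g \<in> alg_hom S (rscal S f T) (rscal S f T')"
  unfolding alg_hom_iff by (auto intro!: lin_homI dest: lin_homD ring_hom_closed)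

lemma over_alg_hom: "g \<in> alg_hom S T T' \<Longrightarrow> S \<in> calg R \<Longrightarrow> g \<in> alg_hom R (over R S T) (over R S T')"
  unfolding over_def by (intro rscal_alg_hom[where S' = S] scalar_ring_hom)

text \<open>\<open>f\<close> respects the scalars from \<open>R\<close>, so both restrictions have
  the same scalar action. This is an equality of records, so functors take literally the same value
  on both sides.\<close>

lemma over_rscal:
  assumes "S \<in> calg R" "f \<in> alg_hom R S S'"
  shows "over R S (rscal S f T) = over R S' T"
proof -
  interpret S: module R S using assms(1) by (rule calg_module)
  interpret S: cring S using assms(1) by (rule calg_cring)
  have "f (r \<odot>\<^bsub>S\<^esub> \<one>\<^bsub>S\<^esub>) = r \<odot>\<^bsub>S'\<^esub> \<one>\<^bsub>S'\<^esub>" if "r \<in> carrier R" for r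
    using that alg_homD(7)[OF assms(2)] alg_homD(8)[OF assms(2), of r "\<one>\<^bsub>S\<^esub>"] by simp
  then show ?thesis by (simp add: over_def rscal_def cong: restrict_cong)
qed

lemma tensor_map_alg_hom:
  assumes "tensor_setup R B T" "tensor_setup R B' T" "f \<in> lin_hom R B B'"
  shows "tensor_map R B T B' T f (\<lambda>t. t) \<in> alg_hom T (tensor R B T) (tensor R B' T)"
proof -
  interpret S: tensor_setup R B T by fact
  have i: "(\<lambda>t. t) \<in> lin_hom R T T"
    by (simp add: lin_hom_id algebra_imp_assoc_algebra S.T_algebra)
  show ?thesis
    unfolding alg_hom_iff lin_hom_def
    using tensor_map_ring_hom[OF assms i] tensor_map_smult[OF assms i] tensor_map_extensional by auto
qed

text \<open>Base change along \<open>g\<close> becomes linear over \<open>T\<close> once its target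
  is viewed as a \<open>T\<close>-algebra by restriction of scalars. Naturality of functions under
  change of base uses this form.\<close>

lemma tensor_map_rscal_alg_hom:
  assumes "tensor_setup R B T" "tensor_setup R B' T'" "f \<in> lin_hom R B B'" "g \<in> alg_hom R T T'"
  shows "tensor_map R B T B' T' f g \<in> alg_hom T (tensor R B T) (rscal T g (tensor R B' T'))"
  unfolding alg_hom_iff lin_hom_def
  using tensor_map_ring_hom[OF assms(1-3) alg_homD(1)[OF assms(4)]]
    tensor_map_smult[OF assms(1-3) alg_homD(1)[OF assms(4)]] tensor_map_extensional
  by (auto simp: ring_hom_def)

section \<open>The tensor product as a coproduct\<close>

definition inl :: "('u, 'm) ring_scheme \<Rightarrow> 'u alg \<Rightarrow> 'u alg \<Rightarrow> 'u \<Rightarrow> 'u" where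
  "inl R B S = (\<lambda>b\<in>carrier B. pure_tensor R B S b \<one>\<^bsub>S\<^esub>)"

lemma tensor_calg:
  assumes "infinite (UNIV :: 'u set)" "B \<in> calg R" "S \<in> calg R"
  shows "tensor R (B :: 'u alg) S \<in> calg S"
  using tensor_setup.tensor_algebra[OF tensor_setupI, of R B S] assms
  by (simp add: calg_def[of S] calg_assoc_algebra calg_cring)

lemma inl_alg_hom:
  assumes "infinite (UNIV :: 'u set)" "B \<in> calg R" "S \<in> calg R"
  shows "inl R (B :: 'u alg) S \<in> alg_hom R B (over R S (tensor R B S))"
proof -
  interpret tensor_setup R B S by (intro tensor_setupI assms calg_assoc_algebra)
  show ?thesis unfolding alg_hom_iff inl_def
    by (auto intro!: lin_homI simp: pt_add_left pt_mult pt_one pt_balanced smult_pt)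
qed

text \<open>The map out of the coproduct of \<open>B\<close> and \<open>S\<close>. It is balanced
  because a scalar of \<open>R\<close> acts on \<open>T\<close> through \<open>S\<close>, and
  multiplicativity has to be checked on pure tensors only.\<close>

lemma tensor_copair:
  assumes "infinite (UNIV :: 'u set)" "B \<in> calg R" "S \<in> calg R" "T \<in> calg S" "f \<in> alg_hom R B (over R S T)"
  obtains k where "k \<in> alg_hom S (tensor R (B :: 'u alg) S) T"
    "\<And>b s. b \<in> carrier B \<Longrightarrow> s \<in> carrier S \<Longrightarrow> k (pure_tensor R B S b s) = s \<odot>\<^bsub>T\<^esub> f b"
proof -
  interpret tensor_setup R B S by (intro tensor_setupI assms calg_assoc_algebra)
  interpret U: module S T using assms(4) by (rule calg_module)
  interpret U: cring T using assms(4) by (rule calg_cring)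
  note f = alg_homD[OF assms(5), simplified]
  have sm: "(s \<odot>\<^bsub>T\<^esub> x) \<otimes>\<^bsub>T\<^esub> (u \<odot>\<^bsub>T\<^esub> y) = (s \<otimes>\<^bsub>S\<^esub> u) \<odot>\<^bsub>T\<^esub> (x \<otimes>\<^bsub>T\<^esub> y)"
    if "s \<in> carrier S" "u \<in> carrier S" "x \<in> carrier T" "y \<in> carrier T" for s u x y
    using that by (simp add: calg_smult_mult(1)[OF assms(4)]) (simp add: calg_smult_mult(2)[OF assms(4)] U.smult_assoc1)
  have bal: "s \<odot>\<^bsub>T\<^esub> f (r \<odot>\<^bsub>B\<^esub> b) = (r \<odot>\<^bsub>S\<^esub> s) \<odot>\<^bsub>T\<^esub> f b"
    if "r \<in> carrier R" "b \<in> carrier B" "s \<in> carrier S" for r b s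
  proof -
    have "s \<odot>\<^bsub>T\<^esub> f (r \<odot>\<^bsub>B\<^esub> b) = (s \<otimes>\<^bsub>S\<^esub> (r \<odot>\<^bsub>S\<^esub> \<one>\<^bsub>S\<^esub>)) \<odot>\<^bsub>T\<^esub> f b"
      using that f by (simp add: U.smult_assoc1)
    also have "s \<otimes>\<^bsub>S\<^esub> (r \<odot>\<^bsub>S\<^esub> \<one>\<^bsub>S\<^esub>) = r \<odot>\<^bsub>S\<^esub> s" using that by (simp add: T_sm)
    finally show ?thesis .
  qed
  obtain h where hc: "\<And>x. x \<in> carrier TP \<Longrightarrow> h x \<in> carrier T"
    and ha: "\<And>x y. x \<in> carrier TP \<Longrightarrow> y \<in> carrier TP \<Longrightarrow> h (x \<oplus>\<^bsub>TP\<^esub> y) = h x \<oplus>\<^bsub>T\<^esub> h y"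
    and hp: "\<And>b s. b \<in> carrier B \<Longrightarrow> s \<in> carrier S \<Longrightarrow> h (pt b s) = s \<odot>\<^bsub>T\<^esub> f b"
    by (rule tensor_lift[of T "\<lambda>b s. s \<odot>\<^bsub>T\<^esub> f b"])
      (auto simp: U.abelian_group_axioms f(4-7) U.smult_l_distr U.smult_r_distr bal)
  have hm: "h (x \<otimes>\<^bsub>TP\<^esub> y) = h x \<otimes>\<^bsub>T\<^esub> h y" if x: "x \<in> carrier TP" and y: "y \<in> carrier TP" for x y
    using x
  proof (induction x rule: tensor_induct)
    case (pure b t)
    from y show ?case
      by (induction y rule: tensor_induct)
        (simp_all add: pure pt_mult hp f(4-7) sm TP.r_distr ha hc U.r_distr)
  qed (simp_all add: y TP.l_distr ha hc U.l_distr)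
  have hs: "h (s \<odot>\<^bsub>TP\<^esub> x) = s \<odot>\<^bsub>T\<^esub> h x" if "s \<in> carrier S" "x \<in> carrier TP" for s x
    using that f(4)[of "\<one>\<^bsub>B\<^esub>"] hc[OF that(2)]
    by (simp add: tensor_simps(6) hm hp f calg_smult_mult[OF assms(4)])
  have "h \<in> lin_hom S TP T"
    using hp[of "\<one>\<^bsub>B\<^esub>" "\<one>\<^bsub>S\<^esub>"] by (intro lin_homI) (simp_all add: hc ha hm hs pt_one f)
  then have "(\<lambda>x\<in>carrier TP. h x) \<in> alg_hom S TP T"
    by (intro restrict_alg_hom tensor_assoc_algebra)
  then show ?thesis by (rule that) (simp add: hp)
qed

text \<open>B \<otimes> R is B: sending b \<otimes> t to tb is a left inverse, and b \<otimes> t =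
  tb \<otimes> 1 by balancedness. Statements over \<open>base R\<close> thereby become statements
  about \<open>B\<close> itself.\<close>

lemma base_pure:
  assumes "infinite (UNIV :: 'u set)" "assoc_algebra R (B :: 'u alg)"
  shows base_pure_inj: "inj_on (\<lambda>b. pure_tensor R B (base R) b \<one>\<^bsub>R\<^esub>) (carrier B)"
    and base_pure_surj: "z \<in> carrier (tensor R B (base R)) \<Longrightarrow> \<exists>b\<in>carrier B. z = pure_tensor R B (base R) b \<one>\<^bsub>R\<^esub>"
proof -
  interpret tensor_setup R B "base R"
    by (intro tensor_setupI assms base_calg assoc_algebra_cring[OF assms(2)])
  have bal: "s \<odot>\<^bsub>B\<^esub> (r \<odot>\<^bsub>B\<^esub> b) = (r \<otimes>\<^bsub>R\<^esub> s) \<odot>\<^bsub>B\<^esub> b" if "r \<in> carrier R" "b \<in> carrier B" "s \<in> carrier R" for r b s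
    using that R.m_comm[of r s] by (simp add: B.smult_assoc1)
  obtain h where h: "\<And>b t. b \<in> carrier B \<Longrightarrow> t \<in> carrier R \<Longrightarrow> h (pt b t) = t \<odot>\<^bsub>B\<^esub> b"
    by (rule tensor_lift[of B "\<lambda>b t. t \<odot>\<^bsub>B\<^esub> b"])
      (auto simp: B.abelian_group_axioms B.smult_l_distr B.smult_r_distr bal)
  show "inj_on (\<lambda>b. pt b \<one>\<^bsub>R\<^esub>) (carrier B)"
    by (rule inj_on_inverseI[of _ h]) (simp add: h)
  show "\<exists>b\<in>carrier B. z = pt b \<one>\<^bsub>R\<^esub>" if "z \<in> carrier TP"
    using that
  proof (induction z rule: tensor_induct)
    case (pure b t)
    then have "pt b t = pt (t \<odot>\<^bsub>B\<^esub> b) \<one>\<^bsub>R\<^esub>" using pt_balanced[of t b "\<one>\<^bsub>R\<^esub>"] by simp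
    then show ?case using pure by auto
  next
    case (add x y)
    then obtain b c where "b \<in> carrier B" "c \<in> carrier B" "x = pt b \<one>\<^bsub>R\<^esub>" "y = pt c \<one>\<^bsub>R\<^esub>" by blast
    then show ?case using pt_add_left[of b c "\<one>\<^bsub>R\<^esub>"] by (intro bexI[of _ "b \<oplus>\<^bsub>B\<^esub> c"]) auto
  qed
qed


section \<open>Square-zero extensions\<close>

text \<open>The sum of \<open>T\<close> and the free module on \<beta>, an ideal of square zero.
  Finite supports keep the carrier small enough to be encoded in \<open>'u\<close>, and they are the
  source of the finiteness of expansions.\<close>

definition sqz :: "'u alg \<Rightarrow> 'i set \<Rightarrow> ('u, 'u \<times> ('i \<Rightarrow> 'u)) module" where
  "sqz T \<beta> =
    \<lparr>carrier = {(r, v). r \<in> carrier T \<and> v \<in> \<beta> \<rightarrow>\<^sub>E carrier T \<and> finite {i \<in> \<beta>. v i \<noteq> \<zero>\<^bsub>T\<^esub>}},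
     monoid.mult = \<lambda>(r, v) (s, w). (r \<otimes>\<^bsub>T\<^esub> s, \<lambda>i\<in>\<beta>. r \<otimes>\<^bsub>T\<^esub> w i \<oplus>\<^bsub>T\<^esub> s \<otimes>\<^bsub>T\<^esub> v i),
     monoid.one = (\<one>\<^bsub>T\<^esub>, \<lambda>i\<in>\<beta>. \<zero>\<^bsub>T\<^esub>), ring.zero = (\<zero>\<^bsub>T\<^esub>, \<lambda>i\<in>\<beta>. \<zero>\<^bsub>T\<^esub>),
     ring.add = \<lambda>(r, v) (s, w). (r \<oplus>\<^bsub>T\<^esub> s, \<lambda>i\<in>\<beta>. v i \<oplus>\<^bsub>T\<^esub> w i),
     smult = \<lambda>a (r, v). (a \<odot>\<^bsub>T\<^esub> r, \<lambda>i\<in>\<beta>. a \<odot>\<^bsub>T\<^esub> v i)\<rparr>"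

lemma sqz_simps:
  "p \<in> carrier (sqz T \<beta>) \<longleftrightarrow> fst p \<in> carrier T \<and> snd p \<in> \<beta> \<rightarrow>\<^sub>E carrier T \<and> finite {i \<in> \<beta>. snd p i \<noteq> \<zero>\<^bsub>T\<^esub>}"
  "p \<otimes>\<^bsub>sqz T \<beta>\<^esub> q = (fst p \<otimes>\<^bsub>T\<^esub> fst q, \<lambda>i\<in>\<beta>. fst p \<otimes>\<^bsub>T\<^esub> snd q i \<oplus>\<^bsub>T\<^esub> fst q \<otimes>\<^bsub>T\<^esub> snd p i)"
  "\<one>\<^bsub>sqz T \<beta>\<^esub> = (\<one>\<^bsub>T\<^esub>, \<lambda>i\<in>\<beta>. \<zero>\<^bsub>T\<^esub>)" "\<zero>\<^bsub>sqz T \<beta>\<^esub> = (\<zero>\<^bsub>T\<^esub>, \<lambda>i\<in>\<beta>. \<zero>\<^bsub>T\<^esub>)"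
  "p \<oplus>\<^bsub>sqz T \<beta>\<^esub> q = (fst p \<oplus>\<^bsub>T\<^esub> fst q, \<lambda>i\<in>\<beta>. snd p i \<oplus>\<^bsub>T\<^esub> snd q i)"
  "a \<odot>\<^bsub>sqz T \<beta>\<^esub> p = (a \<odot>\<^bsub>T\<^esub> fst p, \<lambda>i\<in>\<beta>. a \<odot>\<^bsub>T\<^esub> snd p i)"
  by (cases p; simp add: sqz_def split_beta)+

lemma finite_nonzero_mono:
  "finite A \<Longrightarrow> (\<And>i. i \<in> \<beta> \<Longrightarrow> i \<notin> A \<Longrightarrow> v i = z) \<Longrightarrow> finite {i \<in> \<beta>. v i \<noteq> z}"
  by (rule finite_subset[of _ A]) auto

lemma sqz_algebra:
  fixes T :: "'u alg" and \<beta> :: "'i set"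
  assumes "T \<in> calg R" shows "algebra R (sqz T \<beta>)"
proof -
  interpret T: module R T using assms by (rule calg_module)
  interpret T: cring T using assms by (rule calg_cring)
  let ?S = "sqz T \<beta>"
  have ap: "v i \<in> carrier T" if "v \<in> \<beta> \<rightarrow>\<^sub>E carrier T" "i \<in> \<beta>" for v i using that by auto
  have pe: "p = q" if "fst p = fst q" "\<And>i. i \<in> \<beta> \<Longrightarrow> snd p i = snd q i"
    "snd p \<in> extensional \<beta>" "snd q \<in> extensional \<beta>" for p q :: "'u \<times> ('i \<Rightarrow> 'u)"
    using that by (auto simp: prod_eq_iff intro: extensionalityI)
  have ex: "v \<in> extensional \<beta>" if "v \<in> \<beta> \<rightarrow>\<^sub>E carrier T" for v :: "'i \<Rightarrow> 'u" using that by (auto simp: PiE_def)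
  note [simp] = sqz_simps and [intro] = ap
  have add_cl: "p \<oplus>\<^bsub>?S\<^esub> q \<in> carrier ?S" if "p \<in> carrier ?S" "q \<in> carrier ?S" for p q
    using that by (auto cong: conj_cong intro!: finite_nonzero_mono[of "{i \<in> \<beta>. snd p i \<noteq> \<zero>\<^bsub>T\<^esub>} \<union> {i \<in> \<beta>. snd q i \<noteq> \<zero>\<^bsub>T\<^esub>}"])
  have mult_cl: "p \<otimes>\<^bsub>?S\<^esub> q \<in> carrier ?S" if "p \<in> carrier ?S" "q \<in> carrier ?S" for p q
    using that by (auto cong: conj_cong intro!: finite_nonzero_mono[of "{i \<in> \<beta>. snd p i \<noteq> \<zero>\<^bsub>T\<^esub>} \<union> {i \<in> \<beta>. snd q i \<noteq> \<zero>\<^bsub>T\<^esub>}"])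
  have smult_cl: "a \<odot>\<^bsub>?S\<^esub> q \<in> carrier ?S" if "a \<in> carrier R" "q \<in> carrier ?S" for a q
    using that by (auto cong: conj_cong intro!: finite_nonzero_mono[of "{i \<in> \<beta>. snd q i \<noteq> \<zero>\<^bsub>T\<^esub>}"])
  have neg: "\<exists>q\<in>carrier ?S. q \<oplus>\<^bsub>?S\<^esub> p = \<zero>\<^bsub>?S\<^esub>" if "p \<in> carrier ?S" for p
    by (rule bexI[of _ "(\<ominus>\<^bsub>T\<^esub> fst p, \<lambda>i\<in>\<beta>. \<ominus>\<^bsub>T\<^esub> snd p i)"])
      (use that in \<open>auto simp: T.l_neg ap cong: conj_cong restrict_cong intro!: finite_nonzero_mono[of "{i \<in> \<beta>. snd p i \<noteq> \<zero>\<^bsub>T\<^esub>}"]\<close>)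
  have ag: "abelian_group ?S"
  proof (rule abelian_groupI[OF add_cl])
    show "\<zero>\<^bsub>?S\<^esub> \<in> carrier ?S" by auto
  qed (assumption | (rule neg, assumption) | (rule pe; (auto simp: ex T.a_ac ap)))+
  have cm: "comm_monoid ?S"
  proof (rule comm_monoidI[OF mult_cl])
    show "\<one>\<^bsub>?S\<^esub> \<in> carrier ?S" by auto
    fix x y z assume x: "x \<in> carrier ?S" and y: "y \<in> carrier ?S"
    show "x \<otimes>\<^bsub>?S\<^esub> y = y \<otimes>\<^bsub>?S\<^esub> x"
      by (rule pe) (use x y in \<open>auto simp: ex T.a_comm T.m_comm ap\<close>)
    show "\<one>\<^bsub>?S\<^esub> \<otimes>\<^bsub>?S\<^esub> x = x"
      by (rule pe) (use x in \<open>auto simp: ex ap\<close>)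
    assume z: "z \<in> carrier ?S"
    show "(x \<otimes>\<^bsub>?S\<^esub> y) \<otimes>\<^bsub>?S\<^esub> z = x \<otimes>\<^bsub>?S\<^esub> (y \<otimes>\<^bsub>?S\<^esub> z)"
      by (rule pe) (use x y z in \<open>auto simp: ex ap T.r_distr T.l_distr T.m_ac T.a_ac\<close>)
  qed (assumption)+
  have cr: "cring ?S"
  proof (rule cringI[OF ag cm])
    fix x y z assume x: "x \<in> carrier ?S" and y: "y \<in> carrier ?S" and z: "z \<in> carrier ?S"
    show "(x \<oplus>\<^bsub>?S\<^esub> y) \<otimes>\<^bsub>?S\<^esub> z = x \<otimes>\<^bsub>?S\<^esub> z \<oplus>\<^bsub>?S\<^esub> y \<otimes>\<^bsub>?S\<^esub> z"
      by (rule pe) (use x y z in \<open>auto simp: ex ap T.r_distr T.l_distr T.a_ac\<close>)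
  qed
  show ?thesis
  proof (rule algebraI[OF T.R.cring_axioms cr smult_cl])
    fix a b x y assume a: "a \<in> carrier R" and b: "b \<in> carrier R" and x: "x \<in> carrier ?S"
    show "(a \<oplus>\<^bsub>R\<^esub> b) \<odot>\<^bsub>?S\<^esub> x = a \<odot>\<^bsub>?S\<^esub> x \<oplus>\<^bsub>?S\<^esub> b \<odot>\<^bsub>?S\<^esub> x"
      "(a \<otimes>\<^bsub>R\<^esub> b) \<odot>\<^bsub>?S\<^esub> x = a \<odot>\<^bsub>?S\<^esub> (b \<odot>\<^bsub>?S\<^esub> x)"
      by (rule pe; use a b x in \<open>auto simp: ex ap T.smult_l_distr T.smult_assoc1\<close>)+
  next
    fix a x y assume a: "a \<in> carrier R" and x: "x \<in> carrier ?S" and y: "y \<in> carrier ?S"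
    show "a \<odot>\<^bsub>?S\<^esub> (x \<oplus>\<^bsub>?S\<^esub> y) = a \<odot>\<^bsub>?S\<^esub> x \<oplus>\<^bsub>?S\<^esub> a \<odot>\<^bsub>?S\<^esub> y"
      "(a \<odot>\<^bsub>?S\<^esub> x) \<otimes>\<^bsub>?S\<^esub> y = a \<odot>\<^bsub>?S\<^esub> (x \<otimes>\<^bsub>?S\<^esub> y)"
      by (rule pe; use a x y in \<open>auto simp: ex ap T.smult_r_distr calg_smult_mult[OF assms]\<close>)+
  next
    fix x assume x: "x \<in> carrier ?S"
    show "\<one>\<^bsub>R\<^esub> \<odot>\<^bsub>?S\<^esub> x = x" by (rule pe) (use x in \<open>auto simp: ex ap\<close>)
  qed assumption+
qed

text \<open>Square-zero extensions have to be copied into the universe to be objects of the category.\<close>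

lemma algebra_copy:
  fixes W :: "('u, 'w) module" and e :: "'w \<Rightarrow> 'u"
  assumes "algebra R W" "inj_on e (carrier W)"
  obtains Q where "Q \<in> calg R" "e \<in> lin_hom R W Q" "bij_betw e (carrier W) (carrier Q)"
proof -
  interpret W: module R W using assms(1) by (rule algebra.module)
  interpret W: cring W using assms(1) by (rule algebra.M_cring)
  note W_sm = assoc_algebra_smult_mult[OF algebra_imp_assoc_algebra[OF assms(1)]]
  let ?d = "inv_into (carrier W) e"
  define Q :: "'u alg" where "Q = \<lparr>carrier = e ` carrier W, monoid.mult = \<lambda>x y. e (?d x \<otimes>\<^bsub>W\<^esub> ?d y),
     monoid.one = e \<one>\<^bsub>W\<^esub>, ring.zero = e \<zero>\<^bsub>W\<^esub>, ring.add = \<lambda>x y. e (?d x \<oplus>\<^bsub>W\<^esub> ?d y), smult = \<lambda>a x. e (a \<odot>\<^bsub>W\<^esub> ?d x)\<rparr>"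
  have d: "?d (e x) = x" if "x \<in> carrier W" for x using that assms(2) by simp
  have "e \<in> ring_iso W Q"
    unfolding ring_iso_def using assms(2)
    by (auto intro!: ring_hom_memI simp: Q_def d bij_betw_def)
  from W.ring_iso_imp_img_cring[OF this] have "cring (Q\<lparr>ring.zero := e \<zero>\<^bsub>W\<^esub>\<rparr>)" .
  moreover have "Q\<lparr>ring.zero := e \<zero>\<^bsub>W\<^esub>\<rparr> = Q" by (simp add: Q_def)
  ultimately have "cring Q" by simp
  then have "algebra R Q"
    by (intro algebraI W.R.cring_axioms)
      (auto simp: Q_def d W.smult_l_distr W.smult_r_distr W.smult_assoc1 W_sm)
  moreover have "e \<in> lin_hom R W Q" by (rule lin_homI) (auto simp: Q_def d)
  moreover have "bij_betw e (carrier W) (carrier Q)" using assms(2) by (auto simp: Q_def bij_betw_def)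
  ultimately show ?thesis using that by (simp add: calg_def)
qed

lemma sqz_copy:
  fixes T :: "'u alg" and \<beta> :: "'u set"
  assumes "infinite (UNIV :: 'u set)" "T \<in> calg R"
  obtains Q e where "Q \<in> calg R" "e \<in> lin_hom R (sqz T \<beta>) Q" "bij_betw e (carrier (sqz T \<beta>)) (carrier Q)"
proof -
  obtain e0 :: "'u \<times> ('u \<times> 'u) set \<Rightarrow> 'u" where e0: "inj_on e0 (UNIV \<times> Fpow UNIV)"
    using inj_pair_Fpow_universe[OF assms(1)] by blast
  \<comment> \<open>A vector is zero on \<beta> outside this finite graph, so the graph determines
    it.\<close>
  define g where "g v = (\<lambda>i. (i, v i)) ` {i \<in> \<beta>. v i \<noteq> \<zero>\<^bsub>T\<^esub>}" for v :: "'u \<Rightarrow> 'u"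
  have "inj_on (\<lambda>p. e0 (fst p, g (snd p))) (carrier (sqz T \<beta>))"
  proof (rule inj_onI)
    fix p q assume p: "p \<in> carrier (sqz T \<beta>)" and q: "q \<in> carrier (sqz T \<beta>)"
      and eq: "e0 (fst p, g (snd p)) = e0 (fst q, g (snd q))"
    have "g (snd p) \<in> Fpow UNIV" "g (snd q) \<in> Fpow UNIV"
      using p q by (auto simp: Fpow_def g_def sqz_simps)
    then have eq': "fst p = fst q" "g (snd p) = g (snd q)" using inj_onD[OF e0 eq] by auto
    have "snd p i = snd q i" if "i \<in> \<beta>" for i
    proof -
      have "(i, y) \<in> g v \<longleftrightarrow> v i = y \<and> y \<noteq> \<zero>\<^bsub>T\<^esub>" for y v using that by (auto simp: g_def)
      then show ?thesis using eq'(2) by metis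
    qed
    moreover have "snd p \<in> extensional \<beta>" "snd q \<in> extensional \<beta>" using p q by (auto simp: sqz_simps PiE_def)
    ultimately have "snd p = snd q" by (intro extensionalityI)
    then show "p = q" using eq' by (simp add: prod_eq_iff)
  qed
  then show ?thesis using algebra_copy[OF sqz_algebra[OF assms(2)]] that by blast
qed

lemma sqz_embed:
  assumes T: "T \<in> calg R" and e: "e \<in> lin_hom R (sqz T \<beta>) Q"
  shows "(\<lambda>t\<in>carrier T. e (t, \<lambda>_\<in>\<beta>. \<zero>\<^bsub>T\<^esub>)) \<in> alg_hom R T Q"
proof (rule restrict_alg_hom[OF lin_homI calg_assoc_algebra[OF T]])
  interpret T: module R T by (rule calg_module[OF T])
  interpret T: cring T by (rule calg_cring[OF T])
  note e = lin_homD[OF e]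
  have z: "(t, \<lambda>_\<in>\<beta>. \<zero>\<^bsub>T\<^esub>) \<in> carrier (sqz T \<beta>)" if "t \<in> carrier T" for t
    using that by (auto simp: sqz_simps)
  show "e (t, \<lambda>_\<in>\<beta>. \<zero>\<^bsub>T\<^esub>) \<in> carrier Q" if "t \<in> carrier T" for t by (rule e(2)[OF z[OF that]])
  show "e (a \<oplus>\<^bsub>T\<^esub> b, \<lambda>_\<in>\<beta>. \<zero>\<^bsub>T\<^esub>) = e (a, \<lambda>_\<in>\<beta>. \<zero>\<^bsub>T\<^esub>) \<oplus>\<^bsub>Q\<^esub> e (b, \<lambda>_\<in>\<beta>. \<zero>\<^bsub>T\<^esub>)"
    if "a \<in> carrier T" "b \<in> carrier T" for a b
    using e(3)[OF z z, OF that] by (simp add: sqz_simps cong: restrict_cong)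
  show "e (a \<otimes>\<^bsub>T\<^esub> b, \<lambda>_\<in>\<beta>. \<zero>\<^bsub>T\<^esub>) = e (a, \<lambda>_\<in>\<beta>. \<zero>\<^bsub>T\<^esub>) \<otimes>\<^bsub>Q\<^esub> e (b, \<lambda>_\<in>\<beta>. \<zero>\<^bsub>T\<^esub>)"
    if "a \<in> carrier T" "b \<in> carrier T" for a b
    using e(4)[OF z z, OF that] that by (simp add: sqz_simps cong: restrict_cong)
  show "e (\<one>\<^bsub>T\<^esub>, \<lambda>_\<in>\<beta>. \<zero>\<^bsub>T\<^esub>) = \<one>\<^bsub>Q\<^esub>" using e(5) by (simp add: sqz_simps)
  show "e (r \<odot>\<^bsub>T\<^esub> a, \<lambda>_\<in>\<beta>. \<zero>\<^bsub>T\<^esub>) = r \<odot>\<^bsub>Q\<^esub> e (a, \<lambda>_\<in>\<beta>. \<zero>\<^bsub>T\<^esub>)"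
    if "r \<in> carrier R" "a \<in> carrier T" for r a
    using e(6)[OF that(1) z[OF that(2)]] that by (simp add: sqz_simps cong: restrict_cong)
qed

text \<open>Reading off the i-th coordinate is linear but not multiplicative, so it is tensored with
  \<open>B\<close> through \<open>tensor_lift\<close> rather than \<open>tensor_map\<close>.\<close>

lemma sqz_coeff:
  fixes T :: "'u alg" and \<beta> :: "'u set"
  assumes "infinite (UNIV :: 'u set)" "T \<in> calg R" "assoc_algebra R B" "Q \<in> calg R"
    "e \<in> lin_hom R (sqz T \<beta>) Q" "bij_betw e (carrier (sqz T \<beta>)) (carrier Q)" "i \<in> \<beta>"
  obtains c where "\<And>x. x \<in> carrier (tensor R B Q) \<Longrightarrow> c x \<in> carrier (tensor R B T)"
    "\<And>x y. x \<in> carrier (tensor R B Q) \<Longrightarrow> y \<in> carrier (tensor R B Q) \<Longrightarrow>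
      c (x \<oplus>\<^bsub>tensor R B Q\<^esub> y) = c x \<oplus>\<^bsub>tensor R B T\<^esub> c y"
    "\<And>b p. b \<in> carrier B \<Longrightarrow> p \<in> carrier (sqz T \<beta>) \<Longrightarrow>
      c (pure_tensor R B Q b (e p)) = pure_tensor R B T b (snd p i)"
proof -
  interpret Q: tensor_setup R B Q by (intro tensor_setupI assms)
  interpret T: tensor_setup R B T by (intro tensor_setupI assms)
  let ?d = "inv_into (carrier (sqz T \<beta>)) e"
  interpret W: module R "sqz T \<beta>" by (rule algebra.module[OF sqz_algebra[OF assms(2)]])
  interpret W: cring "sqz T \<beta>" by (rule algebra.M_cring[OF sqz_algebra[OF assms(2)]])
  note e = lin_homD[OF assms(5)]
  have inj: "inj_on e (carrier (sqz T \<beta>))" and im: "carrier Q = e ` carrier (sqz T \<beta>)"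
    using assms(6) by (auto simp: bij_betw_def)
  have d: "?d (e x) = x" if "x \<in> carrier (sqz T \<beta>)" for x using that inj by simp
  have dQ: "?d q \<in> carrier (sqz T \<beta>)" if "q \<in> carrier Q" for q
    using that by (auto simp: im d)
  have dc: "snd (?d q) i \<in> carrier T" if "q \<in> carrier Q" for q
    using dQ[OF that] assms(7) by (auto simp: sqz_simps)
  have da: "?d (x \<oplus>\<^bsub>Q\<^esub> y) = ?d x \<oplus>\<^bsub>sqz T \<beta>\<^esub> ?d y" if "x \<in> carrier Q" "y \<in> carrier Q" for x y
    using that by (auto simp only: im image_iff d W.a_closed simp flip: e(3))
  have ds: "?d (r \<odot>\<^bsub>Q\<^esub> x) = r \<odot>\<^bsub>sqz T \<beta>\<^esub> ?d x" if "r \<in> carrier R" "x \<in> carrier Q" for r x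
    using that by (auto simp only: im image_iff d W.smult_closed simp flip: e(6))
  obtain c where "\<And>x. x \<in> carrier Q.TP \<Longrightarrow> c x \<in> carrier T.TP"
    "\<And>x y. x \<in> carrier Q.TP \<Longrightarrow> y \<in> carrier Q.TP \<Longrightarrow> c (x \<oplus>\<^bsub>Q.TP\<^esub> y) = c x \<oplus>\<^bsub>T.TP\<^esub> c y"
    and cp: "\<And>b q. b \<in> carrier B \<Longrightarrow> q \<in> carrier Q \<Longrightarrow> c (Q.pt b q) = T.pt b (snd (?d q) i)"
    by (rule Q.tensor_lift[of T.TP "\<lambda>b q. T.pt b (snd (?d q) i)"])
      (auto simp: T.TP.abelian_group_axioms dc da ds sqz_simps(5,6) assms(7) T.pt_add_left T.pt_add_right T.pt_balanced)
  moreover have "c (Q.pt b (e p)) = T.pt b (snd p i)" if "b \<in> carrier B" "p \<in> carrier (sqz T \<beta>)" for b p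
    using cp[of b "e p"] that by (simp add: e d)
  ultimately show ?thesis using that by blast
qed

text \<open>The i-th basis vector goes to \<open>y i\<close> in every coordinate of \<gamma>. With a
  singleton \<gamma>, the case used later, the target is the ring of dual numbers over
  \<open>T'\<close> and the basis vector goes to \<open>y i\<close> times \<epsilon>.\<close>

definition sqz_map :: "'u alg \<Rightarrow> 'u alg \<Rightarrow> 'i set \<Rightarrow> 'j set \<Rightarrow> ('u \<Rightarrow> 'u) \<Rightarrow> ('i \<Rightarrow> 'u) \<Rightarrow> 'u \<times> ('i \<Rightarrow> 'u) \<Rightarrow> 'u \<times> ('j \<Rightarrow> 'u)" where
  "sqz_map T T' \<beta> \<gamma> f y = (\<lambda>p. (f (fst p), \<lambda>_\<in>\<gamma>. \<Oplus>\<^bsub>T'\<^esub>i\<in>{i \<in> \<beta>. snd p i \<noteq> \<zero>\<^bsub>T\<^esub>}. f (snd p i) \<otimes>\<^bsub>T'\<^esub> y i))"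

lemma sqz_map_lin_hom:
  assumes "T \<in> calg R" "T' \<in> calg R" "f \<in> alg_hom R T T'" "y \<in> \<beta> \<rightarrow> carrier T'" "finite \<gamma>"
  shows "sqz_map T T' \<beta> \<gamma> f y \<in> lin_hom R (sqz T \<beta>) (sqz T' \<gamma>)"
proof -
  interpret T: module R T using assms(1) by (rule calg_module)
  interpret T: cring T using assms(1) by (rule calg_cring)
  interpret T': module R T' using assms(2) by (rule calg_module)
  interpret T': cring T' using assms(2) by (rule calg_cring)
  note f = alg_homD[OF assms(3)]
  have f0: "f \<zero>\<^bsub>T\<^esub> = \<zero>\<^bsub>T'\<^esub>" by (rule alg_hom_zero[OF assms(3)]) unfold_locales
  define s where "s v = (\<Oplus>\<^bsub>T'\<^esub>i\<in>{i \<in> \<beta>. v i \<noteq> \<zero>\<^bsub>T\<^esub>}. f (v i) \<otimes>\<^bsub>T'\<^esub> y i)" for v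
  have cl: "f (v i) \<otimes>\<^bsub>T'\<^esub> y i \<in> carrier T'" if "v \<in> \<beta> \<rightarrow> carrier T" "i \<in> \<beta>" for v i
    using that f(4) assms(4) by auto
  have yc: "y i \<in> carrier T'" if "i \<in> \<beta>" for i using assms(4) that by auto
  \<comment> \<open>Any finite index set that contains the support computes the same sum, so sums
    with different supports can be compared over a common set.\<close>
  have s_eq: "s v = (\<Oplus>\<^bsub>T'\<^esub>i\<in>F. f (v i) \<otimes>\<^bsub>T'\<^esub> y i)"
    if "v \<in> \<beta> \<rightarrow> carrier T" "finite F" "F \<subseteq> \<beta>" "\<And>i. i \<in> \<beta> - F \<Longrightarrow> v i = \<zero>\<^bsub>T\<^esub>" for v F
    unfolding s_def
  proof (rule T'.add.finprod_mono_neutral_cong_left)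
    show "f (v i) \<otimes>\<^bsub>T'\<^esub> y i = \<zero>\<^bsub>T'\<^esub>" if "i \<in> F - {i \<in> \<beta>. v i \<noteq> \<zero>\<^bsub>T\<^esub>}" for i
      using that \<open>F \<subseteq> \<beta>\<close> yc[of i] f0 by auto
    show "(\<lambda>i. f (v i) \<otimes>\<^bsub>T'\<^esub> y i) \<in> F \<rightarrow> carrier T'" using cl that by auto
  qed (use that in auto)
  have sc: "s v \<in> carrier T'" if "v \<in> \<beta> \<rightarrow> carrier T" for v
    unfolding s_def using cl[OF that] by (intro T'.finsum_closed) auto
  \<comment> \<open>One identity serves three operations: coefficients 1 and 1 for sums, the images
    of the two scalar parts for products, and a scalar together with 0 for the action of
    \<open>R\<close>.\<close>
  have comb: "s u = a \<otimes>\<^bsub>T'\<^esub> s v \<oplus>\<^bsub>T'\<^esub> b \<otimes>\<^bsub>T'\<^esub> s w"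
    if "v \<in> \<beta> \<rightarrow> carrier T" "w \<in> \<beta> \<rightarrow> carrier T" "u \<in> \<beta> \<rightarrow> carrier T" "finite {i \<in> \<beta>. v i \<noteq> \<zero>\<^bsub>T\<^esub>}" "finite {i \<in> \<beta>. w i \<noteq> \<zero>\<^bsub>T\<^esub>}"
     "a \<in> carrier T'" "b \<in> carrier T'" "\<And>i. i \<in> \<beta> \<Longrightarrow> f (u i) = a \<otimes>\<^bsub>T'\<^esub> f (v i) \<oplus>\<^bsub>T'\<^esub> b \<otimes>\<^bsub>T'\<^esub> f (w i)"
     "\<And>i. i \<in> \<beta> \<Longrightarrow> v i = \<zero>\<^bsub>T\<^esub> \<Longrightarrow> w i = \<zero>\<^bsub>T\<^esub> \<Longrightarrow> u i = \<zero>\<^bsub>T\<^esub>" for u v w a b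
  proof -
    let ?F = "{i \<in> \<beta>. v i \<noteq> \<zero>\<^bsub>T\<^esub>} \<union> {i \<in> \<beta>. w i \<noteq> \<zero>\<^bsub>T\<^esub>}"
    have F: "finite ?F" "?F \<subseteq> \<beta>" using that(4,5) by auto
    have c: "f (v i) \<in> carrier T'" "f (w i) \<in> carrier T'" if "i \<in> \<beta>" for i
      using that f(4) \<open>v \<in> _\<close> \<open>w \<in> _\<close> by auto
    have "s u = (\<Oplus>\<^bsub>T'\<^esub>i\<in>?F. f (u i) \<otimes>\<^bsub>T'\<^esub> y i)" by (rule s_eq[OF that(3) F]) (use that(9) in blast)
    also have "\<dots> = (\<Oplus>\<^bsub>T'\<^esub>i\<in>?F. a \<otimes>\<^bsub>T'\<^esub> (f (v i) \<otimes>\<^bsub>T'\<^esub> y i) \<oplus>\<^bsub>T'\<^esub> b \<otimes>\<^bsub>T'\<^esub> (f (w i) \<otimes>\<^bsub>T'\<^esub> y i))"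
    proof (rule T'.finsum_cong')
      fix i assume "i \<in> ?F"
      then have i: "i \<in> \<beta>" by auto
      show "f (u i) \<otimes>\<^bsub>T'\<^esub> y i = a \<otimes>\<^bsub>T'\<^esub> (f (v i) \<otimes>\<^bsub>T'\<^esub> y i) \<oplus>\<^bsub>T'\<^esub> b \<otimes>\<^bsub>T'\<^esub> (f (w i) \<otimes>\<^bsub>T'\<^esub> y i)"
        unfolding that(8)[OF i] using c[OF i] yc[OF i] that(6,7) by (simp add: T'.l_distr T'.m_assoc)
    qed (use c yc that(6,7) in auto)
    also have "\<dots> = a \<otimes>\<^bsub>T'\<^esub> (\<Oplus>\<^bsub>T'\<^esub>i\<in>?F. f (v i) \<otimes>\<^bsub>T'\<^esub> y i) \<oplus>\<^bsub>T'\<^esub> b \<otimes>\<^bsub>T'\<^esub> (\<Oplus>\<^bsub>T'\<^esub>i\<in>?F. f (w i) \<otimes>\<^bsub>T'\<^esub> y i)"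
    proof -
      have "(\<lambda>i. f (v i) \<otimes>\<^bsub>T'\<^esub> y i) \<in> ?F \<rightarrow> carrier T'" "(\<lambda>i. f (w i) \<otimes>\<^bsub>T'\<^esub> y i) \<in> ?F \<rightarrow> carrier T'"
        using c yc by auto
      then show ?thesis using F(1) that(6,7)
        by (subst T'.finsum_addf) (auto simp: T'.finsum_rdistr)
    qed
    also have "\<dots> = a \<otimes>\<^bsub>T'\<^esub> s v \<oplus>\<^bsub>T'\<^esub> b \<otimes>\<^bsub>T'\<^esub> s w"
      by (subst s_eq[OF that(1) F], blast, subst s_eq[OF that(2) F], blast, rule refl)
    finally show ?thesis .
  qed
  have fin\<gamma>: "finite {i \<in> \<gamma>. P i}" for P using assms(5) by simp
  show ?thesis
    unfolding sqz_map_def s_def[symmetric]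
  proof (rule lin_homI)
    fix p assume p: "p \<in> carrier (sqz T \<beta>)"
    then show "(f (fst p), \<lambda>_\<in>\<gamma>. s (snd p)) \<in> carrier (sqz T' \<gamma>)"
      by (auto simp: sqz_simps f fin\<gamma> sc PiE_def)
  next
    fix p q assume p: "p \<in> carrier (sqz T \<beta>)" and q: "q \<in> carrier (sqz T \<beta>)"
    have v: "snd p \<in> \<beta> \<rightarrow> carrier T" "snd q \<in> \<beta> \<rightarrow> carrier T" using p q by (auto simp: sqz_simps PiE_def)
    have fi: "finite {i \<in> \<beta>. snd p i \<noteq> \<zero>\<^bsub>T\<^esub>}" "finite {i \<in> \<beta>. snd q i \<noteq> \<zero>\<^bsub>T\<^esub>}"
      "fst p \<in> carrier T" "fst q \<in> carrier T" using p q by (auto simp: sqz_simps)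
    have vi: "snd p i \<in> carrier T" "snd q i \<in> carrier T" if "i \<in> \<beta>" for i using v that by auto
    have "s (snd (p \<oplus>\<^bsub>sqz T \<beta>\<^esub> q)) = \<one>\<^bsub>T'\<^esub> \<otimes>\<^bsub>T'\<^esub> s (snd p) \<oplus>\<^bsub>T'\<^esub> \<one>\<^bsub>T'\<^esub> \<otimes>\<^bsub>T'\<^esub> s (snd q)"
      by (rule comb) (use v fi vi f in \<open>auto simp: sqz_simps\<close>)
    then show "(f (fst (p \<oplus>\<^bsub>sqz T \<beta>\<^esub> q)), \<lambda>_\<in>\<gamma>. s (snd (p \<oplus>\<^bsub>sqz T \<beta>\<^esub> q))) =
      (f (fst p), \<lambda>_\<in>\<gamma>. s (snd p)) \<oplus>\<^bsub>sqz T' \<gamma>\<^esub> (f (fst q), \<lambda>_\<in>\<gamma>. s (snd q))"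
      using fi f v sc by (auto simp: sqz_simps)
    have "s (snd (p \<otimes>\<^bsub>sqz T \<beta>\<^esub> q)) = f (fst q) \<otimes>\<^bsub>T'\<^esub> s (snd p) \<oplus>\<^bsub>T'\<^esub> f (fst p) \<otimes>\<^bsub>T'\<^esub> s (snd q)"
      by (rule comb) (use v fi vi f in \<open>auto simp: sqz_simps T'.a_comm\<close>)
    then show "(f (fst (p \<otimes>\<^bsub>sqz T \<beta>\<^esub> q)), \<lambda>_\<in>\<gamma>. s (snd (p \<otimes>\<^bsub>sqz T \<beta>\<^esub> q))) =
      (f (fst p), \<lambda>_\<in>\<gamma>. s (snd p)) \<otimes>\<^bsub>sqz T' \<gamma>\<^esub> (f (fst q), \<lambda>_\<in>\<gamma>. s (snd q))"
      using fi f v sc by (auto simp: sqz_simps T'.a_comm)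
  next
    have "s (\<lambda>i\<in>\<beta>. \<zero>\<^bsub>T\<^esub>) = \<zero>\<^bsub>T'\<^esub>" by (subst s_eq[of _ "{}"]) auto
    then show "(f (fst \<one>\<^bsub>sqz T \<beta>\<^esub>), \<lambda>_\<in>\<gamma>. s (snd \<one>\<^bsub>sqz T \<beta>\<^esub>)) = \<one>\<^bsub>sqz T' \<gamma>\<^esub>"
      by (simp add: sqz_simps f)
  next
    fix r p assume r: "r \<in> carrier R" and p: "p \<in> carrier (sqz T \<beta>)"
    have v: "snd p \<in> \<beta> \<rightarrow> carrier T" using p by (auto simp: sqz_simps PiE_def)
    have fi: "finite {i \<in> \<beta>. snd p i \<noteq> \<zero>\<^bsub>T\<^esub>}" "fst p \<in> carrier T" using p by (auto simp: sqz_simps)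
    have vi: "snd p i \<in> carrier T" if "i \<in> \<beta>" for i using v that by auto
    have "s (snd (r \<odot>\<^bsub>sqz T \<beta>\<^esub> p)) = (r \<odot>\<^bsub>T'\<^esub> \<one>\<^bsub>T'\<^esub>) \<otimes>\<^bsub>T'\<^esub> s (snd p) \<oplus>\<^bsub>T'\<^esub> \<zero>\<^bsub>T'\<^esub> \<otimes>\<^bsub>T'\<^esub> s (snd p)"
      by (rule comb) (use v fi vi f r in \<open>auto simp: sqz_simps calg_smult_mult[OF assms(2)]\<close>)
    then show "(f (fst (r \<odot>\<^bsub>sqz T \<beta>\<^esub> p)), \<lambda>_\<in>\<gamma>. s (snd (r \<odot>\<^bsub>sqz T \<beta>\<^esub> p))) = r \<odot>\<^bsub>sqz T' \<gamma>\<^esub> (f (fst p), \<lambda>_\<in>\<gamma>. s (snd p))"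
      using fi f v sc r by (auto simp: sqz_simps calg_smult_mult[OF assms(2)])
  qed
qed

abbreviation base_change where
  "base_change R B T T' g \<equiv> tensor_map R B T B T' (\<lambda>b. b) g"

text \<open>Both sides are additive in \<nu>. For a pure tensor of \<open>b\<close> and
  \<open>eU p\<close>, the single coordinate of the image of \<open>p\<close> is the sum of the
  \<open>f (snd p i) \<otimes> y i\<close>, and the tensor with \<open>b\<close> distributes over
  it.\<close>

lemma sqz_coeff_sum:
  fixes T0 T :: "'u alg" and \<beta> :: "'u set"
  assumes inf: "infinite (UNIV :: 'u set)" and T0: "T0 \<in> calg R" and T: "T \<in> calg R" and B: "assoc_algebra R B"
    and f: "f \<in> alg_hom R T0 T" and y: "y \<in> \<beta> \<rightarrow> carrier T"
    and U: "U \<in> calg R" "eU \<in> lin_hom R (sqz T0 \<beta>) U" "bij_betw eU (carrier (sqz T0 \<beta>)) (carrier U)"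
    and E: "E \<in> calg R" "eE \<in> lin_hom R (sqz T {k}) E"
    and co: "\<And>i x. i \<in> \<beta> \<Longrightarrow> x \<in> carrier (tensor R B U) \<Longrightarrow> co i x \<in> carrier (tensor R B T0)"
      "\<And>i x y. i \<in> \<beta> \<Longrightarrow> x \<in> carrier (tensor R B U) \<Longrightarrow> y \<in> carrier (tensor R B U) \<Longrightarrow>
        co i (x \<oplus>\<^bsub>tensor R B U\<^esub> y) = co i x \<oplus>\<^bsub>tensor R B T0\<^esub> co i y"
      "\<And>i b p. i \<in> \<beta> \<Longrightarrow> b \<in> carrier B \<Longrightarrow> p \<in> carrier (sqz T0 \<beta>) \<Longrightarrow>
        co i (pure_tensor R B U b (eU p)) = pure_tensor R B T0 b (snd p i)"
    and cE: "\<And>x. x \<in> carrier (tensor R B E) \<Longrightarrow> cE x \<in> carrier (tensor R B T)"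
      "\<And>x y. x \<in> carrier (tensor R B E) \<Longrightarrow> y \<in> carrier (tensor R B E) \<Longrightarrow>
        cE (x \<oplus>\<^bsub>tensor R B E\<^esub> y) = cE x \<oplus>\<^bsub>tensor R B T\<^esub> cE y"
      "\<And>b p. b \<in> carrier B \<Longrightarrow> p \<in> carrier (sqz T {k}) \<Longrightarrow>
        cE (pure_tensor R B E b (eE p)) = pure_tensor R B T b (snd p k)"
    and h: "h \<in> lin_hom R U E" "\<And>p. p \<in> carrier (sqz T0 \<beta>) \<Longrightarrow> h (eU p) = eE (sqz_map T0 T \<beta> {k} f y p)"
    and nu: "\<nu> \<in> carrier (tensor R B U)"
    and F: "finite F" "F \<subseteq> \<beta>" "\<And>i. i \<in> \<beta> - F \<Longrightarrow> co i \<nu> = \<zero>\<^bsub>tensor R B T0\<^esub>"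
  shows "cE (base_change R B U E h \<nu>) =
    (\<Oplus>\<^bsub>tensor R B T\<^esub>i\<in>F. y i \<odot>\<^bsub>tensor R B T\<^esub> base_change R B T0 T f (co i \<nu>))"
proof -
  interpret U: tensor_setup R B U by (intro tensor_setupI inf B U)
  interpret E: tensor_setup R B E by (intro tensor_setupI inf B E)
  interpret T0: tensor_setup R B T0 by (intro tensor_setupI inf B T0)
  interpret T: tensor_setup R B T by (intro tensor_setupI inf B T)
  interpret TM: module T "tensor R B T" by (rule assoc_algebra_module[OF T.tensor_assoc_algebra])
  have idB: "(\<lambda>b. b) \<in> lin_hom R B B" by (rule lin_hom_id(1)[OF B])
  note tmh = tensor_map_properties[OF U.tensor_setup_axioms E.tensor_setup_axioms idB h(1)]
  note tmf = tensor_map_properties[OF T0.tensor_setup_axioms T.tensor_setup_axioms idB alg_homD(1)[OF f]]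
  have yc: "y i \<in> carrier T" if "i \<in> \<beta>" for i using y that by auto
  have f0: "f \<zero>\<^bsub>T0\<^esub> = \<zero>\<^bsub>T\<^esub>" by (rule alg_hom_zero[OF f]) unfold_locales
  let ?g = "\<lambda>\<nu> i. y i \<odot>\<^bsub>T.TP\<^esub> base_change R B T0 T f (co i \<nu>)"
  have gc: "?g \<nu> i \<in> carrier T.TP" if "i \<in> \<beta>" "\<nu> \<in> carrier U.TP" for i \<nu>
    using that yc by (intro TM.smult_closed tmf(1) co(1))
  have tm0: "base_change R B T0 T f \<zero>\<^bsub>T0.TP\<^esub> = \<zero>\<^bsub>T.TP\<^esub>"
    by (rule additive_zero[OF T0.TP.abelian_group_axioms T.TP.abelian_group_axioms tmf(1,2)])
  \<comment> \<open>The support varies with the pure tensor, so the claim is made for every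
    sufficiently large finite index set; this form is stable under sums.\<close>
  have "\<exists>F0. finite F0 \<and> F0 \<subseteq> \<beta> \<and> (\<forall>F. finite F \<longrightarrow> F0 \<subseteq> F \<longrightarrow> F \<subseteq> \<beta> \<longrightarrow>
      cE (base_change R B U E h \<nu>) = (\<Oplus>\<^bsub>T.TP\<^esub>i\<in>F. ?g \<nu> i))"
    using nu
  proof (induction \<nu> rule: U.tensor_induct)
    case (pure b q)
    obtain p where p: "p \<in> carrier (sqz T0 \<beta>)" and q: "q = eU p"
      using bij_betw_imp_surj_on[OF U(3)] pure(2) by blast
    let ?S = "{i \<in> \<beta>. snd p i \<noteq> \<zero>\<^bsub>T0\<^esub>}"
    have S: "finite ?S" and pc: "fst p \<in> carrier T0" "\<And>i. i \<in> \<beta> \<Longrightarrow> snd p i \<in> carrier T0"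
      using p by (auto simp: sqz_simps)
    have sc: "sqz_map T0 T \<beta> {k} f y p \<in> carrier (sqz T {k})"
      using lin_homD(2)[OF sqz_map_lin_hom[OF T0 T f y, of "{k}"]] p by simp
    have trm: "f (snd p i) \<otimes>\<^bsub>T\<^esub> y i \<in> carrier T" if "i \<in> \<beta>" for i
      using pc(2)[OF that] yc[OF that] alg_homD(4)[OF f] by auto
    have "cE (base_change R B U E h (U.pt b q)) = T.pt b (snd (sqz_map T0 T \<beta> {k} f y p) k)"
      using pure q by (simp add: tmh(3) h(2)[OF p] cE(3) sc)
    also have "\<dots> = T.pt b (\<Oplus>\<^bsub>T\<^esub>i\<in>?S. f (snd p i) \<otimes>\<^bsub>T\<^esub> y i)"
      by (simp add: sqz_map_def)
    also have "\<dots> = (\<Oplus>\<^bsub>T.TP\<^esub>i\<in>?S. T.pt b (f (snd p i) \<otimes>\<^bsub>T\<^esub> y i))"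
      by (rule additive_finsum[OF T.T.abelian_group_axioms T.TP.abelian_group_axioms])
        (use pure S trm in \<open>auto simp: T.pt_add_right\<close>)
    finally have eq: "cE (base_change R B U E h (U.pt b q)) = (\<Oplus>\<^bsub>T.TP\<^esub>i\<in>?S. T.pt b (f (snd p i) \<otimes>\<^bsub>T\<^esub> y i))" .
    have g: "?g (U.pt b q) i = T.pt b (f (snd p i) \<otimes>\<^bsub>T\<^esub> y i)" if "i \<in> \<beta>" for i
      using that pure(1) pc(2)[OF that] yc[OF that] alg_homD(4)[OF f]
      by (simp add: q co(3) p tmf(3) T.smult_pt T.T.m_comm)
    show ?case
    proof (intro exI[of _ ?S] conjI allI impI)
      fix F assume F: "finite F" "?S \<subseteq> F" "F \<subseteq> \<beta>"
      show "cE (base_change R B U E h (U.pt b q)) = (\<Oplus>\<^bsub>T.TP\<^esub>i\<in>F. ?g (U.pt b q) i)"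
        unfolding eq
      proof (rule T.TP.add.finprod_mono_neutral_cong_left[OF F(1,2)])
        show "?g (U.pt b q) i = \<zero>\<^bsub>T.TP\<^esub>" if "i \<in> F - ?S" for i
        proof -
          have "i \<in> \<beta>" "snd p i = \<zero>\<^bsub>T0\<^esub>" using that F by auto
          then show ?thesis using pure(1) yc by (simp add: g f0 T.pt_zero_right)
        qed
      qed (use F(3) pure(1) trm in \<open>auto simp: g subset_iff\<close>)
    qed (use S in auto)
  next
    case (add \<mu> \<nu>)
    then obtain F1 F2 where F12: "finite F1" "F1 \<subseteq> \<beta>" "finite F2" "F2 \<subseteq> \<beta>"
      and 1: "\<And>F. finite F \<Longrightarrow> F1 \<subseteq> F \<Longrightarrow> F \<subseteq> \<beta> \<Longrightarrow>
      cE (base_change R B U E h \<mu>) = (\<Oplus>\<^bsub>T.TP\<^esub>i\<in>F. ?g \<mu> i)"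
      and 2: "\<And>F. finite F \<Longrightarrow> F2 \<subseteq> F \<Longrightarrow> F \<subseteq> \<beta> \<Longrightarrow>
      cE (base_change R B U E h \<nu>) = (\<Oplus>\<^bsub>T.TP\<^esub>i\<in>F. ?g \<nu> i)"
      by blast
    show ?case
    proof (intro exI[of _ "F1 \<union> F2"] conjI allI impI)
      fix F assume F: "finite F" "F1 \<union> F2 \<subseteq> F" "F \<subseteq> \<beta>"
      have "cE (base_change R B U E h (\<mu> \<oplus>\<^bsub>U.TP\<^esub> \<nu>)) = (\<Oplus>\<^bsub>T.TP\<^esub>i\<in>F. ?g \<mu> i) \<oplus>\<^bsub>T.TP\<^esub> (\<Oplus>\<^bsub>T.TP\<^esub>i\<in>F. ?g \<nu> i)"
        using add(1,2) F 1[OF F(1) _ F(3)] 2[OF F(1) _ F(3)] by (simp add: tmh cE(2))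
      also have "\<dots> = (\<Oplus>\<^bsub>T.TP\<^esub>i\<in>F. ?g \<mu> i \<oplus>\<^bsub>T.TP\<^esub> ?g \<nu> i)"
        by (rule T.TP.finsum_addf[symmetric]) (use F(3) gc add(1,2) in auto)
      also have "\<dots> = (\<Oplus>\<^bsub>T.TP\<^esub>i\<in>F. ?g (\<mu> \<oplus>\<^bsub>U.TP\<^esub> \<nu>) i)"
      proof (rule T.TP.finsum_cong'[OF refl])
        fix i assume "i \<in> F"
        then have i: "i \<in> \<beta>" using F by auto
        show "?g \<mu> i \<oplus>\<^bsub>T.TP\<^esub> ?g \<nu> i = ?g (\<mu> \<oplus>\<^bsub>U.TP\<^esub> \<nu>) i"
          using co(1,2)[OF i] yc[OF i] add(1,2) by (simp add: tmf(1,2) TM.smult_r_distr)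
      qed (use F(3) gc add(1,2) in auto)
      finally show "cE (base_change R B U E h (\<mu> \<oplus>\<^bsub>U.TP\<^esub> \<nu>)) = (\<Oplus>\<^bsub>T.TP\<^esub>i\<in>F. ?g (\<mu> \<oplus>\<^bsub>U.TP\<^esub> \<nu>) i)" .
    qed (use F12 in auto)
  qed
  then obtain F0 where F0: "finite F0" "F0 \<subseteq> \<beta>"
    and eq: "\<And>F. finite F \<Longrightarrow> F0 \<subseteq> F \<Longrightarrow> F \<subseteq> \<beta> \<Longrightarrow>
      cE (base_change R B U E h \<nu>) = (\<Oplus>\<^bsub>T.TP\<^esub>i\<in>F. ?g \<nu> i)" by blast
  \<comment> \<open>Pass to \<open>F0 \<union> F\<close>, then drop the indices outside
    \<open>F\<close>, where the coordinates of \<nu> vanish.\<close>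
  have "cE (base_change R B U E h \<nu>) = (\<Oplus>\<^bsub>T.TP\<^esub>i\<in>F0 \<union> F. ?g \<nu> i)"
    by (rule eq) (use F0 F in auto)
  also have "\<dots> = (\<Oplus>\<^bsub>T.TP\<^esub>i\<in>F. ?g \<nu> i)"
  proof (rule T.TP.add.finprod_mono_neutral_cong_right)
    show "?g \<nu> i = \<zero>\<^bsub>T.TP\<^esub>" if "i \<in> F0 \<union> F - F" for i
      using that F0 F(3)[of i] yc[of i] by (auto simp: tm0)
  qed (use F0 F gc nu in auto)
  finally show ?thesis .
qed


section \<open>Coordinates on essentially free modules\<close>

text \<open>For a limit over a family P of sets, \<open>J\<close> is the union of P, and
  \<open>FS\<close> collects the subsets of \<open>J\<close> that meet every member of P in a finite
  set. Neither depends on the algebra \<open>T\<close>; only the coordinate map \<open>c T\<close>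
  does.\<close>

locale coordinates =
  fixes R :: "('u, 'm) ring_scheme" and A :: "('u, 'v) mod_fun"
    and J :: "'u set" and FS :: "'u set set" and c :: "'u alg \<Rightarrow> 'v \<Rightarrow> 'u \<Rightarrow> 'u"
  assumes module_functor: "module_functor R A"
    and universe_infinite: "infinite (UNIV :: 'u set)"
    and coord_bij: "T \<in> calg R \<Longrightarrow> bij_betw (c T) (carrier (Ob A T)) {y \<in> J \<rightarrow>\<^sub>E carrier T. {i \<in> J. y i \<noteq> \<zero>\<^bsub>T\<^esub>} \<in> FS}"
    and coord_add: "T \<in> calg R \<Longrightarrow> x \<in> carrier (Ob A T) \<Longrightarrow> y \<in> carrier (Ob A T) \<Longrightarrow> i \<in> J \<Longrightarrow>
      c T (x \<oplus>\<^bsub>Ob A T\<^esub> y) i = c T x i \<oplus>\<^bsub>T\<^esub> c T y i"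
    and coord_smult: "T \<in> calg R \<Longrightarrow> x \<in> carrier (Ob A T) \<Longrightarrow> t \<in> carrier T \<Longrightarrow> i \<in> J \<Longrightarrow>
      c T (t \<odot>\<^bsub>Ob A T\<^esub> x) i = t \<otimes>\<^bsub>T\<^esub> c T x i"
    and coord_nat: "T \<in> calg R \<Longrightarrow> T' \<in> calg R \<Longrightarrow> f \<in> alg_hom R T T' \<Longrightarrow> x \<in> carrier (Ob A T) \<Longrightarrow> i \<in> J \<Longrightarrow>
      c T' (Mor A T T' f x) i = f (c T x i)"
    and support_subset: "\<beta> \<in> FS \<Longrightarrow> \<gamma> \<subseteq> \<beta> \<Longrightarrow> \<gamma> \<in> FS"
    and support_J: "\<beta> \<in> FS \<Longrightarrow> \<beta> \<subseteq> J"
    and support_singleton: "i \<in> J \<Longrightarrow> {i} \<in> FS"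
begin

lemma base_cring: "cring R"
  using module_functor by (simp add: module_functor_def set_functor_def)

lemma Mor_carrier:
  "T \<in> calg R \<Longrightarrow> T' \<in> calg R \<Longrightarrow> f \<in> alg_hom R T T' \<Longrightarrow> x \<in> carrier (Ob A T) \<Longrightarrow> Mor A T T' f x \<in> carrier (Ob A T')"
  using set_functor.Mor_closed[of R "uset A" T T' f] module_functor
  by (auto simp: module_functor_def uset_def)

lemma Mor_comp_apply:
  "S \<in> calg R \<Longrightarrow> T \<in> calg R \<Longrightarrow> U \<in> calg R \<Longrightarrow> f \<in> alg_hom R S T \<Longrightarrow> g \<in> alg_hom R T U \<Longrightarrow> x \<in> carrier (Ob A S) \<Longrightarrow>
    Mor A S U (compose (carrier S) g f) x = Mor A T U g (Mor A S T f x)"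
  using set_functor.Mor_comp[of R "uset A" S T U f g] module_functor
  by (simp add: module_functor_def uset_def compose_eq)

lemma Mor_id_apply: "S \<in> calg R \<Longrightarrow> x \<in> carrier (Ob A S) \<Longrightarrow> Mor A S S (\<lambda>s\<in>carrier S. s) x = x"
  using set_functor.Mor_id[of R "uset A" S] module_functor
  by (simp add: module_functor_def uset_def)

lemma Ob_module: "S \<in> calg R \<Longrightarrow> module S (Ob A S)"
  using module_functor by (rule module_functor.Ob_module)

abbreviation supp where "supp T x \<equiv> {i \<in> J. c T x i \<noteq> \<zero>\<^bsub>T\<^esub>}"

lemma coord_closed: "T \<in> calg R \<Longrightarrow> x \<in> carrier (Ob A T) \<Longrightarrow> i \<in> J \<Longrightarrow> c T x i \<in> carrier T"
  using bij_betwE[OF coord_bij] by fastforce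

lemma supp_FS: "T \<in> calg R \<Longrightarrow> x \<in> carrier (Ob A T) \<Longrightarrow> supp T x \<in> FS"
  using bij_betwE[OF coord_bij] by fastforce

lemma coord_eqI:
  assumes "T \<in> calg R" "x \<in> carrier (Ob A T)" "y \<in> carrier (Ob A T)" "\<And>i. i \<in> J \<Longrightarrow> c T x i = c T y i"
  shows "x = y"
proof -
  have "c T x \<in> extensional J" "c T y \<in> extensional J"
    using bij_betwE[OF coord_bij[OF assms(1)]] assms(2,3) by (auto simp: PiE_def)
  then have "c T x = c T y" using assms(4) by (rule extensionalityI)
  then show ?thesis using bij_betw_imp_inj_on[OF coord_bij[OF assms(1)]] assms(2,3) by (auto dest: inj_onD)
qed

lemma coord_surj:
  assumes "T \<in> calg R" "\<And>i. i \<in> J \<Longrightarrow> y i \<in> carrier T" "{i \<in> J. y i \<noteq> \<zero>\<^bsub>T\<^esub>} \<in> FS"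
  obtains x where "x \<in> carrier (Ob A T)" "\<And>i. i \<in> J \<Longrightarrow> c T x i = y i"
proof -
  have "(\<lambda>i\<in>J. y i) \<in> {y \<in> J \<rightarrow>\<^sub>E carrier T. {i \<in> J. y i \<noteq> \<zero>\<^bsub>T\<^esub>} \<in> FS}"
    using assms(2,3) by (auto cong: conj_cong)
  then obtain x where "x \<in> carrier (Ob A T)" "(\<lambda>i\<in>J. y i) = c T x"
    unfolding bij_betw_imp_surj_on[OF coord_bij[OF assms(1)], symmetric] by blast
  then show ?thesis using that by (metis restrict_apply')
qed

definition unit where
  "unit T i = (SOME x. x \<in> carrier (Ob A T) \<and> (\<forall>j\<in>J. c T x j = (if j = i then \<one>\<^bsub>T\<^esub> else \<zero>\<^bsub>T\<^esub>)))"

lemma unit_props: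
  assumes "T \<in> calg R" "i \<in> J"
  shows unit_closed: "unit T i \<in> carrier (Ob A T)"
    and coord_unit: "j \<in> J \<Longrightarrow> c T (unit T i) j = (if j = i then \<one>\<^bsub>T\<^esub> else \<zero>\<^bsub>T\<^esub>)"
proof -
  interpret T: cring T using assms(1) by (rule calg_cring)
  \<comment> \<open>The support is \<open>{i}\<close>, or empty over the zero ring;
    \<open>FS\<close> contains both.\<close>
  obtain x where "x \<in> carrier (Ob A T)" "\<And>j. j \<in> J \<Longrightarrow> c T x j = (if j = i then \<one>\<^bsub>T\<^esub> else \<zero>\<^bsub>T\<^esub>)"
    by (rule coord_surj[OF assms(1), of "\<lambda>j. if j = i then \<one>\<^bsub>T\<^esub> else \<zero>\<^bsub>T\<^esub>"])
      (auto intro: support_subset[OF support_singleton[OF assms(2)]])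
  then have *: "\<exists>x. x \<in> carrier (Ob A T) \<and> (\<forall>j\<in>J. c T x j = (if j = i then \<one>\<^bsub>T\<^esub> else \<zero>\<^bsub>T\<^esub>))" by blast
  show "unit T i \<in> carrier (Ob A T)" "j \<in> J \<Longrightarrow> c T (unit T i) j = (if j = i then \<one>\<^bsub>T\<^esub> else \<zero>\<^bsub>T\<^esub>)"
    using someI_ex[OF *] by (simp_all add: unit_def)
qed

lemma Mor_unit:
  assumes "T \<in> calg R" "T' \<in> calg R" "f \<in> alg_hom R T T'" "i \<in> J"
  shows "Mor A T T' f (unit T i) = unit T' i"
proof -
  interpret T: cring T using assms(1) by (rule calg_cring)
  interpret T': cring T' using assms(2) by (rule calg_cring)
  have "f \<zero>\<^bsub>T\<^esub> = \<zero>\<^bsub>T'\<^esub>" by (rule alg_hom_zero[OF assms(3)]) unfold_locales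
  then show ?thesis
    using assms alg_homD(7)[OF assms(3)]
    by (intro coord_eqI[OF assms(2)]) (auto simp: coord_nat coord_unit unit_closed Mor_carrier)
qed

text \<open>
  A family \<open>\<phi>\<close> of homogeneous natural maps \<open>\<AA>(T) \<rightarrow> B \<otimes> T\<close> over \<open>T0\<close>-algebras \<open>f: T0 \<rightarrow> T\<close> is evaluated at
  the generic element of support \<open>\<beta>\<close>, which lives over the square-zero extension \<open>U = T0 \<oplus> T0\<^sup>(\<^sup>\<beta>\<^sup>)\<close>.
  An element \<open>x\<close> over \<open>T\<close> with support in \<open>\<beta>\<close> is recovered, after multiplication by \<open>\<epsilon>\<close> in \<open>T[\<epsilon>]\<close>, as the
  image of the generic one, and the value over \<open>U\<close> involves only finitely many coordinates.
\<close>

lemma finite_expansion: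
  fixes \<phi> :: "'u alg \<Rightarrow> ('u \<Rightarrow> 'u) \<Rightarrow> 'v \<Rightarrow> 'u"
  defines "\<phi>0 \<equiv> \<lambda>T0 i. \<phi> T0 (\<lambda>t\<in>carrier T0. t) (unit T0 i)"
  assumes T0: "T0 \<in> calg R" and B: "assoc_algebra R B"
    and cl: "\<And>T f x. T \<in> calg R \<Longrightarrow> f \<in> alg_hom R T0 T \<Longrightarrow> x \<in> carrier (Ob A T) \<Longrightarrow> \<phi> T f x \<in> carrier (tensor R B T)"
    and hom: "\<And>T f x t. T \<in> calg R \<Longrightarrow> f \<in> alg_hom R T0 T \<Longrightarrow> x \<in> carrier (Ob A T) \<Longrightarrow> t \<in> carrier T \<Longrightarrow>
      \<phi> T f (t \<odot>\<^bsub>Ob A T\<^esub> x) = t \<odot>\<^bsub>tensor R B T\<^esub> \<phi> T f x"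
    and nat: "\<And>T T' f g x. T \<in> calg R \<Longrightarrow> T' \<in> calg R \<Longrightarrow> f \<in> alg_hom R T0 T \<Longrightarrow> g \<in> alg_hom R T T' \<Longrightarrow> x \<in> carrier (Ob A T) \<Longrightarrow>
      \<phi> T' (compose (carrier T0) g f) (Mor A T T' g x) = base_change R B T T' g (\<phi> T f x)"
    and \<beta>: "\<beta> \<in> FS"
  obtains F where "finite F" "F \<subseteq> \<beta>" "\<And>i. i \<in> \<beta> - F \<Longrightarrow> \<phi>0 T0 i = \<zero>\<^bsub>tensor R B T0\<^esub>"
    "\<And>T f x. T \<in> calg R \<Longrightarrow> f \<in> alg_hom R T0 T \<Longrightarrow> x \<in> carrier (Ob A T) \<Longrightarrow> supp T x \<subseteq> \<beta> \<Longrightarrow>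
      \<phi> T f x = (\<Oplus>\<^bsub>tensor R B T\<^esub>i\<in>F. c T x i \<odot>\<^bsub>tensor R B T\<^esub> base_change R B T0 T f (\<phi>0 T0 i))"
proof -
  note inf = universe_infinite
  have \<beta>J: "\<beta> \<subseteq> J" using \<beta> by (rule support_J)
  have idB: "(\<lambda>b. b) \<in> lin_hom R B B" by (rule lin_hom_id(1)[OF B])
  obtain U eU where U: "U \<in> calg R" "eU \<in> lin_hom R (sqz T0 \<beta>) U" "bij_betw eU (carrier (sqz T0 \<beta>)) (carrier U)"
    by (rule sqz_copy[OF inf T0])
  interpret U: tensor_setup R B U by (intro tensor_setupI inf B U)
  interpret T0: tensor_setup R B T0 by (intro tensor_setupI inf B T0)
  note eU = lin_homD[OF U(2)]
  interpret W: ring "sqz T0 \<beta>" by (rule cring.axioms(1)[OF algebra.M_cring[OF sqz_algebra[OF T0]]])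
  have eU0: "eU \<zero>\<^bsub>sqz T0 \<beta>\<^esub> = \<zero>\<^bsub>U\<^esub>"
    by (rule additive_zero[OF W.abelian_group_axioms U.T.abelian_group_axioms]) (auto simp: eU)
  have "\<forall>i\<in>\<beta>. \<exists>c. (\<forall>x\<in>carrier U.TP. c x \<in> carrier T0.TP) \<and>
    (\<forall>x\<in>carrier U.TP. \<forall>y\<in>carrier U.TP. c (x \<oplus>\<^bsub>U.TP\<^esub> y) = c x \<oplus>\<^bsub>T0.TP\<^esub> c y) \<and>
    (\<forall>b\<in>carrier B. \<forall>p\<in>carrier (sqz T0 \<beta>). c (U.pt b (eU p)) = T0.pt b (snd p i))"
    using sqz_coeff[OF inf T0 B U] by metis
  then obtain co where co: "\<And>i x. i \<in> \<beta> \<Longrightarrow> x \<in> carrier U.TP \<Longrightarrow> co i x \<in> carrier T0.TP"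
    "\<And>i x y. i \<in> \<beta> \<Longrightarrow> x \<in> carrier U.TP \<Longrightarrow> y \<in> carrier U.TP \<Longrightarrow> co i (x \<oplus>\<^bsub>U.TP\<^esub> y) = co i x \<oplus>\<^bsub>T0.TP\<^esub> co i y"
    "\<And>i b p. i \<in> \<beta> \<Longrightarrow> b \<in> carrier B \<Longrightarrow> p \<in> carrier (sqz T0 \<beta>) \<Longrightarrow> co i (U.pt b (eU p)) = T0.pt b (snd p i)"
    unfolding bchoice_iff by blast
  \<comment> \<open>\<open>d i\<close> is the i-th basis vector of the square-zero ideal;
    \<open>eU\<close> moves it into the copy \<open>U\<close>.\<close>
  define d :: "'u \<Rightarrow> 'u \<Rightarrow> 'u" where "d i = (\<lambda>j\<in>\<beta>. if j = i then \<one>\<^bsub>T0\<^esub> else \<zero>\<^bsub>T0\<^esub>)" for i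
  have dW: "(\<zero>\<^bsub>T0\<^esub>, d i) \<in> carrier (sqz T0 \<beta>)" for i
    by (auto simp: sqz_simps d_def intro: finite_nonzero_mono[of "{i}"])
  have zW: "(r, \<lambda>_\<in>\<beta>. \<zero>\<^bsub>T0\<^esub>) \<in> carrier (sqz T0 \<beta>)" if "r \<in> carrier T0" for r
    using that by (auto simp: sqz_simps)
  \<comment> \<open>The generic vector has the basis vectors as coordinates on \<beta> and zeros
    elsewhere. Its support is contained in \<beta>, so it exists in A(U).\<close>
  have "{i \<in> J. (if i \<in> \<beta> then eU (\<zero>\<^bsub>T0\<^esub>, d i) else \<zero>\<^bsub>U\<^esub>) \<noteq> \<zero>\<^bsub>U\<^esub>} \<in> FS"
    by (rule support_subset[OF \<beta>]) auto
  then obtain u where u: "u \<in> carrier (Ob A U)"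
    "\<And>i. i \<in> J \<Longrightarrow> c U u i = (if i \<in> \<beta> then eU (\<zero>\<^bsub>T0\<^esub>, d i) else \<zero>\<^bsub>U\<^esub>)"
    using coord_surj[OF U(1), of "\<lambda>i. if i \<in> \<beta> then eU (\<zero>\<^bsub>T0\<^esub>, d i) else \<zero>\<^bsub>U\<^esub>"] eU(2)[OF dW] U.T.zero_closed by metis
  define j where "j = (\<lambda>r\<in>carrier T0. eU (r, \<lambda>_\<in>\<beta>. \<zero>\<^bsub>T0\<^esub>))"
  have j: "j \<in> alg_hom R T0 U"
    unfolding j_def by (rule sqz_embed[OF T0 U(2)])
  define \<nu> where "\<nu> = \<phi> U j u"
  have nu: "\<nu> \<in> carrier U.TP" unfolding \<nu>_def by (rule cl[OF U(1) j u(1)])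
  \<comment> \<open>\<nu> is a finite sum of pure tensors, and the second factor of each has finite
    support, so only finitely many coordinates survive.\<close>
  have "\<exists>F. finite F \<and> F \<subseteq> \<beta> \<and> (\<forall>i\<in>\<beta> - F. co i \<nu> = \<zero>\<^bsub>T0.TP\<^esub>)"
    using nu
  proof (induction \<nu> rule: U.tensor_induct)
    case (pure b q)
    then obtain p where p: "p \<in> carrier (sqz T0 \<beta>)" and q: "q = eU p"
      using bij_betw_imp_surj_on[OF U(3)] by blast
    show ?case
      using p pure(1) by (intro exI[of _ "{i \<in> \<beta>. snd p i \<noteq> \<zero>\<^bsub>T0\<^esub>}"]) (auto simp: q co(3) sqz_simps(1) T0.pt_zero_right)
  next
    case (add x y)
    then obtain F F' where "finite F" "F \<subseteq> \<beta>" "\<forall>i\<in>\<beta> - F. co i x = \<zero>\<^bsub>T0.TP\<^esub>" "finite F'" "F' \<subseteq> \<beta>" "\<forall>i\<in>\<beta> - F'. co i y = \<zero>\<^bsub>T0.TP\<^esub>"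
      by blast
    then show ?case using add(1,2) by (intro exI[of _ "F \<union> F'"]) (auto simp: co(2))
  qed
  then obtain F where F: "finite F" "F \<subseteq> \<beta>" and Fz: "\<And>i. i \<in> \<beta> - F \<Longrightarrow> co i \<nu> = \<zero>\<^bsub>T0.TP\<^esub>" by blast
  have main: "\<phi> T f x = (\<Oplus>\<^bsub>tensor R B T\<^esub>i\<in>F. c T x i \<odot>\<^bsub>tensor R B T\<^esub> base_change R B T0 T f (co i \<nu>))"
    if T: "T \<in> calg R" and f: "f \<in> alg_hom R T0 T" and x: "x \<in> carrier (Ob A T)" and sx: "supp T x \<subseteq> \<beta>" for T f x
  proof -
    \<comment> \<open>An arbitrary index: over a one-element index set the extension
      \<open>E\<close> is T[\<epsilon>].\<close>
    define k :: 'u where "k = undefined"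
    obtain E eE where E: "E \<in> calg R" "eE \<in> lin_hom R (sqz T {k}) E" "bij_betw eE (carrier (sqz T {k})) (carrier E)"
      by (rule sqz_copy[OF inf T])
    note eE = lin_homD[OF E(2)]
    interpret E: tensor_setup R B E by (intro tensor_setupI inf B E)
    interpret T: tensor_setup R B T by (intro tensor_setupI inf B T)
    interpret WE: ring "sqz T {k}" by (rule cring.axioms(1)[OF algebra.M_cring[OF sqz_algebra[OF T]]])
    obtain cE where cE: "\<And>x. x \<in> carrier E.TP \<Longrightarrow> cE x \<in> carrier T.TP"
      "\<And>x y. x \<in> carrier E.TP \<Longrightarrow> y \<in> carrier E.TP \<Longrightarrow> cE (x \<oplus>\<^bsub>E.TP\<^esub> y) = cE x \<oplus>\<^bsub>T.TP\<^esub> cE y"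
      "\<And>b p. b \<in> carrier B \<Longrightarrow> p \<in> carrier (sqz T {k}) \<Longrightarrow> cE (E.pt b (eE p)) = T.pt b (snd p k)"
      by (rule sqz_coeff[OF inf T B E, of k]) (simp, blast)
    have y: "c T x \<in> \<beta> \<rightarrow> carrier T" using coord_closed[OF T x] \<beta>J by auto
    let ?s = "sqz_map T0 T \<beta> {k} f (c T x)"
    have s: "?s \<in> lin_hom R (sqz T0 \<beta>) (sqz T {k})" by (rule sqz_map_lin_hom[OF T0 T f y]) simp
    \<comment> \<open>\<open>h\<close> is the specialization U \<rightarrow> T[\<epsilon>] that
      sends the i-th basis vector to \<epsilon> times the i-th coordinate of
      \<open>x\<close>.\<close>
    define h where "h = (\<lambda>q\<in>carrier U. eE (?s (inv_into (carrier (sqz T0 \<beta>)) eU q)))"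
    have inj: "inj_on eU (carrier (sqz T0 \<beta>))" and im: "carrier U = eU ` carrier (sqz T0 \<beta>)"
      using U(3) by (auto simp: bij_betw_def)
    have hU: "h (eU p) = eE (?s p)" if "p \<in> carrier (sqz T0 \<beta>)" for p
      using that inj eU(2) by (simp add: h_def)
    note sD = lin_homD[OF s]
    have h: "h \<in> lin_hom R U E"
    proof (rule lin_homI)
      fix a assume "a \<in> carrier U"
      then obtain p where p: "p \<in> carrier (sqz T0 \<beta>)" "a = eU p" by (auto simp: im)
      show "h a \<in> carrier E" unfolding p(2) hU[OF p(1)] by (intro eE(2) sD(2) p(1))
    next
      fix a b assume "a \<in> carrier U" "b \<in> carrier U"
      then obtain p q where pq: "p \<in> carrier (sqz T0 \<beta>)" "q \<in> carrier (sqz T0 \<beta>)" "a = eU p" "b = eU q" by (auto simp: im)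
      show "h (a \<oplus>\<^bsub>U\<^esub> b) = h a \<oplus>\<^bsub>E\<^esub> h b"
        using hU[OF W.a_closed[OF pq(1,2)]] pq(1,2) unfolding pq(3,4) by (simp add: eU(3) hU eE(3) sD(2,3))
      show "h (a \<otimes>\<^bsub>U\<^esub> b) = h a \<otimes>\<^bsub>E\<^esub> h b"
        using hU[OF W.m_closed[OF pq(1,2)]] pq(1,2) unfolding pq(3,4) by (simp add: eU(4) hU eE(4) sD(2,4))
    next
      show "h \<one>\<^bsub>U\<^esub> = \<one>\<^bsub>E\<^esub>" using hU[OF W.one_closed] by (simp add: eU(5) sD(5) eE(5))
    next
      fix r a assume r: "r \<in> carrier R" "a \<in> carrier U"
      then obtain p where p: "p \<in> carrier (sqz T0 \<beta>)" "a = eU p" by (auto simp: im)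
      interpret Wm: module R "sqz T0 \<beta>" by (rule algebra.module[OF sqz_algebra[OF T0]])
      show "h (r \<odot>\<^bsub>U\<^esub> a) = r \<odot>\<^bsub>E\<^esub> h a"
        using hU[OF Wm.smult_closed[OF r(1) p(1)]] p(1) r(1) unfolding p(2) by (simp add: eU(6) hU eE(6) sD(2,6))
    qed
    have hext: "h \<in> extensional (carrier U)" unfolding h_def by (rule restrict_extensional)
    have hA: "h \<in> alg_hom R U E" unfolding alg_hom_iff by (intro conjI h hext)
    have zE: "(t, \<lambda>_\<in>{k}. \<zero>\<^bsub>T\<^esub>) \<in> carrier (sqz T {k})" "(\<zero>\<^bsub>T\<^esub>, \<lambda>_\<in>{k}. t) \<in> carrier (sqz T {k})" if "t \<in> carrier T" for t
      using that by (simp_all add: sqz_simps PiE_iff extensional_def)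
    define j' where "j' = (\<lambda>t\<in>carrier T. eE (t, \<lambda>_\<in>{k}. \<zero>\<^bsub>T\<^esub>))"
    have j': "j' \<in> alg_hom R T E"
      unfolding j'_def by (rule sqz_embed[OF T E(2)])
    define \<epsilon> where "\<epsilon> = eE (\<zero>\<^bsub>T\<^esub>, \<lambda>_\<in>{k}. \<one>\<^bsub>T\<^esub>)"
    have \<epsilon>: "\<epsilon> \<in> carrier E" unfolding \<epsilon>_def by (intro eE(2) zE(2) T.T.one_closed)
    have \<epsilon>j: "\<epsilon> \<otimes>\<^bsub>E\<^esub> j' t = eE (\<zero>\<^bsub>T\<^esub>, \<lambda>_\<in>{k}. t)" if "t \<in> carrier T" for t
      using eE(4)[OF zE(2)[OF T.T.one_closed] zE(1)[OF that]] that
      by (simp add: \<epsilon>_def j'_def sqz_simps cong: restrict_cong)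
    have f0: "f \<zero>\<^bsub>T0\<^esub> = \<zero>\<^bsub>T\<^esub>" by (rule alg_hom_zero[OF f]) unfold_locales
    \<comment> \<open>The two routes from \<open>T0\<close> to T[\<epsilon>] agree, so both
      evaluations of \<phi> below are along the same structure map.\<close>
    have hj: "compose (carrier T0) h j = compose (carrier T0) j' f"
    proof (rule extensionalityI)
      fix r assume r: "r \<in> carrier T0"
      have "h (eU (r, \<lambda>_\<in>\<beta>. \<zero>\<^bsub>T0\<^esub>)) = eE (f r, \<lambda>_\<in>{k}. \<zero>\<^bsub>T\<^esub>)"
        using r by (simp add: hU zW sqz_map_def cong: conj_cong)
      then show "compose (carrier T0) h j r = compose (carrier T0) j' f r"
        using r alg_homD(4)[OF f] by (simp add: compose_eq j_def j'_def)
    qed (auto simp: compose_def)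
    have hd: "h (eU (\<zero>\<^bsub>T0\<^esub>, d i)) = eE (\<zero>\<^bsub>T\<^esub>, \<lambda>_\<in>{k}. c T x i)" if i: "i \<in> \<beta>" for i
    proof -
      have ci: "c T x i \<in> carrier T" using i y by auto
      have "(\<Oplus>\<^bsub>T\<^esub>l\<in>{l \<in> \<beta>. d i l \<noteq> \<zero>\<^bsub>T0\<^esub>}. f (d i l) \<otimes>\<^bsub>T\<^esub> c T x l) = c T x i"
      proof (cases "\<one>\<^bsub>T0\<^esub> = \<zero>\<^bsub>T0\<^esub>")
        \<comment> \<open>Over the zero ring \<open>d i\<close> has empty support; then
          \<open>T\<close> is zero too and both sides vanish.\<close>
        case True
        then have "\<one>\<^bsub>T\<^esub> = \<zero>\<^bsub>T\<^esub>" using f0 alg_homD(7)[OF f] by simp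
        then have "carrier T = {\<zero>\<^bsub>T\<^esub>}" by (rule T.T.one_zeroD)
        moreover have "{l \<in> \<beta>. d i l \<noteq> \<zero>\<^bsub>T0\<^esub>} = {}" using True by (auto simp: d_def)
        ultimately show ?thesis using ci by (simp only: T.T.finsum_empty singleton_iff)
      next
        case False
        then have "{l \<in> \<beta>. d i l \<noteq> \<zero>\<^bsub>T0\<^esub>} = {i}" using i by (auto simp: d_def split: if_splits)
        then show ?thesis using i ci by (simp add: d_def alg_homD(7)[OF f])
      qed
      then show ?thesis using f0 by (simp add: hU dW sqz_map_def)
    qed
    have h0: "h \<zero>\<^bsub>U\<^esub> = \<zero>\<^bsub>E\<^esub>" by (rule alg_hom_zero[OF hA]) unfold_locales
    interpret AE: module E "Ob A E" by (rule Ob_module[OF E(1)])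
    \<comment> \<open>The specialized generic vector is \<epsilon>x, coordinate by coordinate:
      inside \<beta> by \<open>hd\<close>, outside because both coordinates are zero.\<close>
    have hu: "Mor A U E h u = \<epsilon> \<odot>\<^bsub>Ob A E\<^esub> Mor A T E j' x"
    proof (rule coord_eqI[OF E(1)])
      fix i assume i: "i \<in> J"
      have "h (c U u i) = \<epsilon> \<otimes>\<^bsub>E\<^esub> j' (c T x i)"
      proof (cases "i \<in> \<beta>")
        case True
        then show ?thesis using i coord_closed[OF T x i] by (simp add: u hd \<epsilon>j)
      next
        case False
        then have "c T x i = \<zero>\<^bsub>T\<^esub>" using sx i by auto
        moreover have "j' \<zero>\<^bsub>T\<^esub> = \<zero>\<^bsub>E\<^esub>" by (rule alg_hom_zero[OF j']) unfold_locales
        ultimately show ?thesis using False i \<epsilon> by (simp add: u h0)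
      qed
      then show "c E (Mor A U E h u) i = c E (\<epsilon> \<odot>\<^bsub>Ob A E\<^esub> Mor A T E j' x) i"
        using i by (simp add: coord_nat[OF U(1) E(1) hA u(1)] coord_smult[OF E(1)] Mor_carrier[OF T E(1) j' x] \<epsilon> coord_nat[OF T E(1) j' x])
    qed (auto intro!: Mor_carrier AE.smult_closed \<epsilon> T E(1) j' x U(1) hA u(1))
    \<comment> \<open>Naturality along \<open>h\<close> evaluates \<phi> at \<epsilon>x; homogeneity
      then pulls \<epsilon> out, and naturality along \<open>j'\<close> brings \<open>x\<close> back
      to \<open>T\<close>.\<close>
    have tmj: "base_change R B U E h \<nu> = \<epsilon> \<odot>\<^bsub>E.TP\<^esub> base_change R B T E j' (\<phi> T f x)"
    proof -
      have jf: "compose (carrier T0) j' f \<in> alg_hom R T0 E" by (rule alg_hom_compose[OF calg_assoc_algebra[OF T0] f j'])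
      have "base_change R B U E h \<nu> = \<phi> E (compose (carrier T0) h j) (Mor A U E h u)"
        unfolding \<nu>_def by (rule nat[OF U(1) E(1) j hA u(1), symmetric])
      also have "\<dots> = \<epsilon> \<odot>\<^bsub>E.TP\<^esub> \<phi> E (compose (carrier T0) j' f) (Mor A T E j' x)"
        unfolding hj hu by (rule hom[OF E(1) jf Mor_carrier[OF T E(1) j' x] \<epsilon>])
      finally show ?thesis unfolding nat[OF T E(1) f j' x] .
    qed
    note tj = tensor_map_properties[OF T.tensor_setup_axioms E.tensor_setup_axioms idB alg_homD(1)[OF j']]
    interpret ETM: module E E.TP by (rule assoc_algebra_module[OF E.tensor_assoc_algebra])
    \<comment> \<open>Taking the \<epsilon>-coordinate undoes multiplication by \<epsilon>, so
      \<open>\<phi> T f x\<close> itself is recovered.\<close>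
    have "cE (\<epsilon> \<odot>\<^bsub>E.TP\<^esub> base_change R B T E j' z) = z" if "z \<in> carrier T.TP" for z
      using that
    proof (rule T.tensor_ext[where G = T.TP])
      fix b t assume bt: "b \<in> carrier B" "t \<in> carrier T"
      have "cE (\<epsilon> \<odot>\<^bsub>E.TP\<^esub> base_change R B T E j' (T.pt b t)) = cE (E.pt b (eE (\<zero>\<^bsub>T\<^esub>, \<lambda>_\<in>{k}. t)))"
        using bt \<epsilon> alg_homD(4)[OF j'] by (simp add: tj(3) E.smult_pt \<epsilon>j)
      also have "\<dots> = T.pt b t" using bt zE(2) by (simp add: cE(3))
      finally show "cE (\<epsilon> \<odot>\<^bsub>E.TP\<^esub> base_change R B T E j' (T.pt b t)) = T.pt b t" .
    qed (simp_all add: tj(1,2) ETM.smult_r_distr \<epsilon> cE(2))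
    then have "\<phi> T f x = cE (base_change R B U E h \<nu>)"
      using cl[OF T f x] tmj by simp
    also have "\<dots> = (\<Oplus>\<^bsub>T.TP\<^esub>i\<in>F. c T x i \<odot>\<^bsub>T.TP\<^esub> base_change R B T0 T f (co i \<nu>))"
      by (rule sqz_coeff_sum[OF inf T0 T B f y U E(1,2) co cE h hU nu F Fz])
    finally show ?thesis .
  qed
  \<comment> \<open>Applied to a basis vector over \<open>T0\<close>, the formula just proved
    identifies the coordinate of \<nu> with the value of \<phi> at that vector.\<close>
  have \<phi>0: "\<phi>0 T0 i = co i \<nu>" if i: "i \<in> \<beta>" for i
  proof -
    have iJ: "i \<in> J" using i \<beta>J by auto
    let ?id = "\<lambda>t\<in>carrier T0. t"
    let ?g = "\<lambda>l. c T0 (unit T0 i) l \<odot>\<^bsub>T0.TP\<^esub> base_change R B T0 T0 ?id (co l \<nu>)"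
    interpret TM: module T0 T0.TP by (rule assoc_algebra_module[OF T0.tensor_assoc_algebra])
    have g: "?g l = (if l = i then co i \<nu> else \<zero>\<^bsub>T0.TP\<^esub>)" if "l \<in> F" for l
    proof -
      have l: "l \<in> \<beta>" "l \<in> J" using that F \<beta>J by auto
      show ?thesis using co(1)[OF l(1) nu] co(1)[OF i nu]
        by (simp add: coord_unit[OF T0 iJ l(2)] tensor_map_id[OF T0.tensor_setup_axioms])
    qed
    have s: "supp T0 (unit T0 i) \<subseteq> \<beta>" using i by (auto simp: coord_unit[OF T0 iJ] split: if_splits)
    have "\<phi>0 T0 i = (\<Oplus>\<^bsub>T0.TP\<^esub>l\<in>F. ?g l)"
      unfolding \<phi>0_def by (rule main[OF T0 alg_hom_id[OF T0] unit_closed[OF T0 iJ] s])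
    also have "\<dots> = (\<Oplus>\<^bsub>T0.TP\<^esub>l\<in>F. if l = i then co i \<nu> else \<zero>\<^bsub>T0.TP\<^esub>)"
      by (rule T0.TP.finsum_cong') (use g co(1)[OF i nu] in auto)
    also have "\<dots> = co i \<nu>"
    proof (cases "i \<in> F")
      case True
      then show ?thesis using T0.TP.finsum_singleton[of i F "\<lambda>_. co i \<nu>"] F(1) co(1)[OF i nu] by (simp add: eq_commute[of _ i])
    next
      case False
      then have "(\<Oplus>\<^bsub>T0.TP\<^esub>l\<in>F. if l = i then co i \<nu> else \<zero>\<^bsub>T0.TP\<^esub>) = (\<Oplus>\<^bsub>T0.TP\<^esub>l\<in>F. \<zero>\<^bsub>T0.TP\<^esub>)"
        by (intro T0.TP.finsum_cong') auto
      then show ?thesis using False Fz i by (simp add: T0.TP.finsum_zero)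
    qed
    finally show ?thesis .
  qed
  show ?thesis
  proof (rule that[OF F])
    fix i assume "i \<in> \<beta> - F"
    then show "\<phi>0 T0 i = \<zero>\<^bsub>T0.TP\<^esub>" using Fz \<phi>0 by auto
  next
    fix T f x assume T: "T \<in> calg R" and f: "f \<in> alg_hom R T0 T" and x: "x \<in> carrier (Ob A T)" "supp T x \<subseteq> \<beta>"
    interpret T: tensor_setup R B T by (intro tensor_setupI inf B T)
    interpret TM: module T T.TP by (rule assoc_algebra_module[OF T.tensor_assoc_algebra])
    have tc: "base_change R B T0 T f (co i \<nu>) \<in> carrier T.TP" if "i \<in> \<beta>" for i
      using tensor_map_closed[OF T0.tensor_setup_axioms T.tensor_setup_axioms idB alg_homD(1)[OF f]] co(1)[OF that nu] .
    show "\<phi> T f x = (\<Oplus>\<^bsub>T.TP\<^esub>i\<in>F. c T x i \<odot>\<^bsub>T.TP\<^esub> base_change R B T0 T f (\<phi>0 T0 i))"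
      unfolding main[OF T f x]
      by (rule T.TP.finsum_cong') (use F \<beta>J \<phi>0 tc coord_closed[OF T x(1)] in \<open>auto intro!: TM.smult_closed\<close>)
  qed
qed

end

text \<open>A compatible family of vectors, one on each member of P, is a single function on the
  union of P: two members lie in a third, their union, so the values at a common index agree. Finite
  support on every member is the condition that defines \<open>FS\<close>.\<close>

lemma essentially_free_coordinates:
  fixes R :: "('u, 'm) ring_scheme" and A :: "('u, 'v) mod_fun"
  assumes inf: "infinite (UNIV :: 'u set)" and "essentially_free R A"
  obtains J FS c where "coordinates R A J FS c"
proof -
  from assms(2) obtain I :: "'u set" and P \<theta> where mod: "module_functor R A"
    and un: "\<And>\<alpha> \<alpha>'. \<alpha> \<in> P \<Longrightarrow> \<alpha>' \<in> P \<Longrightarrow> \<alpha> \<union> \<alpha>' \<in> P"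
    and th: "\<theta> \<in> mod_iso R A (lim_fun P free_fun free_proj)"
    unfolding essentially_free_def by blast
  define J where "J = \<Union>P"
  define FS where "FS = {\<beta>. \<beta> \<subseteq> J \<and> (\<forall>\<alpha>\<in>P. finite (\<beta> \<inter> \<alpha>))}"
  \<comment> \<open>Some member of P that contains \<open>i\<close>; by \<open>val\<close> below,
    the choice does not affect the coordinate.\<close>
  define idx where "idx i = (SOME \<alpha>. \<alpha> \<in> P \<and> i \<in> \<alpha>)" for i
  have idx: "idx i \<in> P" "i \<in> idx i" if "i \<in> J" for i
    using that someI_ex[of "\<lambda>\<alpha>. \<alpha> \<in> P \<and> i \<in> \<alpha>"] by (auto simp: idx_def J_def)
  define c where "c T a = (\<lambda>i\<in>J. \<theta> T a (idx i) i)" for T a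
  let ?L = "lim_carrier P free_fun free_proj"
  have L: "x \<in> ?L T \<longleftrightarrow> x \<in> extensional P \<and> (\<forall>\<alpha>\<in>P. x \<alpha> \<in> \<alpha> \<rightarrow>\<^sub>E carrier T \<and> finite {i \<in> \<alpha>. x \<alpha> i \<noteq> \<zero>\<^bsub>T\<^esub>}) \<and>
    (\<forall>\<alpha>\<in>P. \<forall>\<gamma>\<in>P. \<gamma> \<subseteq> \<alpha> \<longrightarrow> restrict (x \<alpha>) \<gamma> = x \<gamma>)" for x T
    by (auto simp: lim_carrier_def free_fun_def free_proj_def PiE_iff Let_def restrict_def split: if_splits)
  have thb: "bij_betw (\<theta> T) (carrier (Ob A T)) (?L T)" if "T \<in> calg R" for T
    using th that by (auto simp: mod_iso_def set_iso_def uset_def lim_fun_def)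
  have thL: "\<theta> T a \<in> ?L T" if "T \<in> calg R" "a \<in> carrier (Ob A T)" for T a
    using bij_betwE[OF thb] that by blast
  have val: "x \<alpha> i = x (idx i) i" if "x \<in> ?L T" "\<alpha> \<in> P" "i \<in> \<alpha>" for x T \<alpha> i
  proof -
    have i: "i \<in> J" using that by (auto simp: J_def)
    have u: "\<alpha> \<union> idx i \<in> P" using un idx i that by blast
    have "restrict (x (\<alpha> \<union> idx i)) \<alpha> = x \<alpha>" "restrict (x (\<alpha> \<union> idx i)) (idx i) = x (idx i)"
      using that(1) u that(2) idx(1)[OF i] by (auto simp: L)
    then have "x \<alpha> i = x (\<alpha> \<union> idx i) i" "x (idx i) i = x (\<alpha> \<union> idx i) i"
      using that(3) idx(2)[OF i] by (metis restrict_apply')+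
    then show ?thesis by simp
  qed
  have hom: "\<theta> T \<in> mod_hom T (Ob A T) (Ob (lim_fun P free_fun free_proj) T)" if "T \<in> calg R" for T
    using th that by (auto simp: mod_iso_def mod_trans_def)
  have "coordinates R A J FS c"
  proof (rule coordinates.intro)
    show "module_functor R A" by (rule mod)
    show "infinite (UNIV :: 'u set)" by (rule inf)
    show "\<beta> \<in> FS \<Longrightarrow> \<gamma> \<subseteq> \<beta> \<Longrightarrow> \<gamma> \<in> FS" for \<beta> \<gamma>
      unfolding FS_def by (auto intro: finite_subset[of "\<gamma> \<inter> _" "\<beta> \<inter> _"])
    show "\<beta> \<in> FS \<Longrightarrow> \<beta> \<subseteq> J" for \<beta> by (simp add: FS_def)
    show "i \<in> J \<Longrightarrow> {i} \<in> FS" for i by (simp add: FS_def)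
    fix T assume T: "T \<in> calg R"
    interpret T: cring T using T by (rule calg_cring)
    show "bij_betw (c T) (carrier (Ob A T)) {y \<in> J \<rightarrow>\<^sub>E carrier T. {i \<in> J. y i \<noteq> \<zero>\<^bsub>T\<^esub>} \<in> FS}"
    proof (rule bij_betw_imageI)
      show "inj_on (c T) (carrier (Ob A T))"
      proof (rule inj_onI)
        fix a b assume a: "a \<in> carrier (Ob A T)" and b: "b \<in> carrier (Ob A T)" and eq: "c T a = c T b"
        have "\<theta> T a = \<theta> T b"
        proof (rule extensionalityI)
          show "\<theta> T a \<in> extensional P" "\<theta> T b \<in> extensional P" using thL[OF T a] thL[OF T b] by (auto simp: L)
          fix \<alpha> assume \<alpha>: "\<alpha> \<in> P"
          show "\<theta> T a \<alpha> = \<theta> T b \<alpha>"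
          proof (rule extensionalityI)
            show "\<theta> T a \<alpha> \<in> extensional \<alpha>" "\<theta> T b \<alpha> \<in> extensional \<alpha>"
              using thL[OF T a] thL[OF T b] \<alpha> by (auto simp: L PiE_def)
            fix i assume i: "i \<in> \<alpha>"
            then have "i \<in> J" using \<alpha> by (auto simp: J_def)
            then have "\<theta> T a (idx i) i = \<theta> T b (idx i) i" using fun_cong[OF eq, of i] by (simp add: c_def)
            then show "\<theta> T a \<alpha> i = \<theta> T b \<alpha> i" using val[OF thL[OF T a] \<alpha> i] val[OF thL[OF T b] \<alpha> i] by simp
          qed
        qed
        then show "a = b" using bij_betw_imp_inj_on[OF thb[OF T]] a b by (auto dest: inj_onD)
      qed
      show "c T ` carrier (Ob A T) = {y \<in> J \<rightarrow>\<^sub>E carrier T. {i \<in> J. y i \<noteq> \<zero>\<^bsub>T\<^esub>} \<in> FS}"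
      proof (intro equalityI subsetI)
        fix y assume "y \<in> c T ` carrier (Ob A T)"
        then obtain a where a: "a \<in> carrier (Ob A T)" and y: "y = c T a" by auto
        have "finite ({i \<in> J. y i \<noteq> \<zero>\<^bsub>T\<^esub>} \<inter> \<alpha>)" if \<alpha>: "\<alpha> \<in> P" for \<alpha>
        proof -
          have "finite {i \<in> \<alpha>. \<theta> T a \<alpha> i \<noteq> \<zero>\<^bsub>T\<^esub>}" using thL[OF T a] \<alpha> by (auto simp: L)
          moreover have "{i \<in> J. y i \<noteq> \<zero>\<^bsub>T\<^esub>} \<inter> \<alpha> \<subseteq> {i \<in> \<alpha>. \<theta> T a \<alpha> i \<noteq> \<zero>\<^bsub>T\<^esub>}"
            using val[OF thL[OF T a] \<alpha>] by (auto simp: y c_def)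
          ultimately show ?thesis by (rule finite_subset[rotated])
        qed
        moreover have "\<theta> T a (idx i) i \<in> carrier T" if "i \<in> J" for i
          using thL[OF T a] idx[OF that] by (auto simp: L)
        then have "y \<in> J \<rightarrow>\<^sub>E carrier T" by (auto simp: y c_def)
        ultimately show "y \<in> {y \<in> J \<rightarrow>\<^sub>E carrier T. {i \<in> J. y i \<noteq> \<zero>\<^bsub>T\<^esub>} \<in> FS}" by (auto simp: FS_def)
      next
        fix y assume y: "y \<in> {y \<in> J \<rightarrow>\<^sub>E carrier T. {i \<in> J. y i \<noteq> \<zero>\<^bsub>T\<^esub>} \<in> FS}"
        let ?x = "\<lambda>\<alpha>\<in>P. restrict y \<alpha>"
        have "finite {i \<in> \<alpha>. restrict y \<alpha> i \<noteq> \<zero>\<^bsub>T\<^esub>}" if \<alpha>: "\<alpha> \<in> P" for \<alpha>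
        proof -
          have "{i \<in> \<alpha>. restrict y \<alpha> i \<noteq> \<zero>\<^bsub>T\<^esub>} = {i \<in> J. y i \<noteq> \<zero>\<^bsub>T\<^esub>} \<inter> \<alpha>" using \<alpha> by (auto simp: J_def)
          then show ?thesis using y \<alpha> by (auto simp: FS_def)
        qed
        moreover have "restrict y \<alpha> \<in> \<alpha> \<rightarrow>\<^sub>E carrier T" if "\<alpha> \<in> P" for \<alpha>
          using y that by (auto simp: J_def)
        ultimately have "?x \<in> ?L T" by (auto simp: L Int_absorb1)
        then obtain a where a: "a \<in> carrier (Ob A T)" "\<theta> T a = ?x"
          using bij_betw_imp_surj_on[OF thb[OF T]] by (metis imageE)
        have "c T a = y"
        proof (rule extensionalityI)
          show "c T a \<in> extensional J" "y \<in> extensional J" using y by (auto simp: c_def PiE_def)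
          fix i assume "i \<in> J"
          then show "c T a i = y i" using idx[of i] by (simp add: c_def a(2))
        qed
        then show "y \<in> c T ` carrier (Ob A T)" using a(1) by blast
      qed
    qed
    fix x assume x: "x \<in> carrier (Ob A T)"
    show "c T (x \<oplus>\<^bsub>Ob A T\<^esub> y) i = c T x i \<oplus>\<^bsub>T\<^esub> c T y i" if "y \<in> carrier (Ob A T)" "i \<in> J" for y i
      using hom[OF T] x that idx[OF that(2)] by (simp add: mod_hom_def c_def lim_fun_def free_fun_def Let_def)
    show "c T (t \<odot>\<^bsub>Ob A T\<^esub> x) i = t \<otimes>\<^bsub>T\<^esub> c T x i" if "t \<in> carrier T" "i \<in> J" for t i
      using hom[OF T] x that idx[OF that(2)] by (simp add: mod_hom_def c_def lim_fun_def free_fun_def Let_def)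
    show "c T' (Mor A T T' f x) i = f (c T x i)" if T': "T' \<in> calg R" and f: "f \<in> alg_hom R T T'" and i: "i \<in> J" for T' f i
    proof -
      have "\<theta> T' (Mor A T T' f x) = (\<lambda>\<alpha>\<in>P. Mor (free_fun \<alpha>) T T' f (\<theta> T x \<alpha>))"
        using th T T' f x thL[OF T x] by (auto simp: mod_iso_def set_iso_def set_trans_def uset_def lim_fun_def)
      moreover have "\<theta> T x (idx i) \<in> idx i \<rightarrow>\<^sub>E carrier T" "finite {j \<in> idx i. \<theta> T x (idx i) j \<noteq> \<zero>\<^bsub>T\<^esub>}"
        using thL[OF T x] idx[OF i] by (auto simp: L)
      ultimately show ?thesis using i idx[OF i] by (simp add: c_def free_fun_def Let_def)
    qed
  qed
  then show ?thesis by (rule that)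
qed


section \<open>Transformations into quasi-coherent algebras\<close>

lemma alg_transD:
  assumes "\<eta> \<in> alg_trans R A N" "T \<in> calg R"
  shows "\<eta> T \<in> alg_hom T (Ob A T) (Ob N T)"
    and "T' \<in> calg R \<Longrightarrow> f \<in> alg_hom R T T' \<Longrightarrow> x \<in> carrier (Ob A T) \<Longrightarrow> \<eta> T' (Mor A T T' f x) = Mor N T T' f (\<eta> T x)"
  using assms by (auto simp: alg_trans_def set_trans_def uset_def)

lemma alg_trans_extensional: "\<eta> \<in> alg_trans R A N \<Longrightarrow> \<eta> \<in> extensional (calg R)"
  by (auto simp: alg_trans_def set_trans_def PiE_def)

lemma alg_transI:
  assumes "\<eta> \<in> extensional (calg R)" "\<And>T. T \<in> calg R \<Longrightarrow> \<eta> T \<in> alg_hom T (Ob A T) (Ob N T)"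
    "\<And>T T' f x. T \<in> calg R \<Longrightarrow> T' \<in> calg R \<Longrightarrow> f \<in> alg_hom R T T' \<Longrightarrow> x \<in> carrier (Ob A T) \<Longrightarrow>
      \<eta> T' (Mor A T T' f x) = Mor N T T' f (\<eta> T x)"
  shows "\<eta> \<in> alg_trans R A N"
  using assms alg_homD(2)[OF assms(2)] alg_homD(4)[OF assms(2)]
  by (auto simp: alg_trans_def set_trans_def uset_def PiE_iff)

lemma alg_trans_eqI:
  assumes "\<eta> \<in> alg_trans R A N" "\<eta>' \<in> alg_trans R A N'"
    "\<And>T x. T \<in> calg R \<Longrightarrow> x \<in> carrier (Ob A T) \<Longrightarrow> \<eta> T x = \<eta>' T x"
  shows "\<eta> = \<eta>'"
proof (rule extensionalityI[OF alg_trans_extensional[OF assms(1)] alg_trans_extensional[OF assms(2)]])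
  fix T assume "T \<in> calg R"
  then show "\<eta> T = \<eta>' T"
    using alg_homD(2)[OF alg_transD(1)[OF assms(1)]] alg_homD(2)[OF alg_transD(1)[OF assms(2)]] assms(3)
    by (intro extensionalityI)
qed

lemma qcoh_simps [simp]:
  "Ob (qcoh R B) T = tensor R B T" "Mor (qcoh R B) T T' g = base_change R B T T' g"
  by (simp_all add: qcoh_def)

abbreviation scalar_ext where
  "scalar_ext R B B' T f \<equiv> tensor_map R B T B' T f (\<lambda>t. t)"

text \<open>Both composites are \<open>tensor_map\<close> with \<open>f\<close> and \<open>g\<close>
  acting at the same time.\<close>

lemma tensor_map_swap:
  assumes "infinite (UNIV :: 'u set)" "assoc_algebra R (B :: 'u alg)" "assoc_algebra R B'" "T \<in> calg R" "T' \<in> calg R"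
    "f \<in> lin_hom R B B'" "g \<in> lin_hom R T T'" "x \<in> carrier (tensor R B T)"
  shows "scalar_ext R B B' T' f (base_change R B T T' g x) =
    base_change R B' T T' g (scalar_ext R B B' T f x)"
proof -
  note i = lin_hom_id(1)[OF assms(2)] lin_hom_id(1)[OF assms(3)] lin_hom_id(1)[OF calg_assoc_algebra[OF assms(4)]]
    lin_hom_id(1)[OF calg_assoc_algebra[OF assms(5)]]
  note s = tensor_setupI[OF assms(1)]
  have "scalar_ext R B B' T' f (base_change R B T T' g x) = tensor_map R B T B' T' f g x"
    by (rule tensor_map_comp) (intro s assms i refl)+
  moreover have "base_change R B' T T' g (scalar_ext R B B' T f x) = tensor_map R B T B' T' f g x"
    by (rule tensor_map_comp) (intro s assms i refl)+
  ultimately show ?thesis by simp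
qed

lemma scalar_ext_alg_hom:
  assumes "infinite (UNIV :: 'u set)" "assoc_algebra R (B :: 'u alg)" "assoc_algebra R B'" "T \<in> calg R" "f \<in> lin_hom R B B'"
  shows "scalar_ext R B B' T f \<in> alg_hom T (tensor R B T) (tensor R B' T)"
  by (intro tensor_map_alg_hom tensor_setupI assms)

lemma scalar_ext_pure:
  assumes "infinite (UNIV :: 'u set)" "assoc_algebra R (B :: 'u alg)" "assoc_algebra R B'" "T \<in> calg R" "f \<in> lin_hom R B B'"
    "b \<in> carrier B" "t \<in> carrier T"
  shows "scalar_ext R B B' T f (pure_tensor R B T b t) = pure_tensor R B' T (f b) t"
  by (intro tensor_map_pure tensor_setupI assms lin_hom_id calg_assoc_algebra)

lemma scalar_ext_comp:
  assumes "infinite (UNIV :: 'u set)" "assoc_algebra R (B :: 'u alg)" "assoc_algebra R B'" "assoc_algebra R B''" "T \<in> calg R"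
    "f \<in> lin_hom R B B'" "g \<in> lin_hom R B' B''" "h \<in> lin_hom R B B''" "\<And>b. b \<in> carrier B \<Longrightarrow> h b = g (f b)"
    "x \<in> carrier (tensor R B T)"
  shows "scalar_ext R B' B'' T g (scalar_ext R B B' T f x) = scalar_ext R B B'' T h x"
  by (rule tensor_map_comp[OF tensor_setupI tensor_setupI tensor_setupI assms(6) lin_hom_id(1) assms(7) lin_hom_id(1)
      assms(8) lin_hom_id(1)]) (use assms calg_assoc_algebra in blast)+

text \<open>Over R the tensor product is \<open>B\<close> itself, so injectivity of \<open>f\<close>
  survives. Over a general algebra it can be lost, which is why later comparisons inside S \<otimes>
  T are made at \<open>base R\<close> only.\<close>

lemma scalar_ext_base_inj:
  assumes inf: "infinite (UNIV :: 'u set)" and B: "assoc_algebra R (B :: 'u alg)" and B': "assoc_algebra R B'"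
    and f: "f \<in> lin_hom R B B'" "inj_on f (carrier B)"
  shows "inj_on (scalar_ext R B B' (base R) f) (carrier (tensor R B (base R)))"
proof (rule inj_onI)
  interpret R: cring R using B by (rule assoc_algebra_cring)
  have bR: "base R \<in> calg R" by (rule base_calg) unfold_locales
  fix x y assume x: "x \<in> carrier (tensor R B (base R))" and y: "y \<in> carrier (tensor R B (base R))"
    and eq: "scalar_ext R B B' (base R) f x = scalar_ext R B B' (base R) f y"
  obtain b b' where b: "b \<in> carrier B" "b' \<in> carrier B"
    "x = pure_tensor R B (base R) b \<one>\<^bsub>R\<^esub>" "y = pure_tensor R B (base R) b' \<one>\<^bsub>R\<^esub>"
    using base_pure_surj[OF inf B x] base_pure_surj[OF inf B y] by blast
  have "pure_tensor R B' (base R) (f b) \<one>\<^bsub>R\<^esub> = pure_tensor R B' (base R) (f b') \<one>\<^bsub>R\<^esub>"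
    using eq b by (simp add: scalar_ext_pure[OF inf B B' bR f(1)])
  then have "f b = f b'" using base_pure_inj[OF inf B'] b lin_homD(2)[OF f(1)] by (auto dest: inj_onD)
  then show "x = y" using b f(2) by (auto dest: inj_onD)
qed

section \<open>Morphisms between quasi-coherent algebras\<close>

definition scalar_ext_trans where
  "scalar_ext_trans R B B' f = (\<lambda>T\<in>calg R. scalar_ext R B B' T f)"

lemma scalar_ext_trans_in:
  assumes "infinite (UNIV :: 'u set)" "assoc_algebra R (B :: 'u alg)" "assoc_algebra R B'" "f \<in> lin_hom R B B'"
  shows "scalar_ext_trans R B B' f \<in> alg_trans R (qcoh R B) (qcoh R B')"
  by (rule alg_transI) (auto simp: scalar_ext_trans_def scalar_ext_alg_hom assms
      intro!: tensor_map_swap[OF assms(1-3) _ _ assms(4)] dest: alg_homD(1))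

text \<open>Since S \<otimes> R is S, a homomorphism into it is one into \<open>S\<close>. The laws
  for the lift are checked after applying the injection s \<mapsto> s \<otimes> 1.\<close>

lemma base_lift:
  assumes inf: "infinite (UNIV :: 'u set)" and S: "assoc_algebra R (S :: 'u alg)" and M: "assoc_algebra (base R) M"
    and y: "y \<in> alg_hom (base R) M (tensor R S (base R))"
  obtains q where "q \<in> lin_hom R M S" "\<And>a. a \<in> carrier M \<Longrightarrow> y a = pure_tensor R S (base R) (q a) \<one>\<^bsub>R\<^esub>"
proof -
  interpret R: cring R using S by (rule assoc_algebra_cring)
  have bR: "base R \<in> calg R" by (rule base_calg) unfold_locales
  interpret Mr: ring M using M by (rule assoc_algebra_ring)
  interpret Mm: module "base R" M using M by (rule assoc_algebra_module)
  interpret Sm: module R S using S by (rule assoc_algebra_module)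
  interpret Sr: ring S using S by (rule assoc_algebra_ring)
  interpret TS: tensor_setup R S "base R" by (intro tensor_setupI inf S bR)
  note yD = alg_homD[OF y]
  have "\<forall>a\<in>carrier M. \<exists>s. s \<in> carrier S \<and> y a = TS.pt s \<one>\<^bsub>R\<^esub>"
    using base_pure_surj[OF inf S] yD(4) by blast
  then obtain f where fc: "\<And>a. a \<in> carrier M \<Longrightarrow> f a \<in> carrier S"
    and fy: "\<And>a. a \<in> carrier M \<Longrightarrow> y a = TS.pt (f a) \<one>\<^bsub>R\<^esub>"
    unfolding bchoice_iff by blast
  have eqI: "s = s'" if "s \<in> carrier S" "s' \<in> carrier S" "TS.pt s \<one>\<^bsub>R\<^esub> = TS.pt s' \<one>\<^bsub>R\<^esub>" for s s'
    using base_pure_inj[OF inf S] that by (auto dest: inj_onD)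
  have "f \<in> lin_hom R M S"
  proof (rule lin_homI[OF fc])
    fix a b assume ab: "a \<in> carrier M" "b \<in> carrier M"
    show "f (a \<oplus>\<^bsub>M\<^esub> b) = f a \<oplus>\<^bsub>S\<^esub> f b"
    proof (rule eqI)
      show "TS.pt (f (a \<oplus>\<^bsub>M\<^esub> b)) \<one>\<^bsub>R\<^esub> = TS.pt (f a \<oplus>\<^bsub>S\<^esub> f b) \<one>\<^bsub>R\<^esub>"
        unfolding fy[OF Mr.a_closed[OF ab], symmetric] yD(5)[OF ab] fy[OF ab(1)] fy[OF ab(2)]
        using fc ab by (simp add: TS.pt_add_left)
    qed (use ab fc in auto)
    show "f (a \<otimes>\<^bsub>M\<^esub> b) = f a \<otimes>\<^bsub>S\<^esub> f b"
    proof (rule eqI)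
      show "TS.pt (f (a \<otimes>\<^bsub>M\<^esub> b)) \<one>\<^bsub>R\<^esub> = TS.pt (f a \<otimes>\<^bsub>S\<^esub> f b) \<one>\<^bsub>R\<^esub>"
        unfolding fy[OF Mr.m_closed[OF ab], symmetric] yD(6)[OF ab] fy[OF ab(1)] fy[OF ab(2)]
        using fc ab by (simp add: TS.pt_mult)
    qed (use ab fc in auto)
  next
    show "f \<one>\<^bsub>M\<^esub> = \<one>\<^bsub>S\<^esub>"
      by (rule eqI) (use fc fy[of "\<one>\<^bsub>M\<^esub>"] TS.pt_one yD(7) in auto)
  next
    fix r a assume ra: "r \<in> carrier R" "a \<in> carrier M"
    have m: "r \<odot>\<^bsub>M\<^esub> a \<in> carrier M" using Mm.smult_closed[of r a] ra by simp
    have ys: "y (r \<odot>\<^bsub>M\<^esub> a) = r \<odot>\<^bsub>TS.TP\<^esub> y a" using yD(8)[of r a] ra by simp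
    show "f (r \<odot>\<^bsub>M\<^esub> a) = r \<odot>\<^bsub>S\<^esub> f a"
    proof (rule eqI)
      show "TS.pt (f (r \<odot>\<^bsub>M\<^esub> a)) \<one>\<^bsub>R\<^esub> = TS.pt (r \<odot>\<^bsub>S\<^esub> f a) \<one>\<^bsub>R\<^esub>"
        unfolding fy[OF m, symmetric] ys fy[OF ra(2)]
        using ra fc by (simp add: TS.smult_pt TS.pt_balanced)
    qed (use ra fc m in auto)
  qed
  then show ?thesis using that fy by blast
qed

text \<open>b \<otimes> t is t times b \<otimes> 1, and b \<otimes> 1 comes from
  \<open>base R\<close>. Linearity and naturality therefore leave only the component at
  \<open>base R\<close>, which is a homomorphism B \<rightarrow> S.\<close>

lemma qcoh_yoneda:
  assumes inf: "infinite (UNIV :: 'u set)" and B: "assoc_algebra R (B :: 'u alg)" and S: "assoc_algebra R S"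
    and y: "y \<in> alg_trans R (qcoh R B) (qcoh R S)"
  obtains f where "f \<in> alg_hom R B S" "y = scalar_ext_trans R B S f"
proof -
  interpret R: cring R using B by (rule assoc_algebra_cring)
  have bR: "base R \<in> calg R" by (rule base_calg) unfold_locales
  interpret Br: ring B using B by (rule assoc_algebra_ring)
  interpret Bm: module R B using B by (rule assoc_algebra_module)
  interpret TB: tensor_setup R B "base R" by (intro tensor_setupI inf B bR)
  interpret TS: tensor_setup R S "base R" by (intro tensor_setupI inf S bR)
  have yb: "y (base R) \<in> alg_hom (base R) TB.TP TS.TP" using alg_transD(1)[OF y bR] by simp
  obtain q where q: "q \<in> lin_hom R TB.TP S"
    and yq: "\<And>z. z \<in> carrier TB.TP \<Longrightarrow> y (base R) z = TS.pt (q z) \<one>\<^bsub>R\<^esub>"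
    by (rule base_lift[OF inf S TB.tensor_assoc_algebra yb]) blast
  note qD = lin_homD[OF q]
  define f where "f b = q (TB.pt b \<one>\<^bsub>R\<^esub>)" for b
  have fc: "f b \<in> carrier S" and fy: "y (base R) (TB.pt b \<one>\<^bsub>R\<^esub>) = TS.pt (f b) \<one>\<^bsub>R\<^esub>" if "b \<in> carrier B" for b
    using that by (simp_all add: f_def qD(2) yq)
  have f: "f \<in> lin_hom R B S"
  proof (rule lin_homI[OF fc])
    fix a b assume ab: "a \<in> carrier B" "b \<in> carrier B"
    show "f (a \<oplus>\<^bsub>B\<^esub> b) = f a \<oplus>\<^bsub>S\<^esub> f b"
      using ab by (simp add: f_def TB.pt_add_left qD(3))
    show "f (a \<otimes>\<^bsub>B\<^esub> b) = f a \<otimes>\<^bsub>S\<^esub> f b"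
      using ab qD(4)[of "TB.pt a \<one>\<^bsub>R\<^esub>" "TB.pt b \<one>\<^bsub>R\<^esub>"] by (simp add: f_def TB.pt_mult)
  next
    show "f \<one>\<^bsub>B\<^esub> = \<one>\<^bsub>S\<^esub>" using qD(5) TB.pt_one by (simp add: f_def)
  next
    fix r a assume ra: "r \<in> carrier R" "a \<in> carrier B"
    show "f (r \<odot>\<^bsub>B\<^esub> a) = r \<odot>\<^bsub>S\<^esub> f a"
      using ra qD(6)[of r "TB.pt a \<one>\<^bsub>R\<^esub>"] by (simp add: f_def TB.smult_pt TB.pt_balanced)
  qed
  let ?f = "\<lambda>b\<in>carrier B. f b"
  have fA: "?f \<in> alg_hom R B S" by (rule restrict_alg_hom[OF f B])
  note st = scalar_ext_trans_in[OF inf B S alg_homD(1)[OF fA]]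
  have "y = scalar_ext_trans R B S ?f"
  proof (rule alg_trans_eqI[OF y st])
    fix T x assume T: "T \<in> calg R" and x: "x \<in> carrier (Ob (qcoh R B) T)"
    interpret TT: tensor_setup R B T by (intro tensor_setupI inf B T)
    interpret ST: tensor_setup R S T by (intro tensor_setupI inf S T)
    have yT: "y T \<in> alg_hom T TT.TP ST.TP" using alg_transD(1)[OF y T] by simp
    have sT: "scalar_ext_trans R B S ?f T \<in> alg_hom T TT.TP ST.TP" using alg_transD(1)[OF st T] by simp
    have u: "unit_hom R T \<in> alg_hom R (base R) T" by (rule unit_hom_alg_hom[OF T])
    show "y T x = scalar_ext_trans R B S ?f T x"
    proof (rule TT.tensor_ext[where G = ST.TP and f = "y T" and g = "scalar_ext_trans R B S ?f T"])
      show "x \<in> carrier TT.TP" using x by simp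
      fix b t assume bt: "b \<in> carrier B" "t \<in> carrier T"
      \<comment> \<open>b \<otimes> 1 over \<open>T\<close> is the base change of b \<otimes> 1 over
        R, so naturality of \<open>y\<close> fixes its value.\<close>
      have "TT.pt b \<one>\<^bsub>T\<^esub> = base_change R B (base R) T (unit_hom R T) (TB.pt b \<one>\<^bsub>R\<^esub>)"
        using bt alg_homD(7)[OF u]
        by (simp add: tensor_map_pure[OF TB.tensor_setup_axioms TT.tensor_setup_axioms lin_hom_id(1)[OF B] alg_homD(1)[OF u]])
      then have "y T (TT.pt b \<one>\<^bsub>T\<^esub>) = base_change R S (base R) T (unit_hom R T) (TS.pt (f b) \<one>\<^bsub>R\<^esub>)"
        using alg_transD(2)[OF y bR T u, of "TB.pt b \<one>\<^bsub>R\<^esub>"] bt by (simp add: fy)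
      also have "\<dots> = ST.pt (f b) \<one>\<^bsub>T\<^esub>"
        using bt fc alg_homD(7)[OF u]
        by (simp add: tensor_map_pure[OF TS.tensor_setup_axioms ST.tensor_setup_axioms lin_hom_id(1)[OF S] alg_homD(1)[OF u]])
      finally have "t \<odot>\<^bsub>ST.TP\<^esub> y T (TT.pt b \<one>\<^bsub>T\<^esub>) = ST.pt (f b) t"
        using bt fc by (simp add: ST.smult_pt)
      moreover have "y T (TT.pt b t) = t \<odot>\<^bsub>ST.TP\<^esub> y T (TT.pt b \<one>\<^bsub>T\<^esub>)"
        using alg_homD(8)[OF yT bt(2), of "TT.pt b \<one>\<^bsub>T\<^esub>"] bt by (simp add: TT.smult_pt)
      moreover have "scalar_ext_trans R B S ?f T (TT.pt b t) = ST.pt (f b) t"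
        using T bt by (simp add: scalar_ext_trans_def scalar_ext_pure[OF inf B S T alg_homD(1)[OF fA]])
      ultimately show "y T (TT.pt b t) = scalar_ext_trans R B S ?f T (TT.pt b t)" by simp
    qed (auto dest: alg_homD(5)[OF yT] alg_homD(5)[OF sT])
  qed
  then show ?thesis using that fA by blast
qed


section \<open>Quasi-coherent quotients through which a point factors\<close>

text \<open>Homogeneous natural maps on the algebras under \<open>T0\<close>, in the form that
  \<open>finite_expansion\<close> takes. The structure map \<open>f\<close> is an argument because
  multiplication by a fixed element over \<open>T0\<close> depends on it.\<close>

definition lin_family where
  "lin_family R A T0 B \<phi> \<longleftrightarrow>
     (\<forall>T\<in>calg R. \<forall>f\<in>alg_hom R T0 T. \<forall>x\<in>carrier (Ob A T). \<phi> T f x \<in> carrier (tensor R B T) \<and>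
        (\<forall>t\<in>carrier T. \<phi> T f (t \<odot>\<^bsub>Ob A T\<^esub> x) = t \<odot>\<^bsub>tensor R B T\<^esub> \<phi> T f x) \<and>
        (\<forall>T'\<in>calg R. \<forall>g\<in>alg_hom R T T'.
           \<phi> T' (compose (carrier T0) g f) (Mor A T T' g x) = base_change R B T T' g (\<phi> T f x)))"

context coordinates
begin

text \<open>The two families have the same expansion terms, and only the finite index sets can
  differ. A term outside either set vanishes, since the common value at its basis vector is
  zero.\<close>

lemma lin_family_unique:
  assumes T0: "T0 \<in> calg R" and B: "assoc_algebra R B"
    and fam: "lin_family R A T0 B \<phi>" "lin_family R A T0 B \<psi>"
    and eq: "\<And>i. i \<in> J \<Longrightarrow> \<phi> T0 (\<lambda>t\<in>carrier T0. t) (unit T0 i) = \<psi> T0 (\<lambda>t\<in>carrier T0. t) (unit T0 i)"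
    and T: "T \<in> calg R" and f: "f \<in> alg_hom R T0 T" and x: "x \<in> carrier (Ob A T)"
  shows "\<phi> T f x = \<psi> T f x"
proof -
  note inf = universe_infinite
  interpret T0: tensor_setup R B T0 by (intro tensor_setupI inf B T0)
  interpret T: tensor_setup R B T by (intro tensor_setupI inf B T)
  interpret TM: module T T.TP by (rule assoc_algebra_module[OF T.tensor_assoc_algebra])
  have idB: "(\<lambda>b. b) \<in> lin_hom R B B" by (rule lin_hom_id(1)[OF B])
  note tm = tensor_map_properties[OF T0.tensor_setup_axioms T.tensor_setup_axioms idB alg_homD(1)[OF f]]
  have tm0: "base_change R B T0 T f \<zero>\<^bsub>T0.TP\<^esub> = \<zero>\<^bsub>T.TP\<^esub>"
    by (rule additive_zero[OF T0.TP.abelian_group_axioms T.TP.abelian_group_axioms tm(1,2)])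
  define \<beta> where "\<beta> = supp T x"
  have \<beta>: "\<beta> \<in> FS" "\<beta> \<subseteq> J" using supp_FS[OF T x] support_J by (auto simp: \<beta>_def)
  define n where "n i = \<phi> T0 (\<lambda>t\<in>carrier T0. t) (unit T0 i)" for i
  have nc: "n i \<in> carrier T0.TP" if "i \<in> J" for i
    using fam(1) that T0 alg_hom_id[OF T0] unit_closed[OF T0] by (auto simp: lin_family_def n_def)
  let ?t = "\<lambda>i. c T x i \<odot>\<^bsub>T.TP\<^esub> base_change R B T0 T f (n i)"
  have ex: "\<exists>F. finite F \<and> F \<subseteq> \<beta> \<and> (\<forall>i\<in>\<beta> - F. n i = \<zero>\<^bsub>T0.TP\<^esub>) \<and> \<chi> T f x = (\<Oplus>\<^bsub>T.TP\<^esub>i\<in>F. ?t i)"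
    if fam: "lin_family R A T0 B \<chi>" and n: "\<And>i. i \<in> J \<Longrightarrow> \<chi> T0 (\<lambda>t\<in>carrier T0. t) (unit T0 i) = n i" for \<chi>
  proof -
    obtain F where F: "finite F" "F \<subseteq> \<beta>" "\<And>i. i \<in> \<beta> - F \<Longrightarrow> \<chi> T0 (\<lambda>t\<in>carrier T0. t) (unit T0 i) = \<zero>\<^bsub>T0.TP\<^esub>"
      and eq: "\<And>T f x. T \<in> calg R \<Longrightarrow> f \<in> alg_hom R T0 T \<Longrightarrow> x \<in> carrier (Ob A T) \<Longrightarrow> supp T x \<subseteq> \<beta> \<Longrightarrow>
      \<chi> T f x = (\<Oplus>\<^bsub>tensor R B T\<^esub>i\<in>F. c T x i \<odot>\<^bsub>tensor R B T\<^esub>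
        base_change R B T0 T f (\<chi> T0 (\<lambda>t\<in>carrier T0. t) (unit T0 i)))"
    proof (rule finite_expansion[OF T0 B _ _ _ \<beta>(1), of \<chi>])
      fix T f x assume Tfx: "T \<in> calg R" "f \<in> alg_hom R T0 T" "x \<in> carrier (Ob A T)"
      note fam' = fam[unfolded lin_family_def, rule_format, OF Tfx]
      show "\<chi> T f x \<in> carrier (tensor R B T)" using fam' by blast
      show "\<chi> T f (t \<odot>\<^bsub>Ob A T\<^esub> x) = t \<odot>\<^bsub>tensor R B T\<^esub> \<chi> T f x" if "t \<in> carrier T" for t
        using fam' that by blast
      show "\<chi> T' (compose (carrier T0) g f) (Mor A T T' g x) = base_change R B T T' g (\<chi> T f x)"
        if "T' \<in> calg R" "g \<in> alg_hom R T T'" for T' g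
        using fam' that by blast
    qed (rule that; assumption)
    have "\<chi> T f x = (\<Oplus>\<^bsub>T.TP\<^esub>i\<in>F. c T x i \<odot>\<^bsub>T.TP\<^esub> base_change R B T0 T f (\<chi> T0 (\<lambda>t\<in>carrier T0. t) (unit T0 i)))"
      by (rule eq[OF T f x]) (simp add: \<beta>_def)
    also have "\<dots> = (\<Oplus>\<^bsub>T.TP\<^esub>i\<in>F. ?t i)"
    proof (rule T.TP.finsum_cong'[OF refl])
      have iJ: "i \<in> J" if "i \<in> F" for i using that F(2) \<beta>(2) by auto
      show "?t \<in> F \<rightarrow> carrier T.TP" using iJ nc tm(1) coord_closed[OF T x] by (auto intro!: TM.smult_closed)
    qed (use n F(2) \<beta>(2) in auto)
    finally have sum: "\<chi> T f x = (\<Oplus>\<^bsub>T.TP\<^esub>i\<in>F. ?t i)" .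
    have "n i = \<zero>\<^bsub>T0.TP\<^esub>" if "i \<in> \<beta> - F" for i
      using F(3)[OF that] n[of i] that \<beta>(2) by auto
    then show ?thesis using F(1,2) sum by (intro exI[of _ F] conjI ballI)
  qed
  obtain F where F: "finite F" "F \<subseteq> \<beta>" "\<forall>i\<in>\<beta> - F. n i = \<zero>\<^bsub>T0.TP\<^esub>" "\<phi> T f x = (\<Oplus>\<^bsub>T.TP\<^esub>i\<in>F. ?t i)"
    using ex[OF fam(1)] unfolding n_def by blast
  have "\<psi> T0 (\<lambda>t\<in>carrier T0. t) (unit T0 i) = n i" if "i \<in> J" for i
    using eq[OF that] by (simp add: n_def)
  then obtain G where G: "finite G" "G \<subseteq> \<beta>" "\<forall>i\<in>\<beta> - G. n i = \<zero>\<^bsub>T0.TP\<^esub>" "\<psi> T f x = (\<Oplus>\<^bsub>T.TP\<^esub>i\<in>G. ?t i)"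
    using ex[OF fam(2)] by blast
  have tc: "?t i \<in> carrier T.TP" if "i \<in> \<beta>" for i
    using that \<beta>(2) nc tm(1) coord_closed[OF T x] by (intro TM.smult_closed) auto
  have tz: "?t i = \<zero>\<^bsub>T.TP\<^esub>" if "i \<in> \<beta>" "n i = \<zero>\<^bsub>T0.TP\<^esub>" for i
    using that \<beta>(2) coord_closed[OF T x, of i] by (auto simp: tm0)
  show ?thesis unfolding F(4) G(4)
    by (rule T.TP.add.finprod_mono_neutral_cong) (use F(1-3) G(1-3) tc tz in auto)
qed

lemma alg_trans_lin_family:
  assumes "\<eta> \<in> alg_trans R A (qcoh R B)" "T0 \<in> calg R"
  shows "lin_family R A T0 B (\<lambda>T f. \<eta> T)"
  unfolding lin_family_def
  using alg_transD[OF assms(1)] alg_homD(4,8)[OF alg_transD(1)[OF assms(1)]] by auto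

text \<open>Take \<open>base R\<close> as \<open>T0\<close>: the basis vectors exist over R, so
  agreement there suffices.\<close>

lemma alg_trans_unique:
  assumes B: "assoc_algebra R B" and \<eta>: "\<eta> \<in> alg_trans R A (qcoh R B)" "\<eta>' \<in> alg_trans R A (qcoh R B)"
    and eq: "\<And>a. a \<in> carrier (Ob A (base R)) \<Longrightarrow> \<eta> (base R) a = \<eta>' (base R) a"
  shows "\<eta> = \<eta>'"
proof (rule alg_trans_eqI[OF \<eta>])
  fix T x assume T: "T \<in> calg R" "x \<in> carrier (Ob A T)"
  have b: "base R \<in> calg R" by (rule base_calg[OF base_cring])
  show "\<eta> T x = \<eta>' T x"
    by (rule lin_family_unique[OF b B alg_trans_lin_family[OF \<eta>(1) b] alg_trans_lin_family[OF \<eta>(2) b] _ T(1) unit_hom_alg_hom[OF T(1)] T(2)])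
      (simp add: eq unit_closed[OF b])
qed

end

text \<open>Zero and negatives are the scalar multiples by 0 and by the negative of 1, so closure
  under the remaining operations is enough.\<close>

lemma subalgebra_calg:
  assumes S: "S \<in> calg R" and sub: "H \<subseteq> carrier S" and one: "\<one>\<^bsub>S\<^esub> \<in> H"
    and add: "\<And>x y. x \<in> H \<Longrightarrow> y \<in> H \<Longrightarrow> x \<oplus>\<^bsub>S\<^esub> y \<in> H" and mult: "\<And>x y. x \<in> H \<Longrightarrow> y \<in> H \<Longrightarrow> x \<otimes>\<^bsub>S\<^esub> y \<in> H"
    and smult: "\<And>r x. r \<in> carrier R \<Longrightarrow> x \<in> H \<Longrightarrow> r \<odot>\<^bsub>S\<^esub> x \<in> H"
  shows "S\<lparr>carrier := H\<rparr> \<in> calg R"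
proof -
  interpret S: module R S using S by (rule calg_module)
  interpret S: cring S using S by (rule calg_cring)
  have c: "x \<in> carrier S" if "x \<in> H" for x using that sub by auto
  have z: "\<zero>\<^bsub>S\<^esub> \<in> H" using smult[OF S.R.zero_closed one] by simp
  have n: "\<exists>y\<in>H. x \<oplus>\<^bsub>S\<^esub> y = \<zero>\<^bsub>S\<^esub>" if "x \<in> H" for x
    using smult[of "\<ominus>\<^bsub>R\<^esub> \<one>\<^bsub>R\<^esub>" x] that c[OF that]
    by (intro bexI[of _ "(\<ominus>\<^bsub>R\<^esub> \<one>\<^bsub>R\<^esub>) \<odot>\<^bsub>S\<^esub> x"]) (auto simp: S.smult_l_minus S.r_neg)
  have "abelian_group (S\<lparr>carrier := H\<rparr>)"
    by (rule abelian_groupI) (auto simp: S.a_ac c z add n)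
  moreover have "comm_monoid (S\<lparr>carrier := H\<rparr>)"
    by (rule comm_monoidI) (auto simp: S.m_ac c one mult)
  ultimately have "cring (S\<lparr>carrier := H\<rparr>)"
    by (rule cringI) (simp add: S.l_distr c)
  then show ?thesis unfolding calg_def
    by (auto intro!: algebraI simp: S.R.cring_axioms smult c S.smult_l_distr S.smult_r_distr S.smult_assoc1 calg_smult_mult[OF S])
qed

lemma quotientsD:
  assumes "(B, \<pi>) \<in> quotients R A"
  shows "assoc_algebra R B" "\<pi> \<in> alg_trans R A (qcoh R B)"
    "S \<in> calg R \<Longrightarrow> \<pi> S ` carrier (Ob A S) = carrier (tensor R B S)"
  using assms by (auto simp: quotients_def)

section \<open>Multiplicativity from the values over the base ring\<close>

locale comm_coordinates = coordinates R A J FS c + CA: comm_algebra_functor R A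
  for R :: "('u, 'm) ring_scheme" and A :: "('u, 'v) mod_fun"
    and J :: "'u set" and FS :: "'u set set" and c :: "'u alg \<Rightarrow> 'v \<Rightarrow> 'u \<Rightarrow> 'u"
begin

lemma base_in: "base R \<in> calg R" by (rule base_calg[OF base_cring])

lemma Mor_mult: "T \<in> calg R \<Longrightarrow> T' \<in> calg R \<Longrightarrow> f \<in> alg_hom R T T' \<Longrightarrow> x \<in> carrier (Ob A T) \<Longrightarrow> y \<in> carrier (Ob A T) \<Longrightarrow>
    Mor A T T' f (x \<otimes>\<^bsub>Ob A T\<^esub> y) = Mor A T T' f x \<otimes>\<^bsub>Ob A T'\<^esub> Mor A T T' f y"
  using CA.Mor_ring_hom ring_hom_mult by fastforce

lemma Mor_one: "T \<in> calg R \<Longrightarrow> T' \<in> calg R \<Longrightarrow> f \<in> alg_hom R T T' \<Longrightarrow> Mor A T T' f \<one>\<^bsub>Ob A T\<^esub> = \<one>\<^bsub>Ob A T'\<^esub>"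
  using CA.Mor_ring_hom ring_hom_one by blast

lemma Mor_add: "T \<in> calg R \<Longrightarrow> T' \<in> calg R \<Longrightarrow> f \<in> alg_hom R T T' \<Longrightarrow> x \<in> carrier (Ob A T) \<Longrightarrow> y \<in> carrier (Ob A T) \<Longrightarrow>
    Mor A T T' f (x \<oplus>\<^bsub>Ob A T\<^esub> y) = Mor A T T' f x \<oplus>\<^bsub>Ob A T'\<^esub> Mor A T T' f y"
  using CA.Mor_ring_hom ring_hom_add by fastforce

lemma Mor_smult: "T \<in> calg R \<Longrightarrow> T' \<in> calg R \<Longrightarrow> f \<in> alg_hom R T T' \<Longrightarrow> x \<in> carrier (Ob A T) \<Longrightarrow> t \<in> carrier T \<Longrightarrow>
    Mor A T T' f (t \<odot>\<^bsub>Ob A T\<^esub> x) = f t \<odot>\<^bsub>Ob A T'\<^esub> Mor A T T' f x"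
  using module_functor.Mor_smult[OF module_functor] by blast

text \<open>
  Two uniqueness steps, first with one factor a basis element over \<open>R\<close>, then with an arbitrary one
  over the base \<open>T0\<close>, reduce multiplicativity to \<open>\<AA>(R)\<close>.
\<close>

lemma multiplicative_from_base:
  assumes B: "assoc_algebra R B" "cring B"
    and fam: "lin_family R A (base R) B (\<lambda>T f. \<psi> T)"
    and mult: "\<And>a b. a \<in> carrier (Ob A (base R)) \<Longrightarrow> b \<in> carrier (Ob A (base R)) \<Longrightarrow>
      \<psi> (base R) (a \<otimes>\<^bsub>Ob A (base R)\<^esub> b) = \<psi> (base R) a \<otimes>\<^bsub>tensor R B (base R)\<^esub> \<psi> (base R) b"
    and T0: "T0 \<in> calg R" and a: "a \<in> carrier (Ob A T0)" and b: "b \<in> carrier (Ob A T0)"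
  shows "\<psi> T0 (a \<otimes>\<^bsub>Ob A T0\<^esub> b) = \<psi> T0 a \<otimes>\<^bsub>tensor R B T0\<^esub> \<psi> T0 b"
proof -
  note inf = universe_infinite
  have idB: "(\<lambda>b. b) \<in> lin_hom R B B" by (rule lin_hom_id(1)[OF B(1)])
  have cl: "\<psi> T x \<in> carrier (tensor R B T)" if "T \<in> calg R" "x \<in> carrier (Ob A T)" for T x
    using fam that unit_hom_alg_hom[OF that(1)] by (auto simp: lin_family_def)
  have hom: "\<psi> T (t \<odot>\<^bsub>Ob A T\<^esub> x) = t \<odot>\<^bsub>tensor R B T\<^esub> \<psi> T x" if "T \<in> calg R" "x \<in> carrier (Ob A T)" "t \<in> carrier T" for T x t
    using fam that unit_hom_alg_hom[OF that(1)] by (auto simp: lin_family_def)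
  have nat: "\<psi> T' (Mor A T T' g x) = base_change R B T T' g (\<psi> T x)"
    if "T \<in> calg R" "T' \<in> calg R" "g \<in> alg_hom R T T'" "x \<in> carrier (Ob A T)" for T T' g x
    using fam that unit_hom_alg_hom[OF that(1)] unfolding lin_family_def by blast
  \<comment> \<open>For a fixed \<open>y\<close> over \<open>T1\<close>, the maps sending x to
    \<psi>(xy) and to \<psi>(x)\<psi>(y) are both homogeneous and natural over
    \<open>T1\<close>-algebras, so uniqueness can compare them.\<close>
  have family: "lin_family R A T1 B (\<lambda>T f x. \<psi> T (x \<otimes>\<^bsub>Ob A T\<^esub> Mor A T1 T f y))"
    "lin_family R A T1 B (\<lambda>T f x. \<psi> T x \<otimes>\<^bsub>tensor R B T\<^esub> \<psi> T (Mor A T1 T f y))"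
    if T1: "T1 \<in> calg R" and y: "y \<in> carrier (Ob A T1)" for T1 y
  proof -
    have *: "\<psi> T (x \<otimes>\<^bsub>Ob A T\<^esub> Mor A T1 T f y) \<in> carrier (tensor R B T) \<and>
        (\<forall>t\<in>carrier T. \<psi> T ((t \<odot>\<^bsub>Ob A T\<^esub> x) \<otimes>\<^bsub>Ob A T\<^esub> Mor A T1 T f y) = t \<odot>\<^bsub>tensor R B T\<^esub> \<psi> T (x \<otimes>\<^bsub>Ob A T\<^esub> Mor A T1 T f y)) \<and>
        (\<forall>T'\<in>calg R. \<forall>g\<in>alg_hom R T T'. \<psi> T' (Mor A T T' g x \<otimes>\<^bsub>Ob A T'\<^esub> Mor A T1 T' (compose (carrier T1) g f) y) =
           base_change R B T T' g (\<psi> T (x \<otimes>\<^bsub>Ob A T\<^esub> Mor A T1 T f y)))"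
      and **: "\<psi> T x \<otimes>\<^bsub>tensor R B T\<^esub> \<psi> T (Mor A T1 T f y) \<in> carrier (tensor R B T) \<and>
        (\<forall>t\<in>carrier T. \<psi> T (t \<odot>\<^bsub>Ob A T\<^esub> x) \<otimes>\<^bsub>tensor R B T\<^esub> \<psi> T (Mor A T1 T f y) =
           t \<odot>\<^bsub>tensor R B T\<^esub> (\<psi> T x \<otimes>\<^bsub>tensor R B T\<^esub> \<psi> T (Mor A T1 T f y))) \<and>
        (\<forall>T'\<in>calg R. \<forall>g\<in>alg_hom R T T'. \<psi> T' (Mor A T T' g x) \<otimes>\<^bsub>tensor R B T'\<^esub> \<psi> T' (Mor A T1 T' (compose (carrier T1) g f) y) =
           base_change R B T T' g (\<psi> T x \<otimes>\<^bsub>tensor R B T\<^esub> \<psi> T (Mor A T1 T f y)))"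
      if T: "T \<in> calg R" and f: "f \<in> alg_hom R T1 T" and x: "x \<in> carrier (Ob A T)" for T f x
    proof -
      interpret AT: ring "Ob A T" by (rule assoc_algebra_ring[OF CA.Ob_algebra[OF T]])
      interpret T: tensor_setup R B T by (intro tensor_setupI inf B T)
      have y': "Mor A T1 T f y \<in> carrier (Ob A T)" by (rule Mor_carrier[OF T1 T f y])
      have m: "x \<otimes>\<^bsub>Ob A T\<^esub> Mor A T1 T f y \<in> carrier (Ob A T)" using x y' by simp
      have n: "Mor A T1 T' (compose (carrier T1) g f) y = Mor A T T' g (Mor A T1 T f y)"
        if "T' \<in> calg R" "g \<in> alg_hom R T T'" for T' g
        by (rule Mor_comp_apply[OF T1 T that(1) f that(2) y])
      have tmm: "base_change R B T T' g (p \<otimes>\<^bsub>T.TP\<^esub> q) = base_change R B T T' g p \<otimes>\<^bsub>tensor R B T'\<^esub> base_change R B T T' g q"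
        if "T' \<in> calg R" "g \<in> alg_hom R T T'" "p \<in> carrier T.TP" "q \<in> carrier T.TP" for T' g p q
        by (rule ring_hom_mult[OF tensor_map_ring_hom[OF T.tensor_setup_axioms tensor_setupI[OF inf B(1) that(1)] idB alg_homD(1)[OF that(2)]] that(3,4)])
      show "\<psi> T (x \<otimes>\<^bsub>Ob A T\<^esub> Mor A T1 T f y) \<in> carrier (tensor R B T) \<and>
        (\<forall>t\<in>carrier T. \<psi> T ((t \<odot>\<^bsub>Ob A T\<^esub> x) \<otimes>\<^bsub>Ob A T\<^esub> Mor A T1 T f y) = t \<odot>\<^bsub>tensor R B T\<^esub> \<psi> T (x \<otimes>\<^bsub>Ob A T\<^esub> Mor A T1 T f y)) \<and>
        (\<forall>T'\<in>calg R. \<forall>g\<in>alg_hom R T T'. \<psi> T' (Mor A T T' g x \<otimes>\<^bsub>Ob A T'\<^esub> Mor A T1 T' (compose (carrier T1) g f) y) =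
           base_change R B T T' g (\<psi> T (x \<otimes>\<^bsub>Ob A T\<^esub> Mor A T1 T f y)))"
        using m cl[OF T m] hom[OF T m] nat[OF T _ _ m]
        by (simp add: assoc_algebra_smult_mult(1)[OF CA.Ob_algebra[OF T] _ x y'] n Mor_mult[OF T _ _ x y', symmetric])
      show "\<psi> T x \<otimes>\<^bsub>tensor R B T\<^esub> \<psi> T (Mor A T1 T f y) \<in> carrier (tensor R B T) \<and>
        (\<forall>t\<in>carrier T. \<psi> T (t \<odot>\<^bsub>Ob A T\<^esub> x) \<otimes>\<^bsub>tensor R B T\<^esub> \<psi> T (Mor A T1 T f y) =
           t \<odot>\<^bsub>tensor R B T\<^esub> (\<psi> T x \<otimes>\<^bsub>tensor R B T\<^esub> \<psi> T (Mor A T1 T f y))) \<and>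
        (\<forall>T'\<in>calg R. \<forall>g\<in>alg_hom R T T'. \<psi> T' (Mor A T T' g x) \<otimes>\<^bsub>tensor R B T'\<^esub> \<psi> T' (Mor A T1 T' (compose (carrier T1) g f) y) =
           base_change R B T T' g (\<psi> T x \<otimes>\<^bsub>tensor R B T\<^esub> \<psi> T (Mor A T1 T f y)))"
        using cl[OF T x] cl[OF T y'] hom[OF T x] nat[OF T _ _ x] nat[OF T _ _ y']
        by (simp add: assoc_algebra_smult_mult(1)[OF T.tensor_assoc_algebra] n tmm)
    qed
    show "lin_family R A T1 B (\<lambda>T f x. \<psi> T (x \<otimes>\<^bsub>Ob A T\<^esub> Mor A T1 T f y))"
      "lin_family R A T1 B (\<lambda>T f x. \<psi> T x \<otimes>\<^bsub>tensor R B T\<^esub> \<psi> T (Mor A T1 T f y))"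
      unfolding lin_family_def using * ** by blast+
  qed
  \<comment> \<open>Here the fixed factor is a basis vector over R, and agreement on basis vectors
    is the hypothesis over \<open>base R\<close>.\<close>
  have unit_mult: "\<psi> T (x \<otimes>\<^bsub>Ob A T\<^esub> unit T i) = \<psi> T x \<otimes>\<^bsub>tensor R B T\<^esub> \<psi> T (unit T i)"
    if T: "T \<in> calg R" and x: "x \<in> carrier (Ob A T)" and i: "i \<in> J" for T x i
  proof -
    have ui: "unit (base R) i \<in> carrier (Ob A (base R))" by (rule unit_closed[OF base_in i])
    have "\<psi> T (x \<otimes>\<^bsub>Ob A T\<^esub> Mor A (base R) T (unit_hom R T) (unit (base R) i)) =
      \<psi> T x \<otimes>\<^bsub>tensor R B T\<^esub> \<psi> T (Mor A (base R) T (unit_hom R T) (unit (base R) i))"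
      by (rule lin_family_unique[OF base_in B(1) family[OF base_in ui] _ T unit_hom_alg_hom[OF T] x])
        (simp add: Mor_id_apply[OF base_in ui, simplified] mult unit_closed[OF base_in] ui)
    then show ?thesis by (simp add: Mor_unit[OF base_in T unit_hom_alg_hom[OF T] i])
  qed
  interpret A0: cring "Ob A T0" by (rule CA.Ob_comm[OF T0])
  interpret T0: tensor_setup R B T0 by (intro tensor_setupI inf B T0)
  interpret T0T: cring T0.TP by (rule T0.tensor_cring[OF B(2)])
  \<comment> \<open>Now the fixed factor is \<open>b\<close> over \<open>T0\<close>, and agreement
    on basis vectors is \<open>unit_mult\<close> with the factors swapped by commutativity.\<close>
  have "\<psi> T0 (a \<otimes>\<^bsub>Ob A T0\<^esub> Mor A T0 T0 (\<lambda>t\<in>carrier T0. t) b) = \<psi> T0 a \<otimes>\<^bsub>T0.TP\<^esub> \<psi> T0 (Mor A T0 T0 (\<lambda>t\<in>carrier T0. t) b)"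
  proof (rule lin_family_unique[OF T0 B(1) family[OF T0 b] _ T0 alg_hom_id[OF T0] a])
    fix i assume i: "i \<in> J"
    have ui: "unit T0 i \<in> carrier (Ob A T0)" by (rule unit_closed[OF T0 i])
    show "\<psi> T0 (unit T0 i \<otimes>\<^bsub>Ob A T0\<^esub> Mor A T0 T0 (\<lambda>t\<in>carrier T0. t) b) =
      \<psi> T0 (unit T0 i) \<otimes>\<^bsub>T0.TP\<^esub> \<psi> T0 (Mor A T0 T0 (\<lambda>t\<in>carrier T0. t) b)"
      unfolding Mor_id_apply[OF T0 b] A0.m_comm[OF ui b] unit_mult[OF T0 b i]
      by (rule T0T.m_comm[OF cl[OF T0 b] cl[OF T0 ui]])
  qed
  then show ?thesis unfolding Mor_id_apply[OF T0 b] .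
qed

end

lemma tcomp_apply: "T \<in> calg R \<Longrightarrow> a \<in> carrier (Ob M T) \<Longrightarrow> tcomp R (uset M) \<zeta> \<eta> T a = \<zeta> T (\<eta> T a)"
  by (simp add: tcomp_def uset_def compose_eq)

lemma tcomp_alg_trans:
  assumes alg: "\<And>T. T \<in> calg R \<Longrightarrow> assoc_algebra T (Ob M T)"
    and mor: "\<And>T T' f x. T \<in> calg R \<Longrightarrow> T' \<in> calg R \<Longrightarrow> f \<in> alg_hom R T T' \<Longrightarrow> x \<in> carrier (Ob M T) \<Longrightarrow>
      Mor M T T' f x \<in> carrier (Ob M T')"
    and \<eta>: "\<eta> \<in> alg_trans R M N" and \<zeta>: "\<zeta> \<in> alg_trans R N K"
  shows "tcomp R (uset M) \<zeta> \<eta> \<in> alg_trans R M K"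
proof (rule alg_transI)
  show "tcomp R (uset M) \<zeta> \<eta> \<in> extensional (calg R)" by (simp add: tcomp_def)
  fix T assume T: "T \<in> calg R"
  show "tcomp R (uset M) \<zeta> \<eta> T \<in> alg_hom T (Ob M T) (Ob K T)"
    using alg_hom_compose[OF alg[OF T] alg_transD(1)[OF \<eta> T] alg_transD(1)[OF \<zeta> T]] T
    by (simp add: tcomp_def uset_def)
next
  fix T T' f x assume *: "T \<in> calg R" "T' \<in> calg R" "f \<in> alg_hom R T T'" "x \<in> carrier (Ob M T)"
  then have "\<eta> T x \<in> carrier (Ob N T)" using alg_homD(4)[OF alg_transD(1)[OF \<eta>]] by blast
  then show "tcomp R (uset M) \<zeta> \<eta> T' (Mor M T T' f x) = Mor K T T' f (tcomp R (uset M) \<zeta> \<eta> T x)"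
    using * alg_transD(2)[OF \<eta>] alg_transD(2)[OF \<zeta>] by (simp add: tcomp_apply mor)
qed

section \<open>The image of a point and its universal property\<close>

locale point_image = comm_coordinates R A J FS c
  for R :: "('u, 'm) ring_scheme" and A :: "('u, 'v) mod_fun"
    and J :: "'u set" and FS :: "'u set set" and c :: "'u alg \<Rightarrow> 'v \<Rightarrow> 'u \<Rightarrow> 'u" +
  fixes S :: "'u alg" and x :: "('u, 'v, 'u) trans" and q :: "'v \<Rightarrow> 'u"
  assumes S: "S \<in> calg R" and x: "x \<in> alg_trans R A (qcoh R S)"
    and q: "q \<in> lin_hom R (Ob A (base R)) S"
    and xq: "a \<in> carrier (Ob A (base R)) \<Longrightarrow> x (base R) a = pure_tensor R S (base R) (q a) \<one>\<^bsub>R\<^esub>"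
begin

definition "B0 = S\<lparr>carrier := q ` carrier (Ob A (base R))\<rparr>"
definition "incl = (\<lambda>s\<in>carrier B0. s)"
abbreviation "q0 i \<equiv> q (unit (base R) i)"
text \<open>The indices that can contribute. This set is finite by \<open>point_expansion\<close>,
  although the support of \<open>a\<close> may be infinite.\<close>

definition "N T a = {i \<in> J. c T a i \<noteq> \<zero>\<^bsub>T\<^esub> \<and> q0 i \<noteq> \<zero>\<^bsub>S\<^esub>}"
text \<open>The expansion of \<open>x T a\<close> from \<open>point_expansion\<close>, with the
  coefficients \<open>q0 i\<close> regarded in \<open>B0\<close> rather than in
  \<open>S\<close>.\<close>

definition "psi T a = (\<Oplus>\<^bsub>tensor R B0 T\<^esub>i\<in>N T a. pure_tensor R B0 T (q0 i) (c T a i))"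

lemmas qD = lin_homD[OF q]

lemma B0_simps [simp]:
  "carrier B0 = q ` carrier (Ob A (base R))" "y \<oplus>\<^bsub>B0\<^esub> z = y \<oplus>\<^bsub>S\<^esub> z" "y \<otimes>\<^bsub>B0\<^esub> z = y \<otimes>\<^bsub>S\<^esub> z"
  "\<one>\<^bsub>B0\<^esub> = \<one>\<^bsub>S\<^esub>" "\<zero>\<^bsub>B0\<^esub> = \<zero>\<^bsub>S\<^esub>" "r \<odot>\<^bsub>B0\<^esub> y = r \<odot>\<^bsub>S\<^esub> y"
  by (simp_all add: B0_def)

lemma B0_calg: "B0 \<in> calg R"
  unfolding B0_def
proof (rule subalgebra_calg[OF S])
  interpret M: module "base R" "Ob A (base R)" by (rule Ob_module[OF base_in])
  interpret Mr: cring "Ob A (base R)" by (rule CA.Ob_comm[OF base_in])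
  let ?H = "q ` carrier (Ob A (base R))"
  show "?H \<subseteq> carrier S" using qD(2) by auto
  show "\<one>\<^bsub>S\<^esub> \<in> ?H" using qD(5) Mr.one_closed by (metis imageI)
  show "y \<oplus>\<^bsub>S\<^esub> z \<in> ?H" "y \<otimes>\<^bsub>S\<^esub> z \<in> ?H" if "y \<in> ?H" "z \<in> ?H" for y z
    using that by (auto simp flip: qD(3,4))
  show "r \<odot>\<^bsub>S\<^esub> y \<in> ?H" if "r \<in> carrier R" "y \<in> ?H" for r y
    using that M.smult_closed[of r] by (auto simp flip: qD(6))
qed

lemma incl: "incl \<in> alg_hom R B0 S"
proof -
  interpret B0: module R B0 by (rule calg_module[OF B0_calg])
  interpret B0: cring B0 by (rule calg_cring[OF B0_calg])
  have "(\<lambda>s. s) \<in> lin_hom R B0 S" using qD(2) by (intro lin_homI) auto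
  then show ?thesis unfolding incl_def by (rule restrict_alg_hom[OF _ calg_assoc_algebra[OF B0_calg]])
qed

lemma incl_apply: "s \<in> carrier B0 \<Longrightarrow> incl s = s"
  by (simp add: incl_def)

lemma q0: "i \<in> J \<Longrightarrow> q0 i \<in> carrier B0" "i \<in> J \<Longrightarrow> q0 i \<in> carrier S"
  using unit_closed[OF base_in] qD(2) by auto

lemma tsetup: "T \<in> calg R \<Longrightarrow> tensor_setup R B0 T" "T \<in> calg R \<Longrightarrow> tensor_setup R S T"
  by (simp_all add: tensor_setupI universe_infinite calg_assoc_algebra B0_calg S)

lemmas ext_pure = scalar_ext_pure[OF universe_infinite calg_assoc_algebra[OF B0_calg] calg_assoc_algebra[OF S] _ alg_homD(1)[OF incl]]
lemmas ext_hom = scalar_ext_alg_hom[OF universe_infinite calg_assoc_algebra[OF B0_calg] calg_assoc_algebra[OF S] _ alg_homD(1)[OF incl]]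
lemmas ext_base_inj = scalar_ext_base_inj[OF universe_infinite calg_assoc_algebra[OF B0_calg] calg_assoc_algebra[OF S] alg_homD(1)[OF incl]]

text \<open>\<open>finite_expansion\<close> yields some finite index set \<open>F\<close>; dropping
  zero terms leaves \<open>N T a\<close>, a set that no longer depends on a choice.\<close>

lemma point_expansion:
  assumes T: "T \<in> calg R" and a: "a \<in> carrier (Ob A T)"
  shows "finite (N T a)" "x T a = (\<Oplus>\<^bsub>tensor R S T\<^esub>i\<in>N T a. pure_tensor R S T (q0 i) (c T a i))"
proof -
  note SA = calg_assoc_algebra[OF S]
  interpret T: tensor_setup R S T using tsetup T by blast
  interpret T0: tensor_setup R S "base R" using tsetup base_in by blast
  note fam = alg_trans_lin_family[OF x base_in, unfolded lin_family_def, rule_format]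
  have \<beta>: "supp T a \<in> FS" by (rule supp_FS[OF T a])
  obtain F where F: "finite F" "F \<subseteq> supp T a"
    "\<And>i. i \<in> supp T a - F \<Longrightarrow> x (base R) (unit (base R) i) = \<zero>\<^bsub>T0.TP\<^esub>"
    and eq: "\<And>T' f a'. T' \<in> calg R \<Longrightarrow> f \<in> alg_hom R (base R) T' \<Longrightarrow> a' \<in> carrier (Ob A T') \<Longrightarrow> supp T' a' \<subseteq> supp T a \<Longrightarrow>
      x T' a' = (\<Oplus>\<^bsub>tensor R S T'\<^esub>i\<in>F. c T' a' i \<odot>\<^bsub>tensor R S T'\<^esub>
        base_change R S (base R) T' f (x (base R) (unit (base R) i)))"
  proof (rule finite_expansion[OF base_in SA _ _ _ \<beta>, of "\<lambda>T f. x T"])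
    fix T f a assume Tfx: "T \<in> calg R" "f \<in> alg_hom R (base R) T" "a \<in> carrier (Ob A T)"
    show "x T a \<in> carrier (tensor R S T)" using fam[OF Tfx] by blast
    show "x T (t \<odot>\<^bsub>Ob A T\<^esub> a) = t \<odot>\<^bsub>tensor R S T\<^esub> x T a" if "t \<in> carrier T" for t
      using fam[OF Tfx] that by blast
    show "x T' (Mor A T T' g a) = base_change R S T T' g (x T a)"
      if "T' \<in> calg R" "g \<in> alg_hom R T T'" for T' g
      using fam[OF Tfx] that by blast
  qed (rule that; assumption)
  have FJ: "i \<in> J" if "i \<in> F" for i using that F by auto
  have u: "unit_hom R T \<in> alg_hom R (base R) T" by (rule unit_hom_alg_hom[OF T])
  \<comment> \<open>An index of the support outside \<open>F\<close> has \<open>q0 i\<close>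
    \<otimes> 1 = 0 over R, hence \<open>q0 i\<close> is zero, since S \<rightarrow> S \<otimes> R
    is injective.\<close>
  have NF: "N T a \<subseteq> F"
  proof
    fix i assume i: "i \<in> N T a"
    show "i \<in> F"
    proof (rule ccontr)
      assume "i \<notin> F"
      then have "T0.pt (q0 i) \<one>\<^bsub>R\<^esub> = T0.pt \<zero>\<^bsub>S\<^esub> \<one>\<^bsub>R\<^esub>"
        using i F(3)[of i] xq[OF unit_closed[OF base_in, of i]] by (simp add: N_def T0.pt_zero_left)
      then have "q0 i = \<zero>\<^bsub>S\<^esub>"
        using base_pure_inj[OF universe_infinite SA] q0(2)[of i] i by (auto simp: N_def dest: inj_onD)
      then show False using i by (simp add: N_def)
    qed
  qed
  show fin: "finite (N T a)" using NF F(1) by (rule finite_subset)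
  have tm: "c T a i \<odot>\<^bsub>T.TP\<^esub> base_change R S (base R) T (unit_hom R T) (x (base R) (unit (base R) i)) = T.pt (q0 i) (c T a i)"
    if "i \<in> J" for i
  proof -
    have "base_change R S (base R) T (unit_hom R T) (x (base R) (unit (base R) i)) = T.pt (q0 i) \<one>\<^bsub>T\<^esub>"
      using tensor_map_pure[OF T0.tensor_setup_axioms T.tensor_setup_axioms lin_hom_id(1)[OF SA] alg_homD(1)[OF u] q0(2)[OF that], of "\<one>\<^bsub>R\<^esub>"]
        alg_homD(7)[OF u] xq[OF unit_closed[OF base_in that]] by simp
    then show ?thesis using q0(2)[OF that] coord_closed[OF T a that] by (simp add: T.smult_pt)
  qed
  have "x T a = (\<Oplus>\<^bsub>T.TP\<^esub>i\<in>F. c T a i \<odot>\<^bsub>T.TP\<^esub> base_change R S (base R) T (unit_hom R T) (x (base R) (unit (base R) i)))"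
    by (rule eq[OF T u a order_refl])
  also have "\<dots> = (\<Oplus>\<^bsub>T.TP\<^esub>i\<in>N T a. T.pt (q0 i) (c T a i))"
  proof (rule T.TP.add.finprod_mono_neutral_cong_right[OF F(1) NF])
    show "c T a i \<odot>\<^bsub>T.TP\<^esub> base_change R S (base R) T (unit_hom R T) (x (base R) (unit (base R) i)) = \<zero>\<^bsub>T.TP\<^esub>"
      if "i \<in> F - N T a" for i
    proof -
      have iJ: "i \<in> J" using that FJ by auto
      then have "c T a i = \<zero>\<^bsub>T\<^esub> \<or> q0 i = \<zero>\<^bsub>S\<^esub>" using that by (auto simp: N_def)
      then show ?thesis unfolding tm[OF iJ] using q0(2)[OF iJ] coord_closed[OF T a iJ]
        by (auto simp: T.pt_zero_left T.pt_zero_right)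
    qed
    show "(\<lambda>i. c T a i \<odot>\<^bsub>T.TP\<^esub> base_change R S (base R) T (unit_hom R T) (x (base R) (unit (base R) i))) \<in> F \<rightarrow> carrier T.TP"
      using tm FJ q0(2) coord_closed[OF T a] by auto
  qed (use tm FJ NF in auto)
  finally show "x T a = (\<Oplus>\<^bsub>T.TP\<^esub>i\<in>N T a. T.pt (q0 i) (c T a i))" .
qed

text \<open>Padding with zero terms lets sums with different index sets be compared over a common
  finite one.\<close>

lemma psi_eq:
  assumes T: "T \<in> calg R" and a: "a \<in> carrier (Ob A T)" and F: "finite F" "N T a \<subseteq> F" "F \<subseteq> J"
  shows "psi T a = (\<Oplus>\<^bsub>tensor R B0 T\<^esub>i\<in>F. pure_tensor R B0 T (q0 i) (c T a i))"
proof -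
  interpret T: tensor_setup R B0 T using tsetup T by blast
  show ?thesis unfolding psi_def
  proof (rule T.TP.add.finprod_mono_neutral_cong_left[OF F(1,2)])
    show "T.pt (q0 i) (c T a i) = \<zero>\<^bsub>T.TP\<^esub>" if "i \<in> F - N T a" for i
    proof -
      have iJ: "i \<in> J" using that F by auto
      then have "c T a i = \<zero>\<^bsub>T\<^esub> \<or> q0 i = \<zero>\<^bsub>B0\<^esub>" using that by (auto simp: N_def)
      then show ?thesis using q0(1)[OF iJ] coord_closed[OF T a iJ] T.pt_zero_left T.pt_zero_right by metis
    qed
    show "(\<lambda>i. T.pt (q0 i) (c T a i)) \<in> F \<rightarrow> carrier T.TP"
      using F(3) q0(1) coord_closed[OF T a] by (auto simp del: B0_simps(1) intro!: T.pt_closed)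
  qed simp
qed

lemma psi_terms_closed:
  "T \<in> calg R \<Longrightarrow> a \<in> carrier (Ob A T) \<Longrightarrow> F \<subseteq> J \<Longrightarrow> (\<lambda>i. pure_tensor R B0 T (q0 i) (c T a i)) \<in> F \<rightarrow> carrier (tensor R B0 T)"
  using q0(1) coord_closed[of T a] by (auto simp del: B0_simps(1) intro!: tensor_setup.pt_closed tsetup)

lemma N_J: "N T a \<subseteq> J" by (auto simp: N_def)

lemma psi_closed:
  assumes T: "T \<in> calg R" and a: "a \<in> carrier (Ob A T)" shows "psi T a \<in> carrier (tensor R B0 T)"
proof -
  interpret T: tensor_setup R B0 T using tsetup T by blast
  show ?thesis unfolding psi_def by (rule T.TP.finsum_closed[OF psi_terms_closed[OF T a N_J]])
qed

lemma incl_psi: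
  assumes T: "T \<in> calg R" and a: "a \<in> carrier (Ob A T)" shows "scalar_ext R B0 S T incl (psi T a) = x T a"
proof -
  interpret T: tensor_setup R B0 T using tsetup T by blast
  interpret TS: tensor_setup R S T using tsetup T by blast
  note h = alg_homD[OF ext_hom[OF T]]
  have "scalar_ext R B0 S T incl (psi T a) = (\<Oplus>\<^bsub>TS.TP\<^esub>i\<in>N T a. scalar_ext R B0 S T incl (T.pt (q0 i) (c T a i)))"
    unfolding psi_def
    by (rule additive_finsum[OF T.TP.abelian_group_axioms TS.TP.abelian_group_axioms h(4,5) point_expansion(1)[OF T a]])
      (use psi_terms_closed[OF T a N_J] in auto)
  also have "\<dots> = (\<Oplus>\<^bsub>TS.TP\<^esub>i\<in>N T a. TS.pt (q0 i) (c T a i))"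
  proof (rule TS.TP.finsum_cong'[OF refl])
    show "(\<lambda>i. TS.pt (q0 i) (c T a i)) \<in> N T a \<rightarrow> carrier TS.TP"
      using q0(2) coord_closed[OF T a] by (auto intro!: TS.pt_closed dest: subsetD[OF N_J])
    fix i assume "i \<in> N T a"
    then have i: "i \<in> J" using N_J by auto
    show "scalar_ext R B0 S T incl (T.pt (q0 i) (c T a i)) = TS.pt (q0 i) (c T a i)"
      unfolding ext_pure[OF T q0(1)[OF i] coord_closed[OF T a i]] incl_apply[OF q0(1)[OF i]] ..
  qed
  finally show ?thesis using point_expansion(2)[OF T a] by simp
qed

lemma psi_add:
  assumes T: "T \<in> calg R" and a: "a \<in> carrier (Ob A T)" and b: "b \<in> carrier (Ob A T)"
  shows "psi T (a \<oplus>\<^bsub>Ob A T\<^esub> b) = psi T a \<oplus>\<^bsub>tensor R B0 T\<^esub> psi T b"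
proof -
  interpret T: tensor_setup R B0 T using tsetup T by blast
  interpret AT: module T "Ob A T" by (rule Ob_module[OF T])
  have ab: "a \<oplus>\<^bsub>Ob A T\<^esub> b \<in> carrier (Ob A T)" using a b by simp
  let ?F = "N T a \<union> N T b \<union> N T (a \<oplus>\<^bsub>Ob A T\<^esub> b)"
  have F: "finite ?F" "?F \<subseteq> J" using point_expansion(1)[OF T] a b ab N_J by auto
  have "psi T (a \<oplus>\<^bsub>Ob A T\<^esub> b) = (\<Oplus>\<^bsub>T.TP\<^esub>i\<in>?F. T.pt (q0 i) (c T (a \<oplus>\<^bsub>Ob A T\<^esub> b) i))"
    by (rule psi_eq[OF T ab F(1) _ F(2)]) auto
  also have "\<dots> = (\<Oplus>\<^bsub>T.TP\<^esub>i\<in>?F. T.pt (q0 i) (c T a i) \<oplus>\<^bsub>T.TP\<^esub> T.pt (q0 i) (c T b i))"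
  proof (rule T.TP.finsum_cong'[OF refl])
    fix i assume "i \<in> ?F"
    then have i: "i \<in> J" using F by blast
    show "T.pt (q0 i) (c T (a \<oplus>\<^bsub>Ob A T\<^esub> b) i) = T.pt (q0 i) (c T a i) \<oplus>\<^bsub>T.TP\<^esub> T.pt (q0 i) (c T b i)"
      unfolding coord_add[OF T a b i] by (rule T.pt_add_right[OF q0(1)[OF i] coord_closed[OF T a i] coord_closed[OF T b i]])
  qed (use psi_terms_closed[OF T a F(2)] psi_terms_closed[OF T b F(2)] in blast)
  also have "\<dots> = (\<Oplus>\<^bsub>T.TP\<^esub>i\<in>?F. T.pt (q0 i) (c T a i)) \<oplus>\<^bsub>T.TP\<^esub> (\<Oplus>\<^bsub>T.TP\<^esub>i\<in>?F. T.pt (q0 i) (c T b i))"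
    by (rule T.TP.finsum_addf[OF psi_terms_closed[OF T a F(2)] psi_terms_closed[OF T b F(2)]])
  also have "\<dots> = psi T a \<oplus>\<^bsub>T.TP\<^esub> psi T b"
    by (subst (1 2) psi_eq[OF _ _ F(1) _ F(2)]) (use T a b in blast)+
  finally show ?thesis .
qed

lemma psi_smult:
  assumes T: "T \<in> calg R" and a: "a \<in> carrier (Ob A T)" and t: "t \<in> carrier T"
  shows "psi T (t \<odot>\<^bsub>Ob A T\<^esub> a) = t \<odot>\<^bsub>tensor R B0 T\<^esub> psi T a"
proof -
  interpret T: tensor_setup R B0 T using tsetup T by blast
  interpret AT: module T "Ob A T" by (rule Ob_module[OF T])
  interpret TM: module T T.TP by (rule assoc_algebra_module[OF T.tensor_assoc_algebra])
  have ta: "t \<odot>\<^bsub>Ob A T\<^esub> a \<in> carrier (Ob A T)" using a t by simp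
  have N: "N T (t \<odot>\<^bsub>Ob A T\<^esub> a) \<subseteq> N T a"
    using t by (auto simp: N_def coord_smult[OF T a t])
  have "psi T (t \<odot>\<^bsub>Ob A T\<^esub> a) = (\<Oplus>\<^bsub>T.TP\<^esub>i\<in>N T a. T.pt (q0 i) (c T (t \<odot>\<^bsub>Ob A T\<^esub> a) i))"
    by (rule psi_eq[OF T ta point_expansion(1)[OF T a] N N_J])
  also have "\<dots> = (\<Oplus>\<^bsub>T.TP\<^esub>i\<in>N T a. t \<odot>\<^bsub>T.TP\<^esub> T.pt (q0 i) (c T a i))"
  proof (rule T.TP.finsum_cong'[OF refl])
    fix i assume "i \<in> N T a"
    then have i: "i \<in> J" using N_J by blast
    show "T.pt (q0 i) (c T (t \<odot>\<^bsub>Ob A T\<^esub> a) i) = t \<odot>\<^bsub>T.TP\<^esub> T.pt (q0 i) (c T a i)"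
      unfolding coord_smult[OF T a t i] by (rule T.smult_pt[OF q0(1)[OF i] coord_closed[OF T a i] t, symmetric])
  qed (use psi_terms_closed[OF T a N_J] t in blast)
  also have "\<dots> = t \<odot>\<^bsub>T.TP\<^esub> psi T a" unfolding psi_def
    by (rule additive_finsum[OF T.TP.abelian_group_axioms T.TP.abelian_group_axioms _ _ point_expansion(1)[OF T a], symmetric])
      (use psi_terms_closed[OF T a N_J] t in \<open>auto simp: TM.smult_r_distr\<close>)
  finally show ?thesis .
qed

lemma psi_nat:
  assumes T: "T \<in> calg R" and T': "T' \<in> calg R" and g: "g \<in> alg_hom R T T'" and a: "a \<in> carrier (Ob A T)"
  shows "psi T' (Mor A T T' g a) = base_change R B0 T T' g (psi T a)"
proof -
  interpret T: tensor_setup R B0 T using tsetup T by blast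
  interpret T': tensor_setup R B0 T' using tsetup T' by blast
  note a' = Mor_carrier[OF T T' g a]
  have g0: "g \<zero>\<^bsub>T\<^esub> = \<zero>\<^bsub>T'\<^esub>" by (rule alg_hom_zero[OF g]) unfold_locales
  note tm = tensor_map_properties[OF T.tensor_setup_axioms T'.tensor_setup_axioms lin_hom_id(1)[OF T.B_algebra] alg_homD(1)[OF g]]
  have N: "N T' (Mor A T T' g a) \<subseteq> N T a"
    using g0 by (auto simp: N_def coord_nat[OF T T' g a])
  have "psi T' (Mor A T T' g a) = (\<Oplus>\<^bsub>T'.TP\<^esub>i\<in>N T a. T'.pt (q0 i) (c T' (Mor A T T' g a) i))"
    by (rule psi_eq[OF T' a' point_expansion(1)[OF T a] N N_J])
  also have "\<dots> = (\<Oplus>\<^bsub>T'.TP\<^esub>i\<in>N T a. base_change R B0 T T' g (T.pt (q0 i) (c T a i)))"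
  proof (rule T'.TP.finsum_cong'[OF refl])
    fix i assume "i \<in> N T a"
    then have i: "i \<in> J" using N_J by blast
    show "T'.pt (q0 i) (c T' (Mor A T T' g a) i) = base_change R B0 T T' g (T.pt (q0 i) (c T a i))"
      unfolding coord_nat[OF T T' g a i] tm(3)[OF q0(1)[OF i] coord_closed[OF T a i]] ..
  qed (use psi_terms_closed[OF T a N_J] tm(1) in blast)
  also have "\<dots> = base_change R B0 T T' g (psi T a)" unfolding psi_def
    by (rule additive_finsum[OF T.TP.abelian_group_axioms T'.TP.abelian_group_axioms tm(1,2) point_expansion(1)[OF T a], symmetric])
      (use psi_terms_closed[OF T a N_J] in auto)
  finally show ?thesis .
qed

lemma incl_base_inj:
  assumes "y \<in> carrier (tensor R B0 (base R))" "z \<in> carrier (tensor R B0 (base R))"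
    "scalar_ext R B0 S (base R) incl y = scalar_ext R B0 S (base R) incl z"
  shows "y = z"
  by (rule inj_onD[OF ext_base_inj assms(3,1,2)]) (auto simp: inj_on_def incl_apply simp del: B0_simps(1))

text \<open>Over R, multiplicativity is pulled back from \<open>x\<close> along the injection B0
  \<otimes> R \<rightarrow> S \<otimes> R; \<open>multiplicative_from_base\<close> carries it to all
  algebras.\<close>

lemma psi_mult:
  assumes T: "T \<in> calg R" and a: "a \<in> carrier (Ob A T)" and b: "b \<in> carrier (Ob A T)"
  shows "psi T (a \<otimes>\<^bsub>Ob A T\<^esub> b) = psi T a \<otimes>\<^bsub>tensor R B0 T\<^esub> psi T b"
proof (rule multiplicative_from_base[OF calg_assoc_algebra[OF B0_calg] calg_cring[OF B0_calg] _ _ T a b])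
  show "lin_family R A (base R) B0 (\<lambda>T f. psi T)"
    unfolding lin_family_def using psi_closed psi_smult psi_nat by blast
  interpret T0: tensor_setup R B0 "base R" using tsetup base_in by blast
  interpret A0: ring "Ob A (base R)" by (rule cring.axioms(1)[OF CA.Ob_comm[OF base_in]])
  fix a b assume a: "a \<in> carrier (Ob A (base R))" and b: "b \<in> carrier (Ob A (base R))"
  show "psi (base R) (a \<otimes>\<^bsub>Ob A (base R)\<^esub> b) = psi (base R) a \<otimes>\<^bsub>T0.TP\<^esub> psi (base R) b"
  proof (rule incl_base_inj)
    show "scalar_ext R B0 S (base R) incl (psi (base R) (a \<otimes>\<^bsub>Ob A (base R)\<^esub> b)) =
      scalar_ext R B0 S (base R) incl (psi (base R) a \<otimes>\<^bsub>T0.TP\<^esub> psi (base R) b)"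
      using a b alg_homD(6)[OF ext_hom[OF base_in]] alg_homD(6)[OF alg_transD(1)[OF x base_in]]
      by (simp add: incl_psi[OF base_in] psi_closed[OF base_in])
  qed (use a b psi_closed[OF base_in] in auto)
qed

text \<open>Over R by injectivity into S \<otimes> R, elsewhere by naturality along the structure
  map.\<close>

lemma psi_one:
  assumes T: "T \<in> calg R" shows "psi T \<one>\<^bsub>Ob A T\<^esub> = \<one>\<^bsub>tensor R B0 T\<^esub>"
proof -
  interpret T0: tensor_setup R B0 "base R" using tsetup base_in by blast
  interpret T: tensor_setup R B0 T using tsetup T by blast
  interpret A0: ring "Ob A (base R)" by (rule cring.axioms(1)[OF CA.Ob_comm[OF base_in]])
  have u: "unit_hom R T \<in> alg_hom R (base R) T" by (rule unit_hom_alg_hom[OF T])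
  have "psi (base R) \<one>\<^bsub>Ob A (base R)\<^esub> = \<one>\<^bsub>T0.TP\<^esub>"
    by (rule incl_base_inj)
      (use alg_homD(7)[OF ext_hom[OF base_in]] alg_homD(7)[OF alg_transD(1)[OF x base_in]] in
        \<open>auto simp: incl_psi[OF base_in] psi_closed[OF base_in]\<close>)
  then have "psi T (Mor A (base R) T (unit_hom R T) \<one>\<^bsub>Ob A (base R)\<^esub>) = \<one>\<^bsub>T.TP\<^esub>"
    using psi_nat[OF base_in T u A0.one_closed]
      ring_hom_one[OF tensor_map_ring_hom[OF T0.tensor_setup_axioms T.tensor_setup_axioms lin_hom_id(1)[OF T.B_algebra] alg_homD(1)[OF u]]]
    by simp
  then show ?thesis by (simp add: Mor_one[OF base_in T u])
qed

text \<open>If b = q(a), then b \<otimes> t is the value at t times the image of \<open>a\<close>.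
  This is where it matters that \<open>B0\<close> is exactly the image of A(R).\<close>

lemma psi_surj:
  assumes T: "T \<in> calg R" and z: "z \<in> carrier (tensor R B0 T)"
  shows "\<exists>a\<in>carrier (Ob A T). z = psi T a"
proof -
  interpret T0: tensor_setup R B0 "base R" using tsetup base_in by blast
  interpret T0S: tensor_setup R S "base R" using tsetup base_in by blast
  interpret T: tensor_setup R B0 T using tsetup T by blast
  interpret AT: module T "Ob A T" by (rule Ob_module[OF T])
  have u: "unit_hom R T \<in> alg_hom R (base R) T" by (rule unit_hom_alg_hom[OF T])
  show ?thesis using z
  proof (induction z rule: T.tensor_induct)
    case (pure b t)
    then obtain a where a: "a \<in> carrier (Ob A (base R))" and b: "b = q a" by auto
    have "psi (base R) a = T0.pt b \<one>\<^bsub>R\<^esub>"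
      by (rule incl_base_inj)
        (use a psi_closed[OF base_in a] pure(1) T0.pt_closed[OF pure(1), of "\<one>\<^bsub>R\<^esub>"] ext_pure[OF base_in pure(1), of "\<one>\<^bsub>R\<^esub>"] incl_apply[OF pure(1)]
          in \<open>simp_all add: incl_psi[OF base_in] xq b\<close>)
    then have "psi T (Mor A (base R) T (unit_hom R T) a) = T.pt b \<one>\<^bsub>T\<^esub>"
      using psi_nat[OF base_in T u a] alg_homD(7)[OF u]
        tensor_map_pure[OF T0.tensor_setup_axioms T.tensor_setup_axioms lin_hom_id(1)[OF T.B_algebra] alg_homD(1)[OF u] pure(1), of "\<one>\<^bsub>R\<^esub>"]
      by simp
    then have "psi T (t \<odot>\<^bsub>Ob A T\<^esub> Mor A (base R) T (unit_hom R T) a) = T.pt b t"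
      using psi_smult[OF T Mor_carrier[OF base_in T u a] pure(2)] T.smult_pt[OF pure(1) T.T.one_closed pure(2)] pure(2) by simp
    then show ?case using Mor_carrier[OF base_in T u a] pure(2) by (metis AT.smult_closed)
  next
    case (add y z)
    then show ?case using psi_add[OF T] by (metis AT.a_closed)
  qed
qed

definition "psi_trans = (\<lambda>T\<in>calg R. \<lambda>a\<in>carrier (Ob A T). psi T a)"

lemma psi_trans_apply: "T \<in> calg R \<Longrightarrow> a \<in> carrier (Ob A T) \<Longrightarrow> psi_trans T a = psi T a"
  by (simp add: psi_trans_def)

lemma psi_trans: "psi_trans \<in> alg_trans R A (qcoh R B0)"
proof (rule alg_transI)
  show "psi_trans \<in> extensional (calg R)" by (simp add: psi_trans_def)
  fix T assume T: "T \<in> calg R"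
  interpret AT: module T "Ob A T" by (rule Ob_module[OF T])
  interpret AT: cring "Ob A T" by (rule CA.Ob_comm[OF T])
  have "psi T \<in> lin_hom T (Ob A T) (tensor R B0 T)"
    by (rule lin_homI) (simp_all add: psi_closed psi_add psi_mult psi_one psi_smult T)
  then show "psi_trans T \<in> alg_hom T (Ob A T) (Ob (qcoh R B0) T)"
    using restrict_alg_hom[OF _ CA.Ob_algebra[OF T], of "psi T"] T by (simp add: psi_trans_def)
next
  fix T T' f a assume "T \<in> calg R" "T' \<in> calg R" "f \<in> alg_hom R T T'" "a \<in> carrier (Ob A T)"
  then show "psi_trans T' (Mor A T T' f a) = Mor (qcoh R B0) T T' f (psi_trans T a)"
    by (simp add: psi_trans_apply Mor_carrier psi_nat)
qed

lemma psi_quotient: "(B0, psi_trans) \<in> quotients R A"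
  unfolding quotients_def
  using psi_trans psi_surj psi_closed calg_assoc_algebra[OF B0_calg] by (auto simp: psi_trans_apply image_iff)

text \<open>Surjectivity of \<pi> over R writes b \<otimes> 1 as \<pi>(a), so f(b) = q(a) lies in
  \<open>B0\<close>, and the factor is \<open>f\<close> with a smaller target. That it carries \<pi>
  to \<open>psi_trans\<close> is checked over R inside S \<otimes> R and extended by
  \<open>alg_trans_unique\<close>.\<close>

lemma factor_through_image:
  assumes Q: "(B, \<pi>) \<in> quotients R A" and f: "f \<in> alg_hom R B S"
    and eq: "\<And>T a. T \<in> calg R \<Longrightarrow> a \<in> carrier (Ob A T) \<Longrightarrow> scalar_ext R B S T f (\<pi> T a) = x T a"
  obtains g where "g \<in> alg_hom R B B0" "\<And>b. b \<in> carrier B \<Longrightarrow> incl (g b) = f b"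
    "\<And>T a. T \<in> calg R \<Longrightarrow> a \<in> carrier (Ob A T) \<Longrightarrow> scalar_ext R B B0 T g (\<pi> T a) = psi_trans T a"
proof -
  note inf = universe_infinite and SA = calg_assoc_algebra[OF S] and B0A = calg_assoc_algebra[OF B0_calg]
  note B = quotientsD(1)[OF Q] and \<pi> = quotientsD(2)[OF Q]
  interpret Bm: module R B by (rule assoc_algebra_module[OF B])
  interpret Br: ring B by (rule assoc_algebra_ring[OF B])
  interpret TB: tensor_setup R B "base R" by (intro tensor_setupI inf B base_in)
  note fD = alg_homD[OF f]
  have fB0: "f b \<in> carrier B0" if b: "b \<in> carrier B" for b
  proof -
    have "TB.pt b \<one>\<^bsub>R\<^esub> \<in> \<pi> (base R) ` carrier (Ob A (base R))"
      unfolding quotientsD(3)[OF Q base_in] using b by simp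
    then obtain a where a: "a \<in> carrier (Ob A (base R))" "TB.pt b \<one>\<^bsub>R\<^esub> = \<pi> (base R) a" by auto
    have "pure_tensor R S (base R) (f b) \<one>\<^bsub>R\<^esub> = pure_tensor R S (base R) (q a) \<one>\<^bsub>R\<^esub>"
      using eq[OF base_in a(1)] xq[OF a(1)] scalar_ext_pure[OF inf B SA base_in fD(1) b, of "\<one>\<^bsub>R\<^esub>"] by (simp flip: a(2))
    then have "f b = q a" using base_pure_inj[OF inf SA] fD(4)[OF b] qD(2)[OF a(1)] by (auto dest: inj_onD)
    then show ?thesis using a by simp
  qed
  have f0: "f \<in> lin_hom R B B0"
    using fB0 fD by (intro lin_homI) (auto simp del: B0_simps(1))
  then have g: "f \<in> alg_hom R B B0" using fD(2) by (simp add: alg_hom_iff)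
  define \<eta> where "\<eta> = tcomp R (uset A) (scalar_ext_trans R B B0 f) \<pi>"
  have \<eta>: "\<eta> \<in> alg_trans R A (qcoh R B0)"
    unfolding \<eta>_def
    by (rule tcomp_alg_trans[OF CA.Ob_algebra Mor_carrier \<pi> scalar_ext_trans_in[OF inf B B0A f0]])
  have \<eta>_apply: "\<eta> T a = scalar_ext R B B0 T f (\<pi> T a)" if "T \<in> calg R" "a \<in> carrier (Ob A T)" for T a
    using that by (simp add: \<eta>_def tcomp_apply scalar_ext_trans_def)
  have "\<eta> = psi_trans"
  proof (rule alg_trans_unique[OF B0A \<eta> psi_trans])
    fix a assume a: "a \<in> carrier (Ob A (base R))"
    have \<pi>a: "\<pi> (base R) a \<in> carrier TB.TP" using alg_homD(4)[OF alg_transD(1)[OF \<pi> base_in] a] by simp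
    show "\<eta> (base R) a = psi_trans (base R) a"
    proof (rule incl_base_inj)
      show "\<eta> (base R) a \<in> carrier (tensor R B0 (base R))" "psi_trans (base R) a \<in> carrier (tensor R B0 (base R))"
        using alg_homD(4)[OF alg_transD(1)[OF \<eta> base_in] a] alg_homD(4)[OF alg_transD(1)[OF psi_trans base_in] a] by simp_all
      have "scalar_ext R B0 S (base R) incl (\<eta> (base R) a) = scalar_ext R B S (base R) f (\<pi> (base R) a)"
        unfolding \<eta>_apply[OF base_in a]
        by (simp add: scalar_ext_comp[OF inf B B0A SA base_in f0 alg_homD(1)[OF incl] fD(1) _ \<pi>a] incl_apply[OF fB0])
      then show "scalar_ext R B0 S (base R) incl (\<eta> (base R) a) = scalar_ext R B0 S (base R) incl (psi_trans (base R) a)"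
        using a by (simp add: eq base_in psi_trans_apply incl_psi)
    qed
  qed
  have "scalar_ext R B B0 T f (\<pi> T a) = psi_trans T a" if "T \<in> calg R" "a \<in> carrier (Ob A T)" for T a
    using that by (simp add: \<eta>_apply flip: \<open>\<eta> = psi_trans\<close>)
  then show ?thesis using that[OF g] incl_apply[OF fB0] by blast
qed

end

context comm_coordinates
begin

text \<open>By definition a quotient is only an associative algebra. Over R, \<pi> is onto from a
  commutative ring and B \<rightarrow> B \<otimes> R is injective, so products in \<open>B\<close>
  commute.\<close>

lemma quotient_calg:
  assumes Q: "(B, \<pi>) \<in> quotients R A" shows "B \<in> calg R"
proof -
  note B = quotientsD(1)[OF Q] and \<pi> = quotientsD(2)[OF Q]
  interpret Br: ring B by (rule assoc_algebra_ring[OF B])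
  interpret TB: tensor_setup R B "base R" by (intro tensor_setupI universe_infinite B base_in)
  interpret A0: cring "Ob A (base R)" by (rule CA.Ob_comm[OF base_in])
  note pD = alg_homD[OF alg_transD(1)[OF \<pi> base_in], simplified]
  have "b \<otimes>\<^bsub>B\<^esub> b' = b' \<otimes>\<^bsub>B\<^esub> b" if b: "b \<in> carrier B" "b' \<in> carrier B" for b b'
  proof -
    have "TB.pt b \<one>\<^bsub>R\<^esub> \<in> \<pi> (base R) ` carrier (Ob A (base R))" "TB.pt b' \<one>\<^bsub>R\<^esub> \<in> \<pi> (base R) ` carrier (Ob A (base R))"
      unfolding quotientsD(3)[OF Q base_in] using b by simp_all
    then obtain a a' where a: "a \<in> carrier (Ob A (base R))" "TB.pt b \<one>\<^bsub>R\<^esub> = \<pi> (base R) a"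
      "a' \<in> carrier (Ob A (base R))" "TB.pt b' \<one>\<^bsub>R\<^esub> = \<pi> (base R) a'" by auto
    have "TB.pt b \<one>\<^bsub>R\<^esub> \<otimes>\<^bsub>TB.TP\<^esub> TB.pt b' \<one>\<^bsub>R\<^esub> = TB.pt b' \<one>\<^bsub>R\<^esub> \<otimes>\<^bsub>TB.TP\<^esub> TB.pt b \<one>\<^bsub>R\<^esub>"
      unfolding a(2,4) using pD(6)[OF a(1,3)] pD(6)[OF a(3,1)] A0.m_comm[OF a(1,3)] by simp
    then have "TB.pt (b \<otimes>\<^bsub>B\<^esub> b') \<one>\<^bsub>R\<^esub> = TB.pt (b' \<otimes>\<^bsub>B\<^esub> b) \<one>\<^bsub>R\<^esub>"
      using b by (simp add: TB.pt_mult)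
    then show ?thesis using base_pure_inj[OF universe_infinite B] b by (auto dest: inj_onD)
  qed
  then have "cring B"
    by (intro cring.intro comm_monoid.intro comm_monoid_axioms.intro Br.ring_axioms Br.monoid_axioms)
  then show ?thesis using assoc_algebra_imp_algebra[OF B] by (simp add: calg_def)
qed

text \<open>Among the quotients through which \<open>x\<close> factors, the image is terminal: each
  of them maps to it compatibly.\<close>

lemma factorization:
  assumes S: "S \<in> calg R" and x: "x \<in> alg_trans R A (qcoh R S)"
  obtains B0 \<psi> \<iota> where "(B0, \<psi>) \<in> quotients R A" "\<iota> \<in> alg_hom R B0 S"
    "\<And>T a. T \<in> calg R \<Longrightarrow> a \<in> carrier (Ob A T) \<Longrightarrow> scalar_ext R B0 S T \<iota> (\<psi> T a) = x T a"
    "\<And>B \<pi> f. (B, \<pi>) \<in> quotients R A \<Longrightarrow> f \<in> alg_hom R B S \<Longrightarrow>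
      (\<And>T a. T \<in> calg R \<Longrightarrow> a \<in> carrier (Ob A T) \<Longrightarrow> scalar_ext R B S T f (\<pi> T a) = x T a) \<Longrightarrow>
      \<exists>g\<in>alg_hom R B B0. (\<forall>b\<in>carrier B. \<iota> (g b) = f b) \<and>
        (\<forall>T\<in>calg R. \<forall>a\<in>carrier (Ob A T). scalar_ext R B B0 T g (\<pi> T a) = \<psi> T a)"
proof -
  obtain q where q: "q \<in> lin_hom R (Ob A (base R)) S"
    "\<And>a. a \<in> carrier (Ob A (base R)) \<Longrightarrow> x (base R) a = pure_tensor R S (base R) (q a) \<one>\<^bsub>R\<^esub>"
    by (rule base_lift[OF universe_infinite calg_assoc_algebra[OF S] CA.Ob_algebra[OF base_in]])
      (use alg_transD(1)[OF x base_in] in auto)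
  interpret P: point_image R A J FS c S x q
    by unfold_locales (use S x q in auto)
  show ?thesis
  proof (rule that[OF P.psi_quotient P.incl])
    show "scalar_ext R P.B0 S T P.incl (P.psi_trans T a) = x T a" if "T \<in> calg R" "a \<in> carrier (Ob A T)" for T a
      using that by (simp add: P.psi_trans_apply P.incl_psi)
    show "\<exists>g\<in>alg_hom R B P.B0. (\<forall>b\<in>carrier B. P.incl (g b) = f b) \<and>
        (\<forall>T\<in>calg R. \<forall>a\<in>carrier (Ob A T). scalar_ext R B P.B0 T g (\<pi> T a) = P.psi_trans T a)"
      if "(B, \<pi>) \<in> quotients R A" "f \<in> alg_hom R B S"
        "\<And>T a. T \<in> calg R \<Longrightarrow> a \<in> carrier (Ob A T) \<Longrightarrow> scalar_ext R B S T f (\<pi> T a) = x T a" for B \<pi> f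
      by (rule P.factor_through_image[OF that]) blast+
  qed
qed

end


section \<open>The spectrum as a colimit\<close>

lemma spec_simps [simp]: "Ob (spec R B) S = alg_trans R B (qcoh R S)"
  by (simp add: spec_def)

lemma qcoh_algebra:
  "infinite (UNIV :: 'u set) \<Longrightarrow> assoc_algebra R (B :: 'u alg) \<Longrightarrow> T \<in> calg R \<Longrightarrow> assoc_algebra T (Ob (qcoh R B) T)"
  by (simp add: tensor_setup.tensor_assoc_algebra[OF tensor_setupI])

lemma qcoh_Mor_carrier:
  assumes "infinite (UNIV :: 'u set)" "assoc_algebra R (B :: 'u alg)" "T \<in> calg R" "T' \<in> calg R" "f \<in> alg_hom R T T'"
    "x \<in> carrier (Ob (qcoh R B) T)"
  shows "Mor (qcoh R B) T T' f x \<in> carrier (Ob (qcoh R B) T')"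
  using assms tensor_map_closed[OF tensor_setupI tensor_setupI lin_hom_id(1) alg_homD(1)] by (metis qcoh_simps)

lemma spec_Mor_tcomp:
  assumes "x \<in> alg_trans R M (qcoh R S)"
  shows "Mor (spec R M) S S' f x = tcomp R (uset M) (scalar_ext_trans R S S' f) x"
  using assms by (simp add: spec_def tcomp_def scalar_ext_trans_def cong: restrict_cong)

lemma spec_map_tcomp:
  "S \<in> calg R \<Longrightarrow> y \<in> alg_trans R N (qcoh R S) \<Longrightarrow> spec_map R M N \<eta> S y = tcomp R (uset M) y \<eta>"
  by (simp add: spec_map_def)

lemma tcomp_assoc:
  assumes "\<eta> \<in> alg_trans R M N"
  shows "tcomp R (uset M) (tcomp R (uset N) \<xi> \<zeta>) \<eta> = tcomp R (uset M) \<xi> (tcomp R (uset M) \<zeta> \<eta>)"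
  unfolding tcomp_def uset_def using alg_homD(4)[OF alg_transD(1)[OF assms]]
  by (intro ext) (auto simp: compose_def restrict_def)

context comm_coordinates
begin

lemma tcomp_spec:
  assumes "\<pi> \<in> alg_trans R A (qcoh R B)" "y \<in> alg_trans R (qcoh R B) (qcoh R S)"
  shows "tcomp R (uset A) y \<pi> \<in> alg_trans R A (qcoh R S)"
  by (rule tcomp_alg_trans[OF CA.Ob_algebra Mor_carrier assms])

lemma spec_Mor_in:
  assumes "assoc_algebra R B" "assoc_algebra R B'" "f \<in> alg_hom R B B'" "\<pi> \<in> alg_trans R A (qcoh R B)"
  shows "Mor (spec R A) B B' f \<pi> \<in> alg_trans R A (qcoh R B')"
  unfolding spec_Mor_tcomp[OF assms(4)]
  by (rule tcomp_spec[OF assms(4) scalar_ext_trans_in[OF universe_infinite assms(1,2) alg_homD(1)[OF assms(3)]]])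

lemma spec_Mor_apply:
  assumes "\<pi> \<in> alg_trans R A (qcoh R B)" "T \<in> calg R" "a \<in> carrier (Ob A T)"
  shows "Mor (spec R A) B B' f \<pi> T a = scalar_ext R B B' T f (\<pi> T a)"
  unfolding spec_Mor_tcomp[OF assms(1)] using assms(2,3) by (simp add: tcomp_apply scalar_ext_trans_def)

lemma trans_closed:
  "\<pi> \<in> alg_trans R A (qcoh R B) \<Longrightarrow> T \<in> calg R \<Longrightarrow> a \<in> carrier (Ob A T) \<Longrightarrow> \<pi> T a \<in> carrier (tensor R B T)"
  using alg_homD(4)[OF alg_transD(1)] by fastforce

lemma spec_Mor_comp:
  assumes "assoc_algebra R B" "assoc_algebra R B'" "assoc_algebra R B''" "f \<in> alg_hom R B B'" "g \<in> alg_hom R B' B''"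
    "h \<in> alg_hom R B B''" "\<And>b. b \<in> carrier B \<Longrightarrow> h b = g (f b)" "\<pi> \<in> alg_trans R A (qcoh R B)"
  shows "Mor (spec R A) B' B'' g (Mor (spec R A) B B' f \<pi>) = Mor (spec R A) B B'' h \<pi>"
proof (rule alg_trans_eqI)
  show "Mor (spec R A) B' B'' g (Mor (spec R A) B B' f \<pi>) \<in> alg_trans R A (qcoh R B'')"
    by (intro spec_Mor_in assms)
  show "Mor (spec R A) B B'' h \<pi> \<in> alg_trans R A (qcoh R B'')" by (intro spec_Mor_in assms)
  fix T a assume T: "T \<in> calg R" and a: "a \<in> carrier (Ob A T)"
  show "Mor (spec R A) B' B'' g (Mor (spec R A) B B' f \<pi>) T a = Mor (spec R A) B B'' h \<pi> T a"
    unfolding spec_Mor_apply[OF spec_Mor_in[OF assms(1,2,4,8)] T a] spec_Mor_apply[OF assms(8) T a]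
    by (rule scalar_ext_comp[OF universe_infinite assms(1,2,3) T alg_homD(1)[OF assms(4)] alg_homD(1)[OF assms(5)]
      alg_homD(1)[OF assms(6)] assms(7) trans_closed[OF assms(8) T a]])
qed

text \<open>A quotient map A \<rightarrow> B is itself a B-point of the spectrum, and factoring
  \<open>x\<close> through it means pushing that point forward along B \<rightarrow> S.\<close>

lemma spec_factorization:
  assumes S: "S \<in> calg R" and x: "x \<in> alg_trans R A (qcoh R S)"
  obtains B0 \<psi> \<iota> where "(B0, \<psi>) \<in> quotients R A" "\<iota> \<in> alg_hom R B0 S" "Mor (spec R A) B0 S \<iota> \<psi> = x"
    "\<And>B \<pi> f. (B, \<pi>) \<in> quotients R A \<Longrightarrow> f \<in> alg_hom R B S \<Longrightarrow> Mor (spec R A) B S f \<pi> = x \<Longrightarrow>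
      \<exists>g\<in>alg_hom R B B0. (\<forall>b\<in>carrier B. \<iota> (g b) = f b) \<and> Mor (spec R A) B B0 g \<pi> = \<psi>"
proof -
  obtain B0 \<psi> \<iota> where f: "(B0, \<psi>) \<in> quotients R A" "\<iota> \<in> alg_hom R B0 S"
    "\<And>T a. T \<in> calg R \<Longrightarrow> a \<in> carrier (Ob A T) \<Longrightarrow> scalar_ext R B0 S T \<iota> (\<psi> T a) = x T a"
    and u: "\<And>B \<pi> f. (B, \<pi>) \<in> quotients R A \<Longrightarrow> f \<in> alg_hom R B S \<Longrightarrow>
      (\<And>T a. T \<in> calg R \<Longrightarrow> a \<in> carrier (Ob A T) \<Longrightarrow> scalar_ext R B S T f (\<pi> T a) = x T a) \<Longrightarrow>
      \<exists>g\<in>alg_hom R B B0. (\<forall>b\<in>carrier B. \<iota> (g b) = f b) \<and>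
        (\<forall>T\<in>calg R. \<forall>a\<in>carrier (Ob A T). scalar_ext R B B0 T g (\<pi> T a) = \<psi> T a)"
    by (rule factorization[OF S x]) blast
  note Q = quotientsD[OF f(1)] and SA = calg_assoc_algebra[OF S]
  show ?thesis
  proof (rule that[OF f(1,2)])
    show "Mor (spec R A) B0 S \<iota> \<psi> = x"
      by (rule alg_trans_eqI[OF spec_Mor_in[OF Q(1) SA f(2) Q(2)] x]) (simp add: spec_Mor_apply[OF Q(2)] f(3))
    fix B \<pi> f' assume B: "(B, \<pi>) \<in> quotients R A" and f': "f' \<in> alg_hom R B S" and eq: "Mor (spec R A) B S f' \<pi> = x"
    note Q' = quotientsD[OF B]
    have "scalar_ext R B S T f' (\<pi> T a) = x T a" if "T \<in> calg R" "a \<in> carrier (Ob A T)" for T a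
      using spec_Mor_apply[OF Q'(2) that, of S f'] eq by simp
    from u[OF B f' this] obtain g where g: "g \<in> alg_hom R B B0" "\<forall>b\<in>carrier B. \<iota> (g b) = f' b"
      "\<And>T a. T \<in> calg R \<Longrightarrow> a \<in> carrier (Ob A T) \<Longrightarrow> scalar_ext R B B0 T g (\<pi> T a) = \<psi> T a" by auto
    have "Mor (spec R A) B B0 g \<pi> = \<psi>"
      by (rule alg_trans_eqI[OF spec_Mor_in[OF Q'(1) Q(1) g(1) Q'(2)] Q(2)]) (simp add: spec_Mor_apply[OF Q'(2)] g(3))
    then show "\<exists>g\<in>alg_hom R B B0. (\<forall>b\<in>carrier B. \<iota> (g b) = f' b) \<and> Mor (spec R A) B B0 g \<pi> = \<psi>"
      using g(1,2) by blast
  qed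
qed

lemma quot_mor_scalar_ext:
  assumes "(B, \<pi>) \<in> quotients R A" "(B', \<pi>') \<in> quotients R A" "g \<in> alg_hom R B B'" "Mor (spec R A) B B' g \<pi> = \<pi>'"
  shows "scalar_ext_trans R B B' g \<in> quot_mor R A (B, \<pi>) (B', \<pi>')"
  using assms scalar_ext_trans_in[OF universe_infinite quotientsD(1)[OF assms(1)] quotientsD(1)[OF assms(2)] alg_homD(1)[OF assms(3)]]
  by (simp add: quot_mor_def quot_fun_def spec_Mor_tcomp[OF quotientsD(2)[OF assms(1)]])

text \<open>By \<open>qcoh_yoneda\<close> a transition morphism is induced by an algebra
  homomorphism, and compatibility with the quotient maps says that this homomorphism moves the point
  \<pi> to the point \<pi>'.\<close>

lemma quot_mor_elim:
  assumes "(B, \<pi>) \<in> quotients R A" "(B', \<pi>') \<in> quotients R A" "h \<in> quot_mor R A (B, \<pi>) (B', \<pi>')"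
  obtains g where "g \<in> alg_hom R B B'" "h = scalar_ext_trans R B B' g" "Mor (spec R A) B B' g \<pi> = \<pi>'"
proof -
  have h: "h \<in> alg_trans R (qcoh R B) (qcoh R B')" "tcomp R (uset A) h \<pi> = \<pi>'"
    using assms(3) by (auto simp: quot_mor_def quot_fun_def)
  obtain g where g: "g \<in> alg_hom R B B'" "h = scalar_ext_trans R B B' g"
    by (rule qcoh_yoneda[OF universe_infinite quotientsD(1)[OF assms(1)] quotientsD(1)[OF assms(2)] h(1)])
  show ?thesis by (rule that[OF g]) (use h(2) g(2) in \<open>simp add: spec_Mor_tcomp[OF quotientsD(2)[OF assms(1)]]\<close>)
qed

section \<open>Representatives in the colimit and the points they define\<close>

abbreviation "Q \<equiv> quotients R A"
abbreviation "cpts S \<equiv> (SIGMA i:Q. Ob (spec R (quot_fun R i)) S)"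
abbreviation "crel \<equiv> colim_rel Q (\<lambda>i. spec R (quot_fun R i))
     (\<lambda>i j. spec_map R (quot_fun R j) (quot_fun R i) ` quot_mor R A j i)"
text \<open>The point of Spec A represented by a quotient together with a point of its spectrum. By
  \<open>crel_cval\<close> and \<open>cval_inj\<close> it is a complete invariant of the
  class.\<close>

definition "cval p = tcomp R (uset A) (snd p) (snd (fst p))"

lemma cpts_D:
  assumes "p \<in> cpts S"
  shows "fst p \<in> Q" "assoc_algebra R (fst (fst p))" "snd (fst p) \<in> alg_trans R A (qcoh R (fst (fst p)))"
    "snd p \<in> alg_trans R (qcoh R (fst (fst p))) (qcoh R S)"
proof -
  obtain B \<pi> y where p: "p = ((B, \<pi>), y)" by (metis prod.collapse)
  show "fst p \<in> Q" "assoc_algebra R (fst (fst p))" "snd (fst p) \<in> alg_trans R A (qcoh R (fst (fst p)))"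
    "snd p \<in> alg_trans R (qcoh R (fst (fst p))) (qcoh R S)"
    using assms quotientsD[of B \<pi> R A] by (auto simp: p quot_fun_def)
qed

lemma cval_in: "p \<in> cpts S \<Longrightarrow> cval p \<in> alg_trans R A (qcoh R S)"
  unfolding cval_def by (rule tcomp_spec[OF cpts_D(3,4)])

lemma cval_spec_map:
  assumes "S \<in> calg R" "p \<in> cpts S" shows "spec_map R A (quot_fun R (fst p)) (snd (fst p)) S (snd p) = cval p"
  unfolding cval_def quot_fun_def by (rule spec_map_tcomp[OF assms(1) cpts_D(4)[OF assms(2)]])

text \<open>The transition is compatible with the quotient maps, so by associativity of composition
  the represented point of Spec A is unchanged.\<close>

lemma crel_step:
  assumes S: "S \<in> calg R" and i: "i \<in> Q" and j: "j \<in> Q" and h: "h \<in> quot_mor R A j i"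
    and y: "y \<in> alg_trans R (qcoh R (fst i)) (qcoh R S)"
  shows "(j, spec_map R (quot_fun R j) (quot_fun R i) h S y) \<in> cpts S"
    "cval (j, spec_map R (quot_fun R j) (quot_fun R i) h S y) = cval (i, y)"
proof -
  have B: "assoc_algebra R (fst j)" "snd j \<in> alg_trans R A (qcoh R (fst j))"
    using quotientsD[of "fst j" "snd j" R A] j by auto
  have h': "h \<in> alg_trans R (qcoh R (fst j)) (qcoh R (fst i))" "tcomp R (uset A) h (snd j) = snd i"
    using h by (auto simp: quot_mor_def quot_fun_def)
  have e: "spec_map R (quot_fun R j) (quot_fun R i) h S y = tcomp R (uset (qcoh R (fst j))) y h"
    unfolding quot_fun_def by (rule spec_map_tcomp[OF S y])
  have "tcomp R (uset (qcoh R (fst j))) y h \<in> alg_trans R (qcoh R (fst j)) (qcoh R S)"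
    by (rule tcomp_alg_trans[OF qcoh_algebra[OF universe_infinite B(1)] qcoh_Mor_carrier[OF universe_infinite B(1)] h'(1) y])
  then show "(j, spec_map R (quot_fun R j) (quot_fun R i) h S y) \<in> cpts S"
    using j by (simp add: e[unfolded quot_fun_def] quot_fun_def)
  show "cval (j, spec_map R (quot_fun R j) (quot_fun R i) h S y) = cval (i, y)"
    unfolding cval_def e by (simp add: tcomp_assoc[OF B(2)] h'(2))
qed

text \<open>The relation is generated by single steps and their inverses, so the invariant is
  followed along a zigzag.\<close>

lemma crel_cval:
  assumes S: "S \<in> calg R" and pq: "(p, p') \<in> crel S" and p: "p \<in> cpts S"
  shows "p' \<in> cpts S \<and> cval p' = cval p"
  using pq unfolding colim_rel_def Let_def
proof (induction rule: rtrancl_induct)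
  case base
  show ?case using p by simp
next
  case (step r s)
  show ?case using step(2)
  proof
    assume "(r, s) \<in> {((i, x), j, h S x) |i j h x. i \<in> Q \<and> j \<in> Q \<and>
      h \<in> spec_map R (quot_fun R j) (quot_fun R i) ` quot_mor R A j i \<and> x \<in> Ob (spec R (quot_fun R i)) S}"
    then show ?case using step(3) crel_step[OF S] by (auto simp: quot_fun_def)
  next
    assume "(r, s) \<in> {((i, x), j, h S x) |i j h x. i \<in> Q \<and> j \<in> Q \<and>
      h \<in> spec_map R (quot_fun R j) (quot_fun R i) ` quot_mor R A j i \<and> x \<in> Ob (spec R (quot_fun R i)) S}\<inverse>"
    then show ?case using step(3) crel_step[OF S] by (auto simp: quot_fun_def)
  qed
qed

lemma crel_sym: "(p, q) \<in> crel S \<Longrightarrow> (q, p) \<in> crel S"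
  unfolding colim_rel_def Let_def by (rule symD[OF sym_rtrancl]) (auto simp: sym_def)

lemma crel_trans: "(p, q) \<in> crel S \<Longrightarrow> (q, r) \<in> crel S \<Longrightarrow> (p, r) \<in> crel S"
  unfolding colim_rel_def Let_def by (rule rtrancl_trans)

lemma crel_refl: "(p, p) \<in> crel S"
  unfolding colim_rel_def Let_def by simp

text \<open>Both points are connected to the one given by the image of their common value.\<close>

lemma cval_inj:
  assumes S: "S \<in> calg R" and p: "p \<in> cpts S" and p': "p' \<in> cpts S" and eq: "cval p = cval p'"
  shows "(p, p') \<in> crel S"
proof -
  note SA = calg_assoc_algebra[OF S]
  obtain B0 \<psi> \<iota> where f: "(B0, \<psi>) \<in> Q" "\<iota> \<in> alg_hom R B0 S"
    and u: "\<And>B \<pi> f. (B, \<pi>) \<in> quotients R A \<Longrightarrow> f \<in> alg_hom R B S \<Longrightarrow> Mor (spec R A) B S f \<pi> = cval p \<Longrightarrow>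
      \<exists>g\<in>alg_hom R B B0. (\<forall>b\<in>carrier B. \<iota> (g b) = f b) \<and> Mor (spec R A) B B0 g \<pi> = \<psi>"
    by (rule spec_factorization[OF S cval_in[OF p]]) blast
  note Q0 = quotientsD[OF f(1)]
  let ?c = "((B0, \<psi>), scalar_ext_trans R B0 S \<iota>)"
  \<comment> \<open>One step is enough: factoring \<open>r\<close> through the image supplies a
    transition from the quotient of \<open>r\<close> to the image quotient.\<close>
  have "(?c, r) \<in> crel S" if r: "r \<in> cpts S" and rv: "cval r = cval p" for r
  proof -
    obtain B \<pi> y where ry: "r = ((B, \<pi>), y)" by (metis prod.collapse)
    have BQ: "(B, \<pi>) \<in> Q" and y: "y \<in> alg_trans R (qcoh R B) (qcoh R S)"
      using cpts_D[OF r] by (auto simp: ry)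
    note Q' = quotientsD[OF BQ]
    obtain f where fy: "f \<in> alg_hom R B S" "y = scalar_ext_trans R B S f"
      by (rule qcoh_yoneda[OF universe_infinite Q'(1) SA y])
    have "Mor (spec R A) B S f \<pi> = cval p"
      unfolding spec_Mor_tcomp[OF Q'(2)] rv[symmetric] by (simp add: cval_def ry fy)
    from u[OF BQ fy(1) this] obtain g where g: "g \<in> alg_hom R B B0" "\<forall>b\<in>carrier B. \<iota> (g b) = f b"
      "Mor (spec R A) B B0 g \<pi> = \<psi>" by blast
    have h: "scalar_ext_trans R B B0 g \<in> quot_mor R A (B, \<pi>) (B0, \<psi>)"
      by (rule quot_mor_scalar_ext[OF BQ f(1) g(1,3)])
    have st: "scalar_ext_trans R B0 S \<iota> \<in> alg_trans R (qcoh R B0) (qcoh R S)"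
      by (rule scalar_ext_trans_in[OF universe_infinite Q0(1) SA alg_homD(1)[OF f(2)]])
    have "spec_map R (qcoh R B) (qcoh R B0) (scalar_ext_trans R B B0 g) S (scalar_ext_trans R B0 S \<iota>) = y"
      unfolding spec_map_tcomp[OF S st]
    proof (rule alg_trans_eqI[OF tcomp_alg_trans[OF qcoh_algebra[OF universe_infinite Q'(1)] qcoh_Mor_carrier[OF universe_infinite Q'(1)] _ st] y])
      show "scalar_ext_trans R B B0 g \<in> alg_trans R (qcoh R B) (qcoh R B0)"
        by (rule scalar_ext_trans_in[OF universe_infinite Q'(1) Q0(1) alg_homD(1)[OF g(1)]])
      fix T z assume T: "T \<in> calg R" and z: "z \<in> carrier (Ob (qcoh R B) T)"
      show "tcomp R (uset (qcoh R B)) (scalar_ext_trans R B0 S \<iota>) (scalar_ext_trans R B B0 g) T z = y T z"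
        unfolding tcomp_apply[where M = "qcoh R B", OF T z] fy(2) using T z
        by (simp add: scalar_ext_trans_def
          scalar_ext_comp[OF universe_infinite Q'(1) Q0(1) SA T alg_homD(1)[OF g(1)] alg_homD(1)[OF f(2)] alg_homD(1)[OF fy(1)] g(2)[rule_format, symmetric]])
    qed
    then have "(?c, r) \<in> {((i, x), j, h S x) |i j h x. i \<in> Q \<and> j \<in> Q \<and>
      h \<in> spec_map R (quot_fun R j) (quot_fun R i) ` quot_mor R A j i \<and> x \<in> Ob (spec R (quot_fun R i)) S}"
      unfolding ry using f(1) BQ h st by (force simp: quot_fun_def)
    then show ?thesis unfolding colim_rel_def Let_def by blast
  qed
  from this[OF p refl] this[OF p' eq[symmetric]] show ?thesis using crel_sym crel_trans by blast
qed

text \<open>\<open>cval\<close> is constant on a class, so the set to which \<open>the_elem\<close>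
  is applied is a singleton.\<close>

lemma spec_colim_map_class:
  assumes S: "S \<in> calg R" and p: "p \<in> cpts S"
  shows "spec_colim_map R A S (crel S `` {p}) = cval p"
proof -
  have "(\<lambda>(i, x). spec_map R A (quot_fun R i) (snd i) S x) ` (crel S `` {p}) = {cval p}"
  proof (intro equalityI subsetI)
    fix v assume "v \<in> (\<lambda>(i, x). spec_map R A (quot_fun R i) (snd i) S x) ` (crel S `` {p})"
    then obtain r where r: "(p, r) \<in> crel S" and v: "v = spec_map R A (quot_fun R (fst r)) (snd (fst r)) S (snd r)"
      by (auto simp: case_prod_beta)
    show "v \<in> {cval p}" using crel_cval[OF S r p] v cval_spec_map[OF S, of r] by auto
  next
    fix v assume "v \<in> {cval p}"
    then have "v = (\<lambda>(i, x). spec_map R A (quot_fun R i) (snd i) S x) p"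
      using cval_spec_map[OF S p] by (simp add: case_prod_beta)
    then show "v \<in> (\<lambda>(i, x). spec_map R A (quot_fun R i) (snd i) S x) ` (crel S `` {p})"
      using crel_refl by blast
  qed
  moreover have "crel S `` {p} \<in> Ob (spec_colim R A) S"
    using p by (auto simp: spec_colim_def colim_fun_def quotient_def simp del: spec_simps)
  ultimately show ?thesis using S by (simp add: spec_colim_map_def)
qed

lemma spec_colim_Ob: "z \<in> Ob (spec_colim R A) S \<longleftrightarrow> (\<exists>p\<in>cpts S. z = crel S `` {p})"
  by (auto simp: spec_colim_def colim_fun_def quotient_def simp del: spec_simps)

definition "cpush S T f p = (fst p, Mor (spec R (quot_fun R (fst p))) S T f (snd p))"

lemma cpush:
  assumes S: "S \<in> calg R" and T: "T \<in> calg R" and f: "f \<in> alg_hom R S T" and p: "p \<in> cpts S"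
  shows "cpush S T f p \<in> cpts T" "cval (cpush S T f p) = Mor (spec R A) S T f (cval p)"
proof -
  note D = cpts_D[OF p]
  have e: "Mor (spec R (quot_fun R (fst p))) S T f (snd p) = tcomp R (uset (qcoh R (fst (fst p)))) (scalar_ext_trans R S T f) (snd p)"
    unfolding quot_fun_def by (rule spec_Mor_tcomp[OF D(4)])
  have st: "scalar_ext_trans R S T f \<in> alg_trans R (qcoh R S) (qcoh R T)"
    by (rule scalar_ext_trans_in[OF universe_infinite calg_assoc_algebra[OF S] calg_assoc_algebra[OF T] alg_homD(1)[OF f]])
  have "tcomp R (uset (qcoh R (fst (fst p)))) (scalar_ext_trans R S T f) (snd p) \<in> alg_trans R (qcoh R (fst (fst p))) (qcoh R T)"
    by (rule tcomp_alg_trans[OF qcoh_algebra[OF universe_infinite D(2)] qcoh_Mor_carrier[OF universe_infinite D(2)] D(4) st])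
  then show "cpush S T f p \<in> cpts T" using D(1) by (simp add: cpush_def e[unfolded quot_fun_def] quot_fun_def)
  show "cval (cpush S T f p) = Mor (spec R A) S T f (cval p)"
    unfolding spec_Mor_tcomp[OF cval_in[OF p]] by (simp add: cpush_def cval_def e tcomp_assoc[OF D(3)])
qed

text \<open>Members of a class have equal values, hence so do their push-forwards, and
  \<open>cval_inj\<close> puts these into one class. Zigzags are not transported step by
  step.\<close>

lemma spec_colim_Mor_class:
  assumes S: "S \<in> calg R" and T: "T \<in> calg R" and f: "f \<in> alg_hom R S T" and p: "p \<in> cpts S"
  shows "Mor (spec_colim R A) S T f (crel S `` {p}) = crel T `` {cpush S T f p}"
proof -
  have e: "(\<lambda>(i, x). (i, Mor (spec R (quot_fun R i)) S T f x)) = cpush S T f"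
    by (auto simp: cpush_def)
  have "crel S `` {p} \<in> cpts S // crel S" using p by (rule quotientI)
  then have "Mor (spec_colim R A) S T f (crel S `` {p}) =
      crel T `` ((\<lambda>(i, x). (i, Mor (spec R (quot_fun R i)) S T f x)) ` (crel S `` {p}))"
    by (simp add: spec_colim_def colim_fun_def del: spec_simps)
  also have "\<dots> = crel T `` (cpush S T f ` (crel S `` {p}))" unfolding e ..
  also have "\<dots> = crel T `` {cpush S T f p}"
  proof (intro equalityI subsetI)
    fix r assume "r \<in> crel T `` (cpush S T f ` (crel S `` {p}))"
    then obtain s where s: "(p, s) \<in> crel S" and r: "(cpush S T f s, r) \<in> crel T" by auto
    have s': "s \<in> cpts S" "cval s = cval p" using crel_cval[OF S s p] by auto
    have "(cpush S T f p, cpush S T f s) \<in> crel T"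
      by (rule cval_inj[OF T]) (use cpush[OF S T f] p s' in auto)
    then show "r \<in> crel T `` {cpush S T f p}" using r crel_trans by blast
  qed (use crel_refl in blast)
  finally show ?thesis .
qed

text \<open>On classes the map is \<open>cval\<close>: injectivity is \<open>cval_inj\<close>, and
  every point is reached through the image quotient of \<open>spec_factorization\<close>.\<close>

theorem spec_colim_iso: "spec_colim_map R A \<in> set_iso R (spec_colim R A) (spec R A)"
proof -
  have mem: "spec_colim_map R A S c \<in> alg_trans R A (qcoh R S)" if "S \<in> calg R" "c \<in> Ob (spec_colim R A) S" for S c
    using that spec_colim_map_class[OF that(1)] cval_in by (auto simp: spec_colim_Ob)
  have nat: "spec_colim_map R A T (Mor (spec_colim R A) S T f c) = Mor (spec R A) S T f (spec_colim_map R A S c)"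
    if S: "S \<in> calg R" and T: "T \<in> calg R" and f: "f \<in> alg_hom R S T" and c: "c \<in> Ob (spec_colim R A) S" for S T f c
  proof -
    obtain p where p: "p \<in> cpts S" and c: "c = crel S `` {p}" using c by (auto simp: spec_colim_Ob)
    show ?thesis
      unfolding c spec_colim_Mor_class[OF S T f p] spec_colim_map_class[OF T cpush(1)[OF S T f p]]
        spec_colim_map_class[OF S p] by (rule cpush(2)[OF S T f p])
  qed
  have bij: "bij_betw (spec_colim_map R A S) (Ob (spec_colim R A) S) (alg_trans R A (qcoh R S))" if S: "S \<in> calg R" for S
  proof (rule bij_betw_imageI)
    show "inj_on (spec_colim_map R A S) (Ob (spec_colim R A) S)"
    proof (rule inj_onI)
      fix c d assume c: "c \<in> Ob (spec_colim R A) S" and d: "d \<in> Ob (spec_colim R A) S"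
        and eq: "spec_colim_map R A S c = spec_colim_map R A S d"
      obtain p where p: "p \<in> cpts S" "c = crel S `` {p}" using c by (auto simp: spec_colim_Ob)
      obtain p' where p': "p' \<in> cpts S" "d = crel S `` {p'}" using d by (auto simp: spec_colim_Ob)
      have "(p, p') \<in> crel S"
        using eq unfolding p(2) p'(2) spec_colim_map_class[OF S p(1)] spec_colim_map_class[OF S p'(1)]
        by (rule cval_inj[OF S p(1) p'(1)])
      then show "c = d" unfolding p(2) p'(2) using crel_sym crel_trans by blast
    qed
    show "spec_colim_map R A S ` Ob (spec_colim R A) S = alg_trans R A (qcoh R S)"
    proof (intro equalityI subsetI)
      fix x assume x: "x \<in> alg_trans R A (qcoh R S)"
      obtain B0 \<psi> \<iota> where f: "(B0, \<psi>) \<in> Q" "\<iota> \<in> alg_hom R B0 S" "Mor (spec R A) B0 S \<iota> \<psi> = x"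
        by (rule spec_factorization[OF S x]) blast
      let ?p = "((B0, \<psi>), scalar_ext_trans R B0 S \<iota>)"
      have p: "?p \<in> cpts S"
        using f(1) scalar_ext_trans_in[OF universe_infinite quotientsD(1)[OF f(1)] calg_assoc_algebra[OF S] alg_homD(1)[OF f(2)]]
        by (simp add: quot_fun_def)
      have "cval ?p = x" using f(3) by (simp add: cval_def spec_Mor_tcomp[OF quotientsD(2)[OF f(1)]])
      then have "x = spec_colim_map R A S (crel S `` {?p})" by (simp only: spec_colim_map_class[OF S p])
      moreover have "crel S `` {?p} \<in> Ob (spec_colim R A) S" using p unfolding spec_colim_Ob by blast
      ultimately show "x \<in> spec_colim_map R A S ` Ob (spec_colim R A) S" by (rule image_eqI)
    qed (use mem S in auto)
  qed
  have ext: "spec_colim_map R A \<in> extensional (calg R)" "S \<in> calg R \<Longrightarrow> spec_colim_map R A S \<in> extensional (Ob (spec_colim R A) S)" for S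
    by (simp_all add: spec_colim_map_def)
  show ?thesis
    unfolding set_iso_def set_trans_def using mem nat bij ext by (auto simp: PiE_iff)
qed

end


section \<open>Functions on the spectrum\<close>

lemma base_fun_simps [simp]:
  "Ob (uset base_fun) T = carrier T" "Mor (uset base_fun) T T' f = f"
  by (simp_all add: uset_def base_fun_def self_def)

lemma restr_simps [simp]:
  "Ob (restr R S F) T = Ob F (over R S T)" "Mor (restr R S F) T T' f = Mor F (over R S T) (over R S T') f"
  by (simp_all add: restr_def)

lemma fun_alg_carrier:
  "F \<in> carrier (Ob (fun_alg R X) S) \<longleftrightarrow> F \<in> extensional (calg S) \<and>
     (\<forall>T\<in>calg S. F T \<in> Ob X (over R S T) \<rightarrow>\<^sub>E carrier T) \<and>
     (\<forall>T\<in>calg S. \<forall>T'\<in>calg S. \<forall>f\<in>alg_hom S T T'. \<forall>x\<in>Ob X (over R S T).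
        F T' (Mor X (over R S T) (over R S T') f x) = f (F T x))"
  by (auto simp: fun_alg_def pointwise_def set_trans_def PiE_iff)

lemma fun_algD:
  assumes "F \<in> carrier (Ob (fun_alg R X) S)" "T \<in> calg S" "x \<in> Ob X (over R S T)"
  shows "F T x \<in> carrier T"
    and "T' \<in> calg S \<Longrightarrow> f \<in> alg_hom S T T' \<Longrightarrow> F T' (Mor X (over R S T) (over R S T') f x) = f (F T x)"
proof -
  show "F T x \<in> carrier T" using assms PiE_mem[of "F T"] unfolding fun_alg_carrier by blast
  show "T' \<in> calg S \<Longrightarrow> f \<in> alg_hom S T T' \<Longrightarrow> F T' (Mor X (over R S T) (over R S T') f x) = f (F T x)"
    using assms unfolding fun_alg_carrier by blast
qed

lemma fun_alg_eqI:
  assumes "F \<in> carrier (Ob (fun_alg R X) S)" "G \<in> carrier (Ob (fun_alg R X) S)"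
    "\<And>T x. T \<in> calg S \<Longrightarrow> x \<in> Ob X (over R S T) \<Longrightarrow> F T x = G T x"
  shows "F = G"
proof (rule extensionalityI)
  show "F \<in> extensional (calg S)" "G \<in> extensional (calg S)" using assms by (auto simp: fun_alg_carrier)
  fix T assume T: "T \<in> calg S"
  then have "F T \<in> extensional (Ob X (over R S T))" "G T \<in> extensional (Ob X (over R S T))"
    using assms by (auto simp: fun_alg_carrier PiE_def)
  then show "F T = G T" using assms(3)[OF T] by (rule extensionalityI)
qed

lemma fun_alg_ops:
  assumes "T \<in> calg S" "x \<in> Ob X (over R S T)"
  shows "(F \<otimes>\<^bsub>Ob (fun_alg R X) S\<^esub> G) T x = F T x \<otimes>\<^bsub>T\<^esub> G T x"
    "\<one>\<^bsub>Ob (fun_alg R X) S\<^esub> T x = \<one>\<^bsub>T\<^esub>"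
    "(F \<oplus>\<^bsub>Ob (fun_alg R X) S\<^esub> G) T x = F T x \<oplus>\<^bsub>T\<^esub> G T x"
    "(s \<odot>\<^bsub>Ob (fun_alg R X) S\<^esub> F) T x = s \<odot>\<^bsub>T\<^esub> F T x"
  using assms by (simp_all add: fun_alg_def pointwise_def)

lemma fun_alg_Mor:
  assumes "F \<in> carrier (Ob (fun_alg R X) S)" "T \<in> calg S'"
  shows "Mor (fun_alg R X) S S' f F T = F (rscal S f T)"
  using assms by (simp add: fun_alg_def pointwise_def)

lemma quot_lim_simps:
  "carrier (Ob (quot_lim R A) S) = lim_carrier (quotients R A) (quot_fun R) (quot_mor R A) S"
  "y \<otimes>\<^bsub>Ob (quot_lim R A) S\<^esub> z = (\<lambda>i\<in>quotients R A. y i \<otimes>\<^bsub>tensor R (fst i) S\<^esub> z i)"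
  "\<one>\<^bsub>Ob (quot_lim R A) S\<^esub> = (\<lambda>i\<in>quotients R A. \<one>\<^bsub>tensor R (fst i) S\<^esub>)"
  "y \<oplus>\<^bsub>Ob (quot_lim R A) S\<^esub> z = (\<lambda>i\<in>quotients R A. y i \<oplus>\<^bsub>tensor R (fst i) S\<^esub> z i)"
  "s \<odot>\<^bsub>Ob (quot_lim R A) S\<^esub> z = (\<lambda>i\<in>quotients R A. s \<odot>\<^bsub>tensor R (fst i) S\<^esub> z i)"
  by (simp_all add: quot_lim_def lim_fun_def quot_fun_def)

lemma quot_lim_carrier:
  "y \<in> lim_carrier (quotients R A) (quot_fun R) (quot_mor R A) S \<longleftrightarrow> y \<in> extensional (quotients R A) \<and>
     (\<forall>i\<in>quotients R A. y i \<in> carrier (tensor R (fst i) S)) \<and>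
     (\<forall>i\<in>quotients R A. \<forall>j\<in>quotients R A. \<forall>h\<in>quot_mor R A i j. h S (y i) = y j)"
  by (auto simp: lim_carrier_def quot_fun_def PiE_iff)

lemma fun_alg_memI:
  assumes mor: "\<And>S T f x. S \<in> calg R \<Longrightarrow> T \<in> calg R \<Longrightarrow> f \<in> alg_hom R S T \<Longrightarrow> x \<in> Ob X S \<Longrightarrow> Mor X S T f x \<in> Ob X T"
    and S: "S \<in> calg R"
    and cl: "\<And>T x. T \<in> calg S \<Longrightarrow> x \<in> Ob X (over R S T) \<Longrightarrow> h T x \<in> carrier T"
    and nat: "\<And>T T' f x. T \<in> calg S \<Longrightarrow> T' \<in> calg S \<Longrightarrow> f \<in> alg_hom S T T' \<Longrightarrow> x \<in> Ob X (over R S T) \<Longrightarrow>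
      h T' (Mor X (over R S T) (over R S T') f x) = f (h T x)"
  shows "(\<lambda>T\<in>calg S. \<lambda>x\<in>Ob X (over R S T). h T x) \<in> carrier (Ob (fun_alg R X) S)"
  unfolding fun_alg_carrier
  using mor[OF over_calg[OF S] over_calg[OF S] over_alg_hom[OF _ S]] cl nat by (auto simp: PiE_iff)

text \<open>The operations are pointwise, so each law is a law in the algebras \<open>T\<close>; the
  results are natural because morphisms of algebras preserve the operations.\<close>

lemma fun_alg_algebra:
  assumes mor: "\<And>S T f x. S \<in> calg R \<Longrightarrow> T \<in> calg R \<Longrightarrow> f \<in> alg_hom R S T \<Longrightarrow> x \<in> Ob X S \<Longrightarrow> Mor X S T f x \<in> Ob X T"
    and S: "S \<in> calg R"
  shows "algebra S (Ob (fun_alg R X) S)"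
proof -
  let ?A = "Ob (fun_alg R X) S"
  note memI = fun_alg_memI[OF mor S]
  note [simp] = fun_alg_ops
  have rT: "cring T" "module S T" "algebra S T" if "T \<in> calg S" for T
    using that by (auto intro: calg_cring calg_module calg_algebra)
  note cl = fun_algD(1) and nat = fun_algD(2)
  have one: "\<one>\<^bsub>?A\<^esub> \<in> carrier ?A"
  proof -
    have "(\<lambda>T\<in>calg S. \<lambda>x\<in>Ob X (over R S T). \<one>\<^bsub>T\<^esub>) \<in> carrier ?A"
      by (rule memI) (use rT(1) in \<open>auto simp: alg_homD(7) cring.cring_simprules(6)\<close>)
    then show ?thesis by (simp add: fun_alg_def pointwise_def)
  qed
  have zero: "\<zero>\<^bsub>?A\<^esub> \<in> carrier ?A"
  proof -
    have "(\<lambda>T\<in>calg S. \<lambda>x\<in>Ob X (over R S T). \<zero>\<^bsub>T\<^esub>) \<in> carrier ?A"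
      by (rule memI) (use rT(1) in \<open>auto simp: alg_hom_zero cring.axioms(1) cring.cring_simprules(2)\<close>)
    then show ?thesis by (simp add: fun_alg_def pointwise_def)
  qed
  have zero_app: "\<zero>\<^bsub>?A\<^esub> T x = \<zero>\<^bsub>T\<^esub>" if "T \<in> calg S" "x \<in> Ob X (over R S T)" for T x
    using that by (simp add: fun_alg_def pointwise_def)
  have mult: "F \<otimes>\<^bsub>?A\<^esub> G \<in> carrier ?A" and add: "F \<oplus>\<^bsub>?A\<^esub> G \<in> carrier ?A"
    if F: "F \<in> carrier ?A" and G: "G \<in> carrier ?A" for F G
  proof -
    have "F \<otimes>\<^bsub>?A\<^esub> G = (\<lambda>T\<in>calg S. \<lambda>x\<in>Ob X (over R S T). F T x \<otimes>\<^bsub>T\<^esub> G T x)"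
      "F \<oplus>\<^bsub>?A\<^esub> G = (\<lambda>T\<in>calg S. \<lambda>x\<in>Ob X (over R S T). F T x \<oplus>\<^bsub>T\<^esub> G T x)"
      by (simp_all add: fun_alg_def pointwise_def)
    moreover have "(\<lambda>T\<in>calg S. \<lambda>x\<in>Ob X (over R S T). F T x \<otimes>\<^bsub>T\<^esub> G T x) \<in> carrier ?A"
      by (rule memI) (use cl[OF F] cl[OF G] rT in \<open>auto simp: cring.cring_simprules(5) nat[OF F] nat[OF G] alg_homD(6)\<close>)
    moreover have "(\<lambda>T\<in>calg S. \<lambda>x\<in>Ob X (over R S T). F T x \<oplus>\<^bsub>T\<^esub> G T x) \<in> carrier ?A"
      by (rule memI) (use cl[OF F] cl[OF G] rT in \<open>auto simp: cring.cring_simprules(1) nat[OF F] nat[OF G] alg_homD(5)\<close>)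
    ultimately show "F \<otimes>\<^bsub>?A\<^esub> G \<in> carrier ?A" "F \<oplus>\<^bsub>?A\<^esub> G \<in> carrier ?A" by simp_all
  qed
  have smult: "s \<odot>\<^bsub>?A\<^esub> F \<in> carrier ?A" if F: "F \<in> carrier ?A" and s: "s \<in> carrier S" for F s
  proof -
    have "(\<lambda>T\<in>calg S. \<lambda>x\<in>Ob X (over R S T). s \<odot>\<^bsub>T\<^esub> F T x) \<in> carrier ?A"
      by (rule memI) (use cl[OF F] s in \<open>auto simp: nat[OF F] alg_homD(8) intro!: module.smult_closed[OF rT(2)]\<close>)
    then show ?thesis by (simp add: fun_alg_def pointwise_def)
  qed
  interpret S: cring S by (rule calg_cring[OF S])
  \<comment> \<open>The negative is obtained as the scalar -1 times \<open>F\<close>.\<close>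
  have neg: "\<exists>G\<in>carrier ?A. G \<oplus>\<^bsub>?A\<^esub> F = \<zero>\<^bsub>?A\<^esub>" if F: "F \<in> carrier ?A" for F
  proof (rule bexI)
    have m: "(\<ominus>\<^bsub>S\<^esub> \<one>\<^bsub>S\<^esub>) \<odot>\<^bsub>?A\<^esub> F \<in> carrier ?A" by (rule smult[OF F]) simp
    then show "(\<ominus>\<^bsub>S\<^esub> \<one>\<^bsub>S\<^esub>) \<odot>\<^bsub>?A\<^esub> F \<in> carrier ?A" .
    show "(\<ominus>\<^bsub>S\<^esub> \<one>\<^bsub>S\<^esub>) \<odot>\<^bsub>?A\<^esub> F \<oplus>\<^bsub>?A\<^esub> F = \<zero>\<^bsub>?A\<^esub>"
    proof (rule fun_alg_eqI[OF add[OF m F] zero])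
      fix T x assume Tx: "T \<in> calg S" "x \<in> Ob X (over R S T)"
      interpret Tc: cring T by (rule rT(1)[OF Tx(1)])
      interpret T: module S T by (rule rT(2)[OF Tx(1)])
      show "((\<ominus>\<^bsub>S\<^esub> \<one>\<^bsub>S\<^esub>) \<odot>\<^bsub>?A\<^esub> F \<oplus>\<^bsub>?A\<^esub> F) T x = \<zero>\<^bsub>?A\<^esub> T x"
        using cl[OF F Tx] by (simp add: Tx zero_app T.smult_l_minus Tc.l_neg)
    qed
  qed
  note eqI = fun_alg_eqI[of _ R X S] and ax = cring.cring_simprules
  have "abelian_group ?A"
  proof (rule abelian_groupI[OF add zero _ _ _ neg])
    show "F \<oplus>\<^bsub>?A\<^esub> G \<oplus>\<^bsub>?A\<^esub> H = F \<oplus>\<^bsub>?A\<^esub> (G \<oplus>\<^bsub>?A\<^esub> H)" if "F \<in> carrier ?A" "G \<in> carrier ?A" "H \<in> carrier ?A" for F G H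
      by (rule eqI) (use that rT(1) in \<open>auto intro!: add ax(7) dest: cl\<close>)
    show "F \<oplus>\<^bsub>?A\<^esub> G = G \<oplus>\<^bsub>?A\<^esub> F" if "F \<in> carrier ?A" "G \<in> carrier ?A" for F G
      by (rule eqI) (use that rT(1) in \<open>auto intro!: add ax(10) dest: cl\<close>)
    show "\<zero>\<^bsub>?A\<^esub> \<oplus>\<^bsub>?A\<^esub> F = F" if "F \<in> carrier ?A" for F
      by (rule eqI) (use that rT(1) in \<open>auto simp: zero_app intro!: add zero ax(8) dest: cl\<close>)
  qed
  moreover have "comm_monoid ?A"
  proof (rule comm_monoidI[OF mult one])
    show "F \<otimes>\<^bsub>?A\<^esub> G \<otimes>\<^bsub>?A\<^esub> H = F \<otimes>\<^bsub>?A\<^esub> (G \<otimes>\<^bsub>?A\<^esub> H)" if "F \<in> carrier ?A" "G \<in> carrier ?A" "H \<in> carrier ?A" for F G H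
      by (rule eqI) (use that rT(1) in \<open>auto intro!: mult ax(11) dest: cl\<close>)
    show "F \<otimes>\<^bsub>?A\<^esub> G = G \<otimes>\<^bsub>?A\<^esub> F" if "F \<in> carrier ?A" "G \<in> carrier ?A" for F G
      by (rule eqI) (use that rT(1) in \<open>auto intro!: mult ax(14) dest: cl\<close>)
    show "\<one>\<^bsub>?A\<^esub> \<otimes>\<^bsub>?A\<^esub> F = F" if "F \<in> carrier ?A" for F
      by (rule eqI) (use that rT(1) in \<open>auto intro!: mult one ax(12) dest: cl\<close>)
  qed
  ultimately have "cring ?A"
  proof (rule cringI)
    show "(F \<oplus>\<^bsub>?A\<^esub> G) \<otimes>\<^bsub>?A\<^esub> H = F \<otimes>\<^bsub>?A\<^esub> H \<oplus>\<^bsub>?A\<^esub> G \<otimes>\<^bsub>?A\<^esub> H" if "F \<in> carrier ?A" "G \<in> carrier ?A" "H \<in> carrier ?A" for F G H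
      by (rule eqI) (use that rT(1) in \<open>auto intro!: add mult ax(13) dest: cl\<close>)
  qed
  then show ?thesis
  proof (rule algebraI[OF S.cring_axioms _ smult])
    fix a F G assume a: "a \<in> carrier S" and F: "F \<in> carrier ?A" and G: "G \<in> carrier ?A"
    show "a \<odot>\<^bsub>?A\<^esub> (F \<oplus>\<^bsub>?A\<^esub> G) = a \<odot>\<^bsub>?A\<^esub> F \<oplus>\<^bsub>?A\<^esub> a \<odot>\<^bsub>?A\<^esub> G"
      by (rule eqI) (use a F G rT(2) in \<open>auto intro!: add smult module.smult_r_distr dest: cl\<close>)
    show "(a \<odot>\<^bsub>?A\<^esub> F) \<otimes>\<^bsub>?A\<^esub> G = a \<odot>\<^bsub>?A\<^esub> (F \<otimes>\<^bsub>?A\<^esub> G)"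
      by (rule eqI) (use a F G rT(3) in \<open>auto intro!: mult smult algebra.smult_assoc2 dest: cl\<close>)
  next
    fix a b F assume a: "a \<in> carrier S" and b: "b \<in> carrier S" and F: "F \<in> carrier ?A"
    show "(a \<oplus>\<^bsub>S\<^esub> b) \<odot>\<^bsub>?A\<^esub> F = a \<odot>\<^bsub>?A\<^esub> F \<oplus>\<^bsub>?A\<^esub> b \<odot>\<^bsub>?A\<^esub> F"
      by (rule eqI) (use a b F rT(2) in \<open>auto intro!: add smult module.smult_l_distr dest: cl\<close>)
    show "(a \<otimes>\<^bsub>S\<^esub> b) \<odot>\<^bsub>?A\<^esub> F = a \<odot>\<^bsub>?A\<^esub> (b \<odot>\<^bsub>?A\<^esub> F)"
      by (rule eqI) (use a b F rT(2) in \<open>auto intro!: smult module.smult_assoc1 dest: cl\<close>)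
  next
    fix F assume F: "F \<in> carrier ?A"
    show "\<one>\<^bsub>S\<^esub> \<odot>\<^bsub>?A\<^esub> F = F"
      by (rule eqI) (use F rT(2) in \<open>auto intro!: smult module.smult_one dest: cl\<close>)
  qed
qed

text \<open>\<open>Mor\<close> evaluates at the restricted algebras \<open>rscal S f T\<close>. By
  \<open>over_rscal\<close> these have the same points as \<open>T\<close> over \<open>S'\<close>,
  so values and naturality carry over directly.\<close>

lemma fun_alg_Mor_in:
  assumes S: "S \<in> calg R" and S': "S' \<in> calg R" and f: "f \<in> alg_hom R S S'" and F: "F \<in> carrier (Ob (fun_alg R X) S)"
  shows "Mor (fun_alg R X) S S' f F \<in> carrier (Ob (fun_alg R X) S')"
proof -
  have r: "rscal S f T \<in> calg S" if "T \<in> calg S'" for T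
    by (rule rscal_calg[OF calg_cring[OF S] that alg_homD(3)[OF f]])
  have g: "g \<in> alg_hom S (rscal S f T) (rscal S f T')" if "g \<in> alg_hom S' T T'" for g T T'
    by (rule rscal_alg_hom[OF that alg_homD(3)[OF f]])
  have e: "Mor (fun_alg R X) S S' f F \<in> extensional (calg S')" using F by (simp add: fun_alg_def pointwise_def)
  show ?thesis
    unfolding fun_alg_carrier
  proof (intro conjI ballI e)
    fix T assume T: "T \<in> calg S'"
    have FT: "F (rscal S f T) \<in> Ob X (over R S (rscal S f T)) \<rightarrow>\<^sub>E carrier (rscal S f T)"
      using F r[OF T] unfolding fun_alg_carrier by blast
    then show "Mor (fun_alg R X) S S' f F T \<in> Ob X (over R S' T) \<rightarrow>\<^sub>E carrier T"
      unfolding fun_alg_Mor[OF F T] by (simp add: over_rscal[OF S f])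
    fix T' h x assume T': "T' \<in> calg S'" and h: "h \<in> alg_hom S' T T'" and x: "x \<in> Ob X (over R S' T)"
    show "Mor (fun_alg R X) S S' f F T' (Mor X (over R S' T) (over R S' T') h x) = h (Mor (fun_alg R X) S S' f F T x)"
      unfolding fun_alg_Mor[OF F T] fun_alg_Mor[OF F T']
      using fun_algD(2)[OF F r[OF T] _ r[OF T'] g[OF h]] x by (simp add: over_rscal[OF S f])
  qed
qed

section \<open>Functions on the spectrum and compatible families\<close>

context comm_coordinates
begin

abbreviation "FA \<equiv> fun_alg R (spec R A)"

text \<open>The universal point through the quotient \<open>i\<close> over S-algebras: by
  \<open>rep_map_generic\<close>, every point that factors through \<open>i\<close> is an image of
  it.\<close>

definition generic where
  "generic i S = Mor (spec R A) (fst i) (over R S (tensor R (fst i) S)) (inl R (fst i) S) (snd i)"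

lemma quotD:
  assumes "i \<in> Q"
  shows "fst i \<in> calg R" "snd i \<in> alg_trans R A (qcoh R (fst i))" "assoc_algebra R (fst i)"
  using quotient_calg[of "fst i" "snd i"] quotientsD[of "fst i" "snd i" R A] assms by auto

lemma generic_in:
  assumes "i \<in> Q" "S \<in> calg R"
  shows "generic i S \<in> Ob (spec R A) (over R S (tensor R (fst i) S))"
  unfolding generic_def spec_simps
  by (intro spec_Mor_in quotD assms inl_alg_hom universe_infinite calg_assoc_algebra over_calg tensor_calg)

lemma spec_fun_lim_apply:
  assumes "S \<in> calg R" "F \<in> carrier (Ob FA S)" "i \<in> Q"
  shows "spec_fun_lim_map R A S F i = F (tensor R (fst i) S) (generic i S)"
  using assms by (simp add: spec_fun_lim_map_def Let_def generic_def inl_def)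

lemma tensor_in: "i \<in> Q \<Longrightarrow> S \<in> calg R \<Longrightarrow> tensor R (fst i) S \<in> calg S"
  by (intro tensor_calg universe_infinite quotD)

text \<open>
  A compatible family \<open>y\<close> is glued to a function by evaluating at a point \<open>z\<close> over \<open>T\<close> through any quotient
  \<open>i\<close> that \<open>z\<close> factors through, along the map \<open>k: A\<^sub>i \<otimes>\<^sub>R S \<rightarrow> T\<close> induced by \<open>f: A\<^sub>i \<rightarrow> T\<close>.
\<close>

definition "rep_map S T B f k \<longleftrightarrow> k \<in> alg_hom S (tensor R B S) T \<and>
  (\<forall>b\<in>carrier B. \<forall>s\<in>carrier S. k (pure_tensor R B S b s) = s \<odot>\<^bsub>T\<^esub> f b)"

definition "rep_val S y T z v \<longleftrightarrow> (\<exists>i\<in>Q. \<exists>f\<in>alg_hom R (fst i) (over R S T). \<exists>k.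
  Mor (spec R A) (fst i) (over R S T) f (snd i) = z \<and> rep_map S T (fst i) f k \<and> v = k (y i))"

lemma rep_map_ex:
  assumes "S \<in> calg R" "T \<in> calg S" "i \<in> Q" "f \<in> alg_hom R (fst i) (over R S T)"
  shows "\<exists>k. rep_map S T (fst i) f k"
  using tensor_copair[OF universe_infinite quotD(1)[OF assms(3)] assms(1,2,4)] unfolding rep_map_def by metis

lemma rep_map_inl:
  assumes S: "S \<in> calg R" and T: "T \<in> calg S" and i: "i \<in> Q" and f: "f \<in> alg_hom R (fst i) (over R S T)"
    and k: "rep_map S T (fst i) f k" and b: "b \<in> carrier (fst i)"
  shows "f b = k (inl R (fst i) S b)"
proof -
  interpret S: cring S by (rule calg_cring[OF S])
  interpret T: module S T by (rule calg_module[OF T])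
  show ?thesis using k b alg_homD(4)[OF f b] by (simp add: rep_map_def inl_def)
qed

text \<open>\<open>f\<close> is \<open>k\<close> after the inclusion of the first tensor factor, so
  pushing forward along \<open>f\<close> passes through the generic point.\<close>

lemma rep_map_generic:
  assumes S: "S \<in> calg R" and T: "T \<in> calg S" and i: "i \<in> Q" and f: "f \<in> alg_hom R (fst i) (over R S T)"
    and k: "rep_map S T (fst i) f k"
  shows "Mor (spec R A) (over R S (tensor R (fst i) S)) (over R S T) k (generic i S) = Mor (spec R A) (fst i) (over R S T) f (snd i)"
  unfolding generic_def
proof (rule spec_Mor_comp)
  show "k \<in> alg_hom R (over R S (tensor R (fst i) S)) (over R S T)"
    using over_alg_hom[OF _ S] k by (simp add: rep_map_def)
  show "\<And>b. b \<in> carrier (fst i) \<Longrightarrow> f b = k (inl R (fst i) S b)" by (rule rep_map_inl[OF S T i f k])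
qed (intro quotD i f inl_alg_hom universe_infinite S calg_assoc_algebra over_calg tensor_in T)+

lemma point_rep:
  assumes S: "S \<in> calg R" and T: "T \<in> calg S" and z: "z \<in> alg_trans R A (qcoh R (over R S T))"
  shows "\<exists>i\<in>Q. \<exists>f\<in>alg_hom R (fst i) (over R S T). Mor (spec R A) (fst i) (over R S T) f (snd i) = z"
proof -
  obtain B0 \<psi> \<iota> where "(B0, \<psi>) \<in> Q" "\<iota> \<in> alg_hom R B0 (over R S T)" "Mor (spec R A) B0 (over R S T) \<iota> \<psi> = z"
    by (rule spec_factorization[OF over_calg[OF S T] z]) blast
  then show ?thesis by (metis fst_conv snd_conv)
qed

lemma rep_val_ex:
  assumes S: "S \<in> calg R" and T: "T \<in> calg S" and z: "z \<in> alg_trans R A (qcoh R (over R S T))"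
  shows "\<exists>v. rep_val S y T z v"
  unfolding rep_val_def using point_rep[OF assms] rep_map_ex[OF S T] by metis

text \<open>Every representative is compared with the one through the image of \<open>z\<close>.
  Compatibility of \<open>y\<close> along the transition to that quotient moves \<open>y i\<close>
  to the component there, and the two maps to \<open>T\<close> agree on pure tensors.\<close>

lemma rep_val_unique:
  assumes S: "S \<in> calg R" and T: "T \<in> calg S" and z: "z \<in> alg_trans R A (qcoh R (over R S T))"
    and y: "y \<in> lim_carrier Q (quot_fun R) (quot_mor R A) S"
    and v: "rep_val S y T z v" "rep_val S y T z w"
  shows "v = w"
proof -
  obtain B0 \<psi> \<iota> where f0: "(B0, \<psi>) \<in> Q" "\<iota> \<in> alg_hom R B0 (over R S T)"
    and u: "\<And>B \<pi> f. (B, \<pi>) \<in> quotients R A \<Longrightarrow> f \<in> alg_hom R B (over R S T) \<Longrightarrow> Mor (spec R A) B (over R S T) f \<pi> = z \<Longrightarrow>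
      \<exists>g\<in>alg_hom R B B0. (\<forall>b\<in>carrier B. \<iota> (g b) = f b) \<and> Mor (spec R A) B B0 g \<pi> = \<psi>"
    by (rule spec_factorization[OF over_calg[OF S T] z]) blast
  note Q0 = quotientsD[OF f0(1)]
  obtain k0 where k0: "rep_map S T B0 \<iota> k0" using rep_map_ex[OF S T f0(1)] f0(2) by auto
  interpret T0: tensor_setup R B0 S by (intro tensor_setupI universe_infinite Q0(1) S)
  have can: "v = k0 (y (B0, \<psi>))" if v: "rep_val S y T z v" for v
  proof -
    obtain B \<pi> f k where BQ: "(B, \<pi>) \<in> Q" and f: "f \<in> alg_hom R B (over R S T)" and zf: "Mor (spec R A) B (over R S T) f \<pi> = z"
      and k: "rep_map S T B f k" and vk: "v = k (y (B, \<pi>))"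
      using v by (auto simp: rep_val_def)
    note Q' = quotientsD[OF BQ]
    interpret TB: tensor_setup R B S by (intro tensor_setupI universe_infinite Q'(1) S)
    obtain g where g: "g \<in> alg_hom R B B0" "\<forall>b\<in>carrier B. \<iota> (g b) = f b" "Mor (spec R A) B B0 g \<pi> = \<psi>"
      using u[OF BQ f zf] by blast
    have "scalar_ext_trans R B B0 g \<in> quot_mor R A (B, \<pi>) (B0, \<psi>)"
      by (rule quot_mor_scalar_ext[OF BQ f0(1) g(1,3)])
    then have "scalar_ext_trans R B B0 g S (y (B, \<pi>)) = y (B0, \<psi>)"
      using y BQ f0(1) unfolding quot_lim_carrier by blast
    then have y0: "y (B0, \<psi>) = scalar_ext R B B0 S g (y (B, \<pi>))" using S by (simp add: scalar_ext_trans_def)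
    have yB: "y (B, \<pi>) \<in> carrier TB.TP" using y BQ by (auto simp: quot_lim_carrier)
    have sh: "scalar_ext R B B0 S g \<in> alg_hom S TB.TP T0.TP"
      by (rule scalar_ext_alg_hom[OF universe_infinite Q'(1) Q0(1) S alg_homD(1)[OF g(1)]])
    have kk: "k \<in> alg_hom S TB.TP T" "k0 \<in> alg_hom S T0.TP T" using k k0 by (auto simp: rep_map_def)
    have "k (y (B, \<pi>)) = k0 (scalar_ext R B B0 S g (y (B, \<pi>)))"
    proof (rule TB.tensor_ext[where f = k and g = "\<lambda>w. k0 (scalar_ext R B B0 S g w)" and G = T, OF yB])
      fix b s assume bs: "b \<in> carrier B" "s \<in> carrier S"
      show "k (TB.pt b s) = k0 (scalar_ext R B B0 S g (TB.pt b s))"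
        unfolding scalar_ext_pure[OF universe_infinite Q'(1) Q0(1) S alg_homD(1)[OF g(1)] bs]
        using k k0 bs g(2) alg_homD(4)[OF g(1) bs(1)] by (simp add: rep_map_def)
    qed (simp_all add: alg_homD(5)[OF kk(1)] alg_homD(5)[OF kk(2)] alg_homD(4,5)[OF sh])
    then show ?thesis using vk y0 by simp
  qed
  show ?thesis using can[OF v(1)] can[OF v(2)] by simp
qed

definition "glue S y = (\<lambda>T\<in>calg S. \<lambda>z\<in>alg_trans R A (qcoh R (over R S T)). THE v. rep_val S y T z v)"

lemma glue_eqI:
  assumes S: "S \<in> calg R" and T: "T \<in> calg S" and z: "z \<in> alg_trans R A (qcoh R (over R S T))"
    and y: "y \<in> lim_carrier Q (quot_fun R) (quot_mor R A) S" and v: "rep_val S y T z v"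
  shows "glue S y T z = v"
proof -
  have "(THE v. rep_val S y T z v) = v"
    by (rule the_equality[where P = "rep_val S y T z", OF v]) (rule rep_val_unique[OF S T z y _ v])
  then show ?thesis using T z by (simp add: glue_def)
qed

lemma glue_rep:
  assumes S: "S \<in> calg R" and T: "T \<in> calg S" and z: "z \<in> alg_trans R A (qcoh R (over R S T))"
    and y: "y \<in> lim_carrier Q (quot_fun R) (quot_mor R A) S"
  shows "rep_val S y T z (glue S y T z)"
  using rep_val_ex[OF S T z, of y] glue_eqI[OF S T z y] by auto

text \<open>Naturality: if \<open>z\<close> is represented through \<open>i\<close> by
  \<open>f\<close> and \<open>k\<close>, then its push-forward along \<open>g\<close> is represented
  through the same \<open>i\<close> by the composites with \<open>g\<close>.\<close>

lemma glue_in: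
  assumes S: "S \<in> calg R" and y: "y \<in> lim_carrier Q (quot_fun R) (quot_mor R A) S"
  shows "glue S y \<in> carrier (Ob FA S)"
  unfolding fun_alg_carrier spec_simps
proof (intro conjI ballI)
  show "glue S y \<in> extensional (calg S)" by (simp add: glue_def)
  fix T assume T: "T \<in> calg S"
  show "glue S y T \<in> alg_trans R A (qcoh R (over R S T)) \<rightarrow>\<^sub>E carrier T"
  proof (rule PiE_I)
    fix z assume z: "z \<in> alg_trans R A (qcoh R (over R S T))"
    obtain i k where "i \<in> Q" "k \<in> alg_hom S (tensor R (fst i) S) T" "glue S y T z = k (y i)"
      using glue_rep[OF S T z y] by (auto simp: rep_val_def rep_map_def)
    then show "glue S y T z \<in> carrier T" using y alg_homD(4) by (fastforce simp: quot_lim_carrier)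
  qed (simp add: glue_def T)
  fix T' g z assume T': "T' \<in> calg S" and g: "g \<in> alg_hom S T T'" and z: "z \<in> alg_trans R A (qcoh R (over R S T))"
  obtain i f k where i: "i \<in> Q" and f: "f \<in> alg_hom R (fst i) (over R S T)" and zf: "Mor (spec R A) (fst i) (over R S T) f (snd i) = z"
    and k: "rep_map S T (fst i) f k" and v: "glue S y T z = k (y i)"
    using glue_rep[OF S T z y] by (auto simp: rep_val_def)
  have yi: "y i \<in> carrier (tensor R (fst i) S)" using y i by (auto simp: quot_lim_carrier)
  have gR: "g \<in> alg_hom R (over R S T) (over R S T')" by (rule over_alg_hom[OF g S])
  have f': "compose (carrier (fst i)) g f \<in> alg_hom R (fst i) (over R S T')"
    by (rule alg_hom_compose[OF quotD(3)[OF i] f gR])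
  note oT = calg_assoc_algebra[OF over_calg[OF S T]] and oT' = calg_assoc_algebra[OF over_calg[OF S T']]
  have "rep_val S y T' (Mor (spec R A) (over R S T) (over R S T') g z) (g (k (y i)))"
    unfolding rep_val_def
  proof (intro bexI[OF _ i] bexI[OF _ f'] exI[of _ "compose (carrier (tensor R (fst i) S)) g k"] conjI)
    show "Mor (spec R A) (fst i) (over R S T') (compose (carrier (fst i)) g f) (snd i) = Mor (spec R A) (over R S T) (over R S T') g z"
      unfolding zf[symmetric]
      by (rule spec_Mor_comp[OF quotD(3)[OF i] oT oT' f gR f' _ quotD(2)[OF i], symmetric]) (simp add: compose_eq)
    have kh: "k \<in> alg_hom S (tensor R (fst i) S) T" using k by (simp add: rep_map_def)
    show "rep_map S T' (fst i) (compose (carrier (fst i)) g f) (compose (carrier (tensor R (fst i) S)) g k)"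
      unfolding rep_map_def
    proof (intro conjI ballI)
      show "compose (carrier (tensor R (fst i) S)) g k \<in> alg_hom S (tensor R (fst i) S) T'"
        by (rule alg_hom_compose[OF calg_assoc_algebra[OF tensor_in[OF i S]] kh g])
      fix b s assume bs: "b \<in> carrier (fst i)" "s \<in> carrier S"
      interpret TB: tensor_setup R "fst i" S by (intro tensor_setupI universe_infinite quotD(3)[OF i] S)
      show "compose (carrier (tensor R (fst i) S)) g k (TB.pt b s) = s \<odot>\<^bsub>T'\<^esub> compose (carrier (fst i)) g f b"
        using bs k alg_homD(4)[OF f bs(1)] alg_homD(8)[OF g] by (simp add: compose_eq rep_map_def)
    qed
    show "g (k (y i)) = compose (carrier (tensor R (fst i) S)) g k (y i)" using yi by (simp add: compose_eq)
  qed
  then show "glue S y T' (Mor (spec R A) (over R S T) (over R S T') g z) = g (glue S y T z)"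
    unfolding v by (rule glue_eqI[OF S T' spec_Mor_in[OF oT oT' gR z] y])
qed

text \<open>The generic point is represented through \<open>i\<close> itself, with the identity as
  the map out of the tensor product.\<close>

lemma glue_generic:
  assumes S: "S \<in> calg R" and y: "y \<in> lim_carrier Q (quot_fun R) (quot_mor R A) S" and i: "i \<in> Q"
  shows "glue S y (tensor R (fst i) S) (generic i S) = y i"
proof -
  interpret TB: tensor_setup R "fst i" S by (intro tensor_setupI universe_infinite quotD(3)[OF i] S)
  note U = tensor_in[OF i S]
  have yi: "y i \<in> carrier TB.TP" using y i by (auto simp: quot_lim_carrier)
  have il: "inl R (fst i) S \<in> alg_hom R (fst i) (over R S TB.TP)"
    by (rule inl_alg_hom[OF universe_infinite quotD(1)[OF i] S])
  have "rep_val S y TB.TP (generic i S) (y i)"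
    unfolding rep_val_def
  proof (intro bexI[OF _ i] bexI[OF _ il] exI[of _ "\<lambda>u\<in>carrier TB.TP. u"] conjI)
    show "Mor (spec R A) (fst i) (over R S TB.TP) (inl R (fst i) S) (snd i) = generic i S" by (simp add: generic_def)
    show "rep_map S TB.TP (fst i) (inl R (fst i) S) (\<lambda>u\<in>carrier TB.TP. u)"
      unfolding rep_map_def by (auto simp: alg_hom_id[OF U] inl_def TB.smult_pt)
  qed (simp add: yi)
  then show ?thesis by (rule glue_eqI[OF S U generic_in[OF i S, unfolded spec_simps] y])
qed

text \<open>A transition between quotients carries the generic point of its source to that of its
  target, so naturality of \<open>F\<close> makes the values compatible.\<close>

lemma spec_fun_lim_in:
  assumes S: "S \<in> calg R" and F: "F \<in> carrier (Ob FA S)"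
  shows "spec_fun_lim_map R A S F \<in> lim_carrier Q (quot_fun R) (quot_mor R A) S"
  unfolding quot_lim_carrier
proof (intro conjI ballI)
  show "spec_fun_lim_map R A S F \<in> extensional Q" using S F by (simp add: spec_fun_lim_map_def)
  fix i assume i: "i \<in> Q"
  show "spec_fun_lim_map R A S F i \<in> carrier (tensor R (fst i) S)"
    unfolding spec_fun_lim_apply[OF S F i] by (rule fun_algD(1)[OF F tensor_in[OF i S] generic_in[OF i S]])
  fix j h assume j: "j \<in> Q" and h: "h \<in> quot_mor R A i j"
  obtain g where g: "g \<in> alg_hom R (fst i) (fst j)" and hg: "h = scalar_ext_trans R (fst i) (fst j) g"
    and gm: "Mor (spec R A) (fst i) (fst j) g (snd i) = snd j"
    by (rule quot_mor_elim[of "fst i" "snd i" "fst j" "snd j" h]) (use i j h in auto)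
  note Ui = tensor_in[OF i S] and Uj = tensor_in[OF j S]
  note oi = calg_assoc_algebra[OF over_calg[OF S Ui]] and oj = calg_assoc_algebra[OF over_calg[OF S Uj]]
  have hS: "h S = scalar_ext R (fst i) (fst j) S g" using S by (simp add: hg scalar_ext_trans_def)
  have hA: "h S \<in> alg_hom S (tensor R (fst i) S) (tensor R (fst j) S)"
    unfolding hS by (rule scalar_ext_alg_hom[OF universe_infinite quotD(3)[OF i] quotD(3)[OF j] S alg_homD(1)[OF g]])
  have hR: "h S \<in> alg_hom R (over R S (tensor R (fst i) S)) (over R S (tensor R (fst j) S))" by (rule over_alg_hom[OF hA S])
  have il: "inl R (fst i) S \<in> alg_hom R (fst i) (over R S (tensor R (fst i) S))"
    "inl R (fst j) S \<in> alg_hom R (fst j) (over R S (tensor R (fst j) S))"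
    by (intro inl_alg_hom universe_infinite quotD S i j)+
  let ?m = "compose (carrier (fst i)) (inl R (fst j) S) g"
  have m: "?m \<in> alg_hom R (fst i) (over R S (tensor R (fst j) S))" by (rule alg_hom_compose[OF quotD(3)[OF i] g il(2)])
  have mh: "?m b = h S (inl R (fst i) S b)" if b: "b \<in> carrier (fst i)" for b
  proof -
    interpret S: cring S by (rule calg_cring[OF S])
    show ?thesis using b alg_homD(4)[OF g b]
      by (simp add: hS compose_eq inl_def scalar_ext_pure[OF universe_infinite quotD(3)[OF i] quotD(3)[OF j] S alg_homD(1)[OF g]])
  qed
  \<comment> \<open>Both routes from the i-th quotient algebra to the tensor product for
    \<open>j\<close>, through \<open>h S\<close> and through \<open>g\<close>, agree; this links the
    two generic points.\<close>
  have "Mor (spec R A) (over R S (tensor R (fst i) S)) (over R S (tensor R (fst j) S)) (h S) (generic i S) =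
    Mor (spec R A) (fst i) (over R S (tensor R (fst j) S)) ?m (snd i)"
    unfolding generic_def by (rule spec_Mor_comp[OF quotD(3)[OF i] oi oj il(1) hR m mh quotD(2)[OF i]])
  also have "\<dots> = generic j S"
    unfolding generic_def gm[symmetric]
    by (rule spec_Mor_comp[OF quotD(3)[OF i] quotD(3)[OF j] oj g il(2) m _ quotD(2)[OF i], symmetric]) (simp add: compose_eq)
  finally have "generic j S = Mor (spec R A) (over R S (tensor R (fst i) S)) (over R S (tensor R (fst j) S)) (h S) (generic i S)" ..
  then show "h S (spec_fun_lim_map R A S F i) = spec_fun_lim_map R A S F j"
    unfolding spec_fun_lim_apply[OF S F i] spec_fun_lim_apply[OF S F j]
    using fun_algD(2)[OF F Ui generic_in[OF i S] Uj hA] by simp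
qed

text \<open>Every point over an S-algebra is the image of some generic point, so the values at
  generic points determine a function.\<close>

lemma spec_fun_lim_inj:
  assumes S: "S \<in> calg R" shows "inj_on (spec_fun_lim_map R A S) (carrier (Ob FA S))"
proof (rule inj_onI)
  fix F G assume F: "F \<in> carrier (Ob FA S)" and G: "G \<in> carrier (Ob FA S)"
    and eq: "spec_fun_lim_map R A S F = spec_fun_lim_map R A S G"
  show "F = G"
  proof (rule fun_alg_eqI[OF F G])
    fix T z assume T: "T \<in> calg S" and z: "z \<in> Ob (spec R A) (over R S T)"
    obtain i f where i: "i \<in> Q" and f: "f \<in> alg_hom R (fst i) (over R S T)" and zf: "Mor (spec R A) (fst i) (over R S T) f (snd i) = z"
      using point_rep[OF S T z[unfolded spec_simps]] by blast
    obtain k where k: "rep_map S T (fst i) f k" using rep_map_ex[OF S T i f] by blast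
    have kh: "k \<in> alg_hom S (tensor R (fst i) S) T" using k by (simp add: rep_map_def)
    have z': "z = Mor (spec R A) (over R S (tensor R (fst i) S)) (over R S T) k (generic i S)"
      unfolding rep_map_generic[OF S T i f k] zf ..
    have "F (tensor R (fst i) S) (generic i S) = G (tensor R (fst i) S) (generic i S)"
      using fun_cong[OF eq, of i] unfolding spec_fun_lim_apply[OF S F i] spec_fun_lim_apply[OF S G i] .
    then show "F T z = G T z"
      unfolding z' fun_algD(2)[OF F tensor_in[OF i S] generic_in[OF i S] T kh] fun_algD(2)[OF G tensor_in[OF i S] generic_in[OF i S] T kh]
      by simp
  qed
qed

text \<open>Base change along \<open>f\<close> carries the generic point over \<open>S\<close> to
  the one over \<open>S'\<close>. To apply naturality of \<open>F\<close>, the target is regarded as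
  an \<open>S\<close>-algebra by restriction of scalars.\<close>

lemma spec_fun_lim_nat:
  assumes S: "S \<in> calg R" and S': "S' \<in> calg R" and f: "f \<in> alg_hom R S S'" and F: "F \<in> carrier (Ob FA S)"
  shows "spec_fun_lim_map R A S' (Mor FA S S' f F) = Mor (quot_lim R A) S S' f (spec_fun_lim_map R A S F)"
proof (rule extensionalityI)
  have F': "Mor FA S S' f F \<in> carrier (Ob FA S')" by (rule fun_alg_Mor_in[OF S S' f F])
  have M: "Mor (quot_lim R A) S S' f (spec_fun_lim_map R A S F) =
    (\<lambda>i\<in>Q. base_change R (fst i) S S' f (spec_fun_lim_map R A S F i))"
    using spec_fun_lim_in[OF S F] by (simp add: quot_lim_def lim_fun_def quot_fun_def)
  show "spec_fun_lim_map R A S' (Mor FA S S' f F) \<in> extensional Q"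
    using spec_fun_lim_in[OF S' F'] by (simp add: quot_lim_carrier)
  show "Mor (quot_lim R A) S S' f (spec_fun_lim_map R A S F) \<in> extensional Q" unfolding M by simp
  fix i assume i: "i \<in> Q"
  let ?U = "tensor R (fst i) S" and ?U' = "tensor R (fst i) S'" and ?g = "base_change R (fst i) S S' f"
  note U = tensor_in[OF i S] and U' = tensor_in[OF i S']
  have rU: "rscal S f ?U' \<in> calg S" by (rule rscal_calg[OF calg_cring[OF S] U' alg_homD(3)[OF f]])
  have ts: "tensor_setup R (fst i) S" "tensor_setup R (fst i) S'" by (intro tensor_setupI universe_infinite quotD(3)[OF i] S S')+
  have g: "?g \<in> alg_hom S ?U (rscal S f ?U')"
    by (rule tensor_map_rscal_alg_hom[OF ts lin_hom_id(1)[OF quotD(3)[OF i]] f])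
  have gR: "?g \<in> alg_hom R (over R S ?U) (over R S' ?U')" using over_alg_hom[OF g S] by (simp add: over_rscal[OF S f])
  have il: "inl R (fst i) S \<in> alg_hom R (fst i) (over R S ?U)" "inl R (fst i) S' \<in> alg_hom R (fst i) (over R S' ?U')"
    by (intro inl_alg_hom universe_infinite quotD i S S')+
  have gi: "inl R (fst i) S' b = ?g (inl R (fst i) S b)" if b: "b \<in> carrier (fst i)" for b
  proof -
    interpret S: cring S by (rule calg_cring[OF S])
    show ?thesis using b alg_homD(7)[OF f]
      by (simp add: inl_def tensor_map_pure[OF ts lin_hom_id(1)[OF quotD(3)[OF i]] alg_homD(1)[OF f]])
  qed
  have gen: "Mor (spec R A) (over R S ?U) (over R S' ?U') ?g (generic i S) = generic i S'"
    unfolding generic_def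
    by (rule spec_Mor_comp[OF quotD(3)[OF i] calg_assoc_algebra[OF over_calg[OF S U]] calg_assoc_algebra[OF over_calg[OF S' U']]
      il(1) gR il(2) gi quotD(2)[OF i]])
  have "F (rscal S f ?U') (generic i S') = ?g (F ?U (generic i S))"
    using fun_algD(2)[OF F U generic_in[OF i S] rU g] by (simp add: over_rscal[OF S f] gen)
  then show "spec_fun_lim_map R A S' (Mor FA S S' f F) i = Mor (quot_lim R A) S S' f (spec_fun_lim_map R A S F) i"
    unfolding M spec_fun_lim_apply[OF S' F' i] fun_alg_Mor[OF F U'] using i by (simp add: spec_fun_lim_apply[OF S F i])
qed

lemma spec_fun_lim_bij:
  assumes S: "S \<in> calg R"
  shows "bij_betw (spec_fun_lim_map R A S) (carrier (Ob FA S)) (carrier (Ob (quot_lim R A) S))"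
  unfolding quot_lim_simps(1)
proof (rule bij_betw_imageI[OF spec_fun_lim_inj[OF S]], intro equalityI subsetI)
  fix y assume y: "y \<in> lim_carrier Q (quot_fun R) (quot_mor R A) S"
  have G: "glue S y \<in> carrier (Ob FA S)" by (rule glue_in[OF S y])
  have "spec_fun_lim_map R A S (glue S y) = y"
  proof (rule extensionalityI)
    show "spec_fun_lim_map R A S (glue S y) \<in> extensional Q" "y \<in> extensional Q"
      using spec_fun_lim_in[OF S G] y by (auto simp: quot_lim_carrier)
    show "spec_fun_lim_map R A S (glue S y) i = y i" if "i \<in> Q" for i
      unfolding spec_fun_lim_apply[OF S G that] by (rule glue_generic[OF S y that])
  qed
  then show "y \<in> spec_fun_lim_map R A S ` carrier (Ob FA S)" using G by (metis imageI)
qed (use spec_fun_lim_in[OF S] in auto)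

lemma spec_fun_alg_algebra: "S \<in> calg R \<Longrightarrow> algebra S (Ob FA S)"
  by (rule fun_alg_algebra) (auto intro!: spec_Mor_in calg_assoc_algebra)

text \<open>Surjectivity comes from gluing; the algebra laws hold because the map is evaluation at
  generic points and the operations on functions are pointwise.\<close>

theorem spec_fun_lim_iso: "spec_fun_lim_map R A \<in> alg_iso R FA (quot_lim R A)"
proof -
  have hom: "spec_fun_lim_map R A S \<in> alg_hom S (Ob FA S) (Ob (quot_lim R A) S)" if S: "S \<in> calg R" for S
  proof -
    interpret m: module S "Ob FA S" by (rule algebra.module[OF spec_fun_alg_algebra[OF S]])
    interpret cring "Ob FA S" by (rule algebra.M_cring[OF spec_fun_alg_algebra[OF S]])
    have app: "spec_fun_lim_map R A S F = (\<lambda>i\<in>Q. F (tensor R (fst i) S) (generic i S))" if "F \<in> carrier (Ob FA S)" for F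
      by (rule extensionalityI[of _ Q])
        (use spec_fun_lim_in[OF S that] spec_fun_lim_apply[OF S that] in \<open>auto simp: quot_lim_carrier\<close>)
    note ops = fun_alg_ops[OF tensor_in[OF _ S] generic_in[OF _ S]]
    have "spec_fun_lim_map R A S \<in> lin_hom S (Ob FA S) (Ob (quot_lim R A) S)"
    proof (rule lin_homI)
      show "spec_fun_lim_map R A S F \<in> carrier (Ob (quot_lim R A) S)" if "F \<in> carrier (Ob FA S)" for F
        unfolding quot_lim_simps(1) by (rule spec_fun_lim_in[OF S that])
    qed (simp_all add: quot_lim_simps app ops m.smult_closed cong: restrict_cong)
    moreover have "spec_fun_lim_map R A S \<in> extensional (carrier (Ob FA S))" using S by (simp add: spec_fun_lim_map_def)
    ultimately show ?thesis by (simp add: alg_hom_iff)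
  qed
  have t: "spec_fun_lim_map R A \<in> alg_trans R FA (quot_lim R A)"
  proof (rule alg_transI)
    show "spec_fun_lim_map R A \<in> extensional (calg R)" by (simp add: spec_fun_lim_map_def)
  qed (fact hom spec_fun_lim_nat)+
  then show ?thesis
    using spec_fun_lim_bij by (auto simp: alg_iso_def set_iso_def alg_trans_def uset_def)
qed

end


section \<open>Affine functors\<close>

text \<open>Functoriality and linearity are part of being a module functor, so unit and product are
  what is left. They are compared pointwise, with \<open>over_rscal\<close> identifying the point
  sets on both sides.\<close>

lemma fun_alg_comm_algebra_functor:
  fixes R :: "('u, 'm) ring_scheme" and X :: "('u, 'x) set_fun"
  assumes X: "set_functor R X" and mod: "module_functor R (fun_alg R X)"
  shows "comm_algebra_functor R (fun_alg R X)"
proof -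
  let ?A = "fun_alg R X"
  have mor: "Mor X S T f x \<in> Ob X T" if "S \<in> calg R" "T \<in> calg R" "f \<in> alg_hom R S T" "x \<in> Ob X S" for S T f x
    using set_functor.Mor_closed[OF X that(1-3)] that(4) by auto
  have alg: "algebra S (Ob ?A S)" if "S \<in> calg R" for S
    by (rule fun_alg_algebra[OF _ that]) (rule mor)
  have c: "\<one>\<^bsub>Ob ?A S\<^esub> \<in> carrier (Ob ?A S)" "F \<in> carrier (Ob ?A S) \<Longrightarrow> G \<in> carrier (Ob ?A S) \<Longrightarrow> F \<otimes>\<^bsub>Ob ?A S\<^esub> G \<in> carrier (Ob ?A S)"
    if "S \<in> calg R" for S F G
    using cring.cring_simprules(5,6)[OF algebra.M_cring[OF alg[OF that]]] by blast+
  have r: "rscal S f T \<in> calg S" if "S \<in> calg R" "f \<in> alg_hom R S S'" "T \<in> calg S'" for S S' f T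
    by (rule rscal_calg[OF calg_cring[OF that(1)] that(3) alg_homD(3)[OF that(2)]])
  have one: "Mor ?A S S' f \<one>\<^bsub>Ob ?A S\<^esub> = \<one>\<^bsub>Ob ?A S'\<^esub>"
    if S: "S \<in> calg R" and S': "S' \<in> calg R" and f: "f \<in> alg_hom R S S'" for S S' f
  proof (rule fun_alg_eqI[OF fun_alg_Mor_in[OF S S' f c(1)[OF S]] c(1)[OF S']])
    fix T x assume T: "T \<in> calg S'" and x: "x \<in> Ob X (over R S' T)"
    show "Mor ?A S S' f \<one>\<^bsub>Ob ?A S\<^esub> T x = \<one>\<^bsub>Ob ?A S'\<^esub> T x"
      using r[OF S f T] x T by (simp add: fun_alg_Mor[OF c(1)[OF S] T] fun_alg_ops over_rscal[OF S f])
  qed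
  have mult: "Mor ?A S S' f (F \<otimes>\<^bsub>Ob ?A S\<^esub> G) = Mor ?A S S' f F \<otimes>\<^bsub>Ob ?A S'\<^esub> Mor ?A S S' f G"
    if S: "S \<in> calg R" and S': "S' \<in> calg R" and f: "f \<in> alg_hom R S S'"
      and F: "F \<in> carrier (Ob ?A S)" and G: "G \<in> carrier (Ob ?A S)" for S S' f F G
  proof (rule fun_alg_eqI[OF fun_alg_Mor_in[OF S S' f c(2)[OF S F G]]
        c(2)[OF S' fun_alg_Mor_in[OF S S' f F] fun_alg_Mor_in[OF S S' f G]]])
    fix T x assume T: "T \<in> calg S'" and x: "x \<in> Ob X (over R S' T)"
    show "Mor ?A S S' f (F \<otimes>\<^bsub>Ob ?A S\<^esub> G) T x = (Mor ?A S S' f F \<otimes>\<^bsub>Ob ?A S'\<^esub> Mor ?A S S' f G) T x"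
      using r[OF S f T] x T
      by (simp add: fun_alg_Mor[OF c(2)[OF S F G] T] fun_alg_Mor[OF F T] fun_alg_Mor[OF G T] fun_alg_ops over_rscal[OF S f])
  qed
  show ?thesis
  proof (intro comm_algebra_functor.intro comm_algebra_functor_axioms.intro algebra_functor.intro algebra_functor_axioms.intro)
    show "set_functor R (uset ?A)" using mod by (simp add: module_functor_def)
    show "assoc_algebra S (Ob ?A S)" "cring (Ob ?A S)" if "S \<in> calg R" for S
      using alg[OF that] by (simp_all add: algebra_imp_assoc_algebra algebra.M_cring)
    fix S T f assume *: "S \<in> calg R" "T \<in> calg R" "f \<in> alg_hom R S T"
    show "Mor ?A S T f \<in> ring_hom (Ob ?A S) (Ob ?A T)"
      by (rule ring_hom_memI) (simp_all add: fun_alg_Mor_in[OF *] mult[OF *] one[OF *] module_functor.Mor_add[OF mod *])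
    show "Mor ?A S T f (s \<odot>\<^bsub>Ob ?A S\<^esub> \<one>\<^bsub>Ob ?A S\<^esub>) = f s \<odot>\<^bsub>Ob ?A T\<^esub> \<one>\<^bsub>Ob ?A T\<^esub>" if "s \<in> carrier S" for s
      by (simp add: module_functor.Mor_smult[OF mod * that c(1)[OF *(1)]] one[OF *])
  qed
qed

section \<open>The comparison map into the limit of the quotients\<close>

lemma quot_lim_map_in:
  assumes "S \<in> calg R" "a \<in> carrier (Ob A S)"
  shows "quot_lim_map R A S a \<in> lim_carrier (quotients R A) (quot_fun R) (quot_mor R A) S"
  unfolding quot_lim_carrier
proof (intro conjI ballI)
  show "quot_lim_map R A S a \<in> extensional (quotients R A)" using assms by (simp add: quot_lim_map_def)
  fix i assume i: "i \<in> quotients R A"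
  note Q = quotientsD[of "fst i" "snd i" R A, simplified, OF i]
  show "quot_lim_map R A S a i \<in> carrier (tensor R (fst i) S)"
    using alg_homD(4)[OF alg_transD(1)[OF Q(2) assms(1)] assms(2)] assms i by (simp add: quot_lim_map_def)
  fix j h assume j: "j \<in> quotients R A" and h: "h \<in> quot_mor R A i j"
  have "tcomp R (uset A) h (snd i) = snd j" using h by (simp add: quot_mor_def)
  from tcomp_apply[OF assms, of h "snd i", unfolded this]
  show "h S (quot_lim_map R A S a i) = quot_lim_map R A S a j"
    using assms i j by (simp add: quot_lim_map_def)
qed

lemma quot_lim_map_alg_trans:
  assumes "algebra_functor R A"
  shows "quot_lim_map R A \<in> alg_trans R A (quot_lim R A)"
proof (rule alg_transI)
  show "quot_lim_map R A \<in> extensional (calg R)" by (simp add: quot_lim_map_def)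
  fix S assume S: "S \<in> calg R"
  have a: "assoc_algebra S (Ob A S)" by (rule algebra_functor.Ob_algebra[OF assms S])
  interpret r: ring "Ob A S" by (rule assoc_algebra_ring[OF a])
  interpret m: module S "Ob A S" by (rule assoc_algebra_module[OF a])
  have app: "quot_lim_map R A S x = (\<lambda>i\<in>quotients R A. snd i S x)" if "x \<in> carrier (Ob A S)" for x
    using that S by (simp add: quot_lim_map_def)
  have h: "snd i S \<in> alg_hom S (Ob A S) (tensor R (fst i) S)" if "i \<in> quotients R A" for i
    using alg_transD(1)[OF quotientsD(2)[of "fst i" "snd i"] S] that by simp
  have "quot_lim_map R A S \<in> lin_hom S (Ob A S) (Ob (quot_lim R A) S)"
  proof (rule lin_homI)
    show "quot_lim_map R A S x \<in> carrier (Ob (quot_lim R A) S)" if "x \<in> carrier (Ob A S)" for x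
      unfolding quot_lim_simps(1) by (rule quot_lim_map_in[OF S that])
  qed (simp_all add: quot_lim_simps app alg_homD(5-8)[OF h] cong: restrict_cong)
  then show "quot_lim_map R A S \<in> alg_hom S (Ob A S) (Ob (quot_lim R A) S)"
    using S by (simp add: alg_hom_iff quot_lim_map_def)
next
  have mor: "Mor A S T f x \<in> carrier (Ob A T)" if "S \<in> calg R" "T \<in> calg R" "f \<in> alg_hom R S T" "x \<in> carrier (Ob A S)" for S T f x
    using set_functor.Mor_closed[of R "uset A" S T f] assms that by (auto simp: algebra_functor_def uset_def)
  fix S T f x assume *: "S \<in> calg R" "T \<in> calg R" "f \<in> alg_hom R S T" "x \<in> carrier (Ob A S)"
  have "snd i T (Mor A S T f x) = base_change R (fst i) S T f (snd i S x)" if "i \<in> quotients R A" for i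
    using alg_transD(2)[OF quotientsD(2)[of "fst i" "snd i"] *] that by simp
  moreover have "Mor (quot_lim R A) S T f (quot_lim_map R A S x) =
      (\<lambda>i\<in>quotients R A. base_change R (fst i) S T f (quot_lim_map R A S x i))"
    using quot_lim_map_in[OF *(1,4)] by (simp add: quot_lim_def lim_fun_def quot_fun_def)
  ultimately show "quot_lim_map R A T (Mor A S T f x) = Mor (quot_lim R A) S T f (quot_lim_map R A S x)"
    using * by (simp add: quot_lim_map_def mor cong: restrict_cong)
qed

text \<open>The comparison map into the limit is \<open>spec_fun_lim_map\<close> after transport of
  functions along the inverse of the point map, so its bijectivity reduces to the isomorphism
  already proved for functions on the spectrum.\<close>

lemma pro_quasicoherent_fun_alg:
  fixes R :: "('u, 'm) ring_scheme" and X :: "('u, 'x) set_fun"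
  assumes inf: "infinite (UNIV :: 'u set)" and aff: "affine_fun R X" and ess: "essentially_free R (fun_alg R X)"
  shows "pro_quasicoherent R (fun_alg R X)"
proof -
  let ?A = "fun_alg R X" and ?p = "point_map R X"
  have X: "set_functor R X" and p: "?p \<in> set_iso R X (spec R ?A)" using aff by (auto simp: affine_fun_def)
  have CAF: "comm_algebra_functor R ?A"
    by (rule fun_alg_comm_algebra_functor[OF X]) (use ess in \<open>simp add: essentially_free_def\<close>)
  obtain J FS c where "coordinates R ?A J FS c" by (rule essentially_free_coordinates[OF inf ess])
  then interpret comm_coordinates R ?A J FS c using CAF by (rule comm_coordinates.intro)
  have mor: "Mor X S T f x \<in> Ob X T" if "S \<in> calg R" "T \<in> calg R" "f \<in> alg_hom R S T" "x \<in> Ob X S" for S T f x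
    using set_functor.Mor_closed[OF X that(1-3)] that(4) by auto
  have bij: "bij_betw (?p S) (Ob X S) (alg_trans R ?A (qcoh R S))" if "S \<in> calg R" for S
    using p that unfolding set_iso_def spec_simps by blast
  have nat: "?p T (Mor X S T f x) = Mor (spec R ?A) S T f (?p S x)"
    if "S \<in> calg R" "T \<in> calg R" "f \<in> alg_hom R S T" "x \<in> Ob X S" for S T f x
    using p that unfolding set_iso_def set_trans_def by blast
  define pinv where "pinv S = inv_into (Ob X S) (?p S)" for S
  have pin: "?p S x \<in> alg_trans R ?A (qcoh R S)" "pinv S (?p S x) = x" if "S \<in> calg R" "x \<in> Ob X S" for S x
    unfolding pinv_def
    by (rule bij_betwE[OF bij[OF that(1)], rule_format, OF that(2)], rule bij_betw_inv_into_left[OF bij[OF that(1)] that(2)])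
  have inv: "pinv S z \<in> Ob X S" "?p S (pinv S z) = z" if "S \<in> calg R" "z \<in> alg_trans R ?A (qcoh R S)" for S z
    unfolding pinv_def
    by (rule bij_betwE[OF bij_betw_inv_into[OF bij[OF that(1)]], rule_format, OF that(2)],
      rule bij_betw_inv_into_right[OF bij[OF that(1)] that(2)])
  have inat: "pinv T (Mor (spec R ?A) S T f z) = Mor X S T f (pinv S z)"
    if "S \<in> calg R" "T \<in> calg R" "f \<in> alg_hom R S T" "z \<in> alg_trans R ?A (qcoh R S)" for S T f z
    using pin(2)[OF that(2) mor[OF that(1-3) inv(1)[OF that(1,4)]]] nat[OF that(1-3) inv(1)[OF that(1,4)]] inv(2)[OF that(1,4)] by simp
  \<comment> \<open>\<open>up\<close> and \<open>dn\<close> precompose functions with the inverse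
    point map and with the point map; they identify functions on \<open>X\<close> with functions on
    the spectrum.\<close>
  define up where "up S F = (\<lambda>T\<in>calg S. \<lambda>z\<in>Ob (spec R ?A) (over R S T). F T (pinv (over R S T) z))" for S :: "'u alg" and F :: "('u, 'x, 'u) trans"
  define dn where "dn S G = (\<lambda>T\<in>calg S. \<lambda>x\<in>Ob X (over R S T). G T (?p (over R S T) x))" for S :: "'u alg" and G :: "('u, ('u, ('u, 'x, 'u) trans, 'u) trans, 'u) trans"
  have up: "up S F \<in> carrier (Ob FA S)" if S: "S \<in> calg R" and F: "F \<in> carrier (Ob ?A S)" for S F
    unfolding up_def
  proof (rule fun_alg_memI[OF _ S])
    note o = over_calg[OF S]
    show "F T (pinv (over R S T) z) \<in> carrier T" if "T \<in> calg S" "z \<in> Ob (spec R ?A) (over R S T)" for T z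
      using fun_algD(1)[OF F that(1) inv(1)[OF o[OF that(1)]]] that(2) by simp
    show "F T' (pinv (over R S T') (Mor (spec R ?A) (over R S T) (over R S T') f z)) = f (F T (pinv (over R S T) z))"
      if "T \<in> calg S" "T' \<in> calg S" "f \<in> alg_hom S T T'" "z \<in> Ob (spec R ?A) (over R S T)" for T T' f z
      using fun_algD(2)[OF F that(1) inv(1)[OF o[OF that(1)]] that(2,3)] that(4) inat[OF o[OF that(1)] o[OF that(2)] over_alg_hom[OF that(3) S]]
      by simp
  qed (auto intro!: spec_Mor_in calg_assoc_algebra)
  have dn: "dn S G \<in> carrier (Ob ?A S)" if S: "S \<in> calg R" and G: "G \<in> carrier (Ob FA S)" for S G
    unfolding dn_def
  proof (rule fun_alg_memI[OF mor S])
    note o = over_calg[OF S]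
    show "G T (?p (over R S T) x) \<in> carrier T" if "T \<in> calg S" "x \<in> Ob X (over R S T)" for T x
      using fun_algD(1)[OF G that(1)] pin(1)[OF o[OF that(1)] that(2)] by simp
    show "G T' (?p (over R S T') (Mor X (over R S T) (over R S T') f x)) = f (G T (?p (over R S T) x))"
      if "T \<in> calg S" "T' \<in> calg S" "f \<in> alg_hom S T T'" "x \<in> Ob X (over R S T)" for T T' f x
      using fun_algD(2)[OF G that(1) _ that(2,3)] pin(1)[OF o[OF that(1)] that(4)] nat[OF o[OF that(1)] o[OF that(2)] over_alg_hom[OF that(3) S] that(4)]
      by simp
  qed
  have updn: "up S (dn S G) = G" if S: "S \<in> calg R" and G: "G \<in> carrier (Ob FA S)" for S G
    by (rule fun_alg_eqI[OF up[OF S dn[OF S G]] G]) (use inv over_calg[OF S] in \<open>simp add: up_def dn_def\<close>)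
  have dnup: "dn S (up S F) = F" if S: "S \<in> calg R" and F: "F \<in> carrier (Ob ?A S)" for S F
    by (rule fun_alg_eqI[OF dn[OF S up[OF S F]] F]) (use pin over_calg[OF S] in \<open>simp add: up_def dn_def\<close>)
  have eq: "quot_lim_map R ?A S F = spec_fun_lim_map R ?A S (up S F)" if S: "S \<in> calg R" and F: "F \<in> carrier (Ob ?A S)" for S F
  proof (rule extensionalityI)
    show "quot_lim_map R ?A S F \<in> extensional Q" using S F by (simp add: quot_lim_map_def)
    show "spec_fun_lim_map R ?A S (up S F) \<in> extensional Q"
      using spec_fun_lim_in[OF S up[OF S F]] by (simp add: quot_lim_carrier)
    fix i assume i: "i \<in> Q"
    let ?B = "fst i" and ?U = "tensor R (fst i) S"
    note B = quotD(1)[OF i] and \<pi> = quotD(2)[OF i] and U = tensor_in[OF i S]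
    have il: "inl R ?B S \<in> alg_hom R ?B (over R S ?U)" by (rule inl_alg_hom[OF inf B S])
    \<comment> \<open>The quotient map is a point of the spectrum over its own algebra, so by
      affineness it comes from a point \<open>b\<close> of \<open>X\<close>.\<close>
    define b where "b = pinv ?B (snd i)"
    have b: "b \<in> Ob X ?B" "?p ?B b = snd i" unfolding b_def by (rule inv[OF B \<pi>])+
    \<comment> \<open>By the definition of \<open>point_map\<close>, applying the quotient map to
      \<open>F\<close> is evaluating \<open>F\<close> at the image of \<open>b\<close> over the
      tensor product.\<close>
    have "snd i S F = F ?U (Mor X ?B (over R S ?U) (inl R ?B S) b)"
      unfolding b(2)[symmetric] using B b(1) S F by (simp add: point_map_def inl_def Let_def)
    also have "Mor X ?B (over R S ?U) (inl R ?B S) b = pinv (over R S ?U) (generic i S)"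
      unfolding generic_def b_def by (rule inat[OF B over_calg[OF S U] il \<pi>, symmetric])
    also have "F ?U (pinv (over R S ?U) (generic i S)) = up S F ?U (generic i S)"
      using U generic_in[OF i S] by (simp add: up_def)
    also have "\<dots> = spec_fun_lim_map R ?A S (up S F) i" by (rule spec_fun_lim_apply[OF S up[OF S F] i, symmetric])
    finally show "quot_lim_map R ?A S F i = spec_fun_lim_map R ?A S (up S F) i" using S F i by (simp add: quot_lim_map_def)
  qed
  have "bij_betw (quot_lim_map R ?A S) (carrier (Ob ?A S)) (carrier (Ob (quot_lim R ?A) S))" if S: "S \<in> calg R" for S
  proof -
    have "bij_betw (up S) (carrier (Ob ?A S)) (carrier (Ob FA S))"
      by (rule bij_betw_byWitness[where f' = "dn S"]) (use updn[OF S] dnup[OF S] up[OF S] dn[OF S] in auto)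
    from bij_betw_trans[OF this spec_fun_lim_bij[OF S]] show ?thesis
      by (rule bij_betw_cong[THEN iffD1, rotated]) (simp add: eq[OF S])
  qed
  then show ?thesis
    using quot_lim_map_alg_trans[OF CA.algebra_functor_axioms] CA.algebra_functor_axioms
    by (auto simp: pro_quasicoherent_def alg_iso_def set_iso_def alg_trans_def uset_def)
qed

theorem theorem7p8:
  fixes R :: "'u ring"
    and A :: "('u, 'v) mod_fun"
    and X :: "('u, 'x) set_fun"
  assumes "infinite (UNIV :: 'u set)"
    and "cring R"
  shows "(comm_algebra_functor R A \<and> essentially_free R A \<longrightarrow>
           spec_colim_map R A \<in> set_iso R (spec_colim R A) (spec R A) \<and>
           spec_fun_lim_map R A \<in> alg_iso R (fun_alg R (spec R A)) (quot_lim R A)) \<and>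
         (affine_fun R X \<and> essentially_free R (fun_alg R X) \<longrightarrow>
           pro_quasicoherent R (fun_alg R X))"
proof (intro conjI impI)
  assume A: "comm_algebra_functor R A \<and> essentially_free R A"
  obtain J FS c where "coordinates R A J FS c"
    by (rule essentially_free_coordinates[OF assms(1)]) (use A in blast)
  then interpret comm_coordinates R A J FS c using A by (intro comm_coordinates.intro) auto
  show "spec_colim_map R A \<in> set_iso R (spec_colim R A) (spec R A)" by (rule spec_colim_iso)
  show "spec_fun_lim_map R A \<in> alg_iso R (fun_alg R (spec R A)) (quot_lim R A)" by (rule spec_fun_lim_iso)
next
  assume "affine_fun R X \<and> essentially_free R (fun_alg R X)"
  then show "pro_quasicoherent R (fun_alg R X)" using pro_quasicoherent_fun_alg[OF assms(1)] by blast
qed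

end
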